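(* Let $N\ge 0$ be an integer and let $F:\mathcal W_{[0,1]}\to\mathbb R$ be a class function which is continuous with respect to the $L^1$ norm and $(N+1)$ times G\^ateaux differentiable. Then $F$ satisfies $$d^{N+1}F(f;g_1,\dots,g_{N+1})=0\qquad\text{for all } f\in\mathcal W_{[0,1]},\ g_1,\dots,g_{N+1}\in\operatorname{Adm}(f),$$ if and only if there exist real constants $a_H$ (for $H\in\mathcal H_{\le N}$) such that $$F(f)=\sum_{H\in\mathcal H_{\le N}}a_H\,t(H,f)\qquad\text{for all } f\in\mathcal W_{[0,1]}.$$ Moreover, the constants $a_H$ are unique. If in addition $F$ is continuous with respect to the cut norm, then $a_H=0$ whenever $H\in\mathcal H_{\le N}$ is not a simple graph.
   Context: $\mathcal W$ is the vector space of bounded symmetric measurable functions $f:[0,1]^2\to\mathbb R$, and $\mathcal W_{[0,1]}\subset\mathcal W$ is the set of those with values in $[0,1]$ (graphons). The cut norm is $\|f\|_{\rm cut}=\sup_{S,T\subset[0,1]}\left|\int_{S\times T}f\right|$ (sup over measurable $S,T$). $S_{[0,1]}$ is the group of invertible Lebesgue measure-preserving maps of $[0,1]$, $f^\sigma(x,y)=f(\sigma(x),\sigma(y))$, and $\delta_\Box(f,g)=\inf_{\psi\in S_{[0,1]}}\|f-g^\psi\|_{\rm cut}$. Write $f\sim g$ if $\delta_\Box(f,g)=0$. A class function is a function $F:\mathcal W_{[0,1]}\to\mathbb R$ with $F(f)=F(g)$ whenever $f\sim g$. Admissible directions: for $f\in\mathcal W_{[0,1]}$, $\operatorname{Adm}(f)=\{g\in\mathcal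 W: f+\epsilon g\in\mathcal W_{[0,1]}\text{ for all sufficiently small }\epsilon\in[0,1)\}$. For $g\in\operatorname{Adm}(f)$, the G\^ateaux derivative is $dF(f;g)=\lim_{\lambda\to0,\ f+\lambda g\in\mathcal W_{[0,1]}}\frac1\lambda(F(f+\lambda g)-F(f))$ (one-sided if $-g\notin\operatorname{Adm}(f)$); inductively, for $g_1,\dots,g_n\in\operatorname{Adm}(f)$, $d^nF(f;g_1,\dots,g_n)=\lim_{\lambda\to0,\ f+\lambda g_n\in\mathcal W_{[0,1]}}\frac1\lambda\big(d^{n-1}F(f+\lambda g_n;g_1,\dots,g_{n-1})-d^{n-1}F(f;g_1,\dots,g_{n-1})\big)$. "$n$ times G\^ateaux differentiable" means that these derivatives exist at all $f\in\mathcal W_{[0,1]}$ along all admissible directions. Multigraphs are finite, undirected, without loops, possibly with multiple edges; an edge $e$ has endpoints $\{e_s,e_t\}$. $\mathcal H_n$ is the set of isomorphism classes of multigraphs with $n$ edges and no isolated vertices, and $\mathcal H_{\le N}=\bigcup_{n\le N}\mathcal H_n$. The homomorphism density is $t(H,f)=\int_{[0,1]^{V(H)}}\prod_{e\in E(H)}f(x_{e_s},x_{e_t})\prod_{i\in V(H)}dx_i$, with $t(H,f)\equiv1$ if $H$ has no edges. *)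

theory Defs
  imports "HOL-Analysis.Analysis" "HOL-Library.Multiset"
begin

(* A function on [0,1]^2 is represented by a total function on real * real whose values outside
   the square are irrelevant: every notion below only looks at the values on the square.
   "Measurable" means Lebesgue measurable. *)

type_synonym kernel = "real \<times> real \<Rightarrow> real"

abbreviation unit_interval :: "real set" where
  "unit_interval \<equiv> {0..1}"

abbreviation unit_square :: "(real \<times> real) set" where
  "unit_square \<equiv> unit_interval \<times> unit_interval"

definition kernels :: "kernel set" where
  "kernels = {f. f \<in> borel_measurable (lebesgue_on unit_square)
      \<and> bounded (f ` unit_square)
      \<and> (\<forall>x\<in>unit_interval. \<forall>y\<in>unit_interval. f (x, y) = f (y, x))}"

definition graphons :: "kernel set" where
  "graphons = {f \<in> kernels. \<forall>p\<in>unit_square. 0 \<le> f p \<and> f p \<le> 1}"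

definition L1_norm :: "kernel \<Rightarrow> real" where
  "L1_norm f = (LINT p|lebesgue_on unit_square. \<bar>f p\<bar>)"

definition cut_norm :: "kernel \<Rightarrow> real" where
  "cut_norm f =
    (SUP (S, T) \<in> sets (lebesgue_on unit_interval) \<times> sets (lebesgue_on unit_interval).
       \<bar>LINT p:S \<times> T|lebesgue. f p\<bar>)"

definition measure_preserving_bijections :: "(real \<Rightarrow> real) set" where
  "measure_preserving_bijections = {\<psi>.
      bij_betw \<psi> unit_interval unit_interval
      \<and> \<psi> \<in> lebesgue_on unit_interval \<rightarrow>\<^sub>M lebesgue_on unit_interval
      \<and> the_inv_into unit_interval \<psi> \<in> lebesgue_on unit_interval \<rightarrow>\<^sub>M lebesgue_on unit_interval
      \<and> distr (lebesgue_on unit_interval) (lebesgue_on unit_interval) \<psi>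
          = lebesgue_on unit_interval}"

definition relabel :: "kernel \<Rightarrow> (real \<Rightarrow> real) \<Rightarrow> kernel" where
  "relabel f \<psi> = (\<lambda>(x, y). f (\<psi> x, \<psi> y))"

definition cut_dist :: "kernel \<Rightarrow> kernel \<Rightarrow> real" where
  "cut_dist f g =
    (INF \<psi>\<in>measure_preserving_bijections. cut_norm (\<lambda>p. f p - relabel g \<psi> p))"

definition class_function :: "(kernel \<Rightarrow> real) \<Rightarrow> bool" where
  "class_function F \<longleftrightarrow> (\<forall>f\<in>graphons. \<forall>g\<in>graphons. cut_dist f g = 0 \<longrightarrow> F f = F g)"

definition graphon_continuous :: "(kernel \<Rightarrow> real) \<Rightarrow> (kernel \<Rightarrow> real) \<Rightarrow> bool" where
  "graphon_continuous nrm F \<longleftrightarrow>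
    (\<forall>f\<in>graphons. \<forall>\<epsilon>>0. \<exists>\<delta>>0. \<forall>h\<in>graphons.
       nrm (\<lambda>p. h p - f p) < \<delta> \<longrightarrow> \<bar>F h - F f\<bar> < \<epsilon>)"

definition shift :: "kernel \<Rightarrow> real \<Rightarrow> kernel \<Rightarrow> kernel" where
  "shift f l g = (\<lambda>p. f p + l * g p)"

definition Adm :: "kernel \<Rightarrow> kernel set" where
  "Adm f = {g \<in> kernels. \<exists>\<delta>>0. \<forall>\<epsilon>\<in>{0..<1}. \<epsilon> < \<delta> \<longrightarrow> shift f \<epsilon> g \<in> graphons}"

(* The filter of the limits: it is one-sided exactly if -g is not admissible at f. *)
abbreviation admissible_steps :: "kernel \<Rightarrow> kernel \<Rightarrow> real filter" where
  "admissible_steps f g \<equiv> at 0 within {l. shift f l g \<in> graphons}"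

(* gateaux_deriv F n g f is the n-th derivative of F at f along g 0, ..., g (n - 1). If g 0, ...,
   g n are admissible at f, then by convexity of the set of graphons g 0, ..., g (n - 1) are
   admissible at shift f l (g n) for all small l in the domain of the limit, so the limit only
   depends on derivatives along admissible directions. *)
primrec gateaux_deriv ::
    "(kernel \<Rightarrow> real) \<Rightarrow> nat \<Rightarrow> (nat \<Rightarrow> kernel) \<Rightarrow> kernel \<Rightarrow> real" where
  "gateaux_deriv F 0 g f = F f"
| "gateaux_deriv F (Suc n) g f =
    Lim (admissible_steps f (g n))
      (\<lambda>l. (gateaux_deriv F n g (shift f l (g n)) - gateaux_deriv F n g f) / l)"

definition gateaux_differentiable :: "nat \<Rightarrow> (kernel \<Rightarrow> real) \<Rightarrow> bool" where
  "gateaux_differentiable n F \<longleftrightarrow>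
    (\<forall>k<n. \<forall>f\<in>graphons. \<forall>g. (\<forall>i\<le>k. g i \<in> Adm f) \<longrightarrow>
      (\<exists>D. ((\<lambda>l. (gateaux_deriv F k g (shift f l (g k)) - gateaux_deriv F k g f) / l) \<longlongrightarrow> D)
             (admissible_steps f (g k))))"

(* Parallel edges are recorded by multiplicity. Every finite multigraph is isomorphic to one whose
   vertices are natural numbers. *)
datatype multigraph = Multigraph (verts: "nat set") (edges: "nat set multiset")

definition wf_multigraph :: "multigraph \<Rightarrow> bool" where
  "wf_multigraph H \<longleftrightarrow> finite (verts H) \<and> (\<forall>e\<in>#edges H. e \<subseteq> verts H \<and> card e = 2)"

definition no_isolated_verts :: "multigraph \<Rightarrow> bool" where
  "no_isolated_verts H \<longleftrightarrow> (\<forall>v\<in>verts H. \<exists>e\<in>#edges H. v \<in> e)"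

definition simple_graph :: "multigraph \<Rightarrow> bool" where
  "simple_graph H \<longleftrightarrow> (\<forall>e. count (edges H) e \<le> 1)"

definition multigraph_iso :: "(multigraph \<times> multigraph) set" where
  "multigraph_iso = {(H, K). wf_multigraph H \<and> wf_multigraph K \<and>
      (\<exists>\<phi>. bij_betw \<phi> (verts H) (verts K) \<and> image_mset ((`) \<phi>) (edges H) = edges K)}"

definition multigraph_classes :: "nat \<Rightarrow> multigraph set set" where
  "multigraph_classes n =
    {H. wf_multigraph H \<and> no_isolated_verts H \<and> size (edges H) = n} // multigraph_iso"

definition multigraph_classes_le :: "nat \<Rightarrow> multigraph set set" where
  "multigraph_classes_le N = (\<Union>n\<le>N. multigraph_classes n)"

(* The endpoints of an edge e = {e_s, e_t} are enumerated as Min e and Max e; the order does not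
   matter because f is symmetric. The product measure has to be completed, as otherwise
   x |-> f (x i, x j) need not be measurable for Lebesgue measurable f, in which case the Bochner
   integral would default to 0. *)
definition hom_density :: "multigraph \<Rightarrow> kernel \<Rightarrow> real" where
  "hom_density H f =
    (LINT x|completion (PiM (verts H) (\<lambda>_. lebesgue_on unit_interval)).
       (\<Prod>e\<in>#edges H. f (x (Min e), x (Max e))))"

(* Density and simplicity are invariant under isomorphism, so any representative will do. *)
definition class_rep :: "multigraph set \<Rightarrow> multigraph" where
  "class_rep C = (SOME H. H \<in> C)"

definition density_polynomial :: "nat \<Rightarrow> (multigraph set \<Rightarrow> real) \<Rightarrow> kernel \<Rightarrow> real" where
  "density_polynomial N a f =
    (\<Sum>C\<in>multigraph_classes_le N. a C * hom_density (class_rep C) f)"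

end

theory Submission
  imports Defs "HOL-Combinatorics.Permutations"
begin

text \<open>Vanishing of the derivatives of order \<open>N + 1\<close> is equivalent to vanishing of the mixed differences
  of that order. On the step functions with \<open>k\<close> equal steps, \<open>F\<close> is therefore a polynomial of degree at
  most \<open>N\<close> in the matrix of values. The mixed differences of top order \<open>n\<close> at unit matrices depend only
  on the coincidence pattern of the \<open>2 * n\<close> indices, since \<open>F\<close> is invariant under permutations of the
  steps. Splitting every step into \<open>m\<close> equal parts relates the coefficients of different \<open>k\<close> and forces
  each of them to be a combination of the weights \<open>k powi (- v)\<close> with which a graph on \<open>v\<close> vertices
  contributes to a homomorphism density. Continuity in \<open>L\<^sup>1\<close> excludes patterns with a loop, because
  the diagonal steps have total measure \<open>1 / k\<close>. Subtracting the densities of degree \<open>n\<close> lowers the order,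
  and step functions are dense in \<open>L\<^sup>1\<close>.

  For uniqueness, choose a graph with the most vertices among those of top degree with nonzero
  coefficient. No other one of them has a homomorphism to it that hits every edge exactly once, so that
  directions concentrated on its edges isolate its coefficient. Against the cut norm the same directions are used, but two parallel
  edges receive Hadamard sign matrices: these are small in the cut norm while their product is
  constant.\<close>

section \<open>Mixed differences\<close>

text \<open>Differences are finite combinations of values of \<open>F\<close>, so they pass to
  limits under continuity alone, which derivatives need not do. The price is that all vertices of a
  cube have to be graphons; this explains nonnegative directions, the scale
  \<open>1 / real (Suc n)\<close> and the slack in the passage between the two notions. The power of
  \<open>k\<close> comes from counting. A coefficient of order \<open>n\<close> is indexed by a map
  of \<open>2 * n\<close> half-edges to steps, of which only the partition into fibres matters.
  Under \<open>m\<close>-fold refinement \<open>m ^ v\<close> lifts keep a partition into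
  \<open>v\<close> classes, and every other lift has more classes. For the largest \<open>v\<close>
  with nonzero coefficients the refinement equation is therefore homogeneous and forces decay like
  \<open>k ^ (-v)\<close>; this part is subtracted and \<open>v\<close> decreases. A partition in
  which no edge lies inside one class is the same as an edge-labelled loopless multigraph without
  isolated vertices. For the cut norm, degrees are first separated by rescaling the graphon:
  differences of order \<open>n\<close> also see graphs with more than \<open>n\<close> edges, and
  those may be simple.\<close>

definition mixed_diff ::
    "'i set \<Rightarrow> (('a \<Rightarrow> real) \<Rightarrow> real) \<Rightarrow> ('i \<Rightarrow> 'a \<Rightarrow> real) \<Rightarrow> ('a \<Rightarrow> real) \<Rightarrow> real" where
  "mixed_diff I F g f =
    (\<Sum>S\<in>Pow I. (-1) ^ card (I - S) * F (\<lambda>p. f p + (\<Sum>i\<in>S. g i p)))"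

lemma mixed_diff_empty [simp]: "mixed_diff {} F g f = F f"
  by (simp add: mixed_diff_def)

lemma sum_Pow_insert:
  assumes "finite I" "i \<notin> I"
  shows "(\<Sum>S\<in>Pow (insert i I). h S) = (\<Sum>S\<in>Pow I. h S) + (\<Sum>S\<in>Pow I. h (insert i S))"
proof -
  have "inj_on (insert i) (Pow I)"
    using assms(2) by (auto simp: inj_on_def)
  moreover have "Pow I \<inter> insert i ` Pow I = {}"
    using assms(2) by auto
  ultimately show ?thesis
    using assms(1) by (simp add: Pow_insert sum.union_disjoint sum.reindex)
qed

text \<open>Subsets of \<open>insert i I\<close> without \<open>i\<close> have one more element in
  their complement, which flips the sign; those with \<open>i\<close> keep the sign and move the
  base point by \<open>g i\<close>. The recursion links consecutive orders.\<close>

lemma mixed_diff_insert: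
  assumes "finite I" "i \<notin> I"
  shows "mixed_diff (insert i I) F g f = mixed_diff I F g (\<lambda>p. f p + g i p) - mixed_diff I F g f"
proof -
  have A: "(-1) ^ card (insert i I - S) * F (\<lambda>p. f p + (\<Sum>j\<in>S. g j p))
        = - ((-1) ^ card (I - S) * F (\<lambda>p. f p + (\<Sum>j\<in>S. g j p)))" if "S \<in> Pow I" for S
  proof -
    have "insert i I - S = insert i (I - S)"
      using that assms by auto
    then have "card (insert i I - S) = Suc (card (I - S))"
      using assms by (simp add: card_insert_if)
    then show ?thesis by simp
  qed
  have B: "(-1) ^ card (insert i I - insert i S) * F (\<lambda>p. f p + (\<Sum>j\<in>insert i S. g j p))
        = (-1) ^ card (I - S) * F (\<lambda>p. (f p + g i p) + (\<Sum>j\<in>S. g j p))" if "S \<in> Pow I" for S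
  proof -
    have "insert i I - insert i S = I - S" "finite S" "i \<notin> S"
      using that assms by (auto intro: finite_subset)
    then show ?thesis by (simp add: add.assoc)
  qed
  show ?thesis
    unfolding mixed_diff_def sum_Pow_insert[OF assms]
    using sum.cong[OF refl A, of "Pow I" "\<lambda>x. x"] sum.cong[OF refl B, of "Pow I" "\<lambda>x. x"]
    by (simp add: sum_negf)
qed

lemma mixed_diff_cong:
  assumes "\<And>i. i \<in> I \<Longrightarrow> g i = g' i"
    and "\<And>S. S \<subseteq> I \<Longrightarrow> F (\<lambda>p. f p + (\<Sum>i\<in>S. g i p)) = G (\<lambda>p. f p + (\<Sum>i\<in>S. g i p))"
  shows "mixed_diff I F g f = mixed_diff I G g' f"
  unfolding mixed_diff_def
proof (rule sum.cong[OF refl])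
  fix S assume "S \<in> Pow I"
  then have *: "(\<lambda>p. f p + (\<Sum>i\<in>S. g i p)) = (\<lambda>p. f p + (\<Sum>i\<in>S. g' i p))"
    using assms(1) by (intro ext arg_cong2[where f="(+)"] refl sum.cong) auto
  from \<open>S \<in> Pow I\<close> show "(-1) ^ card (I - S) * F (\<lambda>p. f p + (\<Sum>i\<in>S. g i p))
      = (-1) ^ card (I - S) * G (\<lambda>p. f p + (\<Sum>i\<in>S. g' i p))"
    using assms(2)[of S] * by auto
qed

lemma mixed_diff_linear:
  "mixed_diff I (\<lambda>f. \<Sum>x\<in>X. a x * F x f) g f = (\<Sum>x\<in>X. a x * mixed_diff I (F x) g f)"
proof -
  have "mixed_diff I (\<lambda>f. \<Sum>x\<in>X. a x * F x f) g f
      = (\<Sum>S\<in>Pow I. \<Sum>x\<in>X. a x * ((-1) ^ card (I - S) * F x (\<lambda>p. f p + (\<Sum>i\<in>S. g i p))))"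
    by (simp add: mixed_diff_def sum_distrib_left mult_ac)
  also have "\<dots> = (\<Sum>x\<in>X. a x * mixed_diff I (F x) g f)"
    by (subst sum.swap) (simp add: mixed_diff_def sum_distrib_left)
  finally show ?thesis .
qed

lemma mixed_diff_permute:
  assumes "bij_betw \<sigma> I I"
  shows "mixed_diff I F (\<lambda>i. g (\<sigma> i)) f = mixed_diff I F g f"
proof -
  have inj: "inj_on \<sigma> I" and im: "\<sigma> ` I = I"
    using assms by (auto simp: bij_betw_def)
  have "mixed_diff I F (\<lambda>i. g (\<sigma> i)) f
      = (\<Sum>S\<in>Pow I. (-1) ^ card (I - \<sigma> ` S) * F (\<lambda>p. f p + (\<Sum>i\<in>\<sigma> ` S. g i p)))"
    unfolding mixed_diff_def
  proof (rule sum.cong[OF refl])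
    fix S assume S: "S \<in> Pow I"
    have "I - \<sigma> ` S = \<sigma> ` (I - S)"
      using S inj im by (metis PowD image_set_diff inj_on_image_set_diff order_refl Diff_subset)
    then have "card (I - \<sigma> ` S) = card (I - S)"
      using inj by (metis Diff_subset card_image inj_on_subset)
    moreover have "(\<Sum>i\<in>\<sigma> ` S. g i p) = (\<Sum>i\<in>S. g (\<sigma> i) p)" for p
      using S inj by (subst sum.reindex) (auto intro: inj_on_subset)
    ultimately show "(-1) ^ card (I - S) * F (\<lambda>p. f p + (\<Sum>i\<in>S. g (\<sigma> i) p))
        = (-1) ^ card (I - \<sigma> ` S) * F (\<lambda>p. f p + (\<Sum>i\<in>\<sigma> ` S. g i p))"
      by simp
  qed
  also have "\<dots> = mixed_diff I F g f"
    unfolding mixed_diff_def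
    by (rule sum.reindex_bij_betw[OF bij_betw_Pow[OF assms]])
  finally show ?thesis .
qed

text \<open>Complementation turns the sum into the expansion of the product of \<open>-1 + 1\<close>
  over \<open>I - A\<close>, which is an empty product exactly if \<open>A = I\<close>.\<close>

lemma alternating_sum_supersets:
  assumes "finite I" "A \<subseteq> I"
  shows "(\<Sum>S\<in>{S\<in>Pow I. A \<subseteq> S}. (-1) ^ card (I - S)) = (if A = I then 1 else 0 :: real)"
proof -
  have "(\<Sum>S\<in>{S\<in>Pow I. A \<subseteq> S}. (-1) ^ card (I - S)) = (\<Sum>T\<in>Pow (I - A). (-1 :: real) ^ card T)"
    by (rule sum.reindex_bij_witness[where i="\<lambda>T. I - T" and j="\<lambda>S. I - S"])
      (use assms in \<open>auto simp: double_diff\<close>)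
  also have "\<dots> = (\<Prod>i\<in>I - A. (-1) + 1)"
    using assms by (subst prod_add) auto
  also have "\<dots> = (if A = I then 1 else 0)"
    using assms by (auto simp: finite_subset prod_zero_iff)
  finally show ?thesis .
qed

text \<open>Expanding the product assigns to each factor either the base value or one direction.
  Inclusion-exclusion over \<open>S\<close> cancels every assignment that misses a direction; with
  \<open>card J \<le> card I\<close> an assignment that hits all directions has no factor left for
  \<open>y\<close>, so the base point drops out. For \<open>card J < card I\<close> the right-hand
  side is an empty sum.\<close>

lemma mixed_diff_prod:
  fixes x :: "'i \<Rightarrow> 'j \<Rightarrow> real" and y :: "'j \<Rightarrow> real"
  assumes I: "finite I" and J: "finite J" and card: "card J \<le> card I"
  shows "(\<Sum>S\<in>Pow I. (-1) ^ card (I - S) * (\<Prod>j\<in>J. y j + (\<Sum>i\<in>S. x i j)))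
      = (\<Sum>\<sigma>\<in>{\<sigma>\<in>J \<rightarrow>\<^sub>E I. \<sigma> ` J = I}. \<Prod>j\<in>J. x (\<sigma> j) j)"
proof -
  \<comment> \<open>\<open>None\<close> selects the base value \<open>y j\<close>,
    \<open>Some i\<close> the direction \<open>x i j\<close>; \<open>A \<sigma>\<close> below
    collects the directions that an assignment uses.\<close>
  define X where "X a j = (case a of None \<Rightarrow> y j | Some i \<Rightarrow> x i j)" for a j
  define R where "R S = insert None (Some ` S)" for S :: "'i set"
  define A where "A \<sigma> = {i. Some i \<in> \<sigma> ` J}" for \<sigma> :: "'j \<Rightarrow> 'i option"
  have fin: "finite (J \<rightarrow>\<^sub>E R I)"
    unfolding R_def using I J by (intro finite_PiE) auto
  have ex: "(\<Prod>j\<in>J. y j + (\<Sum>i\<in>S. x i j)) = (\<Sum>\<sigma>\<in>{\<sigma>\<in>J \<rightarrow>\<^sub>E R I. A \<sigma> \<subseteq> S}. \<Prod>j\<in>J. X (\<sigma> j) j)"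
    if S: "S \<in> Pow I" for S
  proof -
    have fS: "finite S"
      using S I by (auto intro: finite_subset)
    have "(\<Prod>j\<in>J. y j + (\<Sum>i\<in>S. x i j)) = (\<Prod>j\<in>J. \<Sum>a\<in>R S. X a j)"
      using fS by (intro prod.cong) (auto simp: R_def X_def sum.reindex)
    also have "\<dots> = (\<Sum>\<sigma>\<in>J \<rightarrow>\<^sub>E R S. \<Prod>j\<in>J. X (\<sigma> j) j)"
      using fS J by (subst prod_sum_PiE) (auto simp: R_def)
    also have "J \<rightarrow>\<^sub>E R S = {\<sigma>\<in>J \<rightarrow>\<^sub>E R I. A \<sigma> \<subseteq> S}"
    proof (intro equalityI subsetI)
      fix \<sigma> assume "\<sigma> \<in> J \<rightarrow>\<^sub>E R S"
      then show "\<sigma> \<in> {\<sigma>\<in>J \<rightarrow>\<^sub>E R I. A \<sigma> \<subseteq> S}"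
        using S unfolding R_def A_def PiE_iff by auto
    next
      fix \<sigma> assume \<sigma>: "\<sigma> \<in> {\<sigma>\<in>J \<rightarrow>\<^sub>E R I. A \<sigma> \<subseteq> S}"
      show "\<sigma> \<in> J \<rightarrow>\<^sub>E R S"
      proof (rule PiE_I)
        fix j assume j: "j \<in> J"
        show "\<sigma> j \<in> R S"
        proof (cases "\<sigma> j")
          case (Some i)
          then have "i \<in> A \<sigma>"
            using j unfolding A_def by (metis imageI mem_Collect_eq)
          then show ?thesis using \<sigma> Some by (auto simp: R_def)
        qed (auto simp: R_def)
      qed (use \<sigma> in \<open>auto simp: PiE_iff extensional_def\<close>)
    qed
    finally show ?thesis .
  qed
  have "(\<Sum>S\<in>Pow I. (-1) ^ card (I - S) * (\<Prod>j\<in>J. y j + (\<Sum>i\<in>S. x i j)))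
      = (\<Sum>S\<in>Pow I. \<Sum>\<sigma>\<in>{\<sigma>\<in>J \<rightarrow>\<^sub>E R I. A \<sigma> \<subseteq> S}. (-1) ^ card (I - S) * (\<Prod>j\<in>J. X (\<sigma> j) j))"
    by (intro sum.cong refl) (simp only: ex sum_distrib_left)
  also have "\<dots> = (\<Sum>\<sigma>\<in>J \<rightarrow>\<^sub>E R I. \<Sum>S\<in>{S\<in>Pow I. A \<sigma> \<subseteq> S}. (-1) ^ card (I - S) * (\<Prod>j\<in>J. X (\<sigma> j) j))"
    using I fin by (intro sum.swap_restrict) auto
  also have "\<dots> = (\<Sum>\<sigma>\<in>J \<rightarrow>\<^sub>E R I. (if A \<sigma> = I then 1 else 0) * (\<Prod>j\<in>J. X (\<sigma> j) j))"
  proof (intro sum.cong refl)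
    fix \<sigma> assume "\<sigma> \<in> J \<rightarrow>\<^sub>E R I"
    then have "A \<sigma> \<subseteq> I"
      by (auto simp: A_def R_def PiE_iff)
    then show "(\<Sum>S\<in>{S\<in>Pow I. A \<sigma> \<subseteq> S}. (-1) ^ card (I - S) * (\<Prod>j\<in>J. X (\<sigma> j) j))
        = (if A \<sigma> = I then 1 else 0) * (\<Prod>j\<in>J. X (\<sigma> j) j)"
      using alternating_sum_supersets[OF I, of "A \<sigma>"] by (simp flip: sum_distrib_right)
  qed
  also have "\<dots> = (\<Sum>\<sigma>\<in>{\<sigma>\<in>J \<rightarrow>\<^sub>E R I. A \<sigma> = I}. \<Prod>j\<in>J. X (\<sigma> j) j)"
    using fin by (intro sum.mono_neutral_cong_right) auto
  also have "\<dots> = (\<Sum>\<sigma>\<in>{\<sigma>\<in>J \<rightarrow>\<^sub>E I. \<sigma> ` J = I}. \<Prod>j\<in>J. x (\<sigma> j) j)"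
  proof -
    \<comment> \<open>At most \<open>card I\<close> factors have to hit all of \<open>I\<close>, so
      none of them can take \<open>None\<close>.\<close>
    have im: "\<sigma> ` J = Some ` I" if "\<sigma> \<in> J \<rightarrow>\<^sub>E R I" "A \<sigma> = I" for \<sigma>
    proof -
      have "Some ` I \<subseteq> \<sigma> ` J"
        using that(2) by (auto simp: A_def)
      moreover have "card (\<sigma> ` J) \<le> card (Some ` I)"
        using card card_image_le[OF J, of \<sigma>] by (simp add: card_image)
      ultimately show ?thesis
        using J by (metis card_seteq finite_imageI)
    qed
    show ?thesis
    proof (rule sum.reindex_bij_witness[where i="\<lambda>\<sigma>. restrict (\<lambda>j. Some (\<sigma> j)) J"
            and j="\<lambda>\<sigma>. restrict (\<lambda>j. the (\<sigma> j)) J"], goal_cases)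
      case (1 \<sigma>)
      then have *: "\<sigma> ` J = Some ` I" using im by auto
      have "\<sigma> j = Some (the (\<sigma> j))" if "j \<in> J" for j
        using * that by (metis (no_types, lifting) imageE image_eqI option.sel)
      then show ?case using 1 by (auto simp: fun_eq_iff PiE_iff extensional_def)
    next
      case (2 \<sigma>)
      then have *: "\<sigma> ` J = Some ` I" using im by auto
      then have "the ` \<sigma> ` J = I" by (simp add: image_image)
      then show ?case by (auto simp: image_image)
    next
      case (3 \<sigma>)
      then show ?case by (auto simp: fun_eq_iff PiE_iff extensional_def)
    next
      case (4 \<sigma>)
      then show ?case by (auto simp: A_def R_def image_iff)
    next
      case (5 \<sigma>)
      then have *: "\<sigma> ` J = Some ` I" using im by auto
      have "\<sigma> j = Some (the (\<sigma> j))" if "j \<in> J" for j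
        using * that by (metis (no_types, lifting) imageE image_eqI option.sel)
      then show ?case by (intro prod.cong refl) (metis X_def option.simps(5) restrict_apply')
    qed
  qed
  finally show ?thesis .
qed

lemma sum_PiE_insert:
  assumes "x \<notin> S"
  shows "(\<Sum>\<phi>\<in>Pi\<^sub>E (insert x S) T. h \<phi>) = (\<Sum>\<phi>\<in>Pi\<^sub>E S T. \<Sum>y\<in>T x. h (\<phi>(x := y)))"
proof -
  have "(\<Sum>\<phi>\<in>Pi\<^sub>E (insert x S) T. h \<phi>) = (\<Sum>(y, \<phi>)\<in>T x \<times> Pi\<^sub>E S T. h (\<phi>(x := y)))"
    unfolding PiE_insert_eq
    by (subst sum.reindex[OF inj_combinator[OF assms]]) (simp add: case_prod_unfold comp_def)
  also have "\<dots> = (\<Sum>y\<in>T x. \<Sum>\<phi>\<in>Pi\<^sub>E S T. h (\<phi>(x := y)))"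
    by (simp add: sum.cartesian_product)
  finally show ?thesis by (simp add: sum.swap[of _ "T x"])
qed

section \<open>Coefficient families invariant under refinement\<close>

text \<open>Equivalently, \<open>\<phi>\<close> factors through \<open>p\<close> on
  \<open>P\<close>. Being finer in both directions means inducing the same partition of
  \<open>P\<close>, the only information about an index map that survives permutations of the
  steps.\<close>

definition finer :: "'i set \<Rightarrow> ('i \<Rightarrow> 'a) \<Rightarrow> ('i \<Rightarrow> 'b) \<Rightarrow> bool" where
  "finer P p \<phi> \<longleftrightarrow> (\<forall>i\<in>P. \<forall>j\<in>P. p i = p j \<longrightarrow> \<phi> i = \<phi> j)"

text \<open>The coefficient of the monomial indexed by \<open>\<phi>\<close> in the homomorphism
  density, on \<open>k\<close> equal steps, of the graph whose vertices are the values of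
  \<open>p\<close>: the monomial occurs if \<open>\<phi>\<close> factors through the vertices, and
  then it carries the volume of a box, one factor \<open>1 / real k\<close> per vertex.\<close>

definition class_weight :: "'i set \<Rightarrow> ('i \<Rightarrow> 'a) \<Rightarrow> nat \<Rightarrow> ('i \<Rightarrow> nat) \<Rightarrow> real" where
  "class_weight P p k \<phi> = (if finer P p \<phi> then (1 / real k) ^ card (p ` P) else 0)"

text \<open>Cutting every step into \<open>m\<close> parts turns step \<open>a\<close> into the
  steps \<open>a * m + r\<close> with \<open>r < m\<close>, so \<open>div m\<close> leads back to
  the coarse step.\<close>

definition lifts :: "'i set \<Rightarrow> nat \<Rightarrow> nat \<Rightarrow> ('i \<Rightarrow> nat) \<Rightarrow> ('i \<Rightarrow> nat) set" where
  "lifts P k m \<phi> = {\<phi>' \<in> P \<rightarrow>\<^sub>E {..<k * m}. \<forall>i\<in>P. \<phi>' i div m = \<phi> i}"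

lemma finite_lifts [simp]: "finite P \<Longrightarrow> finite (lifts P k m \<phi>)"
  by (simp add: lifts_def finite_PiE)

lemma finer_refl [simp]: "finer P p p"
  by (simp add: finer_def)

lemma finer_trans: "finer P p q \<Longrightarrow> finer P q r \<Longrightarrow> finer P p r"
  unfolding finer_def by blast

lemma finer_lift: "\<phi>' \<in> lifts P k m \<phi> \<Longrightarrow> finer P \<phi>' \<phi>"
  unfolding lifts_def finer_def by (simp, metis)

lemma finer_factor:
  assumes "finer P p \<phi>" "i \<in> P"
  shows "\<phi> i = \<phi> (inv_into P p (p i))"
  using assms unfolding finer_def
  by (metis f_inv_into_f image_eqI inv_into_into)

text \<open>Factoring \<open>\<phi>\<close> through \<open>p\<close> maps the values of
  \<open>p\<close> onto those of \<open>\<phi>\<close>; if the cardinalities agree, this map is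
  injective and can be inverted.\<close>

lemma finer_card:
  assumes "finite P" "finer P p \<phi>"
  shows "card (\<phi> ` P) \<le> card (p ` P)"
    and "card (p ` P) \<le> card (\<phi> ` P) \<Longrightarrow> finer P \<phi> p"
proof -
  have im: "\<phi> ` P = (\<lambda>v. \<phi> (inv_into P p v)) ` (p ` P)"
    using finer_factor[OF assms(2)] by (auto simp: image_image intro!: image_cong)
  then show le: "card (\<phi> ` P) \<le> card (p ` P)"
    using assms(1) by (metis card_image_le finite_imageI)
  show "finer P \<phi> p" if "card (p ` P) \<le> card (\<phi> ` P)"
  proof -
    have "inj_on (\<lambda>v. \<phi> (inv_into P p v)) (p ` P)"
      using le that im assms(1) by (intro eq_card_imp_inj_on) auto
    then show ?thesis
      unfolding finer_def
      by (metis finer_factor[OF assms(2)] image_eqI inj_on_contraD)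
  qed
qed

text \<open>A lift that factors through \<open>p\<close> amounts to a free choice of one residue
  modulo \<open>m\<close> for each class of \<open>p\<close>. It exists only if the coarse map
  already factors through \<open>p\<close>.\<close>

lemma card_lifts_finer:
  assumes P: "finite P" and \<phi>: "\<phi> \<in> P \<rightarrow>\<^sub>E {..<k}" and m: "m \<ge> 1"
  shows "card {\<phi>' \<in> lifts P k m \<phi>. finer P p \<phi>'}
      = (if finer P p \<phi> then m ^ card (p ` P) else 0)"
proof (cases "finer P p \<phi>")
  case False
  then have "{\<phi>' \<in> lifts P k m \<phi>. finer P p \<phi>'} = {}"
    using finer_lift finer_trans by blast
  then show ?thesis using False by (metis card.empty)
next
  case True
  let ?A = "p ` P \<rightarrow>\<^sub>E {..<m}"
  let ?B = "{\<phi>' \<in> lifts P k m \<phi>. finer P p \<phi>'}"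
  let ?g = "inv_into P p"
  have g: "?g v \<in> P" "p (?g v) = v" if "v \<in> p ` P" for v
    using that by (auto simp: inv_into_into f_inv_into_f)
  have "bij_betw (\<lambda>r. restrict (\<lambda>i. \<phi> i * m + r (p i)) P) ?A ?B"
  proof (rule bij_betw_byWitness[where f'="\<lambda>\<phi>'. restrict (\<lambda>v. \<phi>' (?g v) mod m) (p ` P)"])
    show "\<forall>r\<in>?A. restrict (\<lambda>v. (restrict (\<lambda>i. \<phi> i * m + r (p i)) P) (?g v) mod m) (p ` P) = r"
    proof
      fix r assume r: "r \<in> ?A"
      show "restrict (\<lambda>v. (restrict (\<lambda>i. \<phi> i * m + r (p i)) P) (?g v) mod m) (p ` P) = r"
      proof
        fix v
        show "restrict (\<lambda>v. (restrict (\<lambda>i. \<phi> i * m + r (p i)) P) (?g v) mod m) (p ` P) v = r v"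
        proof (cases "v \<in> p ` P")
          case v: True
          then have "r v < m" using r by auto
          then show ?thesis using g[OF v] v by simp
        next
          case False
          then show ?thesis using PiE_arb[OF r, of v] by simp
        qed
      qed
    qed
    show "\<forall>\<phi>'\<in>?B. restrict (\<lambda>i. \<phi> i * m + (restrict (\<lambda>v. \<phi>' (?g v) mod m) (p ` P)) (p i)) P = \<phi>'"
    proof
      fix \<phi>' assume \<phi>': "\<phi>' \<in> ?B"
      show "restrict (\<lambda>i. \<phi> i * m + (restrict (\<lambda>v. \<phi>' (?g v) mod m) (p ` P)) (p i)) P = \<phi>'"
      proof
        fix i
        show "restrict (\<lambda>i. \<phi> i * m + (restrict (\<lambda>v. \<phi>' (?g v) mod m) (p ` P)) (p i)) P i = \<phi>' i"
        proof (cases "i \<in> P")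
          case i: True
          have "\<phi>' (?g (p i)) = \<phi>' i"
            using \<phi>' i finer_factor[of P p \<phi>' i] by simp
          moreover have "\<phi>' i div m = \<phi> i"
            using \<phi>' i by (auto simp: lifts_def)
          ultimately show ?thesis using i by (simp flip: \<open>\<phi>' i div m = \<phi> i\<close>)
        next
          case False
          moreover have "\<phi>' \<in> P \<rightarrow>\<^sub>E {..<k * m}" using \<phi>' by (simp add: lifts_def)
          ultimately show ?thesis using PiE_arb[of \<phi>' P _ i] by simp
        qed
      qed
    qed
    show "(\<lambda>r. restrict (\<lambda>i. \<phi> i * m + r (p i)) P) ` ?A \<subseteq> ?B"
    proof (intro image_subsetI CollectI conjI)
      fix r assume r: "r \<in> ?A"
      have rm: "r (p i) < m" if "i \<in> P" for i
        using r that by (auto simp: PiE_iff)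
      have \<phi>k: "\<phi> i < k" if "i \<in> P" for i
        using \<phi> that by (auto simp: PiE_iff)
      have "\<phi> i * m + r (p i) < k * m" if "i \<in> P" for i
      proof -
        have "\<phi> i * m + r (p i) < (\<phi> i + 1) * m" using rm[OF that] by simp
        also have "\<dots> \<le> k * m" using \<phi>k[OF that] by (intro mult_right_mono) auto
        finally show ?thesis .
      qed
      then show "restrict (\<lambda>i. \<phi> i * m + r (p i)) P \<in> lifts P k m \<phi>"
        unfolding lifts_def using rm m by (auto simp: div_mult_self3)
      show "finer P p (restrict (\<lambda>i. \<phi> i * m + r (p i)) P)"
        unfolding finer_def
      proof (intro ballI impI)
        fix i j assume ij: "i \<in> P" "j \<in> P" "p i = p j"
        then have "\<phi> i = \<phi> j"
          using True unfolding finer_def by blast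
        then show "restrict (\<lambda>i. \<phi> i * m + r (p i)) P i = restrict (\<lambda>i. \<phi> i * m + r (p i)) P j"
          using ij by simp
      qed
    qed
    show "(\<lambda>\<phi>'. restrict (\<lambda>v. \<phi>' (?g v) mod m) (p ` P)) ` ?B \<subseteq> ?A"
      using m by auto
  qed
  then have "card ?B = card ?A"
    by (simp add: bij_betw_same_card)
  also have "\<dots> = m ^ card (p ` P)"
    using P by (simp add: card_PiE)
  finally show ?thesis using True by simp
qed

lemma class_weight_cong:
  "finer P \<phi> \<psi> \<Longrightarrow> finer P \<psi> \<phi> \<Longrightarrow> class_weight P p k \<phi> = class_weight P p k \<psi>"
  unfolding class_weight_def using finer_trans by metis

text \<open>With \<open>v\<close> classes, the \<open>m ^ v\<close> lifts compensate exactly for the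
  factor \<open>m ^ v\<close> lost in the weight. Class weights thus solve the refinement equation
  of the coefficient families below.\<close>

lemma sum_class_weight_lifts:
  assumes P: "finite P" and \<phi>: "\<phi> \<in> P \<rightarrow>\<^sub>E {..<k}" and m: "m \<ge> 1"
  shows "(\<Sum>\<phi>'\<in>lifts P k m \<phi>. class_weight P p (k * m) \<phi>') = class_weight P p k \<phi>"
proof -
  have "(\<Sum>\<phi>'\<in>lifts P k m \<phi>. class_weight P p (k * m) \<phi>')
      = (\<Sum>\<phi>'\<in>{\<phi>'\<in>lifts P k m \<phi>. finer P p \<phi>'}. (1 / real (k * m)) ^ card (p ` P))"
    unfolding class_weight_def using P by (intro sum.mono_neutral_cong_right) auto
  also have "\<dots> = class_weight P p k \<phi>"
    using m by (simp add: card_lifts_finer[OF assms] class_weight_def power_mult_distrib field_simps)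
  finally show ?thesis .
qed

text \<open>Lifts with \<open>i\<close> and \<open>j\<close> merged factor through a partition with
  one class fewer. With \<open>m\<close> for \<open>Suc m\<close>, at most
  \<open>m ^ (v - 1)\<close> lifts of weight at most \<open>m ^ (-v)\<close> remain, so the sum is
  of order \<open>1 / m\<close>.\<close>

lemma sum_class_weight_lifts_merged:
  assumes P: "finite P" and k: "k \<ge> 1"
    and \<phi>: "\<phi> \<in> P \<rightarrow>\<^sub>E {..<k}" and ij: "i \<in> P" "j \<in> P" "p i \<noteq> p j"
  shows "(\<lambda>m. \<Sum>\<phi>'\<in>{\<phi>'\<in>lifts P k (Suc m) \<phi>. \<phi>' i = \<phi>' j}. class_weight P p (k * Suc m) \<phi>')
           \<longlonglongrightarrow> 0"
proof (rule Lim_null_comparison)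
  \<comment> \<open>The partition of \<open>p\<close> with the class of \<open>i\<close> merged into
    the class of \<open>j\<close>.\<close>
  define q where "q x = (if p x = p i then p j else p x)" for x
  have q: "finer P q \<phi>' \<longleftrightarrow> finer P p \<phi>' \<and> \<phi>' i = \<phi>' j" for \<phi>' :: "'a \<Rightarrow> nat"
  proof
    assume "finer P q \<phi>'"
    then show "finer P p \<phi>' \<and> \<phi>' i = \<phi>' j"
      using ij unfolding finer_def q_def by metis
  next
    assume "finer P p \<phi>' \<and> \<phi>' i = \<phi>' j"
    then show "finer P q \<phi>'"
      using ij unfolding finer_def q_def by metis
  qed
  have "q ` P = p ` P - {p i}"
  proof (intro equalityI subsetI)
    fix y assume "y \<in> q ` P"
    then show "y \<in> p ` P - {p i}" using ij by (auto simp: q_def)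
  next
    fix y assume y: "y \<in> p ` P - {p i}"
    then obtain x where "x \<in> P" "y = p x" by auto
    then show "y \<in> q ` P" using y by (intro image_eqI[of _ _ x]) (auto simp: q_def)
  qed
  then have cq: "card (p ` P) = Suc (card (q ` P))"
    using ij P card_Suc_Diff1[of "p ` P" "p i"] by simp
  show "\<forall>\<^sub>F m in sequentially. norm (\<Sum>\<phi>'\<in>{\<phi>'\<in>lifts P k (Suc m) \<phi>. \<phi>' i = \<phi>' j}.
            class_weight P p (k * Suc m) \<phi>') \<le> inverse (real (Suc m))"
  proof (intro always_eventually allI)
    fix m
    have "(\<Sum>\<phi>'\<in>{\<phi>'\<in>lifts P k (Suc m) \<phi>. \<phi>' i = \<phi>' j}. class_weight P p (k * Suc m) \<phi>')
        = (\<Sum>\<phi>'\<in>{\<phi>'\<in>lifts P k (Suc m) \<phi>. finer P q \<phi>'}. (1 / real (k * Suc m)) ^ card (p ` P))"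
      unfolding class_weight_def q using P by (intro sum.mono_neutral_cong_right) auto
    also have "\<dots> = real (card {\<phi>'\<in>lifts P k (Suc m) \<phi>. finer P q \<phi>'}) * (1 / real (k * Suc m)) ^ card (p ` P)"
      by simp
    finally have eq: "(\<Sum>\<phi>'\<in>{\<phi>'\<in>lifts P k (Suc m) \<phi>. \<phi>' i = \<phi>' j}. class_weight P p (k * Suc m) \<phi>')
       = real (card {\<phi>'\<in>lifts P k (Suc m) \<phi>. finer P q \<phi>'}) * (1 / real (k * Suc m)) ^ card (p ` P)" .
    have "card {\<phi>'\<in>lifts P k (Suc m) \<phi>. finer P q \<phi>'} \<le> Suc m ^ card (q ` P)"
      by (subst card_lifts_finer[OF P \<phi>]) auto
    then have "real (card {\<phi>'\<in>lifts P k (Suc m) \<phi>. finer P q \<phi>'}) \<le> real (Suc m) ^ card (q ` P)"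
      by (metis of_nat_le_iff of_nat_power)
    then have "real (card {\<phi>'\<in>lifts P k (Suc m) \<phi>. finer P q \<phi>'}) * (1 / real (k * Suc m)) ^ card (p ` P)
        \<le> real (Suc m) ^ card (q ` P) * (1 / real (Suc m)) ^ card (p ` P)"
    proof (intro mult_mono power_mono frac_le)
      show "real (Suc m) \<le> real (k * Suc m)"
        using mult_le_mono1[OF k, of "Suc m"] by (intro of_nat_mono) simp
    qed auto
    also have "\<dots> = inverse (real (Suc m))"
    proof -
      have "x ^ r * (1 / x) ^ Suc r = inverse x" if "x \<noteq> 0" for x :: real and r
        using that by (simp add: power_one_over field_simps)
      then show ?thesis unfolding cq by (metis of_nat_eq_0_iff nat.distinct(2))
    qed
    finally show "norm (\<Sum>\<phi>'\<in>{\<phi>'\<in>lifts P k (Suc m) \<phi>. \<phi>' i = \<phi>' j}.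
            class_weight P p (k * Suc m) \<phi>') \<le> inverse (real (Suc m))"
      unfolding eq by simp
  qed
qed (rule LIMSEQ_inverse_real_of_nat)

text \<open>One representative, with values in \<open>P\<close> itself, for each partition of
  \<open>P\<close>. It keeps sums over maps from counting a partition repeatedly and makes their
  range independent of \<open>k\<close>.\<close>

definition canonical_labelling :: "nat set \<Rightarrow> (nat \<Rightarrow> nat) \<Rightarrow> nat \<Rightarrow> nat" where
  "canonical_labelling P \<phi> = restrict (\<lambda>i. LEAST j. j \<in> P \<and> \<phi> j = \<phi> i) P"

lemma canonical_labelling:
  assumes "i \<in> P"
  shows "canonical_labelling P \<phi> i \<in> P" "\<phi> (canonical_labelling P \<phi> i) = \<phi> i"
  using LeastI[of "\<lambda>j. j \<in> P \<and> \<phi> j = \<phi> i" i] assms by (auto simp: canonical_labelling_def)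

lemma canonical_labelling_PiE: "canonical_labelling P \<phi> \<in> P \<rightarrow>\<^sub>E P"
  using canonical_labelling(1) by (auto simp: canonical_labelling_def)

lemma finer_canonical_labelling:
  "finer P \<phi> (canonical_labelling P \<phi>)" "finer P (canonical_labelling P \<phi>) \<phi>"
  unfolding finer_def
  by (simp add: canonical_labelling_def) (metis canonical_labelling(2))

lemma canonical_labelling_cong:
  assumes "finer P \<phi> \<psi>" "finer P \<psi> \<phi>"
  shows "canonical_labelling P \<phi> = canonical_labelling P \<psi>"
  using assms unfolding canonical_labelling_def finer_def
  by (intro restrict_ext arg_cong[where f=Least] ext) blast

text \<open>\<open>P\<close> stands for the half-edges and \<open>E\<close> for the pairs of
  half-edges that form an edge. The axioms are the traces of three properties of the functional:
  invariance under permutations of the steps, compatibility with refinement, and continuity in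
  \<open>L\<^sup>1\<close>, by which lifts that keep a loop a loop contribute less and less.\<close>

locale coefficient_family =
  fixes P :: "nat set" and E :: "(nat \<times> nat) set" and c :: "nat \<Rightarrow> (nat \<Rightarrow> nat) \<Rightarrow> real"
  assumes c_cong: "\<And>k \<phi> \<psi>. k \<ge> 1 \<Longrightarrow> \<phi> \<in> P \<rightarrow>\<^sub>E {..<k} \<Longrightarrow> \<psi> \<in> P \<rightarrow>\<^sub>E {..<k} \<Longrightarrow>
        finer P \<phi> \<psi> \<Longrightarrow> finer P \<psi> \<phi> \<Longrightarrow> c k \<phi> = c k \<psi>"
    and c_lifts: "\<And>k m \<phi>. k \<ge> 1 \<Longrightarrow> m \<ge> 1 \<Longrightarrow> \<phi> \<in> P \<rightarrow>\<^sub>E {..<k} \<Longrightarrow>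
        (\<Sum>\<phi>'\<in>lifts P k m \<phi>. c (k * m) \<phi>') = c k \<phi>"
    and c_merged: "\<And>k \<phi> i j. k \<ge> 1 \<Longrightarrow> \<phi> \<in> P \<rightarrow>\<^sub>E {..<k} \<Longrightarrow> (i, j) \<in> E \<Longrightarrow> \<phi> i = \<phi> j \<Longrightarrow>
        (\<lambda>m. \<Sum>\<phi>'\<in>{\<phi>'\<in>lifts P k (Suc m) \<phi>. \<phi>' i = \<phi>' j}. c (k * Suc m) \<phi>') \<longlonglongrightarrow> 0"

definition loopless :: "nat set \<Rightarrow> (nat \<times> nat) set \<Rightarrow> (nat \<Rightarrow> nat) set" where
  "loopless P E = {p \<in> P \<rightarrow>\<^sub>E P. \<forall>(i, j)\<in>E. p i \<noteq> p j}"

text \<open>The axioms are linear in \<open>c\<close>, and class weights satisfy them; for the third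
  one the endpoints of each edge must lie in different classes of \<open>p\<close>, hence the sum
  over loopless maps. This closure allows coefficients to be peeled off.\<close>

lemma coefficient_family_class_weights:
  assumes "coefficient_family P E c" and P: "finite P" and E: "E \<subseteq> P \<times> P"
  shows "coefficient_family P E
      (\<lambda>k \<phi>. c k \<phi> - (\<Sum>p\<in>loopless P E. a p * class_weight P p k \<phi>))"
proof -
  interpret coefficient_family P E c by fact
  show ?thesis
  proof
    fix k :: nat and \<phi> \<psi> assume *: "k \<ge> 1" "\<phi> \<in> P \<rightarrow>\<^sub>E {..<k}" "\<psi> \<in> P \<rightarrow>\<^sub>E {..<k}" "finer P \<phi> \<psi>" "finer P \<psi> \<phi>"
    show "c k \<phi> - (\<Sum>p\<in>loopless P E. a p * class_weight P p k \<phi>)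
        = c k \<psi> - (\<Sum>p\<in>loopless P E. a p * class_weight P p k \<psi>)"
    proof -
      have "class_weight P p k \<phi> = class_weight P p k \<psi>" for p :: "nat \<Rightarrow> nat"
        using class_weight_cong[OF *(4,5)] .
      then show ?thesis using c_cong[OF *] by simp
    qed
  next
    fix k m \<phi> assume *: "(k :: nat) \<ge> 1" "(m :: nat) \<ge> 1" "\<phi> \<in> P \<rightarrow>\<^sub>E {..<k}"
    show "(\<Sum>\<phi>'\<in>lifts P k m \<phi>. c (k * m) \<phi>' - (\<Sum>p\<in>loopless P E. a p * class_weight P p (k * m) \<phi>'))
        = c k \<phi> - (\<Sum>p\<in>loopless P E. a p * class_weight P p k \<phi>)"
      by (simp add: sum_subtractf c_lifts[OF *] sum.swap[of _ "loopless P E"] 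
          sum_class_weight_lifts[OF P *(3,2)] flip: sum_distrib_left)
  next
    fix k :: nat and \<phi> i j assume *: "k \<ge> 1" "\<phi> \<in> P \<rightarrow>\<^sub>E {..<k}" "(i, j) \<in> E" "\<phi> i = \<phi> j"
    have "(\<lambda>m. (\<Sum>\<phi>'\<in>{\<phi>'\<in>lifts P k (Suc m) \<phi>. \<phi>' i = \<phi>' j}. c (k * Suc m) \<phi>')
        - (\<Sum>p\<in>loopless P E. a p * (\<Sum>\<phi>'\<in>{\<phi>'\<in>lifts P k (Suc m) \<phi>. \<phi>' i = \<phi>' j}.
               class_weight P p (k * Suc m) \<phi>'))) \<longlonglongrightarrow> 0 - (\<Sum>p\<in>loopless P E. a p * 0)"
      using * E by (intro tendsto_diff tendsto_sum tendsto_mult tendsto_const c_merged[OF *]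
          sum_class_weight_lifts_merged[OF P]) (auto simp: loopless_def)
    then show "(\<lambda>m. \<Sum>\<phi>'\<in>{\<phi>'\<in>lifts P k (Suc m) \<phi>. \<phi>' i = \<phi>' j}. c (k * Suc m) \<phi>'
        - (\<Sum>p\<in>loopless P E. a p * class_weight P p (k * Suc m) \<phi>')) \<longlonglongrightarrow> 0"
      by (simp add: sum_subtractf sum.swap[of _ "loopless P E"] flip: sum_distrib_left)
  qed
qed

context coefficient_family
begin

text \<open>The situation inside the induction on the number of classes: \<open>c\<close> is already
  zero on all maps with more than \<open>v\<close> classes.\<close>

context
  fixes v :: nat
  assumes finite_P: "finite P"
    and vanish: "\<And>k \<phi>. k \<ge> 1 \<Longrightarrow> \<phi> \<in> P \<rightarrow>\<^sub>E {..<k} \<Longrightarrow> v < card (\<phi> ` P) \<Longrightarrow> c k \<phi> = 0"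
begin

text \<open>A lift always refines the partition of \<open>\<phi>\<close>; if it does not induce the
  same partition, it has more than \<open>v\<close> classes.\<close>

lemma vanish_lift:
  assumes "k \<ge> 1" "m \<ge> 1" "card (\<phi> ` P) = v" "\<phi>' \<in> lifts P k m \<phi>" "\<not> finer P \<phi> \<phi>'"
  shows "c (k * m) \<phi>' = 0"
proof (rule vanish)
  show "\<phi>' \<in> P \<rightarrow>\<^sub>E {..<k * m}" using assms(4) by (simp add: lifts_def)
  show "v < card (\<phi>' ` P)"
    using finer_card[OF finite_P finer_lift[OF assms(4)]] assms(3,5) by linarith
qed (use assms in auto)

text \<open>Only lifts with the partition of \<open>\<phi>\<close> survive in the refinement
  equation. There are \<open>m ^ v\<close> of them, and they share one coefficient.\<close>

lemma top_scaling:
  assumes k: "k \<ge> 1" and m: "m \<ge> 1" and \<phi>: "\<phi> \<in> P \<rightarrow>\<^sub>E {..<k}" "card (\<phi> ` P) = v"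
    and \<psi>: "\<psi> \<in> lifts P k m \<phi>" "finer P \<phi> \<psi>"
  shows "c k \<phi> = real m ^ v * c (k * m) \<psi>"
proof -
  have "c k \<phi> = (\<Sum>\<phi>'\<in>lifts P k m \<phi>. c (k * m) \<phi>')"
    using c_lifts[OF k m \<phi>(1)] by simp
  also have "\<dots> = (\<Sum>\<phi>'\<in>{\<phi>'\<in>lifts P k m \<phi>. finer P \<phi> \<phi>'}. c (k * m) \<psi>)"
  proof (intro sum.mono_neutral_cong_right ballI)
    fix \<phi>' assume \<phi>': "\<phi>' \<in> {\<phi>'\<in>lifts P k m \<phi>. finer P \<phi> \<phi>'}"
    have "finer P \<phi>' \<psi>" "finer P \<psi> \<phi>'"
      using \<phi>' \<psi> finer_lift finer_trans by blast+
    then show "c (k * m) \<phi>' = c (k * m) \<psi>"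
      using k m \<phi>' \<psi> by (intro c_cong) (auto simp: lifts_def)
  qed (use finite_P vanish_lift[OF k m \<phi>(2)] in auto)
  also have "\<dots> = real m ^ v * c (k * m) \<psi>"
    by (simp add: card_lifts_finer[OF finite_P \<phi>(1) m] \<phi>(2))
  finally show ?thesis .
qed

text \<open>Both coefficients are compared in the common refinement with \<open>k * k'\<close>
  steps. Hence \<open>real k ^ v * c k \<phi>\<close> depends on the partition alone, which is the
  behaviour of a class weight.\<close>

lemma top_invariant:
  assumes k: "k \<ge> 1" "k' \<ge> 1" and \<phi>: "\<phi> \<in> P \<rightarrow>\<^sub>E {..<k}" "card (\<phi> ` P) = v"
    and \<psi>: "\<psi> \<in> P \<rightarrow>\<^sub>E {..<k'}" and ref: "finer P \<phi> \<psi>" "finer P \<psi> \<phi>"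
  shows "real k ^ v * c k \<phi> = real k' ^ v * c k' \<psi>"
proof -
  have lift: "restrict (\<lambda>i. \<theta> i * m) P \<in> lifts P l m \<theta>" "finer P \<theta> (restrict (\<lambda>i. \<theta> i * m) P)"
      "finer P (restrict (\<lambda>i. \<theta> i * m) P) \<theta>"
    if "\<theta> \<in> P \<rightarrow>\<^sub>E {..<l}" "m \<ge> 1" for l m and \<theta> :: "nat \<Rightarrow> nat"
    using that by (auto simp: lifts_def finer_def PiE_iff)
  have v: "card (\<psi> ` P) = v"
    using finer_card(1)[OF finite_P ref(1)] finer_card(1)[OF finite_P ref(2)] \<phi>(2) by simp
  let ?a = "restrict (\<lambda>i. \<phi> i * k') P" and ?b = "restrict (\<lambda>i. \<psi> i * k) P"
  have "c k \<phi> = real k' ^ v * c (k * k') ?a"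
    using lift[OF \<phi>(1) k(2)] by (intro top_scaling k \<phi>) auto
  moreover have "c k' \<psi> = real k ^ v * c (k' * k) ?b"
    using lift[OF \<psi> k(1)] by (intro top_scaling k \<psi> v) auto
  moreover have "c (k * k') ?a = c (k * k') ?b"
  proof (rule c_cong)
    show "finer P ?a ?b" "finer P ?b ?a"
      using lift(2,3)[OF \<phi>(1) k(2)] lift(2,3)[OF \<psi> k(1)] ref finer_trans by metis+
    show "?a \<in> P \<rightarrow>\<^sub>E {..<k * k'}" "?b \<in> P \<rightarrow>\<^sub>E {..<k * k'}"
      using lift(1)[OF \<phi>(1) k(2)] lift(1)[OF \<psi> k(1)] by (auto simp: lifts_def mult.commute)
  qed (use k in \<open>simp add: Suc_le_eq\<close>)
  ultimately show ?thesis by (simp add: mult_ac)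
qed

text \<open>All surviving lifts keep the partition of \<open>\<phi>\<close>, so they keep
  \<open>i\<close> and \<open>j\<close> merged. The sums in \<open>c_merged\<close> are then
  constantly \<open>c k \<phi>\<close>, and this constant equals the limit 0.\<close>

lemma top_loop:
  assumes E: "E \<subseteq> P \<times> P" and k: "k \<ge> 1" and \<phi>: "\<phi> \<in> P \<rightarrow>\<^sub>E {..<k}" "card (\<phi> ` P) = v"
    and ij: "(i, j) \<in> E" "\<phi> i = \<phi> j"
  shows "c k \<phi> = 0"
proof -
  have "(\<Sum>\<phi>'\<in>{\<phi>'\<in>lifts P k (Suc m) \<phi>. \<phi>' i = \<phi>' j}. c (k * Suc m) \<phi>') = c k \<phi>" for m
  proof -
    have "(\<Sum>\<phi>'\<in>{\<phi>'\<in>lifts P k (Suc m) \<phi>. \<phi>' i = \<phi>' j}. c (k * Suc m) \<phi>')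
        = (\<Sum>\<phi>'\<in>lifts P k (Suc m) \<phi>. c (k * Suc m) \<phi>')"
    proof (intro sum.mono_neutral_left ballI)
      fix \<phi>' assume \<phi>': "\<phi>' \<in> lifts P k (Suc m) \<phi> - {\<phi>'\<in>lifts P k (Suc m) \<phi>. \<phi>' i = \<phi>' j}"
      then have "\<not> finer P \<phi> \<phi>'"
        using ij E by (auto simp: finer_def)
      then show "c (k * Suc m) \<phi>' = 0"
        using \<phi>' vanish_lift[OF k _ \<phi>(2), of "Suc m" \<phi>'] by auto
    qed (use finite_P in auto)
    then show ?thesis using c_lifts[OF k _ \<phi>(1), of "Suc m"] by simp
  qed
  then show ?thesis
    using c_merged[OF k \<phi>(1) ij] by (simp add: LIMSEQ_const_iff)
qed

end

end

text \<open>Induction on a bound for the number of classes. By \<open>top_invariant\<close> the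
  coefficients with the most classes are multiples of class weights, by \<open>top_loop\<close>
  those with a loop vanish; subtracting the matching class weights leaves a family that vanishes one
  level further down.\<close>

theorem coefficient_family_eq_class_weights:
  assumes "coefficient_family P E c" and E: "E \<subseteq> P \<times> P" and P: "P = {..<M}"
  shows "\<exists>a. \<forall>k\<ge>1. \<forall>\<phi>\<in>P \<rightarrow>\<^sub>E {..<k}. c k \<phi> = (\<Sum>p\<in>loopless P E. a p * class_weight P p k \<phi>)"
proof -
  have fin: "finite P" using P by simp
  have finl: "finite (loopless P E)"
    unfolding loopless_def using fin by (intro finite_Collect_conjI disjI1) (simp add: finite_PiE)
  have "\<exists>a. \<forall>k\<ge>1. \<forall>\<phi>\<in>P \<rightarrow>\<^sub>E {..<k}. c k \<phi> = (\<Sum>p\<in>loopless P E. a p * class_weight P p k \<phi>)"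
    if "coefficient_family P E c"
      and "\<And>k \<phi>. k \<ge> 1 \<Longrightarrow> \<phi> \<in> P \<rightarrow>\<^sub>E {..<k} \<Longrightarrow> v \<le> card (\<phi> ` P) \<Longrightarrow> c k \<phi> = 0" for c v
    using that
  proof (induction v arbitrary: c)
    case 0
    then show ?case by (intro exI[of _ "\<lambda>_. 0"]) auto
  next
    case (Suc v)
    interpret coefficient_family P E c by fact
    let ?can = "canonical_labelling P"
    \<comment> \<open>The coefficient is read off at \<open>Suc M\<close> steps: this number is
      positive even for \<open>M = 0\<close>, and canonical labellings take values below it.\<close>
    define a where "a p = (if card (p ` P) = v \<and> p = ?can p then real (Suc M) ^ v * c (Suc M) p else 0)" for p
    define c' where "c' k \<phi> = c k \<phi> - (\<Sum>p\<in>loopless P E. a p * class_weight P p k \<phi>)" for k \<phi>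
    have vanish: "c k \<phi> = 0" if "k \<ge> 1" "\<phi> \<in> P \<rightarrow>\<^sub>E {..<k}" "v < card (\<phi> ` P)" for k \<phi>
      using Suc.prems(2) that by auto
    \<comment> \<open>On a map with at least \<open>v\<close> classes, a class weight with exactly
      \<open>v\<close> classes is nonzero only if the partitions agree, so the sum collapses to the
      canonical labelling.\<close>
    have only: "card (\<phi> ` P) = v" "p = ?can \<phi>"
      if "a p * class_weight P p k \<phi> \<noteq> 0" "v \<le> card (\<phi> ` P)" for p k and \<phi> :: "nat \<Rightarrow> nat"
    proof -
      have *: "card (p ` P) = v" "p = ?can p" "finer P p \<phi>"
        using that(1) by (auto simp: a_def class_weight_def split: if_splits)
      then show "card (\<phi> ` P) = v" using finer_card(1)[OF fin *(3)] that(2) by simp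
      have "finer P \<phi> p" using finer_card(2)[OF fin *(3)] that(2) * by simp
      then show "p = ?can \<phi>" using canonical_labelling_cong * by metis
    qed
    have c': "c' k \<phi> = 0" if k: "k \<ge> 1" and \<phi>: "\<phi> \<in> P \<rightarrow>\<^sub>E {..<k}" and v: "v \<le> card (\<phi> ` P)" for k \<phi>
    proof (cases "card (\<phi> ` P) = v")
      case False
      then have "(\<Sum>p\<in>loopless P E. a p * class_weight P p k \<phi>) = 0"
        using only(1)[OF _ v] by (intro sum.neutral) metis
      then show ?thesis
        using vanish[OF k \<phi>] False v unfolding c'_def by simp
    next
      case True
      have sum: "(\<Sum>p\<in>loopless P E. a p * class_weight P p k \<phi>)
          = (if ?can \<phi> \<in> loopless P E then a (?can \<phi>) * class_weight P (?can \<phi>) k \<phi> else 0)"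
      proof -
        have "(\<Sum>p\<in>loopless P E. a p * class_weight P p k \<phi>)
          = (\<Sum>p\<in>loopless P E. if p = ?can \<phi> then a (?can \<phi>) * class_weight P (?can \<phi>) k \<phi> else 0)"
          using only(2)[OF _ v] by (intro sum.cong refl) (metis (full_types))
        then show ?thesis using finl by simp
      qed
      note ref = finer_canonical_labelling[of P \<phi>]
      have cardc: "card (?can \<phi> ` P) = v"
        using finer_card(1)[OF fin ref(1)] finer_card(1)[OF fin ref(2)] True by simp
      show ?thesis
      proof (cases "?can \<phi> \<in> loopless P E")
        case in_l: True
        have "?can \<phi> \<in> P \<rightarrow>\<^sub>E {..<Suc M}"
          using canonical_labelling_PiE[of P \<phi>] by (force simp: P PiE_iff)
        then have "real k ^ v * c k \<phi> = real (Suc M) ^ v * c (Suc M) (?can \<phi>)"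
          using top_invariant[OF fin vanish k _ \<phi> True _ ref, where k'="Suc M"] by simp
        moreover have "?can \<phi> = ?can (?can \<phi>)"
          using canonical_labelling_cong[OF ref] .
        ultimately have "a (?can \<phi>) * class_weight P (?can \<phi>) k \<phi> = c k \<phi>"
          using cardc ref k by (simp add: a_def class_weight_def field_simps)
        then show ?thesis using in_l sum by (simp add: c'_def)
      next
        case False
        then obtain i j where ij: "(i, j) \<in> E" "?can \<phi> i = ?can \<phi> j"
          using canonical_labelling_PiE[of P \<phi>] by (auto simp: loopless_def)
        then have "\<phi> i = \<phi> j"
          using E ref(2) by (auto simp: finer_def)
        then have "c k \<phi> = 0"
          using top_loop[OF fin vanish E k \<phi> True ij(1)] by simp
        then show ?thesis using False sum by (simp add: c'_def)
      qed
    qed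
    have "coefficient_family P E c'"
      unfolding c'_def using coefficient_family_class_weights[OF Suc.prems(1) fin E] .
    from Suc.IH[OF this c'] obtain a' where
      a': "\<forall>k\<ge>1. \<forall>\<phi>\<in>P \<rightarrow>\<^sub>E {..<k}. c' k \<phi> = (\<Sum>p\<in>loopless P E. a' p * class_weight P p k \<phi>)"
      by blast
    have "c k \<phi> = (\<Sum>p\<in>loopless P E. (a p + a' p) * class_weight P p k \<phi>)"
      if "k \<ge> 1" "\<phi> \<in> P \<rightarrow>\<^sub>E {..<k}" for k \<phi>
    proof -
      have "c' k \<phi> = (\<Sum>p\<in>loopless P E. a' p * class_weight P p k \<phi>)"
        using a' that by blast
      then show ?thesis by (simp add: c'_def ring_distribs sum.distrib)
    qed
    then show ?case by (intro exI[of _ "\<lambda>p. a p + a' p"]) auto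
  qed
  note main = this
  show ?thesis
  \<comment> \<open>\<open>M\<close> half-edges fall into at most \<open>M\<close> classes, so the
    vanishing hypothesis holds vacuously at this level.\<close>
  proof (rule main[of c "Suc M"])
    fix k and \<phi> :: "nat \<Rightarrow> nat" assume "Suc M \<le> card (\<phi> ` P)"
    moreover have "card (\<phi> ` P) \<le> M"
      using card_image_le[OF fin, of \<phi>] P by simp
    ultimately show "c k \<phi> = 0" by simp
  qed (rule assms(1))
qed

section \<open>Kernels and Gateaux derivatives\<close>

lemma kernelsI:
  assumes "f \<in> borel_measurable (lebesgue_on unit_square)"
    and "\<And>p. p \<in> unit_square \<Longrightarrow> \<bar>f p\<bar> \<le> B"
    and "\<And>x y. x \<in> unit_interval \<Longrightarrow> y \<in> unit_interval \<Longrightarrow> f (x, y) = f (y, x)"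
  shows "f \<in> kernels"
  using assms unfolding kernels_def bounded_iff by (auto intro!: exI[of _ B])

lemma kernelsD:
  assumes "f \<in> kernels"
  shows "f \<in> borel_measurable (lebesgue_on unit_square)"
    and "x \<in> unit_interval \<Longrightarrow> y \<in> unit_interval \<Longrightarrow> f (x, y) = f (y, x)"
  using assms unfolding kernels_def by blast+

lemma kernels_bounded:
  assumes "f \<in> kernels"
  obtains B where "\<And>p. p \<in> unit_square \<Longrightarrow> \<bar>f p\<bar> \<le> B"
proof -
  obtain B where "\<forall>p\<in>unit_square. \<bar>f p\<bar> \<le> B"
    using assms unfolding kernels_def bounded_iff by auto
  then show ?thesis using that by blast
qed

lemma kernels_linear:
  assumes f: "f \<in> kernels" and g: "g \<in> kernels"
  shows "(\<lambda>p. a * f p + b * g p) \<in> kernels"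
proof -
  from kernels_bounded[OF f] kernels_bounded[OF g] obtain B C where
    B: "\<And>p. p \<in> unit_square \<Longrightarrow> \<bar>f p\<bar> \<le> B" and C: "\<And>p. p \<in> unit_square \<Longrightarrow> \<bar>g p\<bar> \<le> C" by metis
  show ?thesis
  proof (rule kernelsI)
    show "(\<lambda>p. a * f p + b * g p) \<in> borel_measurable (lebesgue_on unit_square)"
      using kernelsD(1)[OF f] kernelsD(1)[OF g] by measurable
    fix p :: "real \<times> real" assume p: "p \<in> unit_square"
    have "\<bar>a * f p + b * g p\<bar> \<le> \<bar>a\<bar> * \<bar>f p\<bar> + \<bar>b\<bar> * \<bar>g p\<bar>"
      by (metis abs_mult abs_triangle_ineq)
    also have "\<dots> \<le> \<bar>a\<bar> * B + \<bar>b\<bar> * C"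
      using B[OF p] C[OF p] by (intro add_mono mult_left_mono) auto
    finally show "\<bar>a * f p + b * g p\<bar> \<le> \<bar>a\<bar> * B + \<bar>b\<bar> * C" .
  qed (use kernelsD(2)[OF f] kernelsD(2)[OF g] in auto)
qed

lemma kernels_zero [simp]: "(\<lambda>_. 0) \<in> kernels"
  by (rule kernelsI[where B=0]) auto

lemma kernels_add: "f \<in> kernels \<Longrightarrow> g \<in> kernels \<Longrightarrow> (\<lambda>p. f p + g p) \<in> kernels"
  using kernels_linear[of f g 1 1] by simp

lemma kernels_diff: "f \<in> kernels \<Longrightarrow> g \<in> kernels \<Longrightarrow> (\<lambda>p. f p - g p) \<in> kernels"
  using kernels_linear[of f g 1 "-1"] by simp

lemma kernels_scale: "f \<in> kernels \<Longrightarrow> (\<lambda>p. a * f p) \<in> kernels"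
  using kernels_linear[of f f a 0] by simp

lemma kernels_sum: "(\<And>i. i \<in> I \<Longrightarrow> g i \<in> kernels) \<Longrightarrow> (\<lambda>p. \<Sum>i\<in>I. g i p) \<in> kernels"
  by (induction I rule: infinite_finite_induct) (auto intro: kernels_add)

lemma graphonsI:
  "f \<in> kernels \<Longrightarrow> (\<And>p. p \<in> unit_square \<Longrightarrow> 0 \<le> f p) \<Longrightarrow> (\<And>p. p \<in> unit_square \<Longrightarrow> f p \<le> 1) \<Longrightarrow>
    f \<in> graphons"
  by (simp add: graphons_def)

lemma graphonsD:
  assumes "f \<in> graphons"
  shows "f \<in> kernels" and "p \<in> unit_square \<Longrightarrow> 0 \<le> f p" and "p \<in> unit_square \<Longrightarrow> f p \<le> 1"
  using assms unfolding graphons_def by blast+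

lemma graphon_continuous_tendsto:
  assumes "graphon_continuous nrm F" "f \<in> graphons" "\<And>n. h n \<in> graphons"
    and "(\<lambda>n. nrm (\<lambda>p. h n p - f p)) \<longlonglongrightarrow> 0"
  shows "(\<lambda>n. F (h n)) \<longlonglongrightarrow> F f"
proof (rule LIMSEQ_I)
  fix e :: real assume "e > 0"
  then obtain d where d: "d > 0" "\<forall>h\<in>graphons. nrm (\<lambda>p. h p - f p) < d \<longrightarrow> \<bar>F h - F f\<bar> < e"
    using assms(1,2) unfolding graphon_continuous_def by blast
  from order_tendstoD(2)[OF assms(4) d(1)] obtain n0 where
    "\<forall>n\<ge>n0. nrm (\<lambda>p. h n p - f p) < d" by (auto simp: eventually_sequentially)
  then show "\<exists>n0. \<forall>n\<ge>n0. norm (F (h n) - F f) < e"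
    using d(2) assms(3) by auto
qed

lemma L1_norm_scale: "L1_norm (\<lambda>p. a * f p) = \<bar>a\<bar> * L1_norm f"
  by (simp add: L1_norm_def abs_mult)

lemma shift_eq: "shift f l g p = f p + l * g p"
  by (simp add: shift_def)

lemma AdmE:
  assumes "g \<in> Adm f"
  obtains \<delta> where "\<delta> > 0" "\<delta> \<le> 1" "\<And>\<epsilon>. 0 \<le> \<epsilon> \<Longrightarrow> \<epsilon> < \<delta> \<Longrightarrow> shift f \<epsilon> g \<in> graphons"
proof -
  obtain \<delta> where "\<delta> > 0" "\<forall>\<epsilon>\<in>{0..<1}. \<epsilon> < \<delta> \<longrightarrow> shift f \<epsilon> g \<in> graphons"
    using assms unfolding Adm_def by blast
  then show ?thesis using that[of "min \<delta> 1"] by auto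
qed

lemma AdmD: "g \<in> Adm f \<Longrightarrow> g \<in> kernels"
  by (simp add: Adm_def)

text \<open>By convexity: with a common step \<open>e\<close>, the function shifted by
  \<open>l\<close> along \<open>h\<close> and by \<open>\<epsilon>\<close> along \<open>g\<close> is
  a convex combination of \<open>f\<close>, \<open>shift f e h\<close> and
  \<open>shift f e g\<close> as soon as \<open>l + \<epsilon> \<le> e\<close>.\<close>

lemma Adm_shift:
  assumes f: "f \<in> graphons" and "g \<in> Adm f" "h \<in> Adm f"
  shows "\<exists>\<delta>>0. \<forall>l. 0 \<le> l \<and> l < \<delta> \<longrightarrow> g \<in> Adm (shift f l h)"
proof -
  obtain d1 where d1: "d1 > 0" "\<And>\<epsilon>. 0 \<le> \<epsilon> \<Longrightarrow> \<epsilon> < d1 \<Longrightarrow> shift f \<epsilon> g \<in> graphons"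
    using AdmE[OF assms(2)] by metis
  obtain d2 where d2: "d2 > 0" "\<And>\<epsilon>. 0 \<le> \<epsilon> \<Longrightarrow> \<epsilon> < d2 \<Longrightarrow> shift f \<epsilon> h \<in> graphons"
    using AdmE[OF assms(3)] by metis
  define e where "e = min d1 d2 / 2"
  have e: "e > 0" "shift f e g \<in> graphons" "shift f e h \<in> graphons"
    using d1 d2 by (auto simp: e_def)
  have "shift (shift f l h) \<epsilon> g \<in> graphons" if "0 \<le> l" "l < e / 2" "0 \<le> \<epsilon>" "\<epsilon> < e / 2" for l \<epsilon>
  proof -
    define u v where "u = l / e" and "v = \<epsilon> / e"
    have "(l + \<epsilon>) / e \<le> 1"
      using that e(1) by (subst divide_le_eq) auto
    then have uv: "0 \<le> u" "0 \<le> v" "0 \<le> 1 - u - v"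
      using that e(1) by (auto simp: u_def v_def add_divide_distrib)
    have eq: "shift (shift f l h) \<epsilon> g p = (1 - u - v) * f p + (u * shift f e h p + v * shift f e g p)" for p
      using e by (simp add: shift_eq u_def v_def field_simps)
    show ?thesis
    proof (rule graphonsI)
      show "shift (shift f l h) \<epsilon> g \<in> kernels"
        unfolding shift_def using graphonsD(1)[OF f] AdmD assms
        by (intro kernels_add kernels_scale) auto
      fix p :: "real \<times> real" assume p: "p \<in> unit_square"
      note b = graphonsD(2,3)[OF f p] graphonsD(2,3)[OF e(2) p] graphonsD(2,3)[OF e(3) p]
      show "0 \<le> shift (shift f l h) \<epsilon> g p"
        unfolding eq using uv b by (intro add_nonneg_nonneg mult_nonneg_nonneg)
      have "(1 - u - v) * f p + (u * shift f e h p + v * shift f e g p)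
          \<le> (1 - u - v) * 1 + (u * 1 + v * 1)"
        using uv b by (intro add_mono mult_left_mono)
      then show "shift (shift f l h) \<epsilon> g p \<le> 1"
        unfolding eq by simp
    qed
  qed
  then have "\<forall>l. 0 \<le> l \<and> l < e / 2 \<longrightarrow> g \<in> Adm (shift f l h)"
    using assms(2) e(1) unfolding Adm_def by (auto intro!: exI[of _ "e / 2"])
  then show ?thesis using e(1) by (intro exI[of _ "e / 2"]) auto
qed

section \<open>Gateaux derivatives and their relation to mixed differences\<close>

lemma gateaux_deriv_cong:
  "(\<And>i. i < n \<Longrightarrow> g i = g' i) \<Longrightarrow> gateaux_deriv F n g f = gateaux_deriv F n g' f"
proof (induction n arbitrary: f)
  case (Suc n)
  have "gateaux_deriv F n g = gateaux_deriv F n g'" "g n = g' n"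
    using Suc by auto
  then show ?case by simp
qed simp

text \<open>Admissibility fills a right neighbourhood of 0. The filter of steps is therefore
  nontrivial, which makes \<open>Lim\<close> the genuine limit, and limits along it restrict to
  limits from the right.\<close>

lemma at_right_le_admissible_steps:
  assumes "g \<in> Adm f"
  shows "at_right 0 \<le> admissible_steps f g"
proof -
  obtain \<delta> where \<delta>: "\<delta> > 0" "\<And>\<epsilon>. 0 \<le> \<epsilon> \<Longrightarrow> \<epsilon> < \<delta> \<Longrightarrow> shift f \<epsilon> g \<in> graphons"
    using AdmE[OF assms] by metis
  have "at_right 0 = at 0 within {0..\<delta> / 2}"
    using \<delta>(1) by (simp add: at_within_Icc_at_right)
  also have "\<dots> \<le> admissible_steps f g"
    using \<delta> by (intro at_le) auto
  finally show ?thesis .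
qed

lemma gateaux_differentiable_tendsto:
  assumes "gateaux_differentiable n F" "k < n" "f \<in> graphons" "\<And>i. i \<le> k \<Longrightarrow> g i \<in> Adm f"
  shows "((\<lambda>l. (gateaux_deriv F k g (shift f l (g k)) - gateaux_deriv F k g f) / l)
            \<longlongrightarrow> gateaux_deriv F (Suc k) g f) (admissible_steps f (g k))"
proof -
  obtain D where D: "((\<lambda>l. (gateaux_deriv F k g (shift f l (g k)) - gateaux_deriv F k g f) / l) \<longlongrightarrow> D)
             (admissible_steps f (g k))"
    using assms unfolding gateaux_differentiable_def by blast
  have "admissible_steps f (g k) \<noteq> bot"
    using at_right_le_admissible_steps[OF assms(4)[OF order_refl]]
    by (metis le_bot trivial_limit_at_right_real)
  from tendsto_Lim[OF this D] D show ?thesis by simp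
qed

text \<open>Along a segment of graphons all increments from \<open>l\<close> are admissible steps,
  of both signs inside the segment. The Gateaux limit therefore includes the difference quotient
  relative to the segment, one-sided at its ends.\<close>

lemma gateaux_deriv_has_derivative:
  assumes F: "gateaux_differentiable n F" "k < n" and l: "l \<in> {0..1}"
    and seg: "\<And>l. l \<in> {0..1} \<Longrightarrow> (\<lambda>p. q p + l * g k p) \<in> graphons"
    and Adm: "\<And>i. i \<le> k \<Longrightarrow> g i \<in> Adm (\<lambda>p. q p + l * g k p)"
  shows "((\<lambda>l. gateaux_deriv F k g (\<lambda>p. q p + l * g k p)) has_field_derivative
            gateaux_deriv F (Suc k) g (\<lambda>p. q p + l * g k p)) (at l within {0..1})"
proof -
  let ?f = "\<lambda>p. q p + l * g k p"
  have eq: "shift ?f (y - l) (g k) = (\<lambda>p. q p + y * g k p)" for y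
    by (auto simp: shift_def algebra_simps)
  have "filterlim (\<lambda>y. y - l) (admissible_steps ?f (g k)) (at l within {0..1})"
    unfolding filterlim_at
  proof
    show "\<forall>\<^sub>F y in at l within {0..1}. y - l \<in> {l'. shift ?f l' (g k) \<in> graphons} \<and> y - l \<noteq> 0"
      unfolding eventually_at_filter by (rule always_eventually) (simp add: eq seg)
    show "((\<lambda>y. y - l) \<longlongrightarrow> 0) (at l within {0..1})"
      by (auto intro!: tendsto_eq_intros)
  qed
  from filterlim_compose[OF gateaux_differentiable_tendsto[where g=g, OF F seg[OF l] Adm] this]
  show ?thesis
    unfolding has_field_derivative_iff by (simp add: eq)
qed

text \<open>Downward induction on \<open>m\<close>. As a function of the length \<open>l\<close> of
  the step along \<open>g m\<close>, the difference in the remaining directions has as its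
  derivative the same difference of the next Gateaux derivative, which is 0 by induction. So it is
  constant, and its values at 1 and 0 give the difference with \<open>g m\<close> included. The term
  with \<open>\<epsilon>\<close> leaves room above every point of the cube and makes all directions
  admissible there.\<close>

lemma mixed_diff_gateaux_deriv_eq_0:
  assumes F: "gateaux_differentiable (Suc N) F"
    and zero: "\<And>f g. f \<in> graphons \<Longrightarrow> (\<And>i. i \<le> N \<Longrightarrow> g i \<in> Adm f) \<Longrightarrow> gateaux_deriv F (Suc N) g f = 0"
    and g: "\<And>i. i \<le> N \<Longrightarrow> g i \<in> kernels" "\<And>i p. i \<le> N \<Longrightarrow> p \<in> unit_square \<Longrightarrow> 0 \<le> g i p"
    and "\<epsilon> > 0" and "m \<le> Suc N" and "f \<in> kernels" "\<And>p. p \<in> unit_square \<Longrightarrow> 0 \<le> f p"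
    and "\<And>p. p \<in> unit_square \<Longrightarrow> f p + (\<Sum>i\<in>{m..<Suc N}. g i p) + \<epsilon> * (\<Sum>i\<le>N. g i p) \<le> 1"
  shows "mixed_diff {m..<Suc N} (gateaux_deriv F m g) g f = 0"
  using assms(6-)
proof (induction m arbitrary: f rule: inc_induct)
  \<comment> \<open>Nonnegative directions can only violate the upper bound, and each
    \<open>g i\<close> is dominated by the sum that multiplies \<open>\<epsilon>\<close>.\<close>
  have room: "q \<in> graphons" "i \<le> N \<Longrightarrow> g i \<in> Adm q"
    if q: "q \<in> kernels" "\<And>p. p \<in> unit_square \<Longrightarrow> 0 \<le> q p"
      "\<And>p. p \<in> unit_square \<Longrightarrow> q p + \<epsilon> * (\<Sum>i\<le>N. g i p) \<le> 1" for q i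
  proof -
    have s: "0 \<le> (\<Sum>i\<le>N. g i p)" if "p \<in> unit_square" for p
      using g(2) that by (intro sum_nonneg) auto
    have "q p \<le> 1" if "p \<in> unit_square" for p
      using q(3)[OF that] s[OF that] \<open>\<epsilon> > 0\<close> by (smt (verit) mult_nonneg_nonneg)
    then show "q \<in> graphons" using q by (intro graphonsI) auto
    show "g i \<in> Adm q" if i: "i \<le> N"
    proof -
      have "shift q e (g i) \<in> graphons" if e: "0 \<le> e" "e < \<epsilon>" for e
      proof (rule graphonsI)
        show "shift q e (g i) \<in> kernels"
          unfolding shift_def using q(1) g(1)[OF i] by (intro kernels_add kernels_scale)
        fix p :: "real \<times> real" assume p: "p \<in> unit_square"
        show "0 \<le> shift q e (g i) p"
          unfolding shift_eq using q(2)[OF p] g(2)[OF i p] e by simp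
        have "g i p \<le> (\<Sum>i\<le>N. g i p)"
          using i g(2) p by (intro member_le_sum) auto
        then have "e * g i p \<le> \<epsilon> * (\<Sum>i\<le>N. g i p)"
          using e g(2)[OF i p] by (intro mult_mono) auto
        then show "shift q e (g i) p \<le> 1"
          unfolding shift_eq using q(3)[OF p] by linarith
      qed
      then show ?thesis
        using g(1)[OF i] \<open>\<epsilon> > 0\<close> unfolding Adm_def by auto
    qed
  qed
  {
    case base
    then show ?case using room[of f] by (simp add: zero del: gateaux_deriv.simps)
  next
    case (step m)
    let ?I = "{Suc m..<Suc N}"
    have m: "m \<le> N" using step by simp
    have ins: "{m..<Suc N} = insert m ?I" using step(2) by auto
    have le1: "(f p + l * g m p) + (\<Sum>i\<in>?I. g i p) + \<epsilon> * (\<Sum>i\<le>N. g i p) \<le> 1"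
      if "p \<in> unit_square" "l \<le> 1" for p l
    proof -
      have "l * g m p \<le> g m p"
        using mult_right_mono[OF that(2) g(2)[OF m that(1)]] by simp
      then show ?thesis using step.prems(3)[OF that(1)] unfolding ins by simp
    qed
    define \<psi> where "\<psi> l = mixed_diff ?I (gateaux_deriv F m g) g (\<lambda>p. f p + l * g m p)" for l
    have "(\<psi> has_field_derivative 0) (at l within {0..1})" if l: "l \<in> {0..1}" for l
    proof -
      have "((\<lambda>l. gateaux_deriv F m g (\<lambda>p. (f p + (\<Sum>i\<in>S. g i p)) + l * g m p)) has_field_derivative
            gateaux_deriv F (Suc m) g (\<lambda>p. (f p + (\<Sum>i\<in>S. g i p)) + l * g m p)) (at l within {0..1})"
        if S: "S \<in> Pow ?I" for S
      proof -
        have *: "(\<lambda>p. (f p + (\<Sum>i\<in>S. g i p)) + l * g m p) \<in> graphons"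
          "\<And>i. i \<le> m \<Longrightarrow> g i \<in> Adm (\<lambda>p. (f p + (\<Sum>i\<in>S. g i p)) + l * g m p)" if l: "l \<in> {0..1}" for l
        proof -
          let ?q = "\<lambda>p. (f p + (\<Sum>i\<in>S. g i p)) + l * g m p"
          have k: "?q \<in> kernels"
            using step.prems(1) g(1) S m by (intro kernels_add kernels_scale kernels_sum) auto
          have p0: "0 \<le> ?q p" if "p \<in> unit_square" for p
            using step.prems(2) g(2) that S l m by (intro add_nonneg_nonneg sum_nonneg mult_nonneg_nonneg) auto
          have p1: "?q p + \<epsilon> * (\<Sum>i\<le>N. g i p) \<le> 1" if "p \<in> unit_square" for p
          proof -
            have "(\<Sum>i\<in>S. g i p) \<le> (\<Sum>i\<in>?I. g i p)"
              using S g(2) that by (intro sum_mono2) auto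
            then show ?thesis using le1[OF that, of l] l by simp
          qed
          show "?q \<in> graphons" "\<And>i. i \<le> m \<Longrightarrow> g i \<in> Adm ?q"
            using room[OF k p0 p1] m by auto
        qed
        show ?thesis
          using step(2) l by (intro gateaux_deriv_has_derivative[OF F _ l] *) auto
      qed
      then have "(\<psi> has_field_derivative
          (\<Sum>S\<in>Pow ?I. (-1) ^ card (?I - S) *
             gateaux_deriv F (Suc m) g (\<lambda>p. (f p + (\<Sum>i\<in>S. g i p)) + l * g m p))) (at l within {0..1})"
        unfolding \<psi>_def mixed_diff_def
        by (intro DERIV_sum DERIV_cmult) (simp add: add_ac)
      also have "(\<Sum>S\<in>Pow ?I. (-1) ^ card (?I - S) *
             gateaux_deriv F (Suc m) g (\<lambda>p. (f p + (\<Sum>i\<in>S. g i p)) + l * g m p))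
          = mixed_diff ?I (gateaux_deriv F (Suc m) g) g (\<lambda>p. f p + l * g m p)"
        unfolding mixed_diff_def by (simp add: add_ac del: gateaux_deriv.simps)
      also have "\<dots> = 0"
      proof (rule step.IH)
        show "(\<lambda>p. f p + l * g m p) \<in> kernels"
          using step.prems(1) g(1)[OF m] by (intro kernels_add kernels_scale)
        show "0 \<le> f p + l * g m p" if "p \<in> unit_square" for p
          using step.prems(2)[OF that] g(2)[OF m that] l by simp
      qed (use le1 l in auto)
      finally show ?thesis .
    qed
    then obtain c where "\<And>l. l \<in> {0..1} \<Longrightarrow> \<psi> l = c"
      using has_field_derivative_zero_constant[of "{0..1::real}" \<psi>] by auto
    then have "\<psi> 1 = \<psi> 0" by simp
    then show ?case unfolding ins by (simp add: mixed_diff_insert \<psi>_def)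
  }
qed

lemma mixed_diff_tendsto:
  assumes "\<And>S. S \<in> Pow I \<Longrightarrow>
    ((\<lambda>n. F (\<lambda>p. f n p + (\<Sum>i\<in>S. g n i p))) \<longlongrightarrow> F (\<lambda>p. f' p + (\<Sum>i\<in>S. g' i p))) A"
  shows "((\<lambda>n. mixed_diff I F (g n) (f n)) \<longlongrightarrow> mixed_diff I F g' f') A"
  unfolding mixed_diff_def by (intro tendsto_sum tendsto_mult tendsto_const assms)

text \<open>Scaling by a factor below 1 makes all directions admissible at every point of the cube that
  \<open>f\<close> and the \<open>g i\<close> span.\<close>

lemma mixed_diff_eq_0_if_gateaux_deriv_eq_0:
  assumes F: "gateaux_differentiable (Suc N) F" "graphon_continuous L1_norm F"
    and zero: "\<And>f g. f \<in> graphons \<Longrightarrow> (\<And>i. i \<le> N \<Longrightarrow> g i \<in> Adm f) \<Longrightarrow> gateaux_deriv F (Suc N) g f = 0"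
    and g: "\<And>i. i \<le> N \<Longrightarrow> g i \<in> kernels" "\<And>i p. i \<le> N \<Longrightarrow> p \<in> unit_square \<Longrightarrow> 0 \<le> g i p"
    and f: "f \<in> kernels" "\<And>p. p \<in> unit_square \<Longrightarrow> 0 \<le> f p"
    and le: "\<And>p. p \<in> unit_square \<Longrightarrow> f p + (\<Sum>i<Suc N. g i p) \<le> 1"
  shows "mixed_diff {..<Suc N} F g f = 0"
proof -
  \<comment> \<open>The factor lies below 1 and tends to 1; the complement \<open>1 - r n\<close>
    becomes the slack \<open>\<epsilon>\<close> of the preceding lemma.\<close>
  define r where "r n = 1 - inverse (real (Suc n))" for n
  have r: "0 \<le> r n" "r n < 1" for n
    by (auto simp: r_def field_simps)
  have r1: "r \<longlonglongrightarrow> 1"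
    unfolding r_def using tendsto_diff[OF tendsto_const LIMSEQ_inverse_real_of_nat, of 1] by simp
  have "(\<lambda>n. mixed_diff {..<Suc N} F (\<lambda>i p. r n * g i p) (\<lambda>p. r n * f p))
          \<longlonglongrightarrow> mixed_diff {..<Suc N} F g f"
  proof (rule mixed_diff_tendsto)
    fix S assume S: "S \<in> Pow {..<Suc N}"
    let ?q = "\<lambda>p. f p + (\<Sum>i\<in>S. g i p)"
    have k: "?q \<in> kernels"
      using f(1) g(1) S by (intro kernels_add kernels_sum) auto
    have p0: "0 \<le> ?q p" if "p \<in> unit_square" for p
      using f(2) g(2) that S by (intro add_nonneg_nonneg sum_nonneg) auto
    have p1: "?q p \<le> 1" if "p \<in> unit_square" for p
    proof -
      have "(\<Sum>i\<in>S. g i p) \<le> (\<Sum>i<Suc N. g i p)"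
        using S g(2) that by (intro sum_mono2) auto
      then show ?thesis using le[OF that] by simp
    qed
    have eq: "(\<lambda>p. r n * f p + (\<Sum>i\<in>S. r n * g i p)) = (\<lambda>p. r n * ?q p)" for n
      by (simp add: distrib_left sum_distrib_left)
    have "(\<lambda>n. F (\<lambda>p. r n * ?q p)) \<longlonglongrightarrow> F ?q"
    proof (rule graphon_continuous_tendsto[OF F(2)])
      show "?q \<in> graphons" using k p0 p1 by (intro graphonsI)
      show "(\<lambda>p. r n * ?q p) \<in> graphons" for n
      proof (rule graphonsI)
        fix p :: "real \<times> real" assume "p \<in> unit_square"
        then show "0 \<le> r n * ?q p" "r n * ?q p \<le> 1"
          using p0 p1 r[of n] by (auto intro: mult_le_one)
      qed (use k in \<open>intro kernels_scale\<close>)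
      have "(\<lambda>p. r n * ?q p - ?q p) = (\<lambda>p. (r n - 1) * ?q p)" for n
        by (simp add: algebra_simps)
      then have *: "L1_norm (\<lambda>p. r n * ?q p - ?q p) = \<bar>r n - 1\<bar> * L1_norm ?q" for n
        by (simp only: L1_norm_scale)
      have "(\<lambda>n. \<bar>r n - 1\<bar> * L1_norm ?q) \<longlonglongrightarrow> \<bar>1 - 1\<bar> * L1_norm ?q"
        using r1 by (intro tendsto_intros)
      then show "(\<lambda>n. L1_norm (\<lambda>p. r n * ?q p - ?q p)) \<longlonglongrightarrow> 0"
        unfolding * by simp
    qed
    then show "(\<lambda>n. F (\<lambda>p. r n * f p + (\<Sum>i\<in>S. r n * g i p))) \<longlonglongrightarrow> F ?q"
      unfolding eq .
  qed
  moreover have "mixed_diff {..<Suc N} F (\<lambda>i p. r n * g i p) (\<lambda>p. r n * f p) = 0" for n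
  proof -
    have "mixed_diff {0..<Suc N} (gateaux_deriv F 0 (\<lambda>i p. r n * g i p)) (\<lambda>i p. r n * g i p) (\<lambda>p. r n * f p) = 0"
    proof (rule mixed_diff_gateaux_deriv_eq_0[OF F(1) zero, where \<epsilon>="1 - r n"])
      fix p :: "real \<times> real" assume p: "p \<in> unit_square"
      have 0: "0 \<le> f p" "0 \<le> (\<Sum>i<Suc N. g i p)"
        using f(2)[OF p] g(2)[OF _ p] by (auto intro!: sum_nonneg simp del: sum.lessThan_Suc)
      have "r n * f p + (\<Sum>i<Suc N. r n * g i p) + (1 - r n) * (\<Sum>i<Suc N. r n * g i p)
          = r n * (f p + (\<Sum>i<Suc N. g i p)) + (1 - r n) * (r n * (\<Sum>i<Suc N. g i p))"
        by (simp add: distrib_left sum_distrib_left)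
      \<comment> \<open>A convex combination of two quantities bounded by 1.\<close>
      also have "\<dots> \<le> r n * 1 + (1 - r n) * 1"
      proof (intro add_mono mult_left_mono le p)
        show "r n * (\<Sum>i<Suc N. g i p) \<le> 1"
          using r[of n] 0 le[OF p] by (intro mult_le_one) linarith+
      qed (use r[of n] in auto)
      finally show "r n * f p + (\<Sum>i\<in>{0..<Suc N}. r n * g i p) + (1 - r n) * (\<Sum>i\<le>N. r n * g i p) \<le> 1"
        by (simp add: lessThan_Suc_atMost atLeast0LessThan del: sum.lessThan_Suc)
    qed (use f g r[of n] in \<open>auto intro!: kernels_scale\<close>)
    moreover have "gateaux_deriv F 0 g' = F" for g'
      by (rule ext) simp
    ultimately show ?thesis by (simp add: atLeast0LessThan)
  qed
  ultimately show ?thesis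
    by (simp add: LIMSEQ_const_iff)
qed

text \<open>Upward induction on the order \<open>m\<close> of differentiation: \<open>g m\<close> is
  replaced by \<open>l * g m\<close>, the vanishing difference is divided by \<open>l\<close>, and
  \<open>l\<close> tends to 0 from the right. Since directions get rescaled, the claim is stated for
  all \<open>g\<close>. It records that the vertices in the remaining directions are graphons and
  that the directions used for differentiation are admissible at all of them.\<close>

lemma gateaux_deriv_eq_0_if_mixed_diff_eq_0:
  assumes F: "gateaux_differentiable (Suc N) F"
    and zero: "\<And>f g. (\<And>i. i \<le> N \<Longrightarrow> g i \<in> kernels) \<Longrightarrow> (\<And>S. S \<subseteq> {..<Suc N} \<Longrightarrow> (\<lambda>p. f p + (\<Sum>i\<in>S. g i p)) \<in> graphons) \<Longrightarrow>
        mixed_diff {..<Suc N} F g f = 0"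
    and f: "f \<in> graphons" and g: "\<And>i. i \<le> N \<Longrightarrow> g i \<in> Adm f"
  shows "gateaux_deriv F (Suc N) g f = 0"
proof -
  have "mixed_diff {m..<Suc N} (gateaux_deriv F m g) g f = 0"
    if "m \<le> Suc N" and "\<And>i. i \<le> N \<Longrightarrow> g i \<in> kernels"
      and "\<And>S. S \<subseteq> {m..<Suc N} \<Longrightarrow> (\<lambda>p. f p + (\<Sum>i\<in>S. g i p)) \<in> graphons"
      and "\<And>S i. S \<subseteq> {m..<Suc N} \<Longrightarrow> i < m \<Longrightarrow> g i \<in> Adm (\<lambda>p. f p + (\<Sum>i\<in>S. g i p))" for m f g
    using that
  proof (induction m arbitrary: f g)
    case 0
    then show ?case using zero[of g f] by (simp add: atLeast0LessThan)
  next
    case (Suc m)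
    let ?I = "{Suc m..<Suc N}"
    let ?q = "\<lambda>S p. f p + (\<Sum>i\<in>S. g i p)"
    have m: "m \<le> N" using Suc.prems(1) by simp
    have ins: "{m..<Suc N} = insert m ?I" using m by auto
    \<comment> \<open>For small \<open>l\<close> the rescaled cube meets the hypotheses again: there
      are finitely many vertices, and \<open>Adm_shift\<close> preserves admissibility at each of
      them.\<close>
    have "\<forall>\<^sub>F l in at_right 0. \<forall>S\<in>Pow ?I. shift (?q S) l (g m) \<in> graphons \<and>
            (\<forall>i\<in>{..<m}. g i \<in> Adm (shift (?q S) l (g m)))"
    proof (intro eventually_ball_finite ballI eventually_conj)
      fix S assume S: "S \<in> Pow ?I"
      then have "g m \<in> Adm (?q S)" using Suc.prems(4) by auto
      from AdmE[OF this] obtain \<delta> where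
        "\<delta> > 0" "\<And>\<epsilon>. 0 \<le> \<epsilon> \<Longrightarrow> \<epsilon> < \<delta> \<Longrightarrow> shift (?q S) \<epsilon> (g m) \<in> graphons"
        by blast
      then show "\<forall>\<^sub>F l in at_right 0. shift (?q S) l (g m) \<in> graphons"
        unfolding eventually_at_right_field by (intro exI[of _ \<delta>]) auto
      fix i assume i: "i \<in> {..<m}"
      then obtain \<delta> where "\<delta> > 0" "\<forall>l. 0 \<le> l \<and> l < \<delta> \<longrightarrow> g i \<in> Adm (shift (?q S) l (g m))"
        using Adm_shift[of "?q S" "g i" "g m"] Suc.prems S by auto
      then show "\<forall>\<^sub>F l in at_right 0. g i \<in> Adm (shift (?q S) l (g m))"
        unfolding eventually_at_right_field by (intro exI[of _ \<delta>]) auto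
    qed auto
    then have ev: "\<forall>\<^sub>F l in at_right 0. 
        (\<Sum>S\<in>Pow ?I. (-1) ^ card (?I - S) *
          ((gateaux_deriv F m g (shift (?q S) l (g m)) - gateaux_deriv F m g (?q S)) / l)) = 0"
    proof (rule eventually_mono)
      fix l assume l: "\<forall>S\<in>Pow ?I. shift (?q S) l (g m) \<in> graphons \<and>
            (\<forall>i\<in>{..<m}. g i \<in> Adm (shift (?q S) l (g m)))"
      let ?g = "g(m := \<lambda>p. l * g m p)"
      have sum_eq: "(\<lambda>p. f p + (\<Sum>i\<in>S. ?g i p))
          = (if m \<in> S then shift (?q (S - {m})) l (g m) else ?q S)" if "S \<subseteq> {m..<Suc N}" for S
      proof (cases "m \<in> S")
        case True
        moreover have "finite S" using that finite_subset by blast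
        moreover have "(\<Sum>i\<in>S - {m}. ?g i p) = (\<Sum>i\<in>S - {m}. g i p)" for p
          by (intro sum.cong) auto
        ultimately show ?thesis by (auto simp: shift_def sum.remove)
      next
        case False
        then have "(\<Sum>i\<in>S. ?g i p) = (\<Sum>i\<in>S. g i p)" for p
          by (intro sum.cong) auto
        then show ?thesis using False by simp
      qed
      have sub: "S - {m} \<subseteq> ?I" "m \<notin> S \<Longrightarrow> S \<subseteq> ?I" if "S \<subseteq> {m..<Suc N}" for S
        using that unfolding ins by auto
      have "mixed_diff {m..<Suc N} (gateaux_deriv F m ?g) ?g f = 0"
      proof (rule Suc.IH)
        show "?g i \<in> kernels" if "i \<le> N" for i
          using Suc.prems(2) that m by (auto intro: kernels_scale)
        show "(\<lambda>p. f p + (\<Sum>i\<in>S. ?g i p)) \<in> graphons" if S: "S \<subseteq> {m..<Suc N}" for S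
          unfolding sum_eq[OF S] using l sub[OF S] Suc.prems(3) by auto
        show "?g i \<in> Adm (\<lambda>p. f p + (\<Sum>i\<in>S. ?g i p))" if S: "S \<subseteq> {m..<Suc N}" and i: "i < m" for S i
          unfolding sum_eq[OF S] using l sub[OF S] Suc.prems(4) i by auto
      qed (use m in auto)
      moreover have "gateaux_deriv F m ?g = gateaux_deriv F m g"
        by (intro ext gateaux_deriv_cong) simp
      moreover have "mixed_diff ?I G ?g h = mixed_diff ?I G g h" for G h
        by (intro mixed_diff_cong) auto
      ultimately have "mixed_diff ?I (gateaux_deriv F m g) g (\<lambda>p. f p + l * g m p)
          - mixed_diff ?I (gateaux_deriv F m g) g f = 0"
        unfolding ins by (simp add: mixed_diff_insert del: gateaux_deriv.simps)
      then have *: "(\<Sum>S\<in>Pow ?I. (-1) ^ card (?I - S) *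
          (gateaux_deriv F m g (shift (?q S) l (g m)) - gateaux_deriv F m g (?q S))) = 0"
        unfolding mixed_diff_def shift_def 
        by (simp add: algebra_simps sum_subtractf del: gateaux_deriv.simps)
      have "(\<Sum>S\<in>Pow ?I. (-1) ^ card (?I - S) *
          ((gateaux_deriv F m g (shift (?q S) l (g m)) - gateaux_deriv F m g (?q S)) / l))
         = (\<Sum>S\<in>Pow ?I. (-1) ^ card (?I - S) *
          (gateaux_deriv F m g (shift (?q S) l (g m)) - gateaux_deriv F m g (?q S))) / l"
        by (simp add: sum_divide_distrib del: gateaux_deriv.simps)
      then show "(\<Sum>S\<in>Pow ?I. (-1) ^ card (?I - S) *
          ((gateaux_deriv F m g (shift (?q S) l (g m)) - gateaux_deriv F m g (?q S)) / l)) = 0"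
        unfolding * by simp
    qed
    have "((\<lambda>l. \<Sum>S\<in>Pow ?I. (-1) ^ card (?I - S) *
          ((gateaux_deriv F m g (shift (?q S) l (g m)) - gateaux_deriv F m g (?q S)) / l))
        \<longlongrightarrow> (\<Sum>S\<in>Pow ?I. (-1) ^ card (?I - S) * gateaux_deriv F (Suc m) g (?q S))) (at_right 0)"
    proof (intro tendsto_sum tendsto_mult tendsto_const)
      fix S assume S: "S \<in> Pow ?I"
      have A: "i \<le> m \<Longrightarrow> g i \<in> Adm (?q S)" for i
        using Suc.prems(4) S by auto
      have G: "?q S \<in> graphons" using Suc.prems(3) S by auto
      show "((\<lambda>l. (gateaux_deriv F m g (shift (?q S) l (g m)) - gateaux_deriv F m g (?q S)) / l)
          \<longlongrightarrow> gateaux_deriv F (Suc m) g (?q S)) (at_right 0)"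
        by (rule tendsto_mono[OF at_right_le_admissible_steps[OF A[OF order_refl]]
              gateaux_differentiable_tendsto[where g=g, OF F le_imp_less_Suc[OF m] G A]])
    qed
    then have "(\<Sum>S\<in>Pow ?I. (-1) ^ card (?I - S) * gateaux_deriv F (Suc m) g (?q S)) = 0"
      by (rule tendsto_unique[OF trivial_limit_at_right_real _ tendsto_eventually[OF ev]])
    then show ?case unfolding mixed_diff_def .
  qed
  from this[of "Suc N" g f] show ?thesis
    using f g AdmD[OF g] by (simp add: less_Suc_eq_le del: gateaux_deriv.simps)
qed

section \<open>Homomorphism densities of edge labellings\<close>

abbreviation unit_cube_measure :: "'v set \<Rightarrow> ('v \<Rightarrow> real) measure" where
  "unit_cube_measure V \<equiv> completion (PiM V (\<lambda>_. lebesgue_on unit_interval))"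

section \<open>The completed product measure on the unit cube\<close>

lemma unit_square_borel [simp]: "unit_square \<in> sets borel"
  by (intro borel_closed closed_Times) auto

lemma emeasure_unit_square: "emeasure lebesgue unit_square = 1"
proof -
  have "emeasure lebesgue unit_square = emeasure (lborel \<Otimes>\<^sub>M lborel) (unit_interval \<times> unit_interval)"
    unfolding lborel_prod by simp
  also have "\<dots> = emeasure lborel unit_interval * emeasure lborel unit_interval"
    by (rule lborel.emeasure_pair_measure_Times) auto
  finally show ?thesis by simp
qed

lemma unit_square_sets [simp, intro]: "unit_square \<in> sets lebesgue"
  by (rule sets_completionI_sets) simp

lemma finite_measure_unit_square: "finite_measure (lebesgue_on unit_square)"
  by (rule finite_measure_lebesgue_on)
    (simp add: fmeasurable_def emeasure_unit_square)

lemma measure_unit_square: "measure (lebesgue_on unit_square) unit_square = 1"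
  by (simp add: measure_def emeasure_restrict_space emeasure_unit_square)

lemma finite_measure_unit_interval: "finite_measure (lebesgue_on unit_interval)"
  by (rule finite_measure_lebesgue_on) (auto simp: fmeasurable_def)

interpretation unit_product: product_sigma_finite "\<lambda>_ :: 'v. lebesgue_on unit_interval"
  by (simp add: product_sigma_finite_def finite_measure.axioms(1)[OF finite_measure_unit_interval])

lemma emeasure_unit_box:
  assumes "finite V" "\<And>v. v \<in> V \<Longrightarrow> A v \<in> sets (lebesgue_on unit_interval)"
  shows "emeasure (PiM V (\<lambda>_. lebesgue_on unit_interval)) (Pi\<^sub>E V A)
      = (\<Prod>v\<in>V. emeasure (lebesgue_on unit_interval) (A v))"
  using assms by (rule unit_product.emeasure_PiM)

lemma emeasure_unit_product_space:
  assumes "finite V"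
  shows "emeasure (PiM V (\<lambda>_. lebesgue_on unit_interval)) (V \<rightarrow>\<^sub>E unit_interval) = 1"
  using assms by (subst emeasure_unit_box) (auto simp: emeasure_restrict_space)

lemma finite_measure_unit_cube:
  assumes "finite V"
  shows "finite_measure (unit_cube_measure V)"
proof
  have "emeasure (unit_cube_measure V) (space (unit_cube_measure V)) = 1"
    using emeasure_unit_product_space[OF assms] sets.top[of "PiM V (\<lambda>_. lebesgue_on unit_interval)"]
    by (simp add: space_PiM)
  then show "emeasure (unit_cube_measure V) (space (unit_cube_measure V)) \<noteq> \<infinity>" by simp
qed

lemma space_unit_cube: "space (unit_cube_measure V) = V \<rightarrow>\<^sub>E unit_interval"
  by (simp add: space_PiM)

lemma borel_sets_lebesgue_on: "A \<in> sets borel \<Longrightarrow> A \<inter> S \<in> sets (lebesgue_on S)"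
  by (auto simp: sets_restrict_space)

lemma pair_projection_measurable:
  assumes "i \<in> V" "j \<in> V"
  shows "(\<lambda>x. (x i, x j)) \<in> PiM V (\<lambda>_. lebesgue_on unit_interval) \<rightarrow>\<^sub>M (borel :: (real \<times> real) measure)"
proof -
  have "(\<lambda>x. x v) \<in> PiM V (\<lambda>_. lebesgue_on unit_interval) \<rightarrow>\<^sub>M (borel :: real measure)" if "v \<in> V" for v
    using measurable_compose[OF measurable_component_singleton[OF that, of "\<lambda>_. lebesgue_on unit_interval"]
        id_borel_measurable_lebesgue_on] by simp
  then show ?thesis
    using assms unfolding borel_prod[symmetric] by (intro measurable_Pair) auto
qed

text \<open>Distinct coordinates are independent and uniform. For equal coordinates the image would
  sit on the diagonal, a planar null set on which a measurable kernel carries no information; this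
  is why edges have to be loopless throughout.\<close>

lemma distr_pair_projection:
  assumes V: "finite V" and ij: "i \<in> V" "j \<in> V" "i \<noteq> j"
  shows "distr (PiM V (\<lambda>_. lebesgue_on unit_interval)) borel (\<lambda>x. (x i, x j))
      = density lborel (indicator unit_square)"
proof -
  let ?M = "PiM V (\<lambda>_. lebesgue_on unit_interval)"
  let ?T = "\<lambda>x. (x i, x j) :: real \<times> real"
  let ?u = "density lborel (indicator unit_interval) :: real measure"
  have T: "?T \<in> ?M \<rightarrow>\<^sub>M borel" by (rule pair_projection_measurable[OF ij(1,2)])
  have eu: "emeasure ?u A = emeasure (lebesgue_on unit_interval) (A \<inter> unit_interval)" if "A \<in> sets borel" for A
  proof -
    have "emeasure ?u A = emeasure lborel (unit_interval \<inter> A)"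
      using that by (subst emeasure_density) (auto simp flip: indicator_inter_arith)
    moreover have "emeasure (lebesgue_on unit_interval) (A \<inter> unit_interval) = emeasure lborel (unit_interval \<inter> A)"
      using that by (subst emeasure_restrict_space) (auto simp: Int_commute)
    ultimately show ?thesis by simp
  qed
  have fin: "finite_measure ?u"
    by standard (simp add: eu emeasure_restrict_space)
  have sf: "sigma_finite_measure ?u"
    by (rule finite_measure.axioms(1)[OF fin])
  have "?u \<Otimes>\<^sub>M ?u = distr ?M borel ?T"
  proof (rule pair_measure_eqI[OF sf sf])
    show "sets (?u \<Otimes>\<^sub>M ?u) = sets (distr ?M borel ?T)"
      by (simp add: borel_prod[symmetric] cong: sets_pair_measure_cong)
    fix A B assume "A \<in> sets ?u" "B \<in> sets ?u"
    then have A: "A \<in> sets borel" and B: "B \<in> sets borel" by auto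
    let ?C = "\<lambda>v. (if v = i then A else if v = j then B else UNIV) \<inter> unit_interval"
    have AB: "A \<times> B \<in> sets (borel :: (real \<times> real) measure)"
      using A B by (simp add: borel_prod[symmetric])
    have "emeasure (distr ?M borel ?T) (A \<times> B) = emeasure ?M (?T -` (A \<times> B) \<inter> space ?M)"
      by (rule emeasure_distr[OF T AB])
    also have "?T -` (A \<times> B) \<inter> space ?M = Pi\<^sub>E V ?C"
      using ij by (auto simp: space_PiM PiE_iff split: if_splits)
    also have "emeasure ?M \<dots> = (\<Prod>v\<in>V. emeasure (lebesgue_on unit_interval) (?C v))"
      using A B by (intro emeasure_unit_box V borel_sets_lebesgue_on) auto
    also have "\<dots> = (\<Prod>v\<in>V. (if v = i then emeasure ?u A else 1) * (if v = j then emeasure ?u B else 1))"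
      using ij by (intro prod.cong refl) (auto simp: eu A B emeasure_restrict_space)
    also have "\<dots> = emeasure ?u A * emeasure ?u B"
      using V ij by (simp add: prod.distrib)
    finally show "emeasure ?u A * emeasure ?u B = emeasure (distr ?M borel ?T) (A \<times> B)" by simp
  qed
  moreover have "?u \<Otimes>\<^sub>M ?u = density (lborel \<Otimes>\<^sub>M lborel) (\<lambda>(x, y). indicator unit_interval x * indicator unit_interval y)"
    by (rule pair_measure_density) (auto intro: sf lborel.sigma_finite_measure_axioms)
  moreover have "(\<lambda>(x, y). indicator unit_interval x * indicator unit_interval y :: ennreal) = indicator unit_square"
    by (auto simp: indicator_def)
  ultimately show ?thesis by (simp add: lborel_prod)
qed

text \<open>A Lebesgue measurable \<open>u\<close> agrees with a Borel function only almost
  everywhere, so its pullback need not be measurable for the product measure. It is measurable for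
  the completion, because by \<open>distr_pair_projection\<close> planar null sets pull back to null
  sets.\<close>

lemma pair_projection_integral:
  assumes V: "finite V" and ij: "i \<in> V" "j \<in> V" "i \<noteq> j"
    and u: "u \<in> borel_measurable (lebesgue_on unit_square)"
  shows "(\<lambda>x. u (x i, x j)) \<in> borel_measurable (unit_cube_measure V)"
    and "(LINT x|unit_cube_measure V. u (x i, x j)) = (LINT p|lebesgue_on unit_square. u p :: real)"
proof -
  let ?M = "PiM V (\<lambda>_. lebesgue_on unit_interval)"
  let ?T = "\<lambda>x. (x i, x j) :: real \<times> real"
  define w where "w p = (if p \<in> unit_square then u p else 0)" for p
  have T: "?T \<in> ?M \<rightarrow>\<^sub>M borel" by (rule pair_projection_measurable[OF ij(1,2)])
  have w: "w \<in> borel_measurable lebesgue"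
    unfolding w_def by (rule borel_measurable_if_I[OF u]) auto
  obtain w' where w': "w' \<in> borel_measurable lborel" "AE p in lborel. w p = w' p"
    using completion_ex_borel_measurable_real[OF w] by blast
  have "AE p in density lborel (indicator unit_square). w p = w' p"
    using w'(2) by (subst AE_density) (auto simp: borel_prod[symmetric])
  then have "AE p in distr ?M borel ?T. w p = w' p"
    unfolding distr_pair_projection[OF V ij] .
  then have "AE x in ?M. w (?T x) = w' (?T x)"
    by (rule AE_distrD[OF T])
  then have ae: "AE x in unit_cube_measure V. w (?T x) = w' (?T x)"
    by (rule AE_completion)
  have w'T: "(\<lambda>x. w' (?T x)) \<in> borel_measurable ?M"
    using measurable_compose[OF T] w'(1) by simp
  have uw: "u (?T x) = w (?T x)" if "x \<in> space (unit_cube_measure V)" for x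
    using that ij unfolding space_unit_cube w_def by auto
  have lb: "distr (unit_cube_measure V) lborel ?T = distr (unit_cube_measure V) borel ?T"
    by (rule distr_cong) auto
  have "null_sets lborel \<subseteq> null_sets (distr (unit_cube_measure V) lborel ?T)"
    unfolding lb
  proof
    fix Z :: "(real \<times> real) set" assume Z: "Z \<in> null_sets lborel"
    then have "AE p in lborel. p \<notin> Z" by (rule AE_not_in)
    then have "AE p in density lborel (indicator unit_square). p \<notin> Z"
      by (subst AE_density) (auto simp: borel_prod[symmetric])
    then have "Z \<in> null_sets (density lborel (indicator unit_square))"
      using Z by (subst AE_iff_null_sets) auto
    then show "Z \<in> null_sets (distr (unit_cube_measure V) borel ?T)"
      by (simp add: distr_completion[OF T] distr_pair_projection[OF V ij])
  qed
  then have "?T \<in> unit_cube_measure V \<rightarrow>\<^sub>M completion lborel"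
    using measurable_completion[OF T]
    by (intro completion.measurable_completion2) simp_all
  then have wT: "(\<lambda>x. w (?T x)) \<in> borel_measurable (unit_cube_measure V)"
    using measurable_compose[OF _ w] by blast
  then show "(\<lambda>x. u (x i, x j)) \<in> borel_measurable (unit_cube_measure V)"
    by (subst measurable_cong[OF uw])
  have "(LINT x|unit_cube_measure V. u (x i, x j)) = (LINT x|unit_cube_measure V. w (?T x))"
    by (intro Bochner_Integration.integral_cong refl uw)
  also have "\<dots> = (LINT x|unit_cube_measure V. w' (?T x))"
    by (intro integral_cong_AE wT measurable_completion w'T ae)
  also have "\<dots> = (LINT x|?M. w' (?T x))"
    by (rule integral_completion[OF w'T])
  also have "\<dots> = (LINT p|distr ?M borel ?T. w' p)"
    using w'(1) by (subst integral_distr[OF T]) auto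
  also have "\<dots> = (LINT p|lborel. indicator unit_square p *\<^sub>R w' p)"
    unfolding distr_pair_projection[OF V ij] using w'(1)
    by (subst integral_density[symmetric]) (auto simp: borel_prod[symmetric] ennreal_indicator)
  also have "\<dots> = (LINT p|lebesgue. indicator unit_square p *\<^sub>R w' p)"
    using w'(1) by (intro integral_completion[symmetric]) (auto simp: borel_prod[symmetric])
  also have "\<dots> = (LINT p|lebesgue. indicator unit_square p *\<^sub>R u p)"
  proof (rule integral_cong_AE)
    have eq: "indicator unit_square p *\<^sub>R u p = w p" for p
      by (auto simp: w_def indicator_def)
    show "(\<lambda>p. indicator unit_square p *\<^sub>R u p) \<in> borel_measurable lebesgue"
      unfolding eq by (rule w)
    show "(\<lambda>p. indicator unit_square p *\<^sub>R w' p) \<in> borel_measurable lebesgue"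
      using w'(1) by (intro measurable_completion) (auto simp: borel_prod[symmetric])
    show "AE p in lebesgue. indicator unit_square p *\<^sub>R w' p = indicator unit_square p *\<^sub>R u p"
      using AE_completion[OF w'(2)] by eventually_elim (auto simp: w_def indicator_def)
  qed
  also have "\<dots> = (LINT p|lebesgue_on unit_square. u p)"
    by (subst integral_restrict_space) auto
  finally show "(LINT x|unit_cube_measure V. u (x i, x j)) = (LINT p|lebesgue_on unit_square. u p)" .
qed

lemma kernels_integrable: "f \<in> kernels \<Longrightarrow> integrable (lebesgue_on unit_square) f"
proof -
  assume f: "f \<in> kernels"
  obtain B where B: "\<And>p. p \<in> unit_square \<Longrightarrow> \<bar>f p\<bar> \<le> B" using kernels_bounded[OF f] by metis
  show ?thesis
    using kernelsD(1)[OF f] B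
    by (intro finite_measure.integrable_const_bound[OF finite_measure_unit_square, of _ B]) auto
qed

lemma L1_norm_nonneg: "0 \<le> L1_norm f"
  unfolding L1_norm_def by (intro integral_nonneg_AE) auto

lemma L1_norm_triangle:
  assumes "f \<in> kernels" "g \<in> kernels"
  shows "L1_norm (\<lambda>p. f p + g p) \<le> L1_norm f + L1_norm g"
proof -
  have "L1_norm (\<lambda>p. f p + g p) \<le> (LINT p|lebesgue_on unit_square. \<bar>f p\<bar> + \<bar>g p\<bar>)"
    unfolding L1_norm_def using assms
    by (intro integral_mono Bochner_Integration.integrable_add integrable_abs kernels_integrable kernels_add) auto
  then show ?thesis
    unfolding L1_norm_def using assms by (simp add: kernels_integrable)
qed

text \<open>A loopless multigraph without isolated vertices is encoded by the list \<open>p\<close> of the endpoints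
  \<open>p (2 * j)\<close>, \<open>p (2 * j + 1)\<close> of its edges.\<close>

definition graph_of :: "nat \<Rightarrow> (nat \<Rightarrow> nat) \<Rightarrow> multigraph" where
  "graph_of n p = Multigraph (p ` {..<2 * n})
     (image_mset (\<lambda>j. {p (2 * j), p (2 * j + 1)}) (mset_set {..<n}))"

text \<open>The polarised density, with one kernel per edge; the density itself is its diagonal.
  Mixed differences of top order produce such terms.\<close>

definition multi_density :: "nat \<Rightarrow> (nat \<Rightarrow> nat) \<Rightarrow> (nat \<Rightarrow> kernel) \<Rightarrow> real" where
  "multi_density n p g = (LINT x|unit_cube_measure (p ` {..<2 * n}).
     (\<Prod>j<n. g j (x (p (2 * j)), x (p (2 * j + 1)))))"

abbreviation edge_loopless :: "nat \<Rightarrow> (nat \<Rightarrow> nat) \<Rightarrow> bool" where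
  "edge_loopless n p \<equiv> (\<forall>j<n. p (2 * j) \<noteq> p (2 * j + 1))"

lemma endpoint_in:
  fixes n :: nat
  shows "j < n \<Longrightarrow> p (2 * j) \<in> p ` {..<2 * n}" and "j < n \<Longrightarrow> p (2 * j + 1) \<in> p ` {..<2 * n}"
  by auto

text \<open>\<open>Min\<close> and \<open>Max\<close> may list the endpoints in the other order than
  \<open>p\<close> does; the symmetry of \<open>f\<close> on the square absorbs this.\<close>

lemma hom_density_graph_of:
  assumes "edge_loopless n p" "f \<in> kernels"
  shows "hom_density (graph_of n p) f = multi_density n p (\<lambda>_. f)"
proof -
  have "f (x (Min {a, b}), x (Max {a, b})) = f (x a, x b)" if "x a \<in> unit_interval" "x b \<in> unit_interval"
    for x and a b :: nat
    using kernelsD(2)[OF assms(2) that] by (cases "a \<le> b") (auto simp: min_def max_def)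
  note minmax = this
  have "f (x (Min {p (2 * j), p (2 * j + 1)}), x (Max {p (2 * j), p (2 * j + 1)}))
      = f (x (p (2 * j)), x (p (2 * j + 1)))"
    if "x \<in> space (unit_cube_measure (p ` {..<2 * n}))" "j < n" for x j
  proof -
    have "x (p (2 * j)) \<in> unit_interval" "x (p (2 * j + 1)) \<in> unit_interval"
      using that(1) endpoint_in[OF that(2), of p] unfolding space_unit_cube by (auto simp: PiE_iff)
    then show ?thesis by (rule minmax)
  qed
  then show ?thesis
    unfolding hom_density_def multi_density_def graph_of_def
    by (intro Bochner_Integration.integral_cong) (auto simp: image_mset.compositionality comp_def
        prod_unfold_prod_mset simp del: Min_insert Max_insert intro!: arg_cong[where f=prod_mset] image_mset_cong)
qed

lemma multi_density_integrable:
  assumes p: "edge_loopless n p" and g: "\<And>j. j < n \<Longrightarrow> g j \<in> kernels"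
  shows "integrable (unit_cube_measure (p ` {..<2 * n}))
     (\<lambda>x. \<Prod>j<n. g j (x (p (2 * j)), x (p (2 * j + 1))))"
proof -
  have "\<exists>B. \<forall>q\<in>unit_square. \<bar>g j q\<bar> \<le> B" if "j < n" for j
    using kernels_bounded[OF g[OF that]] by metis
  then obtain B where B: "\<And>j q. j < n \<Longrightarrow> q \<in> unit_square \<Longrightarrow> \<bar>g j q\<bar> \<le> B j" by metis
  show ?thesis
  proof (rule finite_measure.integrable_const_bound[OF finite_measure_unit_cube, of _ _ "\<Prod>j<n. B j"])
    show "AE x in unit_cube_measure (p ` {..<2 * n}). norm (\<Prod>j<n. g j (x (p (2 * j)), x (p (2 * j + 1)))) \<le> (\<Prod>j<n. B j)"
    proof (rule AE_I2)
      fix x assume x: "x \<in> space (unit_cube_measure (p ` {..<2 * n}))"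
      have "\<bar>g j (x (p (2 * j)), x (p (2 * j + 1)))\<bar> \<le> B j" if "j < n" for j
        using x endpoint_in[OF that, of p] unfolding space_unit_cube by (intro B that) auto
      then show "norm (\<Prod>j<n. g j (x (p (2 * j)), x (p (2 * j + 1)))) \<le> (\<Prod>j<n. B j)"
        unfolding prod_norm[symmetric] by (intro prod_mono) auto
    qed
    show "(\<lambda>x. \<Prod>j<n. g j (x (p (2 * j)), x (p (2 * j + 1)))) \<in> borel_measurable (unit_cube_measure (p ` {..<2 * n}))"
      using p g kernelsD(1) endpoint_in[of _ n p]
      by (intro borel_measurable_prod pair_projection_integral(1)) auto
  qed auto
qed

text \<open>A difference of products of numbers in the unit interval is at most the sum of the
  differences of the factors, and each edge sees the uniform distribution on the square.\<close>

lemma multi_density_L1: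
  assumes p: "edge_loopless n p" and f: "f \<in> graphons" and h: "h \<in> graphons"
  shows "\<bar>multi_density n p (\<lambda>_. h) - multi_density n p (\<lambda>_. f)\<bar> \<le> real n * L1_norm (\<lambda>q. h q - f q)"
proof -
  let ?M = "unit_cube_measure (p ` {..<2 * n})"
  let ?e = "\<lambda>x j. (x (p (2 * j)), x (p (2 * j + 1))) :: real \<times> real"
  note k = graphonsD(1)[OF f] graphonsD(1)[OF h]
  have m: "(\<lambda>q. \<bar>h q - f q\<bar>) \<in> borel_measurable (lebesgue_on unit_square)"
    using kernelsD(1)[OF kernels_diff[OF k(2,1)]] by measurable
  have int: "integrable ?M (\<lambda>x. \<bar>h (?e x j) - f (?e x j)\<bar>)" if j: "j < n" for j
  proof -
    have e: "?e x j \<in> unit_square" if "x \<in> space ?M" for x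
      using that endpoint_in[OF j, of p] unfolding space_unit_cube by auto
    have b: "\<bar>h (?e x j) - f (?e x j)\<bar> \<le> 1" if "x \<in> space ?M" for x
      using graphonsD(2,3)[OF f e[OF that]] graphonsD(2,3)[OF h e[OF that]] by linarith
    show ?thesis
      using p j endpoint_in[OF j, of p] b
      by (intro finite_measure.integrable_const_bound[OF finite_measure_unit_cube, of _ _ 1] AE_I2
          pair_projection_integral(1)[OF _ _ _ _ m]) auto
  qed
  have "\<bar>multi_density n p (\<lambda>_. h) - multi_density n p (\<lambda>_. f)\<bar>
      = \<bar>LINT x|?M. (\<Prod>j<n. h (?e x j)) - (\<Prod>j<n. f (?e x j))\<bar>"
    unfolding multi_density_def
    using multi_density_integrable[OF p, of "\<lambda>_. h"] multi_density_integrable[OF p, of "\<lambda>_. f"] k by simp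
  also have "\<dots> \<le> (LINT x|?M. (\<Sum>j<n. \<bar>h (?e x j) - f (?e x j)\<bar>))"
  proof (rule integral_abs_bound[THEN order_trans], rule integral_mono)
    show "integrable ?M (\<lambda>x. \<bar>(\<Prod>j<n. h (?e x j)) - (\<Prod>j<n. f (?e x j))\<bar>)"
      using multi_density_integrable[OF p, of "\<lambda>_. h"] multi_density_integrable[OF p, of "\<lambda>_. f"] k by simp
    show "integrable ?M (\<lambda>x. \<Sum>j<n. \<bar>h (?e x j) - f (?e x j)\<bar>)"
      by (intro Bochner_Integration.integrable_sum int) auto
    fix x assume x: "x \<in> space ?M"
    have e: "?e x j \<in> unit_square" if "j < n" for j
      using x endpoint_in[OF that, of p] unfolding space_unit_cube by auto
    have "norm ((\<Prod>j\<in>{..<n}. h (?e x j)) - (\<Prod>j\<in>{..<n}. f (?e x j)))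
        \<le> (\<Sum>j\<in>{..<n}. norm (h (?e x j) - f (?e x j)))"
      using graphonsD(2,3)[OF f e] graphonsD(2,3)[OF h e] by (intro norm_prod_diff) auto
    then show "\<bar>(\<Prod>j<n. h (?e x j)) - (\<Prod>j<n. f (?e x j))\<bar> \<le> (\<Sum>j<n. \<bar>h (?e x j) - f (?e x j)\<bar>)"
      by simp
  qed
  also have "\<dots> = (\<Sum>j<n. LINT x|?M. \<bar>h (?e x j) - f (?e x j)\<bar>)"
    using int by (intro Bochner_Integration.integral_sum) auto
  also have "\<dots> = (\<Sum>j<n. L1_norm (\<lambda>q. h q - f q))"
  proof (intro sum.cong refl)
    fix j assume "j \<in> {..<n}"
    then show "(LINT x|?M. \<bar>h (?e x j) - f (?e x j)\<bar>) = L1_norm (\<lambda>q. h q - f q)"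
      using p endpoint_in[of j n p] unfolding L1_norm_def
      by (intro pair_projection_integral(2)[OF _ _ _ _ m]) auto
  qed
  finally show ?thesis by simp
qed

text \<open>This is \<open>mixed_diff_prod\<close> under the integral. For \<open>n = card I\<close>
  it is polarisation, a sum over all assignments of the directions to the edges.\<close>

lemma mixed_diff_multi_density:
  assumes p: "edge_loopless n p" and I: "finite I" "n \<le> card I"
    and f: "f \<in> kernels" and g: "\<And>i. i \<in> I \<Longrightarrow> g i \<in> kernels"
  shows "mixed_diff I (\<lambda>f. multi_density n p (\<lambda>_. f)) g f
      = (\<Sum>\<sigma>\<in>{\<sigma>\<in>{..<n} \<rightarrow>\<^sub>E I. \<sigma> ` {..<n} = I}. multi_density n p (\<lambda>j. g (\<sigma> j)))"
proof -
  let ?M = "unit_cube_measure (p ` {..<2 * n})"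
  let ?e = "\<lambda>x j. (x (p (2 * j)), x (p (2 * j + 1))) :: real \<times> real"
  have int: "integrable ?M (\<lambda>x. \<Prod>j<n. f (?e x j) + (\<Sum>i\<in>S. g i (?e x j)))" if "S \<in> Pow I" for S
  proof -
    have "(\<lambda>p. f p + (\<Sum>i\<in>S. g i p)) \<in> kernels"
      using f g that by (intro kernels_add kernels_sum) auto
    then show ?thesis using multi_density_integrable[OF p, of "\<lambda>_ p. f p + (\<Sum>i\<in>S. g i p)"] by simp
  qed
  have "mixed_diff I (\<lambda>f. multi_density n p (\<lambda>_. f)) g f
      = (\<Sum>S\<in>Pow I. LINT x|?M. (-1) ^ card (I - S) * (\<Prod>j<n. f (?e x j) + (\<Sum>i\<in>S. g i (?e x j))))"
    unfolding mixed_diff_def multi_density_def by simp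
  also have "\<dots> = (LINT x|?M. (\<Sum>S\<in>Pow I. (-1) ^ card (I - S) * (\<Prod>j<n. f (?e x j) + (\<Sum>i\<in>S. g i (?e x j)))))"
    using int by (intro Bochner_Integration.integral_sum[symmetric]) auto
  also have "\<dots> = (LINT x|?M. (\<Sum>\<sigma>\<in>{\<sigma>\<in>{..<n} \<rightarrow>\<^sub>E I. \<sigma> ` {..<n} = I}. \<Prod>j<n. g (\<sigma> j) (?e x j)))"
    using I by (intro Bochner_Integration.integral_cong refl mixed_diff_prod) auto
  also have "\<dots> = (\<Sum>\<sigma>\<in>{\<sigma>\<in>{..<n} \<rightarrow>\<^sub>E I. \<sigma> ` {..<n} = I}. multi_density n p (\<lambda>j. g (\<sigma> j)))"
    unfolding multi_density_def using g
    by (intro Bochner_Integration.integral_sum multi_density_integrable[OF p]) auto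
  finally show ?thesis .
qed

lemma mixed_diff_multi_density_eq_0:
  assumes "edge_loopless n p" "finite I" "n < card I" "f \<in> kernels" "\<And>i. i \<in> I \<Longrightarrow> g i \<in> kernels"
  shows "mixed_diff I (\<lambda>f. multi_density n p (\<lambda>_. f)) g f = 0"
proof -
  have "\<sigma> ` {..<n} \<noteq> I" for \<sigma>
    using assms(3) card_image_le[of "{..<n}" \<sigma>] by fastforce
  then show ?thesis
    using assms by (simp add: mixed_diff_multi_density)
qed

section \<open>Step functions\<close>

definition cell :: "nat \<Rightarrow> nat \<Rightarrow> real set" where
  "cell k a = {real a / real k..<real (Suc a) / real k}"

text \<open>Within the unit square the half-open cells miss only points with a coordinate equal to
  1, a null set on which the value is 0. For \<open>k \<ge> 1\<close> only the first
  \<open>k\<close> rows and columns of \<open>\<beta>\<close> are read.\<close>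

definition step :: "nat \<Rightarrow> (nat \<times> nat \<Rightarrow> real) \<Rightarrow> kernel" where
  "step k \<beta> = (\<lambda>(x, y). if x \<in> {0..<1} \<and> y \<in> {0..<1}
     then \<beta> (nat \<lfloor>real k * x\<rfloor>, nat \<lfloor>real k * y\<rfloor>) else 0)"

lemma cell_iff:
  assumes "k \<ge> 1" "a < k"
  shows "x \<in> cell k a \<longleftrightarrow> x \<in> {0..<1} \<and> nat \<lfloor>real k * x\<rfloor> = a"
proof -
  have k: "real k > 0" using assms by simp
  have "x \<in> cell k a \<longleftrightarrow> real a \<le> real k * x \<and> real k * x < real a + 1"
    using k by (auto simp: cell_def field_simps)
  also have "\<dots> \<longleftrightarrow> \<lfloor>real k * x\<rfloor> = int a"
    by (simp add: floor_eq_iff)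
  also have "\<dots> \<longleftrightarrow> x \<in> {0..<1} \<and> nat \<lfloor>real k * x\<rfloor> = a"
  proof
    assume eq: "\<lfloor>real k * x\<rfloor> = int a"
    then have "real a \<le> real k * x" "real k * x < real a + 1" by (simp_all add: floor_eq_iff)
    moreover have "real a + 1 \<le> real k" using assms by simp
    ultimately have "0 \<le> real k * x" "real k * x < real k * 1" by linarith+
    then show "x \<in> {0..<1} \<and> nat \<lfloor>real k * x\<rfloor> = a"
      using k eq by (auto simp: zero_le_mult_iff)
  next
    assume "x \<in> {0..<1} \<and> nat \<lfloor>real k * x\<rfloor> = a"
    then show "\<lfloor>real k * x\<rfloor> = int a"
      using k by auto
  qed
  finally show ?thesis .
qed

lemma cell_index:
  assumes "x \<in> {0..<1}" "k \<ge> 1"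
  shows "nat \<lfloor>real k * x\<rfloor> < k"
proof -
  have "real k * x < real k * 1" using assms by (intro mult_strict_left_mono) auto
  then have "\<lfloor>real k * x\<rfloor> < int k" by (simp add: floor_less_iff)
  then show ?thesis using assms by (simp add: nat_less_iff)
qed

lemma cell_subset: "k \<ge> 1 \<Longrightarrow> a < k \<Longrightarrow> cell k a \<subseteq> {0..<1}"
  using cell_iff by blast

lemma cell_sets [simp]: "cell k a \<in> sets borel"
  by (simp add: cell_def)

lemma emeasure_cell: "k \<ge> 1 \<Longrightarrow> emeasure lborel (cell k a) = ennreal (1 / real k)"
  unfolding cell_def by (subst emeasure_lborel_Ico) (auto simp: field_simps)

lemma step_eq_sum:
  assumes k: "k \<ge> 1"
  shows "step k \<beta> p = (\<Sum>c\<in>{..<k} \<times> {..<k}. \<beta> c * indicator (cell k (fst c) \<times> cell k (snd c)) p)"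
proof (cases p)
  case (Pair x y)
  let ?f = "\<lambda>z. nat \<lfloor>real k * z\<rfloor>"
  show ?thesis
  proof (cases "x \<in> {0..<1} \<and> y \<in> {0..<1}")
    case True
    then have xy: "?f x < k" "?f y < k" using cell_index k by auto
    have "(\<Sum>c\<in>{..<k} \<times> {..<k}. \<beta> c * indicator (cell k (fst c) \<times> cell k (snd c)) p)
        = (\<Sum>c\<in>{..<k} \<times> {..<k}. if c = (?f x, ?f y) then \<beta> c else 0)"
      using True k by (intro sum.cong refl) (auto simp: Pair indicator_def cell_iff)
    also have "\<dots> = step k \<beta> p"
      using True xy by (simp add: step_def Pair)
    finally show ?thesis by simp
  next
    case False
    then have "(\<Sum>c\<in>{..<k} \<times> {..<k}. \<beta> c * indicator (cell k (fst c) \<times> cell k (snd c)) p) = 0"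
      using k by (intro sum.neutral) (auto simp: Pair indicator_def cell_iff)
    moreover have "step k \<beta> p = 0" using False by (simp only: step_def Pair prod.case if_False)
    ultimately show ?thesis by simp
  qed
qed

lemma step_cong:
  assumes "k \<ge> 1" "\<And>a b. a < k \<Longrightarrow> b < k \<Longrightarrow> \<beta> (a, b) = \<beta>' (a, b)"
  shows "step k \<beta> = step k \<beta>'"
  using assms cell_index by (fastforce simp: step_def)

lemma step_zero [simp]: "step k (\<lambda>_. 0) = (\<lambda>_. 0)"
  by (auto simp: step_def)

lemma step_add_sum: "(\<lambda>p. step k \<beta> p + (\<Sum>i\<in>S. step k (\<gamma> i) p)) = step k (\<lambda>c. \<beta> c + (\<Sum>i\<in>S. \<gamma> i c))"
  by (auto simp: step_def fun_eq_iff)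

lemma mixed_diff_step:
  "mixed_diff I F (\<lambda>i. step k (\<gamma> i)) (step k \<beta>) = mixed_diff I (\<lambda>\<beta>. F (step k \<beta>)) \<gamma> \<beta>"
  by (simp add: mixed_diff_def step_add_sum)

lemma step_refine:
  assumes "k \<ge> 1" "m \<ge> 1"
  shows "step (k * m) (\<lambda>(a, b). \<beta> (a div m, b div m)) = step k \<beta>"
proof -
  have "nat \<lfloor>real (k * m) * x\<rfloor> div m = nat \<lfloor>real k * x\<rfloor>" if "0 \<le> x" for x
  proof -
    have "\<lfloor>real k * x\<rfloor> = \<lfloor>(real (k * m) * x) / of_int (int m)\<rfloor>"
      using assms by simp
    also have "\<dots> = \<lfloor>real (k * m) * x\<rfloor> div int m"
      by (rule floor_divide_real_eq_div) simp
    finally show ?thesis using that by (simp add: nat_div_distrib)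
  qed
  then show ?thesis by (auto simp: step_def fun_eq_iff)
qed

lemma step_measurable: "k \<ge> 1 \<Longrightarrow> step k \<beta> \<in> borel_measurable borel"
proof -
  assume k: "k \<ge> 1"
  have "cell k a \<times> cell k b \<in> sets borel" for a b
    by (simp add: borel_prod[symmetric])
  then have "(\<lambda>p. \<Sum>c\<in>{..<k} \<times> {..<k}. \<beta> c * indicator (cell k (fst c) \<times> cell k (snd c)) p) \<in> borel_measurable borel"
    by (intro borel_measurable_sum borel_measurable_times borel_measurable_const borel_measurable_indicator)
  moreover have "step k \<beta> = (\<lambda>p. \<Sum>c\<in>{..<k} \<times> {..<k}. \<beta> c * indicator (cell k (fst c) \<times> cell k (snd c)) p)"
    by (rule ext) (rule step_eq_sum[OF k])
  ultimately show ?thesis by simp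
qed

lemma borel_measurable_lebesgue_onI: "f \<in> borel_measurable borel \<Longrightarrow> f \<in> borel_measurable (lebesgue_on S)"
  by (intro measurable_restrict_space1 measurable_completion) simp

lemma step_kernels:
  assumes k: "k \<ge> 1" and sym: "\<And>a b. a < k \<Longrightarrow> b < k \<Longrightarrow> \<beta> (a, b) = \<beta> (b, a)"
  shows "step k \<beta> \<in> kernels"
proof (rule kernelsI[where B="\<Sum>c\<in>{..<k} \<times> {..<k}. \<bar>\<beta> c\<bar>"])
  show "step k \<beta> \<in> borel_measurable (lebesgue_on unit_square)"
    by (rule borel_measurable_lebesgue_onI[OF step_measurable[OF k]])
  fix p :: "real \<times> real"
  obtain x y where p: "p = (x, y)" by (cases p)
  have "\<bar>\<beta> (a, b)\<bar> \<le> (\<Sum>c\<in>{..<k} \<times> {..<k}. \<bar>\<beta> c\<bar>)" if "a < k" "b < k" for a b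
    using that by (intro member_le_sum) auto
  then show "\<bar>step k \<beta> p\<bar> \<le> (\<Sum>c\<in>{..<k} \<times> {..<k}. \<bar>\<beta> c\<bar>)"
    using k cell_index[of _ k] by (auto simp: p step_def sum_nonneg)
qed (use k cell_index[of _ k] sym in \<open>auto simp: step_def\<close>)

definition weights :: "nat \<Rightarrow> (nat \<times> nat \<Rightarrow> real) set" where
  "weights k = {\<beta>. \<forall>a<k. \<forall>b<k. 0 \<le> \<beta> (a, b) \<and> \<beta> (a, b) \<le> 1 \<and> \<beta> (a, b) = \<beta> (b, a)}"

lemma step_graphons:
  assumes k: "k \<ge> 1" and \<beta>: "\<beta> \<in> weights k"
  shows "step k \<beta> \<in> graphons"
proof (rule graphonsI)
  show "step k \<beta> \<in> kernels" using \<beta> by (intro step_kernels k) (auto simp: weights_def)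
  fix p :: "real \<times> real"
  show "0 \<le> step k \<beta> p" "step k \<beta> p \<le> 1"
    using \<beta> k cell_index[of _ k] by (auto simp: step_def weights_def split: prod.splits)
qed

text \<open>With \<open>v\<close> vertices the cube splits, up to a null set, into boxes of volume
  \<open>(1 / real k) ^ v\<close> on which all factors are constant. At points with a coordinate 1
  both integrands vanish, since each vertex is an endpoint of some edge.\<close>

lemma multi_density_step:
  assumes k: "k \<ge> 1"
  shows "multi_density n p (\<lambda>j. step k (\<beta> j))
    = (1 / real k) ^ card (p ` {..<2 * n}) *
      (\<Sum>y\<in>p ` {..<2 * n} \<rightarrow>\<^sub>E {..<k}. \<Prod>j<n. \<beta> j (y (p (2 * j)), y (p (2 * j + 1))))"
proof -
  let ?V = "p ` {..<2 * n}"
  let ?M = "PiM ?V (\<lambda>_. lebesgue_on unit_interval)"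
  let ?f = "\<lambda>z. nat \<lfloor>real k * z\<rfloor>"
  let ?box = "\<lambda>y. Pi\<^sub>E ?V (\<lambda>v. cell k (y v))"
  let ?t = "\<lambda>y. \<Prod>j<n. \<beta> j (y (p (2 * j)), y (p (2 * j + 1)))"
  have fin: "finite (?V \<rightarrow>\<^sub>E {..<k})" by (intro finite_PiE) auto
  have cs: "cell k (y v) \<in> sets (lebesgue_on unit_interval)" if "y \<in> ?V \<rightarrow>\<^sub>E {..<k}" "v \<in> ?V" for y v
  proof -
    have "cell k (y v) = cell k (y v) \<inter> unit_interval"
      using cell_subset[OF k, of "y v"] that by fastforce
    then show ?thesis using borel_sets_lebesgue_on[of "cell k (y v)" unit_interval] by simp
  qed
  have box: "?box y \<in> sets ?M" if "y \<in> ?V \<rightarrow>\<^sub>E {..<k}" for y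
    using cs[OF that] by (intro sets_PiM_I_finite) auto
  have meas: "measure (completion ?M) (?box y) = (1 / real k) ^ card ?V" if y: "y \<in> ?V \<rightarrow>\<^sub>E {..<k}" for y
  proof -
    have "emeasure ?M (?box y) = (\<Prod>v\<in>?V. emeasure (lebesgue_on unit_interval) (cell k (y v)))"
      using cs[OF y] by (intro emeasure_unit_box) auto
    also have "\<dots> = (\<Prod>v\<in>?V. ennreal (1 / real k))"
    proof (intro prod.cong refl)
      fix v assume v: "v \<in> ?V"
      have "cell k (y v) \<subseteq> unit_interval" using cell_subset[OF k, of "y v"] y v by fastforce
      then show "emeasure (lebesgue_on unit_interval) (cell k (y v)) = ennreal (1 / real k)"
        using emeasure_cell[OF k] by (subst emeasure_restrict_space) auto
    qed
    also have "\<dots> = ennreal ((1 / real k) ^ card ?V)"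
      by (simp only: prod_constant ennreal_power[symmetric] divide_nonneg_nonneg of_nat_0_le_iff zero_le_one)
    finally show ?thesis using box[OF y] by (simp add: measure_def)
  qed
  have eq: "(\<Prod>j<n. step k (\<beta> j) (x (p (2 * j)), x (p (2 * j + 1))))
      = (\<Sum>y\<in>?V \<rightarrow>\<^sub>E {..<k}. ?t y * indicator (?box y) x)" if x: "x \<in> space (completion ?M)" for x
  proof (cases "\<forall>v\<in>?V. x v \<in> {0..<1}")
    case True
    define y0 where "y0 = restrict (\<lambda>v. ?f (x v)) ?V"
    have y0: "y0 \<in> ?V \<rightarrow>\<^sub>E {..<k}"
      unfolding y0_def using True cell_index[OF _ k] by auto
    have ind: "x \<in> ?box y \<longleftrightarrow> y = y0" if y: "y \<in> ?V \<rightarrow>\<^sub>E {..<k}" for y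
    proof -
      have "x \<in> ?box y \<longleftrightarrow> (\<forall>v\<in>?V. x v \<in> cell k (y v))"
        using x by (auto simp: space_PiM PiE_iff)
      also have "\<dots> \<longleftrightarrow> (\<forall>v\<in>?V. ?f (x v) = y v)"
        using True y by (intro ball_cong refl) (auto simp: cell_iff[OF k] PiE_iff)
      also have "\<dots> \<longleftrightarrow> y = y0"
        using y y0 by (auto simp: y0_def fun_eq_iff PiE_iff extensional_def)
      finally show ?thesis .
    qed
    have "(\<Sum>y\<in>?V \<rightarrow>\<^sub>E {..<k}. ?t y * indicator (?box y) x) = (\<Sum>y\<in>?V \<rightarrow>\<^sub>E {..<k}. if y = y0 then ?t y0 else 0)"
      using ind by (intro sum.cong refl) (auto simp: indicator_def)
    also have "\<dots> = ?t y0" using fin y0 by simp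
    also have "\<dots> = (\<Prod>j<n. step k (\<beta> j) (x (p (2 * j)), x (p (2 * j + 1))))"
      using True endpoint_in[of _ n p] by (intro prod.cong refl) (auto simp: step_def y0_def)
    finally show ?thesis by simp
  next
    case False
    then obtain i where i: "i < 2 * n" "x (p i) \<notin> {0..<1}" by auto
    \<comment> \<open>Half-edge \<open>i\<close> belongs to edge \<open>i div 2\<close>, whose
      factor is 0 here.\<close>
    define j where "j = i div 2"
    have j: "j < n" "i = 2 * j \<or> i = 2 * j + 1" using i(1) by (auto simp: j_def)
    have "step k (\<beta> j) (x (p (2 * j)), x (p (2 * j + 1))) = 0"
      using i(2) j(2) by (auto simp: step_def)
    then have "(\<Prod>j<n. step k (\<beta> j) (x (p (2 * j)), x (p (2 * j + 1)))) = 0"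
      using j(1) by (intro prod_zero) auto
    moreover have "x \<notin> ?box y" if y: "y \<in> ?V \<rightarrow>\<^sub>E {..<k}" for y
    proof
      assume "x \<in> ?box y"
      then have "x (p i) \<in> cell k (y (p i))" "y (p i) < k" using i(1) y by (auto simp: PiE_iff)
      then show False using cell_subset[OF k] i(2) by blast
    qed
    then have "(\<Sum>y\<in>?V \<rightarrow>\<^sub>E {..<k}. ?t y * indicator (?box y) x) = 0"
      by (intro sum.neutral) auto
    ultimately show ?thesis by simp
  qed
  have "multi_density n p (\<lambda>j. step k (\<beta> j))
      = (LINT x|completion ?M. (\<Sum>y\<in>?V \<rightarrow>\<^sub>E {..<k}. ?t y * indicator (?box y) x))"
    unfolding multi_density_def by (intro Bochner_Integration.integral_cong refl eq)
  also have "\<dots> = (\<Sum>y\<in>?V \<rightarrow>\<^sub>E {..<k}. LINT x|completion ?M. ?t y * indicator (?box y) x)"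
  proof (intro Bochner_Integration.integral_sum integrable_mult_right)
    fix y assume "y \<in> ?V \<rightarrow>\<^sub>E {..<k}"
    interpret finite_measure "completion ?M" by (rule finite_measure_unit_cube) simp
    show "integrable (completion ?M) (indicator (?box y) :: _ \<Rightarrow> real)"
      using box[OF \<open>y \<in> _\<close>] by (intro integrable_real_indicator) (auto simp: less_top emeasure_eq_measure)
  qed
  also have "\<dots> = (\<Sum>y\<in>?V \<rightarrow>\<^sub>E {..<k}. ?t y * (1 / real k) ^ card ?V)"
  proof (intro sum.cong refl)
    fix y assume y: "y \<in> ?V \<rightarrow>\<^sub>E {..<k}"
    have "(LINT x|completion ?M. ?t y * indicator (?box y) x) = ?t y * measure (completion ?M) (?box y \<inter> space (completion ?M))"
      by simp
    also have "?box y \<inter> space (completion ?M) = ?box y"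
      using sets.sets_into_space[OF box[OF y]] by auto
    finally show "(LINT x|completion ?M. ?t y * indicator (?box y) x) = ?t y * (1 / real k) ^ card ?V"
      using meas[OF y] by simp
  qed
  finally show ?thesis by (simp add: sum_distrib_left mult.commute)
qed

section \<open>Rectangles with Lebesgue measurable sides, and step functions on them\<close>

lemma lebesgue_Times:
  fixes S T :: "real set"
  assumes S: "S \<in> sets lebesgue" and T: "T \<in> sets lebesgue"
  shows "S \<times> T \<in> sets lebesgue"
    and "emeasure lebesgue (S \<times> T) = emeasure lebesgue S * emeasure lebesgue T"
proof -
  obtain A N N' where A: "S = A \<union> N" "N \<subseteq> N'" "N' \<in> null_sets lborel" "A \<in> sets lborel"
    using S by (auto elim: sets_completionE)
  obtain B M M' where B: "T = B \<union> M" "M \<subseteq> M'" "M' \<in> null_sets lborel" "B \<in> sets lborel"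
    using T by (auto elim: sets_completionE)
  have null: "N' \<times> UNIV \<union> UNIV \<times> M' \<in> null_sets (lborel :: (real \<times> real) measure)"
    unfolding lborel_prod[symmetric] using A(3) B(3)
    by (intro null_sets.Un lborel.times_in_null_sets1 lborel_pair.times_in_null_sets2 lborel.times_in_null_sets2) auto
  have AB: "A \<times> B \<in> sets (lborel :: (real \<times> real) measure)"
    using A(4) B(4) by (simp add: borel_prod[symmetric])
  have eq: "S \<times> T = A \<times> B \<union> (S \<times> T - A \<times> B)" "S \<times> T - A \<times> B \<subseteq> N' \<times> UNIV \<union> UNIV \<times> M'"
    using A(1,2) B(1,2) by auto
  then show ST: "S \<times> T \<in> sets lebesgue"
    using null AB by (rule sets_completionI)
  have ae: "AE x in lborel. x \<notin> N'" "AE x in lborel. x \<notin> M'"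
    using A(3) B(3) by (auto intro: AE_not_in)
  have ae2: "AE p in lborel. p \<notin> N' \<times> UNIV \<union> UNIV \<times> M'"
    using null by (rule AE_not_in)
  have "emeasure lebesgue (S \<times> T) = emeasure lebesgue (A \<times> B)"
    using AE_completion[OF ae2] ST AB eq by (intro emeasure_eq_AE) auto
  also have "\<dots> = emeasure (lborel \<Otimes>\<^sub>M lborel) (A \<times> B)"
    using AB by (simp add: lborel_prod)
  also have "\<dots> = emeasure lborel A * emeasure lborel B"
    using A(4) B(4) by (intro lborel.emeasure_pair_measure_Times) auto
  also have "emeasure lborel A = emeasure lebesgue S"
  proof -
    have "emeasure lborel A = emeasure lebesgue A" using A(4) by simp
    also have "\<dots> = emeasure lebesgue S"
      using AE_completion[OF ae(1)] S A by (intro emeasure_eq_AE) auto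
    finally show ?thesis .
  qed
  also have "emeasure lborel B = emeasure lebesgue T"
  proof -
    have "emeasure lborel B = emeasure lebesgue B" using B(4) by simp
    also have "\<dots> = emeasure lebesgue T"
      using AE_completion[OF ae(2)] T B by (intro emeasure_eq_AE) auto
    finally show ?thesis .
  qed
  finally show "emeasure lebesgue (S \<times> T) = emeasure lebesgue S * emeasure lebesgue T" .
qed

lemma measure_lebesgue_Times:
  fixes S T :: "real set"
  assumes "S \<in> sets lebesgue" "T \<in> sets lebesgue"
  shows "measure lebesgue (S \<times> T) = measure lebesgue S * measure lebesgue T"
  using lebesgue_Times(2)[OF assms] by (simp add: measure_def enn2real_mult)

lemma measure_cell: "k \<ge> 1 \<Longrightarrow> measure lebesgue (cell k a) = 1 / real k"
  using emeasure_cell[of k a] by (simp add: measure_def)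

lemma L1_norm_step:
  assumes k: "k \<ge> 1"
  shows "L1_norm (step k \<beta>) = (\<Sum>c\<in>{..<k} \<times> {..<k}. \<bar>\<beta> c\<bar>) / (real k)\<^sup>2"
proof -
  let ?C = "\<lambda>c. cell k (fst c) \<times> cell k (snd c)"
  have abs: "\<bar>step k \<beta> p\<bar> = step k (\<lambda>c. \<bar>\<beta> c\<bar>) p" for p
    by (auto simp: step_def split: prod.splits)
  have C: "?C c \<in> sets lebesgue" for c
    by (intro lebesgue_Times(1) sets_completionI_sets) auto
  have sub: "?C c \<subseteq> unit_square" if "c \<in> {..<k} \<times> {..<k}" for c
    using cell_subset[OF k, of "fst c"] cell_subset[OF k, of "snd c"] that by fastforce
  have Cs: "?C c \<in> sets (lebesgue_on unit_square)" if "c \<in> {..<k} \<times> {..<k}" for c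
    using C sub[OF that] by (simp add: sets_restrict_space_iff)
  have m: "measure (lebesgue_on unit_square) (?C c) = 1 / (real k)\<^sup>2" if "c \<in> {..<k} \<times> {..<k}" for c
  proof -
    have "measure (lebesgue_on unit_square) (?C c) = measure lebesgue (?C c)"
      using sub[OF that] by (intro measure_restrict_space) auto
    also have "\<dots> = 1 / (real k)\<^sup>2"
      by (subst measure_lebesgue_Times) (auto simp: measure_cell[OF k] power2_eq_square intro!: sets_completionI_sets)
    finally show ?thesis .
  qed
  interpret finite_measure "lebesgue_on unit_square" by (rule finite_measure_unit_square)
  have "L1_norm (step k \<beta>) = (LINT p|lebesgue_on unit_square. (\<Sum>c\<in>{..<k} \<times> {..<k}. \<bar>\<beta> c\<bar> * indicator (?C c) p))"
    unfolding L1_norm_def abs by (intro Bochner_Integration.integral_cong refl step_eq_sum[OF k])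
  also have "\<dots> = (\<Sum>c\<in>{..<k} \<times> {..<k}. LINT p|lebesgue_on unit_square. \<bar>\<beta> c\<bar> * indicator (?C c) p)"
    using Cs by (intro Bochner_Integration.integral_sum integrable_mult_right integrable_real_indicator)
      (auto simp: less_top emeasure_eq_measure)
  also have "\<dots> = (\<Sum>c\<in>{..<k} \<times> {..<k}. \<bar>\<beta> c\<bar> * (1 / (real k)\<^sup>2))"
  proof (intro sum.cong refl)
    fix c assume c: "c \<in> {..<k} \<times> {..<k}"
    have "(LINT p|lebesgue_on unit_square. \<bar>\<beta> c\<bar> * indicator (?C c) p)
        = \<bar>\<beta> c\<bar> * measure (lebesgue_on unit_square) (?C c \<inter> space (lebesgue_on unit_square))"
      by simp
    also have "?C c \<inter> space (lebesgue_on unit_square) = ?C c" using sub[OF c] by auto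
    finally show "(LINT p|lebesgue_on unit_square. \<bar>\<beta> c\<bar> * indicator (?C c) p) = \<bar>\<beta> c\<bar> * (1 / (real k)\<^sup>2)"
      using m[OF c] by simp
  qed
  also have "\<dots> = (\<Sum>c\<in>{..<k} \<times> {..<k}. \<bar>\<beta> c\<bar>) / (real k)\<^sup>2"
    by (simp add: sum_divide_distrib)
  finally show ?thesis .
qed

lemma integral_rectangle_step:
  assumes k: "k \<ge> 1" and S: "S \<in> sets (lebesgue_on unit_interval)" and T: "T \<in> sets (lebesgue_on unit_interval)"
  shows "(LINT p:S \<times> T|lebesgue. step k \<beta> p)
    = (\<Sum>c\<in>{..<k} \<times> {..<k}. \<beta> c * (measure lebesgue (S \<inter> cell k (fst c)) * measure lebesgue (T \<inter> cell k (snd c))))"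
proof -
  let ?R = "\<lambda>c. (S \<inter> cell k (fst c)) \<times> (T \<inter> cell k (snd c))"
  have SL: "S \<in> sets lebesgue" "T \<in> sets lebesgue"
    using S T by (auto simp: sets_restrict_space_iff)
  have c: "S \<inter> cell k a \<in> sets lebesgue" "T \<inter> cell k a \<in> sets lebesgue" for a
    by (intro sets.Int SL sets_completionI_sets[of "cell k a"]; simp)+
  have R: "?R c \<in> sets lebesgue" for c
    by (intro lebesgue_Times(1) c)
  have fin: "emeasure lebesgue (?R c) < \<infinity>" if "c \<in> {..<k} \<times> {..<k}" for c
  proof -
    have "emeasure lebesgue (?R c) \<le> emeasure lebesgue (cell k (fst c) \<times> cell k (snd c))"
      by (intro emeasure_mono lebesgue_Times(1) sets_completionI_sets) auto
    also have "\<dots> = ennreal (1 / real k) * ennreal (1 / real k)"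
      by (subst lebesgue_Times(2)) (auto simp: emeasure_cell[OF k] intro!: sets_completionI_sets)
    also have "\<dots> < \<infinity>" by (simp add: ennreal_mult_less_top)
    finally show ?thesis .
  qed
  have "(LINT p:S \<times> T|lebesgue. step k \<beta> p)
      = (LINT p|lebesgue. (\<Sum>c\<in>{..<k} \<times> {..<k}. \<beta> c * indicator (?R c) p))"
    unfolding set_lebesgue_integral_def step_eq_sum[OF k]
    unfolding real_scaleR_def sum_distrib_left
    by (intro Bochner_Integration.integral_cong sum.cong refl) (auto split: split_indicator)
  also have "\<dots> = (\<Sum>c\<in>{..<k} \<times> {..<k}. LINT p|lebesgue. \<beta> c * indicator (?R c) p)"
    using R fin by (intro Bochner_Integration.integral_sum integrable_mult_right integrable_real_indicator) auto
  also have "\<dots> = (\<Sum>c\<in>{..<k} \<times> {..<k}. \<beta> c * measure lebesgue (?R c))"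
    by simp
  finally show ?thesis using c by (simp add: measure_lebesgue_Times)
qed

section \<open>Class functions on step graphons\<close>

text \<open>Measurability provides continuous functions that converge almost everywhere; after
  symmetrisation and truncation they still do, and dominated convergence applies. Such a continuous
  function is then sampled at the lower corners of a grid that is fine enough by uniform
  continuity.\<close>

lemma step_dense:
  assumes f: "f \<in> graphons" and e: "e > 0"
  shows "\<exists>k\<ge>1. \<exists>\<beta>\<in>weights k. L1_norm (\<lambda>p. step k \<beta> p - f p) < e"
proof -
  let ?S = "lebesgue_on unit_square"
  have "f measurable_on unit_square"
    using graphonsD(1)[OF f] kernelsD(1) lebesgue_measurable_imp_measurable_on unit_square_sets
    by (metis measurable_on_iff_borel_measurable)
  then obtain N g where N: "negligible N" and g: "\<And>n. continuous_on UNIV (g n)"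
    and lim: "\<And>p. p \<notin> N \<Longrightarrow> (\<lambda>n. g n p) \<longlonglongrightarrow> (if p \<in> unit_square then f p else 0)"
    unfolding measurable_on_def by blast
  define N' where "N' = N \<union> prod.swap ` N"
  have "negligible (prod.swap ` N)"
    by (rule negligible_differentiable_image_negligible[OF order_refl N])
      (auto simp: linear_iff intro: linear_imp_differentiable_on)
  then have N': "negligible N'" unfolding N'_def using N by auto
  define h :: "nat \<Rightarrow> kernel" where "h n p = max 0 (min 1 ((g n p + g n (prod.swap p)) / 2))" for n p
  have cont: "continuous_on UNIV (h n)" for n
  proof -
    have "continuous_on UNIV (\<lambda>p. g n (prod.swap p))"
      by (rule continuous_on_compose2[OF g]) (auto intro: continuous_on_swap)
    then show ?thesis
      unfolding h_def using g[of n]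
      by (intro continuous_on_max continuous_on_min continuous_on_divide continuous_on_add continuous_on_const) auto
  qed
  have h01: "0 \<le> h n p" "h n p \<le> 1" for n p by (auto simp: h_def)
  have hsym: "h n (x, y) = h n (y, x)" for n x y by (simp add: h_def add.commute)
  have hlim: "(\<lambda>n. h n p) \<longlonglongrightarrow> f p" if p: "p \<in> unit_square" "p \<notin> N'" for p
  proof -
    obtain x y where xy: "p = (x, y)" by (cases p)
    have "(y, x) \<notin> N"
    proof
      assume "(y, x) \<in> N"
      then have "prod.swap (y, x) \<in> prod.swap ` N" by (rule imageI)
      then show False using p(2) unfolding N'_def xy by simp
    qed
    moreover have "(x, y) \<notin> N" using p(2) by (auto simp: N'_def xy)
    ultimately have "(\<lambda>n. g n (x, y)) \<longlonglongrightarrow> f (x, y)" "(\<lambda>n. g n (y, x)) \<longlonglongrightarrow> f (y, x)"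
      using lim[of "(x, y)"] lim[of "(y, x)"] p(1) xy by auto
    moreover have "f (y, x) = f (x, y)"
      using kernelsD(2)[OF graphonsD(1)[OF f]] p(1) xy by auto
    ultimately have "(\<lambda>n. max 0 (min 1 ((g n (x, y) + g n (y, x)) / 2))) \<longlonglongrightarrow> max 0 (min 1 ((f (x, y) + f (x, y)) / 2))"
      by (intro tendsto_max tendsto_min tendsto_divide tendsto_add tendsto_const) auto
    also have "max 0 (min 1 ((f (x, y) + f (x, y)) / 2)) = f (x, y)"
      using graphonsD(2,3)[OF f p(1)] xy by simp
    finally show ?thesis by (simp add: h_def xy)
  qed
  have hmeas: "h n \<in> borel_measurable ?S" for n
    by (intro borel_measurable_lebesgue_onI borel_measurable_continuous_onI cont)
  have hk: "h n \<in> kernels" for n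
    using h01[of n] hsym by (intro kernelsI[where B=1] hmeas) auto
  have fmeas: "f \<in> borel_measurable ?S" by (intro kernelsD(1) graphonsD(1) f)
  have AEN: "AE p in ?S. p \<notin> N'"
  proof -
    have "AE p in lebesgue. p \<notin> N'"
      using N' by (simp add: negligible_iff_null_sets AE_not_in)
    then show ?thesis by (subst AE_restrict_space_iff) auto
  qed
  have "(\<lambda>n. LINT p|?S. \<bar>h n p - f p\<bar>) \<longlonglongrightarrow> (LINT p|?S. 0)"
  proof (rule integral_dominated_convergence[where w="\<lambda>_. 1"])
    show "integrable ?S (\<lambda>_. 1 :: real)"
      using finite_measure.integrable_const[OF finite_measure_unit_square] .
    show "AE p in ?S. (\<lambda>n. \<bar>h n p - f p\<bar>) \<longlonglongrightarrow> 0"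
    proof -
      have "AE p in ?S. p \<in> unit_square" by (rule AE_I2) simp
      with AEN show ?thesis
      proof eventually_elim
        case (elim p)
        then have "(\<lambda>n. \<bar>h n p - f p\<bar>) \<longlonglongrightarrow> \<bar>f p - f p\<bar>"
          by (intro tendsto_intros hlim)
        then show ?case by simp
      qed
    qed
    show "AE p in ?S. norm \<bar>h n p - f p\<bar> \<le> 1" for n
    proof (rule AE_I2)
      fix p assume "p \<in> space ?S"
      then show "norm \<bar>h n p - f p\<bar> \<le> 1"
        using graphonsD(2,3)[OF f, of p] h01[of n p] by auto
    qed
  qed (use hmeas fmeas in measurable)
  then have "(\<lambda>n. L1_norm (\<lambda>p. h n p - f p)) \<longlonglongrightarrow> 0"
    by (simp add: L1_norm_def)
  then have "\<forall>\<^sub>F n in sequentially. L1_norm (\<lambda>p. h n p - f p) < e / 2"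
    using e by (intro order_tendstoD(2)[of _ 0]) auto
  then obtain n where n: "L1_norm (\<lambda>p. h n p - f p) < e / 2"
    by (auto simp: eventually_sequentially)
  have "uniformly_continuous_on unit_square (h n)"
    by (intro compact_uniformly_continuous continuous_on_subset[OF cont] compact_Times) auto
  then obtain d where d: "d > 0" "\<And>p q. p \<in> unit_square \<Longrightarrow> q \<in> unit_square \<Longrightarrow> dist q p < d \<Longrightarrow> dist (h n q) (h n p) < e / 2"
    using e unfolding uniformly_continuous_on_def by (metis half_gt_zero)
  obtain k0 where k0: "2 / d < real k0" using reals_Archimedean2 by blast
  define k where "k = max 1 k0"
  have k: "k \<ge> 1" "2 / real k < d"
  proof -
    have "2 / d < real k" using k0 by (simp add: k_def)
    then show "2 / real k < d" using d(1) by (simp add: k_def field_simps split: if_splits)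
  qed (simp add: k_def)
  define \<beta> where "\<beta> = (\<lambda>(a, b). h n (real a / real k, real b / real k))"
  have \<beta>: "\<beta> \<in> weights k"
    using h01[of n] hsym by (auto simp: weights_def \<beta>_def)
  have close: "\<bar>step k \<beta> p - h n p\<bar> \<le> e / 2" if p: "p \<in> {0..<1} \<times> {0..<1}" for p
  proof -
    obtain x y where xy: "p = (x, y)" by (cases p)
    define a b where "a = nat \<lfloor>real k * x\<rfloor>" and "b = nat \<lfloor>real k * y\<rfloor>"
    have lt: "a < k" "b < k" using p k cell_index by (auto simp: a_def b_def xy)
    have "x \<in> cell k a" "y \<in> cell k b"
      using p k lt by (auto simp: cell_iff a_def b_def xy)
    then have ab: "\<bar>real a / real k - x\<bar> \<le> 1 / real k" "\<bar>real b / real k - y\<bar> \<le> 1 / real k"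
      by (auto simp: cell_def add_divide_distrib)
    have "dist (real a / real k, real b / real k) (x, y) \<le> \<bar>real a / real k - x\<bar> + \<bar>real b / real k - y\<bar>"
      unfolding dist_Pair_Pair dist_real_def by (rule sqrt_sum_squares_le_sum_abs[THEN order_trans]) simp
    also have "\<dots> \<le> 2 / real k" using ab by simp
    also have "\<dots> < d" by (rule k)
    finally have "dist (h n (real a / real k, real b / real k)) (h n (x, y)) < e / 2"
      using p lt xy by (intro d) auto
    then show ?thesis
      using p by (auto simp: step_def \<beta>_def xy a_def b_def dist_real_def)
  qed
  have "L1_norm (\<lambda>p. step k \<beta> p - h n p) \<le> (LINT p|?S. e / 2)"
    unfolding L1_norm_def
  proof (rule integral_mono_AE)
    have sk: "step k \<beta> \<in> kernels" by (intro graphonsD(1) step_graphons k \<beta>)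
    show "integrable ?S (\<lambda>p. \<bar>step k \<beta> p - h n p\<bar>)"
      by (intro integrable_abs kernels_integrable kernels_diff sk hk)
    show "integrable ?S (\<lambda>_. e / 2)"
      using finite_measure.integrable_const[OF finite_measure_unit_square] .
    \<comment> \<open>On these two lines the step function is 0 by definition, so the pointwise
      estimate may fail there.\<close>
    define Z :: "(real \<times> real) set" where "Z = {p. p \<bullet> (1, 0) = 1} \<union> {p. p \<bullet> (0, 1) = 1}"
    have "negligible Z"
      unfolding Z_def by (intro negligible_Un negligible_standard_hyperplane) (auto simp: Basis_prod_def)
    then have "AE p in lebesgue. p \<notin> Z"
      by (simp add: negligible_iff_null_sets AE_not_in)
    then have "AE p in ?S. p \<notin> Z"
      by (subst AE_restrict_space_iff) auto
    moreover have "AE p in ?S. p \<in> unit_square" by (rule AE_I2) simp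
    ultimately show "AE p in ?S. \<bar>step k \<beta> p - h n p\<bar> \<le> e / 2"
    proof eventually_elim
      case (elim p)
      then show ?case by (intro close) (auto simp: Z_def inner_prod_def less_le)
    qed
  qed
  also have "\<dots> = e / 2" using measure_unit_square by simp
  finally have "L1_norm (\<lambda>p. step k \<beta> p - h n p) \<le> e / 2" .
  moreover have "L1_norm (\<lambda>p. (step k \<beta> p - h n p) + (h n p - f p))
      \<le> L1_norm (\<lambda>p. step k \<beta> p - h n p) + L1_norm (\<lambda>p. h n p - f p)"
    by (intro L1_norm_triangle kernels_diff hk graphonsD(1) step_graphons k \<beta> f)
  ultimately have "L1_norm (\<lambda>p. step k \<beta> p - f p) < e" using n by simp
  then show ?thesis using k \<beta> by blast
qed

lemma graphon_continuous_eqI: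
  assumes F: "graphon_continuous L1_norm F" "graphon_continuous L1_norm G"
    and eq: "\<And>k \<beta>. k \<ge> 1 \<Longrightarrow> \<beta> \<in> weights k \<Longrightarrow> F (step k \<beta>) = G (step k \<beta>)"
    and f: "f \<in> graphons"
  shows "F f = G f"
proof -
  have "\<exists>h. (\<exists>k\<ge>1. \<exists>\<beta>\<in>weights k. h = step k \<beta>) \<and> L1_norm (\<lambda>p. h p - f p) < inverse (real (Suc n))" for n
    using step_dense[OF f, of "inverse (real (Suc n))"] by fastforce
  then obtain h where h: "\<And>n. \<exists>k\<ge>1. \<exists>\<beta>\<in>weights k. h n = step k \<beta>"
    "\<And>n. L1_norm (\<lambda>p. h n p - f p) < inverse (real (Suc n))" by metis
  have hg: "h n \<in> graphons" for n using h(1)[of n] step_graphons by auto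
  have lim: "(\<lambda>n. L1_norm (\<lambda>p. h n p - f p)) \<longlonglongrightarrow> 0"
    using h(2) L1_norm_nonneg
    by (intro tendsto_sandwich[OF _ _ tendsto_const LIMSEQ_inverse_real_of_nat] always_eventually allI)
      (auto intro: less_imp_le)
  have "F (h n) = G (h n)" for n using h(1)[of n] eq by auto
  then show ?thesis
    using graphon_continuous_tendsto[OF F(1) f hg lim] graphon_continuous_tendsto[OF F(2) f hg lim]
    by (simp add: LIMSEQ_unique)
qed

text \<open>Cell \<open>a\<close> is translated onto cell \<open>\<pi> a\<close>, and all points
  outside the half-open interval are fixed, in particular 1. This realises a permutation of the
  steps by a measure-preserving bijection of the closed interval.\<close>

definition block_map :: "nat \<Rightarrow> (nat \<Rightarrow> nat) \<Rightarrow> real \<Rightarrow> real" where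
  "block_map k \<pi> x = (if x \<in> {0..<1}
     then x + (real (\<pi> (nat \<lfloor>real k * x\<rfloor>)) - real (nat \<lfloor>real k * x\<rfloor>)) / real k else x)"

context
  fixes k :: nat and \<pi> :: "nat \<Rightarrow> nat"
  assumes k: "k \<ge> 1" and \<pi>: "\<pi> permutes {..<k}"
begin

lemma block_map_cell:
  assumes "x \<in> cell k a" "a < k"
  shows "block_map k \<pi> x = x + (real (\<pi> a) - real a) / real k" "block_map k \<pi> x \<in> cell k (\<pi> a)"
proof -
  show eq: "block_map k \<pi> x = x + (real (\<pi> a) - real a) / real k"
    using assms k by (auto simp: block_map_def cell_iff)
  show "block_map k \<pi> x \<in> cell k (\<pi> a)"
    unfolding eq using assms(1) by (auto simp: cell_def diff_divide_distrib add_divide_distrib)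
qed

lemma block_map_index:
  assumes "x \<in> {0..<1}"
  shows "block_map k \<pi> x \<in> {0..<1}" "nat \<lfloor>real k * block_map k \<pi> x\<rfloor> = \<pi> (nat \<lfloor>real k * x\<rfloor>)"
proof -
  define a where "a = nat \<lfloor>real k * x\<rfloor>"
  have a: "a < k" unfolding a_def using assms k by (rule cell_index)
  then have "\<pi> a < k" using permutes_in_image[OF \<pi>] by auto
  moreover have "block_map k \<pi> x \<in> cell k (\<pi> a)"
    using a assms k by (intro block_map_cell) (auto simp: cell_iff a_def)
  ultimately show "block_map k \<pi> x \<in> {0..<1}" "nat \<lfloor>real k * block_map k \<pi> x\<rfloor> = \<pi> (nat \<lfloor>real k * x\<rfloor>)"
    using k by (auto simp: cell_iff a_def)
qed

lemma block_map_outside: "x \<notin> {0..<1} \<Longrightarrow> block_map k \<pi> x = x"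
  unfolding block_map_def by (rule if_not_P)

lemma block_map_unit: "x \<in> unit_interval \<Longrightarrow> block_map k \<pi> x \<in> unit_interval"
  using block_map_index(1)[of x] block_map_outside[of x] by (cases "x \<in> {0..<1}") auto

lemma measure_eq_sum_cells:
  assumes B: "B \<in> lmeasurable" "B \<subseteq> unit_interval"
  shows "measure lebesgue B = (\<Sum>a<k. measure lebesgue (B \<inter> cell k a))"
proof -
  have m: "B \<inter> cell k a \<in> lmeasurable" for a
    by (intro fmeasurable_Int_fmeasurable B sets_completionI_sets) simp
  have "measure lebesgue B = measure lebesgue (\<Union>a<k. B \<inter> cell k a)"
  proof (rule measure_negligible_symdiff[symmetric])
    have eq: "(\<Union>a<k. B \<inter> cell k a) = B \<inter> {0..<1}"
      using cell_index[OF _ k] cell_iff[OF k] by auto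
    have "sym_diff B (\<Union>a<k. B \<inter> cell k a) \<subseteq> {1}"
      unfolding eq using B(2) by force
    then show "negligible (sym_diff B (\<Union>a<k. B \<inter> cell k a))"
      using negligible_subset negligible_sing by blast
  qed (use B in auto)
  also have "\<dots> = (\<Sum>a<k. measure lebesgue (B \<inter> cell k a))"
    using m k by (intro measure_UNION' ) (auto simp: pairwise_def disjnt_iff cell_iff)
  finally show ?thesis .
qed

text \<open>Within each cell the preimage is a translate of a piece of \<open>A\<close>; translation
  invariance and a permutation of the summands give the measure. The point 1, which lies in no cell,
  is treated as a null set.\<close>

lemma block_map_preimage:
  assumes A: "A \<in> sets (lebesgue_on unit_interval)"
  shows "block_map k \<pi> -` A \<inter> unit_interval \<in> sets (lebesgue_on unit_interval)"
    and "measure lebesgue (block_map k \<pi> -` A \<inter> unit_interval) = measure lebesgue A"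
proof -
  let ?B = "block_map k \<pi> -` A \<inter> unit_interval"
  let ?d = "\<lambda>a. (real a - real (\<pi> a)) / real k"
  have Al: "A \<in> sets lebesgue" "A \<subseteq> unit_interval"
    using A by (auto simp: sets_restrict_space_iff)
  have Am: "A \<in> lmeasurable"
    using Al by (metis bounded_closed_interval bounded_set_imp_lmeasurable bounded_subset)
  have Ac: "A \<inter> cell k a \<in> lmeasurable" for a
    by (intro fmeasurable_Int_fmeasurable Am sets_completionI_sets) simp
  have Bc: "?B \<inter> cell k a = (+) (?d a) ` (A \<inter> cell k (\<pi> a))" if a: "a < k" for a
  proof (intro equalityI subsetI)
    fix x assume "x \<in> ?B \<inter> cell k a"
    then have "block_map k \<pi> x \<in> A \<inter> cell k (\<pi> a)" "x = ?d a + block_map k \<pi> x"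
      using block_map_cell[OF _ a, of x] by (auto simp: diff_divide_distrib)
    then show "x \<in> (+) (?d a) ` (A \<inter> cell k (\<pi> a))" by blast
  next
    fix x assume "x \<in> (+) (?d a) ` (A \<inter> cell k (\<pi> a))"
    then obtain y where y: "y \<in> A" "y \<in> cell k (\<pi> a)" "x = ?d a + y" by blast
    then have x: "x \<in> cell k a"
      by (auto simp: cell_def diff_divide_distrib add_divide_distrib)
    then have "block_map k \<pi> x = y"
      using block_map_cell(1)[OF x a] y(3) by (simp add: diff_divide_distrib)
    then show "x \<in> ?B \<inter> cell k a"
      using y x cell_subset[OF k a] by auto
  qed
  have Bcm: "?B \<inter> cell k a \<in> lmeasurable" if "a < k" for a
    unfolding Bc[OF that] by (intro measurable_translation Ac)
  have "?B = (\<Union>a<k. ?B \<inter> cell k a) \<union> (A \<inter> {1})"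
  proof (intro equalityI subsetI)
    fix x assume x: "x \<in> ?B"
    show "x \<in> (\<Union>a<k. ?B \<inter> cell k a) \<union> (A \<inter> {1})"
    proof (cases "x \<in> {0..<1}")
      case True
      then show ?thesis using x cell_index[OF True k] cell_iff[OF k] by blast
    next
      case False
      then show ?thesis using x block_map_outside[OF False] by auto
    qed
  next
    fix x assume "x \<in> (\<Union>a<k. ?B \<inter> cell k a) \<union> (A \<inter> {1})"
    then show "x \<in> ?B" using block_map_outside[of 1] by auto
  qed
  moreover have "(\<Union>a<k. ?B \<inter> cell k a) \<union> (A \<inter> {1}) \<in> lmeasurable"
    using Bcm Am by (intro fmeasurable.Un fmeasurable.finite_UN) (auto intro: negligible_imp_measurable)
  ultimately have Bm: "?B \<in> lmeasurable" by simp
  then show "?B \<in> sets (lebesgue_on unit_interval)"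
    by (subst sets_restrict_space_iff) (auto simp: fmeasurable_def)
  have "measure lebesgue ?B = (\<Sum>a<k. measure lebesgue (?B \<inter> cell k a))"
    by (rule measure_eq_sum_cells[OF Bm]) auto
  also have "\<dots> = (\<Sum>a<k. measure lebesgue (A \<inter> cell k (\<pi> a)))"
    by (intro sum.cong refl) (simp only: lessThan_iff Bc measure_translation)
  also have "\<dots> = (\<Sum>a<k. measure lebesgue (A \<inter> cell k a))"
    by (rule sum.permute[OF \<pi>, symmetric, unfolded comp_def])
  also have "\<dots> = measure lebesgue A"
    by (rule measure_eq_sum_cells[OF Am Al(2), symmetric])
  finally show "measure lebesgue ?B = measure lebesgue A" .
qed

lemma block_map_measurable: "block_map k \<pi> \<in> lebesgue_on unit_interval \<rightarrow>\<^sub>M lebesgue_on unit_interval"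
  by (rule measurableI) (use block_map_unit block_map_preimage(1) in auto)

lemma block_map_distr: "distr (lebesgue_on unit_interval) (lebesgue_on unit_interval) (block_map k \<pi>) = lebesgue_on unit_interval"
proof (rule measure_eqI)
  fix A assume "A \<in> sets (distr (lebesgue_on unit_interval) (lebesgue_on unit_interval) (block_map k \<pi>))"
  then have A: "A \<in> sets (lebesgue_on unit_interval)" by simp
  interpret finite_measure "lebesgue_on unit_interval" by (rule finite_measure_unit_interval)
  have m: "measure (lebesgue_on unit_interval) B = measure lebesgue B" if "B \<in> sets (lebesgue_on unit_interval)" for B
    using that by (intro measure_restrict_space) (auto simp: sets_restrict_space_iff)
  show "emeasure (distr (lebesgue_on unit_interval) (lebesgue_on unit_interval) (block_map k \<pi>)) A
      = emeasure (lebesgue_on unit_interval) A"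
    using block_map_preimage[OF A] A
    by (simp add: emeasure_distr[OF block_map_measurable A] emeasure_eq_measure m)
qed simp

end

lemma block_map_inv:
  assumes "k \<ge> 1" "\<pi> permutes {..<k}"
  shows "block_map k (inv \<pi>) (block_map k \<pi> x) = x"
proof (cases "x \<in> {0..<1}")
  case True
  define a where "a = nat \<lfloor>real k * x\<rfloor>"
  have a: "a < k" "x \<in> cell k a" using True assms cell_index by (auto simp: a_def cell_iff)
  then have \<pi>a: "\<pi> a < k" using permutes_in_image[OF assms(2)] by auto
  have "block_map k (inv \<pi>) (block_map k \<pi> x) = block_map k \<pi> x + (real (inv \<pi> (\<pi> a)) - real (\<pi> a)) / real k"
    by (intro block_map_cell permutes_inv assms block_map_cell(2)[OF assms a(2,1)] \<pi>a)
  also have "inv \<pi> (\<pi> a) = a" using permutes_inverses(2)[OF assms(2)] .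
  finally show ?thesis
    unfolding block_map_cell(1)[OF assms a(2,1)] by (simp add: diff_divide_distrib)
qed (simp only: block_map_outside[OF assms] block_map_outside[OF assms(1) permutes_inv[OF assms(2)]] not_False_eq_True)

lemma block_map_measure_preserving:
  assumes "k \<ge> 1" "\<pi> permutes {..<k}"
  shows "block_map k \<pi> \<in> measure_preserving_bijections"
proof -
  note inv = permutes_inv[OF assms(2)] permutes_inv_inv[OF assms(2)]
  have left: "block_map k (inv \<pi>) (block_map k \<pi> x) = x" for x
    by (rule block_map_inv[OF assms])
  have right: "block_map k \<pi> (block_map k (inv \<pi>) x) = x" for x
    using block_map_inv[OF assms(1) inv(1)] inv(2) by simp
  have bij: "bij_betw (block_map k \<pi>) unit_interval unit_interval"
    by (rule bij_betw_byWitness[where f'="block_map k (inv \<pi>)"])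
      (use left right block_map_unit[OF assms] block_map_unit[OF assms(1) inv(1)] in \<open>auto simp del: atLeastAtMost_iff\<close>)
  have "the_inv_into unit_interval (block_map k \<pi>) x = block_map k (inv \<pi>) x" if "x \<in> unit_interval" for x
    using that bij right block_map_unit[OF assms(1) inv(1)]
    by (intro the_inv_into_f_eq) (auto simp: bij_betw_def simp del: atLeastAtMost_iff)
  then have "the_inv_into unit_interval (block_map k \<pi>) \<in> lebesgue_on unit_interval \<rightarrow>\<^sub>M lebesgue_on unit_interval"
    using block_map_measurable[OF assms(1) inv(1)] by (subst measurable_cong[of _ _ "block_map k (inv \<pi>)"]) auto
  then show ?thesis
    unfolding measure_preserving_bijections_def
    using bij block_map_measurable[OF assms] block_map_distr[OF assms] by blast
qed

section \<open>Bounds for the cut norm and the cut distance\<close>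

lemma abs_rectangle_integral_le:
  fixes h :: kernel
  assumes B: "\<And>p. p \<in> unit_square \<Longrightarrow> \<bar>h p\<bar> \<le> B" and S: "S \<subseteq> unit_interval" "T \<subseteq> unit_interval"
  shows "\<bar>LINT p:S \<times> T|lebesgue. h p\<bar> \<le> B"
proof (cases "integrable lebesgue (\<lambda>p. indicator (S \<times> T) p *\<^sub>R h p)")
  case False
  \<comment> \<open>The integral of a non-integrable function is 0 by default, so the bound also
    covers relabelled kernels, about which only boundedness is known here.\<close>
  have "0 \<le> B" using B[of "(0, 0)"] abs_ge_zero[of "h (0, 0)"] by (simp del: abs_ge_zero)
  with False show ?thesis by (simp add: set_lebesgue_integral_def not_integrable_integral_eq)
next
  case True
  have "\<bar>LINT p:S \<times> T|lebesgue. h p\<bar> \<le> (LINT p|lebesgue. \<bar>indicator (S \<times> T) p *\<^sub>R h p\<bar>)"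
    unfolding set_lebesgue_integral_def by (rule integral_abs_bound)
  also have "\<dots> \<le> (LINT p|lebesgue. B * indicator unit_square p)"
  proof (rule integral_mono)
    show "integrable lebesgue (\<lambda>p. B * indicator unit_square p)"
      using emeasure_unit_square by (intro integrable_mult_right integrable_real_indicator) auto
    show "\<bar>indicator (S \<times> T) p *\<^sub>R h p\<bar> \<le> B * indicator unit_square p" for p
      using B[of p] S B[of "(0, 0)"] by (auto simp: indicator_def)
  qed (use True in auto)
  also have "\<dots> = B" using emeasure_unit_square by (simp add: measure_def)
  finally show ?thesis .
qed

text \<open>The uniform bound \<open>B\<close> makes the supremum one of a set bounded above, and
  the empty rectangle then gives nonnegativity.\<close>

lemma cut_norm_bounds:
  assumes B: "\<And>p. p \<in> unit_square \<Longrightarrow> \<bar>h p\<bar> \<le> B"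
    and C: "\<And>S T. S \<in> sets (lebesgue_on unit_interval) \<Longrightarrow> T \<in> sets (lebesgue_on unit_interval) \<Longrightarrow>
        \<bar>LINT p:S \<times> T|lebesgue. h p\<bar> \<le> C"
  shows "0 \<le> cut_norm h" "cut_norm h \<le> C"
proof -
  let ?I = "sets (lebesgue_on unit_interval) \<times> sets (lebesgue_on unit_interval)"
  let ?f = "\<lambda>(S, T). \<bar>LINT p:S \<times> T|lebesgue. h p\<bar>"
  have sub: "S \<subseteq> unit_interval" if "S \<in> sets (lebesgue_on unit_interval)" for S
    using sets.sets_into_space[OF that] by simp
  have bdd: "bdd_above (?f ` ?I)"
    using abs_rectangle_integral_le[OF B] sub by (intro bdd_aboveI2[of _ _ B]) auto
  have "?f ({}, {}) \<le> (SUP x\<in>?I. ?f x)"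
    by (rule cSUP_upper[OF _ bdd]) auto
  then show "0 \<le> cut_norm h"
    unfolding cut_norm_def by (auto simp: set_lebesgue_integral_def)
  show "cut_norm h \<le> C"
    unfolding cut_norm_def using C by (intro cSUP_least) (auto intro: exI[of _ "{}"])
qed

lemma relabel_measure_preserving_bounded:
  assumes "\<And>p. p \<in> unit_square \<Longrightarrow> \<bar>g p\<bar> \<le> B" "\<psi> \<in> measure_preserving_bijections" "p \<in> unit_square"
  shows "\<bar>relabel g \<psi> p\<bar> \<le> B"
proof -
  have "\<psi> x \<in> unit_interval" if "x \<in> unit_interval" for x
    using assms(2) that by (auto simp: measure_preserving_bijections_def bij_betw_def)
  then show ?thesis using assms by (auto simp: relabel_def split: prod.splits)
qed

text \<open>The infimum over relabellings is controlled from below by the nonnegativity of the cut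
  norm for every relabelling, and from above by the value 0 at \<open>\<psi>\<close>.\<close>

lemma cut_dist_relabel_eq_0:
  assumes f: "f \<in> kernels" and g: "g \<in> kernels" and \<psi>: "\<psi> \<in> measure_preserving_bijections"
    and eq: "\<And>p. p \<in> unit_square \<Longrightarrow> f p = relabel g \<psi> p"
  shows "cut_dist f g = 0"
proof -
  obtain B where B: "\<And>p. p \<in> unit_square \<Longrightarrow> \<bar>f p\<bar> \<le> B" using kernels_bounded[OF f] by metis
  obtain C where C: "\<And>p. p \<in> unit_square \<Longrightarrow> \<bar>g p\<bar> \<le> C" using kernels_bounded[OF g] by metis
  have b: "\<bar>f p - relabel g \<phi> p\<bar> \<le> B + C" if "\<phi> \<in> measure_preserving_bijections" "p \<in> unit_square" for \<phi> p
    using B[OF that(2)] relabel_measure_preserving_bounded[of g C, OF C that] by linarith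
  have nonneg: "0 \<le> cut_norm (\<lambda>p. f p - relabel g \<phi> p)" if "\<phi> \<in> measure_preserving_bijections" for \<phi>
    using b[OF that] sets.sets_into_space[of _ "lebesgue_on unit_interval"]
    by (intro cut_norm_bounds(1)[where B="B + C" and C="B + C"] abs_rectangle_integral_le) auto
  have "cut_norm (\<lambda>p. f p - relabel g \<psi> p) \<le> 0"
    using eq sets.sets_into_space[of _ "lebesgue_on unit_interval"]
    by (intro cut_norm_bounds(2)[where B=0] abs_rectangle_integral_le) auto
  then have "cut_dist f g \<le> 0"
    unfolding cut_dist_def using nonneg \<psi>
    by (intro cINF_lower2[where x=\<psi>] bdd_belowI2[of _ 0]) auto
  moreover have "0 \<le> cut_dist f g"
    unfolding cut_dist_def using nonneg \<psi> by (intro cINF_greatest) auto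
  ultimately show ?thesis by simp
qed

lemma class_function_step_permute:
  assumes F: "class_function F" and k: "k \<ge> 1" and \<pi>: "\<pi> permutes {..<k}" and \<beta>: "\<beta> \<in> weights k"
  shows "F (step k (\<lambda>(a, b). \<beta> (\<pi> a, \<pi> b))) = F (step k \<beta>)"
proof -
  have "(\<lambda>(a, b). \<beta> (\<pi> a, \<pi> b)) \<in> weights k"
    using \<beta> permutes_in_image[OF \<pi>] by (auto simp: weights_def)
  then have g: "step k (\<lambda>(a, b). \<beta> (\<pi> a, \<pi> b)) \<in> graphons" "step k \<beta> \<in> graphons"
    using k \<beta> step_graphons by auto
  have iff: "block_map k \<pi> x \<in> {0..<1} \<longleftrightarrow> x \<in> {0..<1}" for x
    using block_map_index(1)[OF k \<pi>] block_map_outside[OF k \<pi>] by metis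
  have "step k (\<lambda>(a, b). \<beta> (\<pi> a, \<pi> b)) p = relabel (step k \<beta>) (block_map k \<pi>) p" for p
  proof (cases p)
    case (Pair x y)
    show ?thesis
      unfolding Pair step_def relabel_def prod.case iff
      using block_map_index(2)[OF k \<pi>, of x] block_map_index(2)[OF k \<pi>, of y]
      by (intro if_cong refl) (simp del: atLeastLessThan_iff)
  qed
  then have "cut_dist (step k (\<lambda>(a, b). \<beta> (\<pi> a, \<pi> b))) (step k \<beta>) = 0"
    using g graphonsD(1) by (intro cut_dist_relabel_eq_0[OF _ _ block_map_measure_preserving[OF k \<pi>]]) auto
  then show ?thesis using F g unfolding class_function_def by blast
qed

section \<open>Functionals of finite degree on step graphons\<close>

text \<open>Cauchy's functional equation on the unit interval: additivity settles rational
  arguments, continuity the others.\<close>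

lemma additive_continuous_imp_linear:
  fixes u :: "real \<Rightarrow> real"
  assumes add: "\<And>x y. 0 \<le> x \<Longrightarrow> 0 \<le> y \<Longrightarrow> x + y \<le> 1 \<Longrightarrow> u (x + y) = u x + u y"
    and cont: "continuous_on {0..1} u" and t: "t \<in> {0..1}"
  shows "u t = t * u 1"
proof -
  have u0: "u 0 = 0" using add[of 0 0] by simp
  have mult: "u (real j * x) = real j * u x" if "0 \<le> x" "real j * x \<le> 1" for j x
    using that
  proof (induction j)
    case (Suc j)
    then have "real j * x \<le> 1" by (simp add: distrib_right)
    then show ?case using add[of "real j * x" x] Suc by (simp add: distrib_right add.commute)
  qed (use u0 in simp)
  have frac: "u (real j / real m) = real j / real m * u 1" if "j \<le> m" "m \<ge> 1" for j m
  proof -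
    have "u 1 = real m * u (1 / real m)" using mult[of "1 / real m" m] that by simp
    moreover have "u (real j / real m) = real j * u (1 / real m)" using mult[of "1 / real m" j] that by simp
    ultimately show ?thesis using that by simp
  qed
  \<comment> \<open>Rational approximations from below, so that they stay in the unit interval,
    where \<open>frac\<close> applies.\<close>
  define q where "q m = real (nat \<lfloor>t * real (Suc m)\<rfloor>) / real (Suc m)" for m
  have nat: "real (nat \<lfloor>t * real (Suc m)\<rfloor>) = of_int \<lfloor>t * real (Suc m)\<rfloor>" for m using t by simp
  have qle: "q m \<le> t" "t - inverse (real (Suc m)) \<le> q m" "0 \<le> q m" for m
  proof -
    have "of_int \<lfloor>t * real (Suc m)\<rfloor> \<le> t * real (Suc m)" by simp
    then show "q m \<le> t" unfolding q_def nat by (simp add: divide_le_eq)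
    have "t * real (Suc m) - 1 \<le> of_int \<lfloor>t * real (Suc m)\<rfloor>" by linarith
    then have "(t * real (Suc m) - 1) / real (Suc m) \<le> q m" unfolding q_def nat by (intro divide_right_mono) auto
    then show "t - inverse (real (Suc m)) \<le> q m" by (simp add: diff_divide_distrib inverse_eq_divide)
  qed (simp add: q_def)
  have "(\<lambda>m. t - inverse (real (Suc m))) \<longlonglongrightarrow> t - 0"
    by (intro tendsto_diff tendsto_const LIMSEQ_inverse_real_of_nat)
  have qlim: "q \<longlonglongrightarrow> t"
  proof (rule tendsto_sandwich[where f="\<lambda>m. t - inverse (real (Suc m))" and h="\<lambda>_. t"])
    show "(\<lambda>_. t) \<longlonglongrightarrow> t" by (rule tendsto_const)
    show "(\<lambda>m. t - inverse (real (Suc m))) \<longlonglongrightarrow> t"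
      using \<open>(\<lambda>m. t - inverse (real (Suc m))) \<longlonglongrightarrow> t - 0\<close> by (simp only: diff_zero)
    show "\<forall>\<^sub>F m in sequentially. t - inverse (real (Suc m)) \<le> q m" "\<forall>\<^sub>F m in sequentially. q m \<le> t"
      using qle(1,2) by (auto intro: always_eventually)
  qed
  have q01: "q m \<in> {0..1}" for m using qle(1,3)[of m] t by auto
  have "(\<lambda>m. u (q m)) \<longlonglongrightarrow> u t"
    using cont t qlim q01 unfolding continuous_on_sequentially by (auto simp: comp_def)
  moreover have "u (q m) = q m * u 1" for m
  proof -
    have "nat \<lfloor>t * real (Suc m)\<rfloor> \<le> Suc m"
    proof -
      have "t * real (Suc m) \<le> 1 * real (Suc m)" using t by (intro mult_right_mono) auto
      from floor_mono[OF this] have "\<lfloor>t * real (Suc m)\<rfloor> \<le> int (Suc m)"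
        by (simp only: mult_1 floor_of_nat)
      then show ?thesis by simp
    qed
    then show ?thesis unfolding q_def by (intro frac) auto
  qed
  moreover have "(\<lambda>m. q m * u 1) \<longlonglongrightarrow> t * u 1" by (intro tendsto_mult qlim tendsto_const)
  ultimately show ?thesis by (simp add: LIMSEQ_unique)
qed

text \<open>The symmetrised matrix unit at position \<open>x\<close>. With the factor 1/2 a matrix
  is, up to symmetrisation, the combination of these units with its own entries as coefficients
  (\<open>sum_unit_weight\<close>); on the diagonal the two halves add up to 1.\<close>

definition unit_weight :: "nat \<times> nat \<Rightarrow> nat \<times> nat \<Rightarrow> real" where
  "unit_weight x c = (of_bool (c = x) + of_bool (c = prod.swap x)) / 2"

definition sym_weight :: "(nat \<times> nat \<Rightarrow> real) \<Rightarrow> nat \<times> nat \<Rightarrow> real" where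
  "sym_weight \<beta> c = (\<beta> c + \<beta> (prod.swap c)) / 2"

lemma unit_weight_alt: "unit_weight x c = (of_bool (x = c) + of_bool (x = prod.swap c)) / 2"
proof -
  have "c = x \<longleftrightarrow> x = c" "c = prod.swap x \<longleftrightarrow> x = prod.swap c" by auto
  then show ?thesis by (simp only: unit_weight_def)
qed

lemma unit_weight_sym: "unit_weight x (a, b) = unit_weight x (b, a)"
  by (simp add: unit_weight_alt add.commute)

text \<open>Degree below \<open>n\<close> on step graphons, phrased with nonnegative directions
  because these are the ones reached from derivatives. The condition on the top vertex keeps all
  vertices of the cube among the graphons.\<close>

definition vanishing_order :: "nat \<Rightarrow> (kernel \<Rightarrow> real) \<Rightarrow> bool" where
  "vanishing_order n F \<longleftrightarrow> (\<forall>k\<ge>1. \<forall>\<beta>\<in>weights k. \<forall>\<gamma>. (\<forall>i<n. \<gamma> i \<in> weights k) \<longrightarrow>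
     (\<lambda>c. \<beta> c + (\<Sum>i<n. \<gamma> i c)) \<in> weights k \<longrightarrow>
     mixed_diff {..<n} (\<lambda>\<beta>. F (step k \<beta>)) \<gamma> \<beta> = 0)"

lemma vanishing_orderD:
  assumes "vanishing_order n F" "k \<ge> 1" "\<beta> \<in> weights k" "\<forall>i<n. \<gamma> i \<in> weights k"
    "(\<lambda>c. \<beta> c + (\<Sum>i<n. \<gamma> i c)) \<in> weights k"
  shows "mixed_diff {..<n} (\<lambda>\<beta>. F (step k \<beta>)) \<gamma> \<beta> = 0"
  by (rule assms(1)[unfolded vanishing_order_def, rule_format, OF assms(2,3) assms(4)[rule_format] assms(5)])

text \<open>The trace of the class function property on step graphons, in a form that passes to
  \<open>F\<close> minus densities by reindexing a finite sum.\<close>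

definition permutation_invariant :: "(kernel \<Rightarrow> real) \<Rightarrow> bool" where
  "permutation_invariant F \<longleftrightarrow> (\<forall>k\<ge>1. \<forall>\<pi>. \<pi> permutes {..<k} \<longrightarrow> (\<forall>\<beta>\<in>weights k.
     F (step k (\<lambda>(a, b). \<beta> (\<pi> a, \<pi> b))) = F (step k \<beta>)))"

definition directions :: "nat \<Rightarrow> nat \<Rightarrow> (nat \<Rightarrow> nat \<times> nat \<Rightarrow> real) set" where
  "directions n k = {\<gamma>. (\<forall>i<n. \<gamma> i \<in> weights k) \<and> (\<lambda>c. \<Sum>i<n. \<gamma> i c) \<in> weights k}"

section \<open>Weight matrices and jointly admissible directions\<close>

lemma weightsI:
  "(\<And>a b. a < k \<Longrightarrow> b < k \<Longrightarrow> 0 \<le> \<beta> (a, b)) \<Longrightarrow> (\<And>a b. a < k \<Longrightarrow> b < k \<Longrightarrow> \<beta> (a, b) \<le> 1) \<Longrightarrow>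
    (\<And>a b. a < k \<Longrightarrow> b < k \<Longrightarrow> \<beta> (a, b) = \<beta> (b, a)) \<Longrightarrow> \<beta> \<in> weights k"
  by (simp add: weights_def)

lemma weightsD:
  assumes "\<beta> \<in> weights k" "a < k" "b < k"
  shows "0 \<le> \<beta> (a, b)" "\<beta> (a, b) \<le> 1" "\<beta> (a, b) = \<beta> (b, a)"
  using assms unfolding weights_def by blast+

lemma weights_zero [simp]: "(\<lambda>_. 0) \<in> weights k"
  by (simp add: weights_def)

lemma weights_sum_subset:
  assumes "\<And>i. i \<in> I \<Longrightarrow> \<gamma> i \<in> weights k" "(\<lambda>c. \<Sum>i\<in>I. \<gamma> i c) \<in> weights k" "S \<subseteq> I" "finite I"
  shows "(\<lambda>c. \<Sum>i\<in>S. \<gamma> i c) \<in> weights k"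
proof (rule weightsI)
  fix a b assume ab: "a < k" "b < k"
  have g: "i \<in> S \<Longrightarrow> \<gamma> i \<in> weights k" for i using assms by auto
  show "0 \<le> (\<Sum>i\<in>S. \<gamma> i (a, b))" using weightsD(1)[OF g ab] by (intro sum_nonneg) auto
  have "(\<Sum>i\<in>S. \<gamma> i (a, b)) \<le> (\<Sum>i\<in>I. \<gamma> i (a, b))"
    using weightsD(1)[OF assms(1) ab] assms by (intro sum_mono2) auto
  then show "(\<Sum>i\<in>S. \<gamma> i (a, b)) \<le> 1" using weightsD(2)[OF assms(2) ab] by linarith
  show "(\<Sum>i\<in>S. \<gamma> i (a, b)) = (\<Sum>i\<in>S. \<gamma> i (b, a))"
    using weightsD(3)[OF g ab] by (intro sum.cong) auto
qed

lemma weights_le: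
  assumes "\<alpha> \<in> weights k" "\<And>a b. a < k \<Longrightarrow> b < k \<Longrightarrow> 0 \<le> \<beta> (a, b) \<and> \<beta> (a, b) \<le> \<alpha> (a, b) \<and> \<beta> (a, b) = \<beta> (b, a)"
  shows "\<beta> \<in> weights k"
proof (rule weightsI)
  fix a b assume ab: "a < k" "b < k"
  show "0 \<le> \<beta> (a, b)" "\<beta> (a, b) = \<beta> (b, a)" using assms(2)[OF ab] by auto
  show "\<beta> (a, b) \<le> 1" using assms(2)[OF ab] weightsD(2)[OF assms(1) ab] by linarith
qed

lemma directionsD: "\<gamma> \<in> directions n k \<Longrightarrow> i < n \<Longrightarrow> \<gamma> i \<in> weights k"
  by (simp add: directions_def)

lemma directions_le:
  assumes "\<gamma> \<in> directions n k"
    and le: "\<And>i a b. i < n \<Longrightarrow> a < k \<Longrightarrow> b < k \<Longrightarrow> 0 \<le> \<delta> i (a, b) \<and> \<delta> i (a, b) \<le> \<gamma> i (a, b) \<and> \<delta> i (a, b) = \<delta> i (b, a)"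
  shows "\<delta> \<in> directions n k"
  unfolding directions_def
proof (intro CollectI conjI allI impI)
  show "\<delta> i \<in> weights k" if "i < n" for i
    using weights_le[OF directionsD[OF assms(1) that]] le[OF that] by blast
  show "(\<lambda>c. \<Sum>i<n. \<delta> i c) \<in> weights k"
  proof (rule weights_le)
    show "(\<lambda>c. \<Sum>i<n. \<gamma> i c) \<in> weights k" using assms(1) by (simp add: directions_def)
    fix a b assume "a < k" "b < k"
    then show "0 \<le> (\<Sum>i<n. \<delta> i (a, b)) \<and> (\<Sum>i<n. \<delta> i (a, b)) \<le> (\<Sum>i<n. \<gamma> i (a, b)) \<and>
        (\<Sum>i<n. \<delta> i (a, b)) = (\<Sum>i<n. \<delta> i (b, a))"
      using le by (auto intro!: sum_nonneg sum_mono sum.cong)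
  qed
qed

text \<open>\<open>n\<close> directions of size at most \<open>1 / real (Suc n)\<close> have a sum
  below 1; \<open>Suc\<close> keeps the denominator positive for \<open>n = 0\<close>.\<close>

lemma directions_bounded:
  assumes "\<And>i a b. i < n \<Longrightarrow> a < k \<Longrightarrow> b < k \<Longrightarrow> 0 \<le> \<delta> i (a, b) \<and> \<delta> i (a, b) \<le> 1 / real (Suc n) \<and> \<delta> i (a, b) = \<delta> i (b, a)"
  shows "\<delta> \<in> directions n k"
proof (rule directions_le[where \<gamma>="\<lambda>_ _. 1 / real (Suc n)"])
  show "(\<lambda>_ _. 1 / real (Suc n)) \<in> directions n k"
    by (auto simp: directions_def weights_def field_simps)
qed (use assms in auto)

lemma step_L1_continuous:
  assumes F: "graphon_continuous L1_norm F" and k: "k \<ge> 1"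
    and w: "\<And>l. l \<in> {0..1} \<Longrightarrow> (\<lambda>c. l * \<alpha> c + \<delta> c) \<in> weights k"
  shows "continuous_on {0..1} (\<lambda>l. F (step k (\<lambda>c. l * \<alpha> c + \<delta> c)))"
  unfolding continuous_on_sequentially comp_def
proof (intro allI ballI impI)
  fix x and l :: real assume l: "l \<in> {0..1}" and x: "(\<forall>n. x n \<in> {0..1}) \<and> x \<longlonglongrightarrow> l"
  show "(\<lambda>n. F (step k (\<lambda>c. x n * \<alpha> c + \<delta> c))) \<longlonglongrightarrow> F (step k (\<lambda>c. l * \<alpha> c + \<delta> c))"
  proof (rule graphon_continuous_tendsto[OF F])
    show "step k (\<lambda>c. l * \<alpha> c + \<delta> c) \<in> graphons" "step k (\<lambda>c. x n * \<alpha> c + \<delta> c) \<in> graphons" for n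
      using w l x k by (auto intro!: step_graphons)
    have "(\<lambda>p. step k (\<lambda>c. x n * \<alpha> c + \<delta> c) p - step k (\<lambda>c. l * \<alpha> c + \<delta> c) p)
        = (\<lambda>p. (x n - l) * step k \<alpha> p)" for n
      by (auto simp: step_def fun_eq_iff algebra_simps)
    then have *: "L1_norm (\<lambda>p. step k (\<lambda>c. x n * \<alpha> c + \<delta> c) p - step k (\<lambda>c. l * \<alpha> c + \<delta> c) p)
        = \<bar>x n - l\<bar> * L1_norm (step k \<alpha>)" for n
      by (simp only: L1_norm_scale)
    have "(\<lambda>n. \<bar>x n - l\<bar> * L1_norm (step k \<alpha>)) \<longlonglongrightarrow> \<bar>l - l\<bar> * L1_norm (step k \<alpha>)"
      using x by (intro tendsto_intros) auto
    then show "(\<lambda>n. L1_norm (\<lambda>p. step k (\<lambda>c. x n * \<alpha> c + \<delta> c) p - step k (\<lambda>c. l * \<alpha> c + \<delta> c) p)) \<longlonglongrightarrow> 0"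
      unfolding * by simp
  qed
qed

text \<open>On step graphons \<open>F\<close> behaves like a polynomial of degree at most
  \<open>n\<close>. The aim is to identify its leading form, the difference \<open>M\<close> of
  order \<open>n\<close> at the base point 0.\<close>

locale polynomial_functional =
  fixes n :: nat and F :: "kernel \<Rightarrow> real"
  assumes L1_cont: "graphon_continuous L1_norm F"
    and perm_inv: "permutation_invariant F"
    and vanishing: "vanishing_order (Suc n) F"
begin

definition M :: "nat \<Rightarrow> (nat \<Rightarrow> nat \<times> nat \<Rightarrow> real) \<Rightarrow> real" where
  "M k \<gamma> = mixed_diff {..<n} (\<lambda>\<beta>. F (step k \<beta>)) \<gamma> (\<lambda>_. 0)"

lemma M_cong:
  assumes k: "k \<ge> 1" and eq: "\<And>i a b. i < n \<Longrightarrow> a < k \<Longrightarrow> b < k \<Longrightarrow> \<gamma> i (a, b) = \<delta> i (a, b)"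
  shows "M k \<gamma> = M k \<delta>"
  unfolding M_def mixed_diff_def
proof (intro sum.cong refl arg_cong2[where f="(*)"] arg_cong[where f=F] step_cong k)
  fix S a b assume "S \<in> Pow {..<n}" "a < k" "b < k"
  then show "0 + (\<Sum>i\<in>S. \<gamma> i (a, b)) = 0 + (\<Sum>i\<in>S. \<delta> i (a, b))"
    using eq by (intro arg_cong2[where f="(+)"] refl sum.cong) auto
qed

text \<open>One argument is turned into the base point of a difference of lower order, the form in
  which additivity and continuity in that argument become visible.\<close>

lemma M_slot:
  assumes "i < n"
  shows "M k (\<gamma>(i := \<alpha>)) = mixed_diff ({..<n} - {i}) (\<lambda>\<beta>. F (step k \<beta>)) \<gamma> \<alpha>
      - mixed_diff ({..<n} - {i}) (\<lambda>\<beta>. F (step k \<beta>)) \<gamma> (\<lambda>_. 0)"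
proof -
  have ins: "{..<n} = insert i ({..<n} - {i})" using assms by auto
  have cong: "mixed_diff ({..<n} - {i}) (\<lambda>\<beta>. F (step k \<beta>)) (\<gamma>(i := \<alpha>)) f
      = mixed_diff ({..<n} - {i}) (\<lambda>\<beta>. F (step k \<beta>)) \<gamma> f" for f
    by (intro mixed_diff_cong) auto
  show ?thesis
    unfolding M_def by (subst ins, subst mixed_diff_insert) (simp_all add: cong)
qed

lemma M_slot_zero: "i < n \<Longrightarrow> M k (\<gamma>(i := \<lambda>_. 0)) = 0"
  by (simp add: M_slot)

text \<open>The failure of additivity in slot \<open>i\<close> is the difference of order
  \<open>n + 1\<close> with \<open>\<alpha>\<close> in slot \<open>i\<close> and
  \<open>\<alpha>'\<close> in the additional slot \<open>n\<close>, which vanishes.\<close>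

lemma M_slot_add:
  assumes k: "k \<ge> 1" and i: "i < n" and \<alpha>: "\<alpha> \<in> weights k" "\<alpha>' \<in> weights k"
    and dir: "\<gamma>(i := \<lambda>c. \<alpha> c + \<alpha>' c) \<in> directions n k"
  shows "M k (\<gamma>(i := \<lambda>c. \<alpha> c + \<alpha>' c)) = M k (\<gamma>(i := \<alpha>)) + M k (\<gamma>(i := \<alpha>'))"
proof -
  let ?I = "{..<n} - {i}"
  let ?F = "\<lambda>\<beta>. F (step k \<beta>)"
  let ?g = "\<gamma>(i := \<alpha>, n := \<alpha>')"
  have gw: "\<gamma> j \<in> weights k" if "j < n" "j \<noteq> i" for j
    using directionsD[OF dir that(1)] that by simp
  have eqs: "(\<Sum>j<Suc n. ?g j c) = (\<Sum>j<n. (\<gamma>(i := \<lambda>c. \<alpha> c + \<alpha>' c)) j c)" for c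
  proof -
    have "(\<Sum>j<Suc n. ?g j c) = (\<Sum>j<n. (\<gamma>(i := \<alpha>)) j c) + \<alpha>' c"
      by (simp add: sum.lessThan_Suc) 
    also have "(\<Sum>j<n. (\<gamma>(i := \<alpha>)) j c) = \<alpha> c + (\<Sum>j\<in>?I. \<gamma> j c)"
      using i by (subst sum.remove[of _ i]) auto
    also have "\<alpha> c + (\<Sum>j\<in>?I. \<gamma> j c) + \<alpha>' c = (\<Sum>j<n. (\<gamma>(i := \<lambda>c. \<alpha> c + \<alpha>' c)) j c)"
      using i by (subst sum.remove[of _ i]) auto
    finally show ?thesis .
  qed
  have zero: "mixed_diff {..<Suc n} ?F ?g (\<lambda>_. 0) = 0"
  proof -
    have "\<forall>j<Suc n. ?g j \<in> weights k" using gw \<alpha> by auto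
    moreover have "(\<lambda>c. 0 + (\<Sum>j<Suc n. ?g j c)) \<in> weights k"
      unfolding eqs using dir by (simp add: directions_def)
    ultimately show ?thesis
      by (intro vanishing_orderD[OF vanishing k weights_zero]) blast+
  qed
  moreover have ins: "{..<Suc n} = insert n (insert i ?I)" using i by auto
  moreover have cong: "mixed_diff ?I ?F ?g f = mixed_diff ?I ?F \<gamma> f" for f
    by (intro mixed_diff_cong) auto
  ultimately have "mixed_diff ?I ?F \<gamma> (\<lambda>c. \<alpha> c + \<alpha>' c) - mixed_diff ?I ?F \<gamma> \<alpha>'
      - (mixed_diff ?I ?F \<gamma> \<alpha> - mixed_diff ?I ?F \<gamma> (\<lambda>_. 0)) = 0"
  proof -
    have 1: "finite (insert i ?I)" "n \<notin> insert i ?I" "finite ?I" "i \<notin> ?I" using i by auto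
    have g: "?g n = \<alpha>'" "?g i = \<alpha>" using i by auto
    have "mixed_diff {..<Suc n} ?F ?g (\<lambda>_. 0) = (mixed_diff ?I ?F \<gamma> (\<lambda>c. 0 + \<alpha>' c + \<alpha> c) - mixed_diff ?I ?F \<gamma> (\<lambda>c. 0 + \<alpha>' c))
      - (mixed_diff ?I ?F \<gamma> (\<lambda>c. 0 + \<alpha> c) - mixed_diff ?I ?F \<gamma> (\<lambda>_. 0))"
      unfolding ins mixed_diff_insert[OF 1(1,2)] mixed_diff_insert[OF 1(3,4)] g cong ..
    then show ?thesis
      using zero by (simp add: add.commute)
  qed
  then show ?thesis using i by (simp add: M_slot)
qed

text \<open>Along the ray of \<open>\<alpha>\<close> the slot is additive and continuous, hence
  linear by Cauchy's equation. Continuity is inherited from \<open>F\<close>, because step functions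
  with convergent weights converge in \<open>L\<^sup>1\<close>.\<close>

lemma M_slot_scale:
  assumes k: "k \<ge> 1" and i: "i < n" and dir: "\<gamma>(i := \<alpha>) \<in> directions n k" and l: "l \<in> {0..1}"
  shows "M k (\<gamma>(i := \<lambda>c. l * \<alpha> c)) = l * M k (\<gamma>(i := \<alpha>))"
proof -
  let ?I = "{..<n} - {i}"
  have \<alpha>: "\<alpha> \<in> weights k" using directionsD[OF dir i] by simp
  have gw: "\<gamma> j \<in> weights k" if "j \<in> ?I" for j
    using directionsD[OF dir, of j] that by auto
  have scale: "(\<lambda>c. x * \<alpha> c) \<in> weights k" "\<gamma>(i := \<lambda>c. x * \<alpha> c) \<in> directions n k" if x: "x \<in> {0..1}" for x
  proof -
    have *: "0 \<le> x * \<alpha> (a, b) \<and> x * \<alpha> (a, b) \<le> \<alpha> (a, b) \<and> x * \<alpha> (a, b) = x * \<alpha> (b, a)"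
      if "a < k" "b < k" for a b
      using weightsD[OF \<alpha> that] x by (auto simp: mult_left_le_one_le)
    show "(\<lambda>c. x * \<alpha> c) \<in> weights k" by (rule weights_le[OF \<alpha> *])
    show "\<gamma>(i := \<lambda>c. x * \<alpha> c) \<in> directions n k"
    proof (rule directions_le[OF dir])
      fix j a b assume "j < n" "a < k" "b < k"
      then show "0 \<le> (\<gamma>(i := \<lambda>c. x * \<alpha> c)) j (a, b) \<and> (\<gamma>(i := \<lambda>c. x * \<alpha> c)) j (a, b) \<le> (\<gamma>(i := \<alpha>)) j (a, b)
          \<and> (\<gamma>(i := \<lambda>c. x * \<alpha> c)) j (a, b) = (\<gamma>(i := \<lambda>c. x * \<alpha> c)) j (b, a)"
        using * weightsD[OF gw] by auto
    qed
  qed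
  define u where "u x = M k (\<gamma>(i := \<lambda>c. x * \<alpha> c))" for x
  have "u l = l * u 1"
  proof (rule additive_continuous_imp_linear[OF _ _ l])
    fix x y :: real assume xy: "0 \<le> x" "0 \<le> y" "x + y \<le> 1"
    have "\<gamma>(i := \<lambda>c. x * \<alpha> c + y * \<alpha> c) \<in> directions n k"
      using scale(2)[of "x + y"] xy by (simp add: distrib_right)
    then have "M k (\<gamma>(i := \<lambda>c. x * \<alpha> c + y * \<alpha> c)) = u x + u y"
      unfolding u_def using xy by (intro M_slot_add k i scale) auto
    then show "u (x + y) = u x + u y" by (simp add: u_def distrib_right)
  next
    have "continuous_on {0..1} (\<lambda>x. mixed_diff ?I (\<lambda>\<beta>. F (step k \<beta>)) \<gamma> (\<lambda>c. x * \<alpha> c))"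
      unfolding mixed_diff_def
    proof (intro continuous_on_sum continuous_on_mult continuous_on_const step_L1_continuous[OF L1_cont k])
      fix S x assume S: "S \<in> Pow ?I" and x: "x \<in> {0..1::real}"
      have "(\<lambda>c. \<Sum>j\<in>insert i S. (\<gamma>(i := \<lambda>c. x * \<alpha> c)) j c) \<in> weights k"
      proof (rule weights_sum_subset[where I="{..<n}"])
        show "(\<lambda>c. \<Sum>j<n. (\<gamma>(i := \<lambda>c. x * \<alpha> c)) j c) \<in> weights k"
          using scale(2)[OF x] by (simp add: directions_def)
        show "(\<gamma>(i := \<lambda>c. x * \<alpha> c)) j \<in> weights k" if "j \<in> {..<n}" for j
          using directionsD[OF scale(2)[OF x], of j] that by simp
        show "insert i S \<subseteq> {..<n}" using S i by blast
      qed simp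
      moreover have "(\<Sum>j\<in>insert i S. (\<gamma>(i := \<lambda>c. x * \<alpha> c)) j c) = x * \<alpha> c + (\<Sum>j\<in>S. \<gamma> j c)" for c
      proof -
        have "finite S" "i \<notin> S" using S finite_subset by auto
        moreover have "(\<Sum>j\<in>S. (\<gamma>(i := \<lambda>c. x * \<alpha> c)) j c) = (\<Sum>j\<in>S. \<gamma> j c)"
          using S by (intro sum.cong) auto
        ultimately show ?thesis by simp
      qed
      ultimately show "(\<lambda>c. x * \<alpha> c + (\<Sum>j\<in>S. \<gamma> j c)) \<in> weights k" by simp
    qed
    then show "continuous_on {0..1} u"
      unfolding u_def M_slot[OF i] by (intro continuous_on_diff continuous_on_const)
  qed
  then show ?thesis by (simp add: u_def)
qed

lemma M_scale:
  assumes k: "k \<ge> 1" and \<gamma>: "\<gamma> \<in> directions n k" and l: "l \<in> {0..1}"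
  shows "M k (\<lambda>i c. l * \<gamma> i c) = l ^ n * M k \<gamma>"
proof -
  \<comment> \<open>Only the first \<open>m\<close> slots are scaled, so one use of
    \<open>M_slot_scale\<close> raises \<open>m\<close> by one.\<close>
  let ?g = "\<lambda>m i c. (if i < m then l else 1) * \<gamma> i c"
  have dir: "?g m \<in> directions n k" for m
  proof (rule directions_le[OF \<gamma>])
    fix i a b assume "i < n" "a < k" "b < k"
    then show "0 \<le> ?g m i (a, b) \<and> ?g m i (a, b) \<le> \<gamma> i (a, b) \<and> ?g m i (a, b) = ?g m i (b, a)"
      using weightsD[OF directionsD[OF \<gamma>]] l by (auto simp: mult_left_le_one_le)
  qed
  have "M k (?g m) = l ^ m * M k \<gamma>" if "m \<le> n" for m
    using that
  proof (induction m)
    case (Suc m)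
    then have m: "m < n" by simp
    have eq: "?g (Suc m) = (?g m)(m := \<lambda>c. l * \<gamma> m c)" "?g m = (?g m)(m := \<gamma> m)"
      by (auto simp: fun_eq_iff)
    have "(?g m)(m := \<gamma> m) \<in> directions n k" using dir[of m] eq(2) by simp
    from M_slot_scale[OF k m this l] have "M k (?g (Suc m)) = l * M k (?g m)"
      using eq by simp
    then show ?case using Suc by simp
  qed simp
  from this[of n] have "M k (?g n) = l ^ n * M k \<gamma>" by simp
  moreover have "M k (?g n) = M k (\<lambda>i c. l * \<gamma> i c)" by (intro M_cong k) auto
  ultimately show ?thesis by simp
qed

text \<open>Common scale of all directions: any \<open>n\<close> of them with entries up to
  \<open>s\<close> are jointly admissible. The homogeneity in \<open>M_scale\<close> removes it in
  the end.\<close>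

abbreviation "s \<equiv> 1 / real (Suc n)"

lemma sum_unit_weight_le:
  assumes "finite X" "\<And>x. x \<in> X \<Longrightarrow> 0 \<le> \<beta> x \<and> \<beta> x \<le> 1"
  shows "0 \<le> (\<Sum>x\<in>X. \<beta> x * unit_weight x c)" "(\<Sum>x\<in>X. \<beta> x * unit_weight x c) \<le> 1"
proof -
  show "0 \<le> (\<Sum>x\<in>X. \<beta> x * unit_weight x c)"
    using assms by (intro sum_nonneg mult_nonneg_nonneg) (auto simp: unit_weight_def)
  have "(\<Sum>x\<in>X. \<beta> x * unit_weight x c) \<le> (\<Sum>x\<in>X. of_bool (x = c) / 2 + of_bool (x = prod.swap c) / 2)"
  proof (rule sum_mono)
    fix x assume x: "x \<in> X"
    have "\<beta> x * unit_weight x c \<le> 1 * unit_weight x c"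
      using assms(2)[OF x] by (intro mult_right_mono) (auto simp: unit_weight_def)
    then show "\<beta> x * unit_weight x c \<le> of_bool (x = c) / 2 + of_bool (x = prod.swap c) / 2"
      by (simp add: unit_weight_alt add_divide_distrib)
  qed
  also have "\<dots> \<le> 1 / 2 + 1 / 2"
    unfolding sum.distrib
    using assms(1) by (intro add_mono) (auto simp: of_bool_def if_distrib[of "\<lambda>x. x / 2"] cong: if_cong)
  finally show "(\<Sum>x\<in>X. \<beta> x * unit_weight x c) \<le> 1" by simp
qed

text \<open>Additivity is available only inside the cube, so all partial sums have to stay bounded
  by 1 before scaling; \<open>sum_unit_weight_le\<close> ensures this for every finite set of
  positions.\<close>

lemma M_slot_expand:
  assumes k: "k \<ge> 1" and i: "i < n"
    and \<gamma>: "\<And>j a b. j < n \<Longrightarrow> a < k \<Longrightarrow> b < k \<Longrightarrow> 0 \<le> \<gamma> j (a, b) \<and> \<gamma> j (a, b) \<le> s \<and> \<gamma> j (a, b) = \<gamma> j (b, a)"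
    and X: "finite X" and \<beta>: "\<And>x. x \<in> X \<Longrightarrow> 0 \<le> \<beta> x \<and> \<beta> x \<le> 1"
  shows "M k (\<gamma>(i := \<lambda>c. s * (\<Sum>x\<in>X. \<beta> x * unit_weight x c)))
      = (\<Sum>x\<in>X. \<beta> x * M k (\<gamma>(i := \<lambda>c. s * unit_weight x c)))"
proof -
  have dir: "\<gamma>(i := \<alpha>) \<in> directions n k"
    if "\<And>a b. a < k \<Longrightarrow> b < k \<Longrightarrow> 0 \<le> \<alpha> (a, b) \<and> \<alpha> (a, b) \<le> s \<and> \<alpha> (a, b) = \<alpha> (b, a)" for \<alpha>
    using that \<gamma> by (intro directions_bounded) auto
  have bound: "0 \<le> s * r \<and> s * r \<le> s" if "0 \<le> r" "r \<le> 1" for r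
    using that by (auto simp: divide_right_mono)
  have w: "(\<lambda>c. s * g c) \<in> weights k" if "\<And>c. 0 \<le> g c" "\<And>c. g c \<le> 1" "\<And>a b. g (a, b) = g (b, a)" for g
  proof (rule weightsI)
    have "s \<le> 1" by simp
    then show "s * g (a, b) \<le> 1" "0 \<le> s * g (a, b)" for a b
      using bound[OF that(1,2), of "(a, b)"] by linarith+
    show "s * g (a, b) = s * g (b, a)" for a b using that(3)[of a b] by simp
  qed
  have ds: "\<gamma>(i := \<lambda>c. s * g c) \<in> directions n k" if "\<And>c. 0 \<le> g c" "\<And>c. g c \<le> 1" "\<And>a b. g (a, b) = g (b, a)" for g
    using bound that by (intro dir) auto
  have symX: "(\<Sum>x\<in>Y. \<beta> x * unit_weight x (a, b)) = (\<Sum>x\<in>Y. \<beta> x * unit_weight x (b, a))" for Y a b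
    using unit_weight_sym by (intro sum.cong) auto
  have u01: "0 \<le> unit_weight x c" "unit_weight x c \<le> 1" for x c
    by (auto simp: unit_weight_def)
  show ?thesis
    using X \<beta>
  proof (induction X rule: finite_induct)
    case empty
    have "M k (\<gamma>(i := \<lambda>c. s * 0)) = 0" using M_slot_zero[OF i] by (simp only: mult_zero_right)
    then show ?case by (simp only: sum.empty)
  next
    case (insert x X)
    have b01: "0 \<le> \<beta> x" "\<beta> x \<le> 1" using insert.prems by auto
    note leX = sum_unit_weight_le[of X \<beta>]
    have leX: "0 \<le> (\<Sum>y\<in>X. \<beta> y * unit_weight y c)" "(\<Sum>y\<in>X. \<beta> y * unit_weight y c) \<le> 1" for c
      using sum_unit_weight_le[of X \<beta>] insert by auto
    have leI: "0 \<le> (\<Sum>y\<in>insert x X. \<beta> y * unit_weight y c)" "(\<Sum>y\<in>insert x X. \<beta> y * unit_weight y c) \<le> 1" for c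
      using sum_unit_weight_le[of "insert x X" \<beta>] insert.prems insert.hyps(1) by auto
    have bx: "0 \<le> \<beta> x * unit_weight x c" "\<beta> x * unit_weight x c \<le> 1" for c
      using b01 u01[of x c] by (simp_all add: mult_le_one)
    have eq: "(\<lambda>c. s * (\<Sum>y\<in>insert x X. \<beta> y * unit_weight y c))
        = (\<lambda>c. s * (\<beta> x * unit_weight x c) + s * (\<Sum>y\<in>X. \<beta> y * unit_weight y c))"
      using insert by (simp add: distrib_left)
    have "M k (\<gamma>(i := \<lambda>c. s * (\<Sum>y\<in>insert x X. \<beta> y * unit_weight y c)))
       = M k (\<gamma>(i := \<lambda>c. s * (\<beta> x * unit_weight x c))) + M k (\<gamma>(i := \<lambda>c. s * (\<Sum>y\<in>X. \<beta> y * unit_weight y c)))"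
      unfolding eq
    proof (intro M_slot_add k i w)
      show "\<gamma>(i := \<lambda>c. s * (\<beta> x * unit_weight x c) + s * (\<Sum>y\<in>X. \<beta> y * unit_weight y c)) \<in> directions n k"
        unfolding eq[symmetric] by (intro ds leI symX)
    qed (use bx leX symX unit_weight_sym in auto)
    also have "M k (\<gamma>(i := \<lambda>c. s * (\<beta> x * unit_weight x c))) = \<beta> x * M k (\<gamma>(i := \<lambda>c. s * unit_weight x c))"
    proof -
      have "(\<lambda>c. s * (\<beta> x * unit_weight x c)) = (\<lambda>c. \<beta> x * (s * unit_weight x c))" by auto
      then show ?thesis
        using M_slot_scale[OF k i ds, of "unit_weight x" "\<beta> x"] u01 b01 unit_weight_sym by auto
    qed
    also have "M k (\<gamma>(i := \<lambda>c. s * (\<Sum>y\<in>X. \<beta> y * unit_weight y c)))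
        = (\<Sum>y\<in>X. \<beta> y * M k (\<gamma>(i := \<lambda>c. s * unit_weight y c)))"
      by (rule insert.IH) (use insert.prems in auto)
    finally show ?case by (simp only: sum.insert[OF insert.hyps(1,2)])
  qed
qed

lemma sum_unit_weight:
  assumes "a < k" "b < k"
  shows "(\<Sum>x\<in>{..<k} \<times> {..<k}. \<beta> x * unit_weight x (a, b)) = sym_weight \<beta> (a, b)"
proof -
  have "(\<Sum>x\<in>{..<k} \<times> {..<k}. \<beta> x * unit_weight x (a, b))
     = (\<Sum>x\<in>{..<k} \<times> {..<k}. (if x = (a, b) then \<beta> x / 2 else 0) + (if x = (b, a) then \<beta> x / 2 else 0))"
  proof (rule sum.cong[OF refl])
    fix x
    have "unit_weight x (a, b) = ((if x = (a, b) then 1 else 0) + (if x = (b, a) then 1 else 0)) / 2"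
      by (simp only: unit_weight_alt of_bool_def swap_simp)
    moreover have "y * ((of_bool P + of_bool Q) / 2) = (if P then y / 2 else 0) + (if Q then y / 2 else 0)"
      for y :: real and P Q by simp
    ultimately show "\<beta> x * unit_weight x (a, b)
        = (if x = (a, b) then \<beta> x / 2 else 0) + (if x = (b, a) then \<beta> x / 2 else 0)"
      by (simp only: of_bool_def)
  qed
  also have "\<dots> = sym_weight \<beta> (a, b)"
    unfolding sum.distrib using assms by (simp add: sym_weight_def add_divide_distrib)
  finally show ?thesis .
qed

text \<open>Slot \<open>j\<close> receives the matrix unit at row \<open>\<phi> (2 * j)\<close> and
  column \<open>\<phi> (2 * j + 1)\<close>, so \<open>\<phi>\<close> labels half-edges by
  steps.\<close>

definition coeff :: "nat \<Rightarrow> (nat \<Rightarrow> nat) \<Rightarrow> real" where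
  "coeff k \<phi> = M k (\<lambda>j c. s * unit_weight (\<phi> (2 * j), \<phi> (2 * j + 1)) c)"

text \<open>Multilinear expansion, one slot at a time: \<open>G m \<phi>\<close> has matrix units in
  the slots below \<open>m\<close> and the original weights in the others.\<close>

lemma M_expand:
  assumes k: "k \<ge> 1" and \<beta>: "\<And>j a b. j < n \<Longrightarrow> a < k \<Longrightarrow> b < k \<Longrightarrow> 0 \<le> \<beta> j (a, b) \<and> \<beta> j (a, b) \<le> 1"
  shows "M k (\<lambda>j c. s * sym_weight (\<beta> j) c)
    = (\<Sum>\<phi>\<in>{..<2 * n} \<rightarrow>\<^sub>E {..<k}. (\<Prod>j<n. \<beta> j (\<phi> (2 * j), \<phi> (2 * j + 1))) * coeff k \<phi>)"
proof -
  define G where "G m \<phi> j c = (if j < m then s * unit_weight (\<phi> (2 * j), \<phi> (2 * j + 1)) c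
      else s * sym_weight (\<beta> j) c)" for m :: nat and \<phi> :: "nat \<Rightarrow> nat" and j c
  have Gb: "0 \<le> G m \<phi> j (a, b) \<and> G m \<phi> j (a, b) \<le> s \<and> G m \<phi> j (a, b) = G m \<phi> j (b, a)"
    if "j < n" "a < k" "b < k" for m \<phi> j a b
  proof -
    have u: "0 \<le> unit_weight x c" "unit_weight x c \<le> 1" for x c
      by (auto simp: unit_weight_def)
    have w: "0 \<le> sym_weight (\<beta> j) (a, b)" "sym_weight (\<beta> j) (a, b) \<le> 1"
      using \<beta>[OF that] \<beta>[OF that(1,3,2)] by (auto simp: sym_weight_def)
    have sym: "sym_weight (\<beta> j) (a, b) = sym_weight (\<beta> j) (b, a)" by (simp add: sym_weight_def add.commute)
    have scale: "0 \<le> s * r \<and> s * r \<le> s" if "0 \<le> r" "r \<le> 1" for r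
      using that by (auto simp: divide_right_mono)
    show ?thesis
      unfolding G_def unit_weight_sym[of _ a b] sym
      by (cases "j < m") (simp_all only: if_True if_False scale u w[unfolded sym] simp_thms)
  qed
  have "M k (G 0 (\<lambda>_. 0)) = (\<Sum>\<phi>\<in>{..<2 * m} \<rightarrow>\<^sub>E {..<k}. (\<Prod>j<m. \<beta> j (\<phi> (2 * j), \<phi> (2 * j + 1))) * M k (G m \<phi>))"
    if "m \<le> n" for m
    using that
  proof (induction m)
    case 0
    \<comment> \<open>For \<open>m = 0\<close> no slot reads \<open>\<phi>\<close>, and the only
      extensional map on the empty set is constantly \<open>undefined\<close>.\<close>
    have "G 0 (\<lambda>_. 0) = G 0 (\<lambda>_. undefined)" by (simp add: G_def fun_eq_iff)
    then show ?case by simp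
  next
    case (Suc m)
    then have m: "m < n" by simp
    have step: "M k (G m \<phi>) = (\<Sum>a<k. \<Sum>b<k. \<beta> m (a, b) * M k (G (Suc m) (\<phi>(2 * m := a, Suc (2 * m) := b))))" for \<phi>
    proof -
      have "M k (G m \<phi>) = M k ((G m \<phi>)(m := \<lambda>c. s * (\<Sum>x\<in>{..<k} \<times> {..<k}. \<beta> m x * unit_weight x c)))"
        by (intro M_cong k) (auto simp: sum_unit_weight G_def)
      also have "\<dots> = (\<Sum>x\<in>{..<k} \<times> {..<k}. \<beta> m x * M k ((G m \<phi>)(m := \<lambda>c. s * unit_weight x c)))"
        using Gb \<beta>[OF m] by (intro M_slot_expand k m) auto
      also have "\<dots> = (\<Sum>a<k. \<Sum>b<k. \<beta> m (a, b) * M k ((G m \<phi>)(m := \<lambda>c. s * unit_weight (a, b) c)))"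
        by (simp add: sum.cartesian_product)
      also have "\<dots> = (\<Sum>a<k. \<Sum>b<k. \<beta> m (a, b) * M k (G (Suc m) (\<phi>(2 * m := a, Suc (2 * m) := b))))"
      proof (intro sum.cong refl arg_cong2[where f="(*)"] arg_cong[where f="M k"])
        fix a b
        show "(G m \<phi>)(m := \<lambda>c. s * unit_weight (a, b) c) = G (Suc m) (\<phi>(2 * m := a, Suc (2 * m) := b))"
          by (auto simp: G_def fun_eq_iff less_Suc_eq)
      qed
      finally show ?thesis .
    qed
    have ins: "{..<2 * Suc m} = insert (Suc (2 * m)) (insert (2 * m) {..<2 * m})" by auto
    have "(\<Sum>\<phi>\<in>{..<2 * Suc m} \<rightarrow>\<^sub>E {..<k}. (\<Prod>j<Suc m. \<beta> j (\<phi> (2 * j), \<phi> (2 * j + 1))) * M k (G (Suc m) \<phi>))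
      = (\<Sum>\<phi>\<in>{..<2 * m} \<rightarrow>\<^sub>E {..<k}. \<Sum>a<k. \<Sum>b<k. (\<Prod>j<Suc m. \<beta> j ((\<phi>(2 * m := a, Suc (2 * m) := b)) (2 * j),
           (\<phi>(2 * m := a, Suc (2 * m) := b)) (2 * j + 1))) * M k (G (Suc m) (\<phi>(2 * m := a, Suc (2 * m) := b))))"
      unfolding ins by (subst sum_PiE_insert, simp, subst sum_PiE_insert, simp, rule refl)
    also have "\<dots> = (\<Sum>\<phi>\<in>{..<2 * m} \<rightarrow>\<^sub>E {..<k}. (\<Prod>j<m. \<beta> j (\<phi> (2 * j), \<phi> (2 * j + 1))) * M k (G m \<phi>))"
    proof (intro sum.cong refl)
      fix \<phi>
      have "(\<Prod>j<Suc m. \<beta> j ((\<phi>(2 * m := a, Suc (2 * m) := b)) (2 * j), (\<phi>(2 * m := a, Suc (2 * m) := b)) (2 * j + 1)))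
          = (\<Prod>j<m. \<beta> j (\<phi> (2 * j), \<phi> (2 * j + 1))) * \<beta> m (a, b)" for a b
      proof -
        have "(\<Prod>j<m. \<beta> j ((\<phi>(2 * m := a, Suc (2 * m) := b)) (2 * j), (\<phi>(2 * m := a, Suc (2 * m) := b)) (2 * j + 1)))
            = (\<Prod>j<m. \<beta> j (\<phi> (2 * j), \<phi> (2 * j + 1)))"
          by (intro prod.cong refl arg_cong2[where f=\<beta>] arg_cong2[where f=Pair]) auto
        then show ?thesis by simp
      qed
      then show "(\<Sum>a<k. \<Sum>b<k. (\<Prod>j<Suc m. \<beta> j ((\<phi>(2 * m := a, Suc (2 * m) := b)) (2 * j),
           (\<phi>(2 * m := a, Suc (2 * m) := b)) (2 * j + 1))) * M k (G (Suc m) (\<phi>(2 * m := a, Suc (2 * m) := b))))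
          = (\<Prod>j<m. \<beta> j (\<phi> (2 * j), \<phi> (2 * j + 1))) * M k (G m \<phi>)"
        unfolding step sum_distrib_left by (intro sum.cong refl) (simp only: mult.assoc)
    qed
    finally show ?case using Suc by simp
  qed
  from this[of n] have "M k (G 0 (\<lambda>_. 0)) = (\<Sum>\<phi>\<in>{..<2 * n} \<rightarrow>\<^sub>E {..<k}. (\<Prod>j<n. \<beta> j (\<phi> (2 * j), \<phi> (2 * j + 1))) * M k (G n \<phi>))"
    by simp
  moreover have "M k (G n \<phi>) = coeff k \<phi>" for \<phi>
    unfolding coeff_def by (intro M_cong k) (simp add: G_def)
  moreover have "G 0 (\<lambda>_. 0) = (\<lambda>j c. s * sym_weight (\<beta> j) c)" by (simp add: G_def fun_eq_iff)
  ultimately show ?thesis by simp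
qed

lemma M_refine:
  assumes "k \<ge> 1" "m \<ge> 1"
  shows "M (k * m) (\<lambda>j (a, b). \<gamma> j (a div m, b div m)) = M k \<gamma>"
proof -
  have "(\<lambda>c. 0 + (\<Sum>i\<in>S. (\<lambda>(a, b). \<gamma> i (a div m, b div m)) c))
      = (\<lambda>(a, b). (\<lambda>c. 0 + (\<Sum>i\<in>S. \<gamma> i c)) (a div m, b div m))" for S :: "nat set"
    by (auto simp: fun_eq_iff)
  then have "step (k * m) (\<lambda>c. 0 + (\<Sum>i\<in>S. (\<lambda>(a, b). \<gamma> i (a div m, b div m)) c))
      = step k (\<lambda>c. 0 + (\<Sum>i\<in>S. \<gamma> i c))" for S :: "nat set"
    using step_refine[OF assms, of "\<lambda>c. 0 + (\<Sum>i\<in>S. \<gamma> i c)"] by (simp only:)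
  then show ?thesis
    unfolding M_def mixed_diff_def by (simp only:)
qed

end

text \<open>The two maps differ by a bijection between their ranges; the complements of the ranges
  in \<open>{..<k}\<close> have equal size, so it extends to a permutation.\<close>

lemma permutation_extending_labellings:
  assumes P: "finite P" and \<phi>: "\<phi> \<in> P \<rightarrow>\<^sub>E {..<k}" and \<psi>: "\<psi> \<in> P \<rightarrow>\<^sub>E {..<k}"
    and fin: "finer P \<phi> \<psi>" "finer P \<psi> \<phi>"
  obtains \<pi> :: "nat \<Rightarrow> nat" where "\<pi> permutes {..<k}" "\<And>i. i \<in> P \<Longrightarrow> \<psi> i = \<pi> (\<phi> i)"
proof -
  define f where "f v = \<psi> (inv_into P \<phi> v)" for v
  have f: "f (\<phi> i) = \<psi> i" if "i \<in> P" for i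
    using finer_factor[OF fin(1) that] by (simp add: f_def)
  have "inj_on f (\<phi> ` P)"
  proof (rule inj_onI)
    fix u v assume "u \<in> \<phi> ` P" "v \<in> \<phi> ` P" and eq: "f u = f v"
    then obtain i j where ij: "i \<in> P" "j \<in> P" "u = \<phi> i" "v = \<phi> j" by blast
    then have "\<psi> i = \<psi> j" using eq f by simp
    then show "u = v" using fin(2) ij unfolding finer_def by blast
  qed
  moreover have "f ` (\<phi> ` P) = \<psi> ` P" using f by (auto simp: image_image)
  ultimately have bf: "bij_betw f (\<phi> ` P) (\<psi> ` P)" by (simp add: bij_betw_def)
  have sub: "\<phi> ` P \<subseteq> {..<k}" "\<psi> ` P \<subseteq> {..<k}" using \<phi> \<psi> by auto
  have "card ({..<k} - \<phi> ` P) = card ({..<k} - \<psi> ` P)"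
    using bij_betw_same_card[OF bf] P sub by (simp add: card_Diff_subset)
  then obtain g where bg: "bij_betw g ({..<k} - \<phi> ` P) ({..<k} - \<psi> ` P)"
    using finite_same_card_bij[of "{..<k} - \<phi> ` P" "{..<k} - \<psi> ` P"] by auto
  define h where "h x = (if x \<in> \<phi> ` P then f x else if x \<in> {..<k} then g x else x)" for x
  have "bij_betw h (\<phi> ` P \<union> ({..<k} - \<phi> ` P)) (\<psi> ` P \<union> ({..<k} - \<psi> ` P))"
  proof (rule bij_betw_combine)
    show "bij_betw h (\<phi> ` P) (\<psi> ` P)"
      using bf by (subst bij_betw_cong[of _ h f]) (auto simp: h_def)
    show "bij_betw h ({..<k} - \<phi> ` P) ({..<k} - \<psi> ` P)"
      using bg by (subst bij_betw_cong[of _ h g]) (auto simp: h_def)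
  qed auto
  then have "bij_betw h {..<k} {..<k}"
    using sub by (simp add: Un_absorb1)
  then have "h permutes {..<k}"
    using sub by (intro bij_imp_permutes) (auto simp: h_def)
  moreover have "\<psi> i = h (\<phi> i)" if "i \<in> P" for i
    using f that by (simp add: h_def)
  ultimately show ?thesis using that by blast
qed

lemma all_less_double: "(\<forall>i<2 * n. A i) \<longleftrightarrow> (\<forall>j<n. A (2 * j) \<and> A (2 * j + 1))" for n :: nat
proof (intro iffI allI impI)
  fix i assume A: "\<forall>j<n. A (2 * j) \<and> A (2 * j + 1)" and i: "i < 2 * n"
  then have "A (2 * (i div 2)) \<and> A (2 * (i div 2) + 1)" by auto
  then show "A i" by (cases "even i") auto
qed auto

lemma prod_of_bool: "finite I \<Longrightarrow> (\<Prod>j\<in>I. of_bool (A j)) = (of_bool (\<forall>j\<in>I. A j) :: real)"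
  by (induction I rule: finite_induct) auto

text \<open>Maps \<open>\<phi>\<close> that factor through \<open>p\<close> correspond to maps
  \<open>y\<close> on the values of \<open>p\<close>. Together with
  \<open>multi_density_step\<close> this identifies class weights as the coefficients of a
  density.\<close>

lemma sum_class_weight:
  assumes P: "finite P"
  shows "(\<Sum>\<phi>\<in>P \<rightarrow>\<^sub>E {..<k}. h \<phi> * class_weight P p k \<phi>)
      = (1 / real k) ^ card (p ` P) * (\<Sum>y\<in>p ` P \<rightarrow>\<^sub>E {..<k}. h (restrict (\<lambda>i. y (p i)) P))"
proof -
  let ?g = "inv_into P p"
  have "(\<Sum>\<phi>\<in>P \<rightarrow>\<^sub>E {..<k}. h \<phi> * class_weight P p k \<phi>)
      = (\<Sum>\<phi>\<in>{\<phi>\<in>P \<rightarrow>\<^sub>E {..<k}. finer P p \<phi>}. (1 / real k) ^ card (p ` P) * h \<phi>)"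
    using P by (intro sum.mono_neutral_cong_right) (auto simp: class_weight_def finite_PiE)
  also have "\<dots> = (1 / real k) ^ card (p ` P) * (\<Sum>\<phi>\<in>{\<phi>\<in>P \<rightarrow>\<^sub>E {..<k}. finer P p \<phi>}. h \<phi>)"
    by (simp add: sum_distrib_left)
  also have "(\<Sum>\<phi>\<in>{\<phi>\<in>P \<rightarrow>\<^sub>E {..<k}. finer P p \<phi>}. h \<phi>)
      = (\<Sum>y\<in>p ` P \<rightarrow>\<^sub>E {..<k}. h (restrict (\<lambda>i. y (p i)) P))"
  proof (rule sum.reindex_bij_witness[where j="\<lambda>\<phi>. restrict (\<lambda>v. \<phi> (?g v)) (p ` P)"
        and i="\<lambda>y. restrict (\<lambda>i. y (p i)) P"])
    fix \<phi> assume \<phi>: "\<phi> \<in> {\<phi>\<in>P \<rightarrow>\<^sub>E {..<k}. finer P p \<phi>}"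
    have *: "\<phi> (?g (p i)) = \<phi> i" if "i \<in> P" for i
      using finer_factor[of P p \<phi> i] \<phi> that by simp
    have eq: "restrict (\<lambda>i. restrict (\<lambda>v. \<phi> (?g v)) (p ` P) (p i)) P = \<phi>"
      using \<phi> * by (auto simp: fun_eq_iff PiE_iff extensional_def)
    show "restrict (\<lambda>i. restrict (\<lambda>v. \<phi> (?g v)) (p ` P) (p i)) P = \<phi>" by (rule eq)
    show "restrict (\<lambda>v. \<phi> (?g v)) (p ` P) \<in> p ` P \<rightarrow>\<^sub>E {..<k}"
      using \<phi> * by auto
    show "h (restrict (\<lambda>i. restrict (\<lambda>v. \<phi> (?g v)) (p ` P) (p i)) P) = h \<phi>" by (simp only: eq)
  next
    fix y assume y: "y \<in> p ` P \<rightarrow>\<^sub>E {..<k}"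
    show "restrict (\<lambda>v. restrict (\<lambda>i. y (p i)) P (?g v)) (p ` P) = y"
    proof
      fix v
      show "restrict (\<lambda>v. restrict (\<lambda>i. y (p i)) P (?g v)) (p ` P) v = y v"
      proof (cases "v \<in> p ` P")
        case True
        then show ?thesis by (simp add: inv_into_into f_inv_into_f)
      next
        case False
        then show ?thesis using PiE_arb[OF y, of v] by simp
      qed
    qed
    show "restrict (\<lambda>i. y (p i)) P \<in> {\<phi>\<in>P \<rightarrow>\<^sub>E {..<k}. finer P p \<phi>}"
      using y by (auto simp: finer_def PiE_iff)
  qed
  finally show ?thesis .
qed

definition edge_pairs :: "nat \<Rightarrow> (nat \<times> nat) set" where
  "edge_pairs n = (\<lambda>j. (2 * j, 2 * j + 1)) ` {..<n}"

definition loopless_maps :: "nat \<Rightarrow> (nat \<Rightarrow> nat) set" where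
  "loopless_maps n = loopless {..<2 * n} (edge_pairs n)"

lemma loopless_maps_iff: "p \<in> loopless_maps n \<longleftrightarrow> p \<in> {..<2 * n} \<rightarrow>\<^sub>E {..<2 * n} \<and> edge_loopless n p"
  by (auto simp: loopless_maps_def loopless_def edge_pairs_def)

lemma finite_loopless_maps [simp]: "finite (loopless_maps n)"
proof (rule finite_subset)
  show "loopless_maps n \<subseteq> {..<2 * n} \<rightarrow>\<^sub>E {..<2 * n}" using loopless_maps_iff by blast
qed (simp add: finite_PiE)

context polynomial_functional
begin

section \<open>The coefficients of the leading form as a coefficient family\<close>

lemma unit_weight_directions: "(\<lambda>j c. s * unit_weight (x j) c) \<in> directions n k"
proof (rule directions_bounded)
  fix i a b
  have "0 \<le> unit_weight (x i) (a, b)" "unit_weight (x i) (a, b) \<le> 1"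
    by (auto simp: unit_weight_def)
  then show "0 \<le> s * unit_weight (x i) (a, b) \<and> s * unit_weight (x i) (a, b) \<le> s \<and>
      s * unit_weight (x i) (a, b) = s * unit_weight (x i) (b, a)"
    using unit_weight_sym[of "x i" a b] by (simp add: divide_right_mono)
qed

lemma M_permute:
  assumes k: "k \<ge> 1" and \<pi>: "\<pi> permutes {..<k}" and \<gamma>: "\<gamma> \<in> directions n k"
  shows "M k (\<lambda>j (a, b). \<gamma> j (\<pi> a, \<pi> b)) = M k \<gamma>"
  unfolding M_def mixed_diff_def
proof (intro sum.cong refl arg_cong2[where f="(*)"])
  fix S assume S: "S \<in> Pow {..<n}"
  have w: "(\<lambda>c. 0 + (\<Sum>i\<in>S. \<gamma> i c)) \<in> weights k"
    using \<gamma> S weights_sum_subset[of "{..<n}" \<gamma> k S] by (simp add: directions_def)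
  have "(\<lambda>c. 0 + (\<Sum>i\<in>S. (\<lambda>(a, b). \<gamma> i (\<pi> a, \<pi> b)) c)) = (\<lambda>(a, b). (\<lambda>c. 0 + (\<Sum>i\<in>S. \<gamma> i c)) (\<pi> a, \<pi> b))"
    by (auto simp: fun_eq_iff)
  then show "F (step k (\<lambda>c. 0 + (\<Sum>i\<in>S. (\<lambda>(a, b). \<gamma> i (\<pi> a, \<pi> b)) c))) = F (step k (\<lambda>c. 0 + (\<Sum>i\<in>S. \<gamma> i c)))"
    using perm_inv[unfolded permutation_invariant_def, rule_format, OF k \<pi> w] by (simp only:)
qed

text \<open>A permutation of the steps that carries \<open>\<phi>\<close> to \<open>\<psi>\<close>
  moves the matrix units accordingly and leaves \<open>M\<close> unchanged.\<close>

lemma coeff_cong: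
  assumes k: "k \<ge> 1" and \<phi>: "\<phi> \<in> {..<2 * n} \<rightarrow>\<^sub>E {..<k}" and \<psi>: "\<psi> \<in> {..<2 * n} \<rightarrow>\<^sub>E {..<k}"
    and fin: "finer {..<2 * n} \<phi> \<psi>" "finer {..<2 * n} \<psi> \<phi>"
  shows "coeff k \<phi> = coeff k \<psi>"
proof -
  obtain \<pi> where \<pi>: "\<pi> permutes {..<k}" "\<And>i. i \<in> {..<2 * n} \<Longrightarrow> \<psi> i = \<pi> (\<phi> i)"
    using permutation_extending_labellings[OF _ \<phi> \<psi> fin] by blast
  have inj: "\<pi> x = \<pi> y \<longleftrightarrow> x = y" for x y
    using permutes_inj[OF \<pi>(1)] by (simp add: inj_eq)
  have "coeff k \<psi> = M k (\<lambda>j (a, b). s * unit_weight (\<psi> (2 * j), \<psi> (2 * j + 1)) (\<pi> a, \<pi> b))"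
    unfolding coeff_def by (rule M_permute[OF k \<pi>(1) unit_weight_directions, symmetric])
  also have "\<dots> = coeff k \<phi>"
    unfolding coeff_def
  proof (rule M_cong[OF k])
    fix i a b assume "i < n"
    then have "\<psi> (2 * i) = \<pi> (\<phi> (2 * i))" "\<psi> (2 * i + 1) = \<pi> (\<phi> (2 * i + 1))"
      using \<pi>(2) by auto
    then show "(case (a, b) of (a, b) \<Rightarrow> s * unit_weight (\<psi> (2 * i), \<psi> (2 * i + 1)) (\<pi> a, \<pi> b))
        = s * unit_weight (\<phi> (2 * i), \<phi> (2 * i + 1)) (a, b)"
      by (simp only: prod.case unit_weight_def swap_simp prod.inject inj)
  qed
  finally show ?thesis by simp
qed

text \<open>This is \<open>M_expand\<close> for 0-1 matrices: the product of the entries at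
  \<open>\<phi>'\<close> is the indicator of the lifts that satisfy \<open>A\<close> at every edge.
  Sums of coefficients thereby become values of \<open>M\<close>, to which refinement and continuity
  apply.\<close>

lemma sum_coeff_lifts_where:
  assumes k: "k \<ge> 1" and m: "m \<ge> 1"
  shows "(\<Sum>\<phi>'\<in>{\<phi>'\<in>lifts {..<2 * n} k m \<phi>. \<forall>j<n. A j (\<phi>' (2 * j), \<phi>' (2 * j + 1))}. coeff (k * m) \<phi>')
    = M (k * m) (\<lambda>j c. s * sym_weight (\<lambda>(a, b). of_bool (a div m = \<phi> (2 * j) \<and> b div m = \<phi> (2 * j + 1) \<and> A j (a, b))) c)"
proof -
  let ?\<beta> = "\<lambda>j (a, b). of_bool (a div m = \<phi> (2 * j) \<and> b div m = \<phi> (2 * j + 1) \<and> A j (a, b)) :: real"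
  have km: "k * m \<ge> 1" using k m by simp
  have "M (k * m) (\<lambda>j c. s * sym_weight (?\<beta> j) c)
     = (\<Sum>\<phi>'\<in>{..<2 * n} \<rightarrow>\<^sub>E {..<k * m}. (\<Prod>j<n. ?\<beta> j (\<phi>' (2 * j), \<phi>' (2 * j + 1))) * coeff (k * m) \<phi>')"
    by (rule M_expand[OF km]) auto
  also have "\<dots> = (\<Sum>\<phi>'\<in>{..<2 * n} \<rightarrow>\<^sub>E {..<k * m}.
      of_bool (\<phi>' \<in> lifts {..<2 * n} k m \<phi> \<and> (\<forall>j<n. A j (\<phi>' (2 * j), \<phi>' (2 * j + 1)))) * coeff (k * m) \<phi>')"
  proof (intro sum.cong refl arg_cong2[where f="(*)"])
    fix \<phi>' assume \<phi>': "\<phi>' \<in> {..<2 * n} \<rightarrow>\<^sub>E {..<k * m}"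
    have "\<phi>' \<in> lifts {..<2 * n} k m \<phi> \<longleftrightarrow> (\<forall>i<2 * n. \<phi>' i div m = \<phi> i)"
      using \<phi>' by (auto simp: lifts_def)
    also have "\<dots> \<longleftrightarrow> (\<forall>j<n. \<phi>' (2 * j) div m = \<phi> (2 * j) \<and> \<phi>' (2 * j + 1) div m = \<phi> (2 * j + 1))"
      by (rule all_less_double)
    finally have eq: "\<phi>' \<in> lifts {..<2 * n} k m \<phi> \<and> (\<forall>j<n. A j (\<phi>' (2 * j), \<phi>' (2 * j + 1))) \<longleftrightarrow>
        (\<forall>j\<in>{..<n}. \<phi>' (2 * j) div m = \<phi> (2 * j) \<and> \<phi>' (2 * j + 1) div m = \<phi> (2 * j + 1)
          \<and> A j (\<phi>' (2 * j), \<phi>' (2 * j + 1)))" by auto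
    show "(\<Prod>j<n. ?\<beta> j (\<phi>' (2 * j), \<phi>' (2 * j + 1)))
        = of_bool (\<phi>' \<in> lifts {..<2 * n} k m \<phi> \<and> (\<forall>j<n. A j (\<phi>' (2 * j), \<phi>' (2 * j + 1))))"
      unfolding eq prod.case by (rule prod_of_bool) simp
  qed
  also have "\<dots> = (\<Sum>\<phi>'\<in>{\<phi>'\<in>lifts {..<2 * n} k m \<phi>. \<forall>j<n. A j (\<phi>' (2 * j), \<phi>' (2 * j + 1))}. coeff (k * m) \<phi>')"
    by (rule sum.mono_neutral_cong_right) (auto simp: finite_PiE lifts_def)
  finally show ?thesis by simp
qed

text \<open>The symmetrised block indicator on the fine grid is the matrix unit of the coarse grid,
  and \<open>M\<close> depends only on the step functions that its arguments represent.\<close>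

lemma coeff_lifts:
  assumes k: "k \<ge> 1" and m: "m \<ge> 1"
  shows "(\<Sum>\<phi>'\<in>lifts {..<2 * n} k m \<phi>. coeff (k * m) \<phi>') = coeff k \<phi>"
proof -
  have "(\<Sum>\<phi>'\<in>lifts {..<2 * n} k m \<phi>. coeff (k * m) \<phi>')
    = M (k * m) (\<lambda>j c. s * sym_weight (\<lambda>(a, b). of_bool (a div m = \<phi> (2 * j) \<and> b div m = \<phi> (2 * j + 1) \<and> True)) c)"
    using sum_coeff_lifts_where[OF k m, of \<phi> "\<lambda>_ _. True"] by simp
  also have "\<dots> = M (k * m) (\<lambda>j (a, b). (\<lambda>j c. s * unit_weight (\<phi> (2 * j), \<phi> (2 * j + 1)) c) j (a div m, b div m))"
    using k m by (intro M_cong) (auto simp: sym_weight_def unit_weight_def)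
  also have "\<dots> = coeff k \<phi>"
    unfolding coeff_def by (rule M_refine[OF k m])
  finally show ?thesis .
qed

text \<open>Keeping a loop merged confines slot \<open>j0\<close> to diagonal cells of one block.
  Their step function has \<open>L\<^sup>1\<close> norm at most \<open>1 / (k * Suc m)\<close>, so
  by continuity \<open>M\<close> tends to its value with a zero slot, which is 0.\<close>

lemma coeff_merged:
  assumes k: "k \<ge> 1" and \<phi>: "\<phi> \<in> {..<2 * n} \<rightarrow>\<^sub>E {..<k}" and j0: "j0 < n" "\<phi> (2 * j0) = \<phi> (2 * j0 + 1)"
  shows "(\<lambda>m. \<Sum>\<phi>'\<in>{\<phi>'\<in>lifts {..<2 * n} k (Suc m) \<phi>. \<phi>' (2 * j0) = \<phi>' (2 * j0 + 1)}. coeff (k * Suc m) \<phi>') \<longlonglongrightarrow> 0"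
proof -
  let ?I = "{..<n} - {j0}"
  let ?g = "\<lambda>j c. s * unit_weight (\<phi> (2 * j), \<phi> (2 * j + 1)) c"
  let ?g' = "\<lambda>m j (a, b). ?g j (a div Suc m, b div Suc m)"
  define d where "d m = (\<lambda>(a, b). s * of_bool (a = b \<and> a div Suc m = \<phi> (2 * j0)))" for m
  have km: "k * Suc m \<ge> 1" for m using k by simp
  have eq: "(\<Sum>\<phi>'\<in>{\<phi>'\<in>lifts {..<2 * n} k (Suc m) \<phi>. \<phi>' (2 * j0) = \<phi>' (2 * j0 + 1)}. coeff (k * Suc m) \<phi>')
      = M (k * Suc m) ((?g' m)(j0 := d m))" for m
  proof -
    let ?A = "\<lambda>j (a :: nat, b). j = j0 \<longrightarrow> a = b"
    have "{\<phi>'\<in>lifts {..<2 * n} k (Suc m) \<phi>. \<phi>' (2 * j0) = \<phi>' (2 * j0 + 1)}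
        = {\<phi>'\<in>lifts {..<2 * n} k (Suc m) \<phi>. \<forall>j<n. ?A j (\<phi>' (2 * j), \<phi>' (2 * j + 1))}"
      using j0 by auto
    then have "(\<Sum>\<phi>'\<in>{\<phi>'\<in>lifts {..<2 * n} k (Suc m) \<phi>. \<phi>' (2 * j0) = \<phi>' (2 * j0 + 1)}. coeff (k * Suc m) \<phi>')
      = M (k * Suc m) (\<lambda>j c. s * sym_weight (\<lambda>(a, b). of_bool (a div Suc m = \<phi> (2 * j) \<and>
           b div Suc m = \<phi> (2 * j + 1) \<and> ?A j (a, b))) c)"
      using sum_coeff_lifts_where[OF k, of "Suc m" \<phi> ?A] by (simp only: le_add1 Suc_eq_plus1_left)
    also have "\<dots> = M (k * Suc m) ((?g' m)(j0 := d m))"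
    proof (rule M_cong[OF km])
      fix i a b
      show "s * sym_weight (\<lambda>(a, b). of_bool (a div Suc m = \<phi> (2 * i) \<and> b div Suc m = \<phi> (2 * i + 1) \<and> ?A i (a, b))) (a, b)
          = ((?g' m)(j0 := d m)) i (a, b)"
      proof (cases "i = j0")
        case True
        have *: "(of_bool P + of_bool Q) / 2 = (of_bool R :: real)" if "P \<longleftrightarrow> R" "Q \<longleftrightarrow> R" for P Q R
          using that by simp
        show ?thesis
          unfolding True fun_upd_same d_def sym_weight_def prod.case swap_simp j0(2)
          by (intro arg_cong2[where f="(*)"] refl *) auto
      next
        case False
        then have "((?g' m)(j0 := d m)) i = ?g' m i" by (rule fun_upd_other)
        then show ?thesis
          using False by (simp only: sym_weight_def unit_weight_def prod.case swap_simp prod.inject simp_thms) (simp add: conj_commute)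
      qed
    qed
    finally show ?thesis .
  qed
  have gd: "?g \<in> directions n k" by (rule unit_weight_directions)
  have gm: "(?g' m)(j0 := d m) \<in> directions n (k * Suc m)" for m
  proof (rule directions_bounded)
    fix i a b
    have u: "0 \<le> unit_weight x c" "unit_weight x c \<le> 1" for x c
      by (auto simp: unit_weight_def)
    show "0 \<le> ((?g' m)(j0 := d m)) i (a, b) \<and> ((?g' m)(j0 := d m)) i (a, b) \<le> s \<and>
        ((?g' m)(j0 := d m)) i (a, b) = ((?g' m)(j0 := d m)) i (b, a)"
    proof (cases "i = j0")
      case True
      have "d m (a, b) = d m (b, a)" unfolding d_def prod.case by (intro arg_cong2[where f="(*)"] refl arg_cong[where f=of_bool]) auto
      moreover have "0 \<le> d m (a, b) \<and> d m (a, b) \<le> s" by (simp add: d_def)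
      ultimately show ?thesis unfolding True fun_upd_same by blast
    next
      case False
      then have "((?g' m)(j0 := d m)) i = ?g' m i" by (rule fun_upd_other)
      moreover have "0 \<le> s * unit_weight x c \<and> s * unit_weight x c \<le> s" for x c
        using u[of x c] by (simp add: divide_right_mono)
      ultimately show ?thesis
        using unit_weight_sym by (simp only: prod.case) 
    qed
  qed
  \<comment> \<open>The directions in the other slots are fixed step functions of the coarse grid,
    written on finer grids; only the base point \<open>d m\<close> really varies.\<close>
  have lim: "(\<lambda>m. mixed_diff ?I (\<lambda>\<beta>. F (step (k * Suc m) \<beta>)) (?g' m) (d m)) \<longlonglongrightarrow> mixed_diff ?I (\<lambda>\<beta>. F (step k \<beta>)) ?g (\<lambda>_. 0)"
    unfolding mixed_diff_def
  proof (intro tendsto_sum tendsto_mult tendsto_const)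
    fix S assume S: "S \<in> Pow ?I"
    let ?q = "step k (\<lambda>c. 0 + (\<Sum>i\<in>S. ?g i c))"
    let ?h = "\<lambda>m. step (k * Suc m) (\<lambda>c. d m c + (\<Sum>i\<in>S. ?g' m i c))"
    have fS: "finite S" "j0 \<notin> S" using S finite_subset by auto
    have hw: "(\<lambda>c. d m c + (\<Sum>i\<in>S. ?g' m i c)) \<in> weights (k * Suc m)" for m
    proof -
      have "(\<lambda>c. \<Sum>i\<in>insert j0 S. ((?g' m)(j0 := d m)) i c) \<in> weights (k * Suc m)"
      proof (rule weights_sum_subset[where I="{..<n}"])
        show "(\<lambda>c. \<Sum>i<n. ((?g' m)(j0 := d m)) i c) \<in> weights (k * Suc m)"
          using gm[of m] unfolding directions_def by blast
        show "((?g' m)(j0 := d m)) i \<in> weights (k * Suc m)" if "i \<in> {..<n}" for i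
          using directionsD[OF gm] that by blast
        show "insert j0 S \<subseteq> {..<n}" using S j0(1) by blast
      qed simp
      moreover have "(\<Sum>i\<in>insert j0 S. ((?g' m)(j0 := d m)) i c) = d m c + (\<Sum>i\<in>S. ?g' m i c)" for c
      proof -
        have "(\<Sum>i\<in>S. ((?g' m)(j0 := d m)) i c) = (\<Sum>i\<in>S. ?g' m i c)"
          using fS by (intro sum.cong refl) auto
        then show ?thesis by (simp only: sum.insert[OF fS] fun_upd_same)
      qed
      ultimately show ?thesis by (simp only:)
    qed
    show "(\<lambda>m. F (?h m)) \<longlonglongrightarrow> F ?q"
    proof (rule graphon_continuous_tendsto[OF L1_cont])
      have "(\<lambda>c. \<Sum>i\<in>S. ?g i c) \<in> weights k"
      proof (rule weights_sum_subset[where I="{..<n}"])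
        show "(\<lambda>c. \<Sum>i<n. ?g i c) \<in> weights k" using gd unfolding directions_def by blast
        show "?g i \<in> weights k" if "i \<in> {..<n}" for i using directionsD[OF gd] that by blast
        show "S \<subseteq> {..<n}" using S by blast
      qed simp
      then show "?q \<in> graphons" unfolding add_0 by (rule step_graphons[OF k])
      show "?h m \<in> graphons" for m using step_graphons[OF km hw] .
      have q: "?q = step (k * Suc m) (\<lambda>c. \<Sum>i\<in>S. ?g' m i c)" for m
      proof -
        have "(\<lambda>c. \<Sum>i\<in>S. ?g' m i c) = (\<lambda>(a, b). (\<lambda>c. 0 + (\<Sum>i\<in>S. ?g i c)) (a div Suc m, b div Suc m))"
          by (auto simp: fun_eq_iff)
        then show ?thesis
          using step_refine[OF k, of "Suc m" "\<lambda>c. 0 + (\<Sum>i\<in>S. ?g i c)"] by (simp only: le_add1 Suc_eq_plus1_left)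
      qed
      have diff: "(\<lambda>p. ?h m p - ?q p) = step (k * Suc m) (d m)" for m
        unfolding q[of m] by (auto simp: step_def fun_eq_iff)
      have "L1_norm (step (k * Suc m) (d m)) \<le> inverse (real (Suc m))" for m
      proof -
        let ?K = "k * Suc m"
        have "(\<Sum>c\<in>{..<?K} \<times> {..<?K}. \<bar>d m c\<bar>) \<le> (\<Sum>c\<in>{..<?K} \<times> {..<?K}. of_bool (fst c = snd c))"
          by (rule sum_mono) (auto simp: d_def)
        also have "\<dots> = (\<Sum>a<?K. \<Sum>b<?K. of_bool (a = b))"
          unfolding sum.cartesian_product case_prod_unfold ..
        also have "\<dots> = (\<Sum>a<?K. 1)"
          by (intro sum.cong refl) (simp add: of_bool_def)
        also have "\<dots> = real ?K" by simp
        finally have "L1_norm (step ?K (d m)) \<le> real ?K / (real ?K)\<^sup>2"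
          unfolding L1_norm_step[OF km] by (intro divide_right_mono) auto
        also have "\<dots> = 1 / real ?K" using km[of m] by (simp add: power2_eq_square)
        also have "\<dots> \<le> 1 / real (Suc m)"
        proof (rule divide_left_mono)
          show "real (Suc m) \<le> real ?K"
            using mult_le_mono1[OF k, of "Suc m"] by (intro of_nat_mono) simp
        qed (use km[of m] in \<open>auto intro!: mult_pos_pos simp del: of_nat_mult mult_Suc_right\<close>)
        finally show ?thesis by (simp add: inverse_eq_divide)
      qed
      then show "(\<lambda>m. L1_norm (\<lambda>p. ?h m p - ?q p)) \<longlonglongrightarrow> 0"
        unfolding diff using L1_norm_nonneg
        by (intro tendsto_sandwich[OF _ _ tendsto_const LIMSEQ_inverse_real_of_nat] always_eventually allI) auto
    qed
  qed
  have "M (k * Suc m) ((?g' m)(j0 := d m)) = mixed_diff ?I (\<lambda>\<beta>. F (step (k * Suc m) \<beta>)) (?g' m) (d m)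
      - mixed_diff ?I (\<lambda>\<beta>. F (step k \<beta>)) ?g (\<lambda>_. 0)" for m
  proof -
    have "step (k * Suc m) (\<lambda>c. 0 + (\<Sum>i\<in>S. ?g' m i c)) = step k (\<lambda>c. 0 + (\<Sum>i\<in>S. ?g i c))" for S
    proof -
      have "(\<lambda>c. 0 + (\<Sum>i\<in>S. ?g' m i c)) = (\<lambda>(a, b). (\<lambda>c. 0 + (\<Sum>i\<in>S. ?g i c)) (a div Suc m, b div Suc m))"
        by (auto simp: fun_eq_iff)
      then show ?thesis
        using step_refine[OF k, of "Suc m" "\<lambda>c. 0 + (\<Sum>i\<in>S. ?g i c)"] by (simp only: le_add1 Suc_eq_plus1_left)
    qed
    then have "mixed_diff ?I (\<lambda>\<beta>. F (step (k * Suc m) \<beta>)) (?g' m) (\<lambda>_. 0) = mixed_diff ?I (\<lambda>\<beta>. F (step k \<beta>)) ?g (\<lambda>_. 0)"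
      unfolding mixed_diff_def by (simp only:)
    then show ?thesis unfolding M_slot[OF j0(1)] by (simp only:)
  qed
  then show ?thesis
    unfolding eq using tendsto_diff[OF lim tendsto_const[of "mixed_diff ?I (\<lambda>\<beta>. F (step k \<beta>)) ?g (\<lambda>_. 0)"]]
    by (simp only: diff_self)
qed

lemma coeff_family: "coefficient_family {..<2 * n} (edge_pairs n) coeff"
proof
  fix k :: nat and \<phi> i j assume *: "k \<ge> 1" "\<phi> \<in> {..<2 * n} \<rightarrow>\<^sub>E {..<k}" "(i, j) \<in> edge_pairs n" "\<phi> i = \<phi> j"
  then obtain j0 where "j0 < n" "i = 2 * j0" "j = 2 * j0 + 1" by (auto simp: edge_pairs_def)
  then show "(\<lambda>m. \<Sum>\<phi>'\<in>{\<phi>'\<in>lifts {..<2 * n} k (Suc m) \<phi>. \<phi>' i = \<phi>' j}. coeff (k * Suc m) \<phi>') \<longlonglongrightarrow> 0"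
    using coeff_merged[OF *(1,2)] *(4) by simp
qed (rule coeff_cong coeff_lifts; assumption)+

text \<open>The multilinear expansion of \<open>M\<close>, with its coefficients written in class
  weights, is termwise the value of a polarised density on step functions.\<close>

lemma M_eq_densities:
  obtains a where "\<And>k \<gamma>. k \<ge> 1 \<Longrightarrow> (\<And>j. j < n \<Longrightarrow> \<gamma> j \<in> weights k) \<Longrightarrow>
    M k (\<lambda>j c. s * \<gamma> j c) = (\<Sum>p\<in>loopless_maps n. a p * multi_density n p (\<lambda>j. step k (\<gamma> j)))"
proof -
  have "edge_pairs n \<subseteq> {..<2 * n} \<times> {..<2 * n}" by (auto simp: edge_pairs_def)
  from coefficient_family_eq_class_weights[OF coeff_family this refl] obtain a where
    a: "\<And>k \<phi>. k \<ge> 1 \<Longrightarrow> \<phi> \<in> {..<2 * n} \<rightarrow>\<^sub>E {..<k} \<Longrightarrow>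
        coeff k \<phi> = (\<Sum>p\<in>loopless_maps n. a p * class_weight {..<2 * n} p k \<phi>)"
    unfolding loopless_maps_def by blast
  have "M k (\<lambda>j c. s * \<gamma> j c) = (\<Sum>p\<in>loopless_maps n. a p * multi_density n p (\<lambda>j. step k (\<gamma> j)))"
    if k: "k \<ge> 1" and \<gamma>: "\<And>j. j < n \<Longrightarrow> \<gamma> j \<in> weights k" for k \<gamma>
  proof -
    let ?h = "\<lambda>\<phi>. \<Prod>j<n. \<gamma> j (\<phi> (2 * j), \<phi> (2 * j + 1))"
    have "M k (\<lambda>j c. s * \<gamma> j c) = M k (\<lambda>j c. s * sym_weight (\<gamma> j) c)"
      using weightsD(3)[OF \<gamma>] by (intro M_cong k) (simp add: sym_weight_def)
    also have "\<dots> = (\<Sum>\<phi>\<in>{..<2 * n} \<rightarrow>\<^sub>E {..<k}. ?h \<phi> * coeff k \<phi>)"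
      using weightsD(1,2)[OF \<gamma>] by (intro M_expand k) auto
    also have "\<dots> = (\<Sum>\<phi>\<in>{..<2 * n} \<rightarrow>\<^sub>E {..<k}. \<Sum>p\<in>loopless_maps n. a p * (?h \<phi> * class_weight {..<2 * n} p k \<phi>))"
    proof (intro sum.cong refl)
      fix \<phi> assume \<phi>: "\<phi> \<in> {..<2 * n} \<rightarrow>\<^sub>E {..<k}"
      show "?h \<phi> * coeff k \<phi> = (\<Sum>p\<in>loopless_maps n. a p * (?h \<phi> * class_weight {..<2 * n} p k \<phi>))"
        unfolding a[OF k \<phi>] sum_distrib_left by (intro sum.cong refl) (rule mult.left_commute)
    qed
    also have "\<dots> = (\<Sum>p\<in>loopless_maps n. a p * (\<Sum>\<phi>\<in>{..<2 * n} \<rightarrow>\<^sub>E {..<k}. ?h \<phi> * class_weight {..<2 * n} p k \<phi>))"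
      by (subst sum.swap) (simp add: sum_distrib_left)
    also have "\<dots> = (\<Sum>p\<in>loopless_maps n. a p * multi_density n p (\<lambda>j. step k (\<gamma> j)))"
    proof (intro sum.cong refl arg_cong2[where f="(*)"])
      fix p :: "nat \<Rightarrow> nat"
      have "?h (restrict (\<lambda>i. y (p i)) {..<2 * n}) = (\<Prod>j<n. \<gamma> j (y (p (2 * j)), y (p (2 * j + 1))))" for y
        by (intro prod.cong refl) simp
      then show "(\<Sum>\<phi>\<in>{..<2 * n} \<rightarrow>\<^sub>E {..<k}. ?h \<phi> * class_weight {..<2 * n} p k \<phi>) = multi_density n p (\<lambda>j. step k (\<gamma> j))"
        unfolding multi_density_step[OF k] by (subst sum_class_weight) simp_all
    qed
    finally show ?thesis .
  qed
  then show ?thesis using that by blast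
qed

end

section \<open>Closure properties for the induction on the degree\<close>

lemma graphon_continuous_linear:
  assumes F: "graphon_continuous nrm F" and G: "graphon_continuous nrm G"
  shows "graphon_continuous nrm (\<lambda>f. a * F f + b * G f)"
  unfolding graphon_continuous_def
proof (intro ballI allI impI)
  fix f and e :: real assume f: "f \<in> graphons" and e: "e > 0"
  \<comment> \<open>The summand 1 avoids a division by 0 and makes the final inequality
    strict.\<close>
  define c where "c = e / (\<bar>a\<bar> + \<bar>b\<bar> + 1)"
  have c: "c > 0" using e by (simp add: c_def add_nonneg_pos)
  obtain d where d: "d > 0" "\<And>h. h \<in> graphons \<Longrightarrow> nrm (\<lambda>p. h p - f p) < d \<Longrightarrow> \<bar>F h - F f\<bar> < c"
    using F f c unfolding graphon_continuous_def by blast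
  obtain d' where d': "d' > 0" "\<And>h. h \<in> graphons \<Longrightarrow> nrm (\<lambda>p. h p - f p) < d' \<Longrightarrow> \<bar>G h - G f\<bar> < c"
    using G f c unfolding graphon_continuous_def by blast
  have "\<bar>(a * F h + b * G h) - (a * F f + b * G f)\<bar> < e"
    if h: "h \<in> graphons" "nrm (\<lambda>p. h p - f p) < min d d'" for h
  proof -
    have "\<bar>(a * F h + b * G h) - (a * F f + b * G f)\<bar> = \<bar>a * (F h - F f) + b * (G h - G f)\<bar>"
      by (simp add: algebra_simps)
    also have "\<dots> \<le> \<bar>a\<bar> * \<bar>F h - F f\<bar> + \<bar>b\<bar> * \<bar>G h - G f\<bar>"
      by (metis abs_mult abs_triangle_ineq)
    also have "\<dots> \<le> \<bar>a\<bar> * c + \<bar>b\<bar> * c"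
      using d(2)[OF h(1)] d'(2)[OF h(1)] h(2) by (intro add_mono mult_left_mono) auto
    also have "\<dots> < (\<bar>a\<bar> + \<bar>b\<bar> + 1) * c" using c by (simp add: algebra_simps)
    also have "\<dots> = e" using e by (simp add: c_def add_nonneg_pos)
    finally show ?thesis .
  qed
  then show "\<exists>\<delta>>0. \<forall>h\<in>graphons. nrm (\<lambda>p. h p - f p) < \<delta> \<longrightarrow> \<bar>(a * F h + b * G h) - (a * F f + b * G f)\<bar> < e"
    using d(1) d'(1) by (intro exI[of _ "min d d'"]) auto
qed

lemma graphon_continuous_const: "graphon_continuous nrm (\<lambda>_. a)"
  unfolding graphon_continuous_def by (auto intro: exI[of _ 1])

lemma graphon_continuous_sum:
  "(\<And>x. x \<in> X \<Longrightarrow> graphon_continuous nrm (G x)) \<Longrightarrow> graphon_continuous nrm (\<lambda>f. \<Sum>x\<in>X. a x * G x f)"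
proof (induction X rule: infinite_finite_induct)
  case (insert x X)
  then have "graphon_continuous nrm (\<lambda>f. a x * G x f + 1 * (\<Sum>x\<in>X. a x * G x f))"
    by (intro graphon_continuous_linear) auto
  then show ?case using insert by simp
qed (simp_all add: graphon_continuous_const)

lemma graphon_continuous_multi_density:
  assumes p: "edge_loopless n p"
  shows "graphon_continuous L1_norm (\<lambda>f. multi_density n p (\<lambda>_. f))"
  unfolding graphon_continuous_def
proof (intro ballI allI impI)
  fix f and e :: real assume f: "f \<in> graphons" and e: "e > 0"
  have "\<bar>multi_density n p (\<lambda>_. h) - multi_density n p (\<lambda>_. f)\<bar> < e"
    if h: "h \<in> graphons" "L1_norm (\<lambda>q. h q - f q) < e / (real n + 1)" for h
  proof -
    have "real n * L1_norm (\<lambda>q. h q - f q) \<le> real n * (e / (real n + 1))"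
      using h(2) by (intro mult_left_mono) auto
    also have "\<dots> < e" using e by (simp add: divide_less_eq algebra_simps)
    finally show ?thesis using multi_density_L1[OF p f h(1)] by linarith
  qed
  then show "\<exists>\<delta>>0. \<forall>h\<in>graphons. L1_norm (\<lambda>p. h p - f p) < \<delta> \<longrightarrow>
      \<bar>multi_density n p (\<lambda>_. h) - multi_density n p (\<lambda>_. f)\<bar> < e"
    using e by (intro exI[of _ "e / (real n + 1)"]) auto
qed

lemma multi_density_scale: "multi_density n p (\<lambda>j q. l * g j q) = l ^ n * multi_density n p g"
  unfolding multi_density_def by (simp add: prod.distrib)

lemma step_scale: "step k (\<lambda>c. l * \<beta> c) = (\<lambda>q. l * step k \<beta> q)"
  by (auto simp: step_def fun_eq_iff)

lemma multi_density_permute: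
  assumes k: "k \<ge> 1" and \<pi>: "\<pi> permutes {..<k}"
  shows "multi_density n p (\<lambda>j. step k (\<lambda>(a, b). \<beta> j (\<pi> a, \<pi> b))) = multi_density n p (\<lambda>j. step k (\<beta> j))"
proof -
  let ?V = "p ` {..<2 * n}"
  have V: "p (2 * j) \<in> ?V" "p (2 * j + 1) \<in> ?V" if "j \<in> {..<n}" for j using that by auto
  have im: "\<pi> x < k \<longleftrightarrow> x < k" "inv \<pi> x < k \<longleftrightarrow> x < k" for x
    using permutes_in_image[OF \<pi>] permutes_in_image[OF permutes_inv[OF \<pi>]] by simp_all
  have "(\<Sum>y\<in>?V \<rightarrow>\<^sub>E {..<k}. \<Prod>j<n. \<beta> j (\<pi> (y (p (2 * j))), \<pi> (y (p (2 * j + 1)))))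
      = (\<Sum>y\<in>?V \<rightarrow>\<^sub>E {..<k}. \<Prod>j<n. \<beta> j (y (p (2 * j)), y (p (2 * j + 1))))"
  proof (rule sum.reindex_bij_witness[where j="\<lambda>y. restrict (\<lambda>v. \<pi> (y v)) ?V"
        and i="\<lambda>y. restrict (\<lambda>v. inv \<pi> (y v)) ?V"])
    fix y assume y: "y \<in> ?V \<rightarrow>\<^sub>E {..<k}"
    show "restrict (\<lambda>v. inv \<pi> (restrict (\<lambda>v. \<pi> (y v)) ?V v)) ?V = y"
      using y permutes_inverses(2)[OF \<pi>] by (auto simp: fun_eq_iff PiE_iff extensional_def)
    show "restrict (\<lambda>v. \<pi> (restrict (\<lambda>v. inv \<pi> (y v)) ?V v)) ?V = y"
      using y permutes_inverses(1)[OF \<pi>] by (auto simp: fun_eq_iff PiE_iff extensional_def)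
    show "restrict (\<lambda>v. \<pi> (y v)) ?V \<in> ?V \<rightarrow>\<^sub>E {..<k}" "restrict (\<lambda>v. inv \<pi> (y v)) ?V \<in> ?V \<rightarrow>\<^sub>E {..<k}"
      using y im by (auto simp: PiE_iff)
    show "(\<Prod>j<n. \<beta> j (restrict (\<lambda>v. \<pi> (y v)) ?V (p (2 * j)), restrict (\<lambda>v. \<pi> (y v)) ?V (p (2 * j + 1))))
        = (\<Prod>j<n. \<beta> j (\<pi> (y (p (2 * j))), \<pi> (y (p (2 * j + 1)))))"
      by (intro prod.cong refl) (simp only: restrict_apply V if_True)
  qed
  then show ?thesis
    unfolding multi_density_step[OF k] prod.case by (simp only:)
qed

lemma mixed_diff_affine:
  "mixed_diff I (\<lambda>f. F f - c * G f) g f = mixed_diff I F g f - c * mixed_diff I G g f"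
  by (simp add: mixed_diff_def algebra_simps sum_subtractf sum_distrib_left)

lemma weights_kernels: "k \<ge> 1 \<Longrightarrow> \<beta> \<in> weights k \<Longrightarrow> step k \<beta> \<in> kernels"
  by (intro graphonsD(1) step_graphons)

text \<open>Induction on the order. \<open>M_eq_densities\<close> writes the leading form of
  \<open>F\<close> in densities of graphs with \<open>n\<close> edges; after subtraction of the
  matching multiple of these densities the leading form is 0, which means smaller order.\<close>

theorem vanishing_order_imp_density_combination:
  assumes "graphon_continuous L1_norm F" "permutation_invariant F" "vanishing_order n F"
  shows "\<exists>a. \<forall>k\<ge>1. \<forall>\<beta>\<in>weights k.
    F (step k \<beta>) = (\<Sum>m<n. \<Sum>p\<in>loopless_maps m. a m p * multi_density m p (\<lambda>_. step k \<beta>))"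
  using assms
proof (induction n arbitrary: F)
  case 0
  \<comment> \<open>The difference of order 0 is the value of \<open>F\<close> itself.\<close>
  have "F (step k \<beta>) = 0" if "k \<ge> 1" "\<beta> \<in> weights k" for k \<beta>
    using vanishing_orderD[OF 0(3) that, of "\<lambda>_ _. 0"] that(2) by simp
  then show ?case by auto
next
  case (Suc n)
  interpret polynomial_functional n F
    by (rule polynomial_functional.intro) (fact Suc.prems)+
  obtain a where a: "\<And>k \<gamma>. k \<ge> 1 \<Longrightarrow> (\<And>j. j < n \<Longrightarrow> \<gamma> j \<in> weights k) \<Longrightarrow>
    M k (\<lambda>j c. s * \<gamma> j c) = (\<Sum>p\<in>loopless_maps n. a p * multi_density n p (\<lambda>j. step k (\<gamma> j)))"
    by (rule M_eq_densities) (erule that)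
  define SS where "SS = {\<sigma> \<in> {..<n} \<rightarrow>\<^sub>E {..<n}. \<sigma> ` {..<n} = {..<n}}"
  have "finite SS" unfolding SS_def by (simp add: finite_PiE)
  moreover have "restrict id {..<n} \<in> SS" unfolding SS_def by auto
  ultimately have B: "card SS > 0" by (auto simp: card_gt_0_iff)
  define T where "T f = (\<Sum>p\<in>loopless_maps n. a p * multi_density n p (\<lambda>_. f))" for f
  \<comment> \<open>The difference of order \<open>n\<close> of \<open>T\<close> sums over the
    \<open>card SS\<close> bijections of the slots, each contributing \<open>M\<close> by symmetry;
    the factor \<open>s ^ n\<close> appears because \<open>M_eq_densities\<close> scales the
    directions on its left side only.\<close>
  define \<kappa> where "\<kappa> = 1 / (s ^ n * real (card SS))"
  define F' where "F' f = F f - \<kappa> * T f" for f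
  have s: "s > 0" "s \<in> {0..1}" by auto
  have loop: "edge_loopless n p" if "p \<in> loopless_maps n" for p
    using that by (simp add: loopless_maps_iff)
  have T_cont: "graphon_continuous L1_norm T"
    unfolding T_def using loop by (intro graphon_continuous_sum graphon_continuous_multi_density) auto
  have F'_cont: "graphon_continuous L1_norm F'"
    using graphon_continuous_linear[OF Suc.prems(1) T_cont, of 1 "- \<kappa>"] by (simp add: F'_def[abs_def])
  have F'_perm: "permutation_invariant F'"
    unfolding permutation_invariant_def
  proof (intro allI impI ballI)
    fix k :: nat and \<pi> \<beta> assume k: "1 \<le> k" and \<pi>: "\<pi> permutes {..<k}" and \<beta>: "\<beta> \<in> weights k"
    have "T (step k (\<lambda>(a, b). \<beta> (\<pi> a, \<pi> b))) = T (step k \<beta>)"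
      unfolding T_def using multi_density_permute[OF k \<pi>, of n _ "\<lambda>_. \<beta>"] by (simp only:)
    moreover have "F (step k (\<lambda>(a, b). \<beta> (\<pi> a, \<pi> b))) = F (step k \<beta>)"
      using Suc.prems(2)[unfolded permutation_invariant_def, rule_format, OF k \<pi> \<beta>] .
    ultimately show "F' (step k (\<lambda>(a, b). \<beta> (\<pi> a, \<pi> b))) = F' (step k \<beta>)"
      by (simp only: F'_def)
  qed
  have diff_F': "mixed_diff I (\<lambda>\<beta>. F' (step k \<beta>)) \<gamma> \<beta>
      = mixed_diff I (\<lambda>\<beta>. F (step k \<beta>)) \<gamma> \<beta>
        - \<kappa> * (\<Sum>p\<in>loopless_maps n. a p * mixed_diff I (\<lambda>f. multi_density n p (\<lambda>_. f)) (\<lambda>i. step k (\<gamma> i)) (step k \<beta>))"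
    for I :: "nat set" and k \<gamma> \<beta>
  proof -
    have "mixed_diff I (\<lambda>\<beta>. T (step k \<beta>)) \<gamma> \<beta>
        = (\<Sum>p\<in>loopless_maps n. a p * mixed_diff I (\<lambda>f. multi_density n p (\<lambda>_. f)) (\<lambda>i. step k (\<gamma> i)) (step k \<beta>))"
    proof -
      have "mixed_diff I (\<lambda>\<beta>. T (step k \<beta>)) \<gamma> \<beta> = mixed_diff I T (\<lambda>i. step k (\<gamma> i)) (step k \<beta>)"
        by (rule mixed_diff_step[symmetric])
      then show ?thesis unfolding T_def mixed_diff_linear .
    qed
    then show ?thesis unfolding F'_def mixed_diff_affine by simp
  qed
  have F'_van: "vanishing_order (Suc n) F'"
    unfolding vanishing_order_def
  proof (intro allI impI ballI)
    fix k :: nat and \<beta> \<gamma> assume k: "1 \<le> k" and \<beta>: "\<beta> \<in> weights k" and \<gamma>: "\<forall>i<Suc n. \<gamma> i \<in> weights k"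
      and w: "(\<lambda>c. \<beta> c + (\<Sum>i<Suc n. \<gamma> i c)) \<in> weights k"
    have "mixed_diff {..<Suc n} (\<lambda>f. multi_density n p (\<lambda>_. f)) (\<lambda>i. step k (\<gamma> i)) (step k \<beta>) = 0"
      if "p \<in> loopless_maps n" for p
      using \<gamma> \<beta> k by (intro mixed_diff_multi_density_eq_0[OF loop[OF that]] weights_kernels) auto
    then show "mixed_diff {..<Suc n} (\<lambda>\<beta>. F' (step k \<beta>)) \<gamma> \<beta> = 0"
      unfolding diff_F' vanishing_orderD[OF Suc.prems(3) k \<beta> \<gamma> w] by simp
  qed
  interpret P': polynomial_functional n F'
    by (rule polynomial_functional.intro) (fact F'_cont F'_perm F'_van)+
  have M'_zero: "P'.M k \<gamma> = 0" if k: "k \<ge> 1" and \<gamma>: "\<gamma> \<in> directions n k" for k \<gamma>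
  proof -
    have \<gamma>w: "\<gamma> j \<in> weights k" if "j < n" for j by (rule directionsD[OF \<gamma> that])
    have sum_p: "(\<Sum>p\<in>loopless_maps n. a p * mixed_diff {..<n} (\<lambda>f. multi_density n p (\<lambda>_. f))
        (\<lambda>i. step k (\<lambda>c. s * \<gamma> i c)) (step k (\<lambda>_. 0))) = s ^ n * real (card SS) * M k (\<lambda>i c. s * \<gamma> i c)"
    proof -
      have "(\<Sum>p\<in>loopless_maps n. a p * mixed_diff {..<n} (\<lambda>f. multi_density n p (\<lambda>_. f))
        (\<lambda>i. step k (\<lambda>c. s * \<gamma> i c)) (step k (\<lambda>_. 0)))
        = (\<Sum>p\<in>loopless_maps n. \<Sum>\<sigma>\<in>SS. s ^ n * (a p * multi_density n p (\<lambda>j. step k (\<gamma> (\<sigma> j)))))"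
      proof (intro sum.cong refl)
        fix p assume p: "p \<in> loopless_maps n"
        have "mixed_diff {..<n} (\<lambda>f. multi_density n p (\<lambda>_. f)) (\<lambda>i. step k (\<lambda>c. s * \<gamma> i c)) (step k (\<lambda>_. 0))
            = (\<Sum>\<sigma>\<in>SS. multi_density n p (\<lambda>j. step k (\<lambda>c. s * \<gamma> (\<sigma> j) c)))"
          unfolding SS_def
        proof (rule mixed_diff_multi_density[OF loop[OF p]])
          fix i assume "i \<in> {..<n}"
          then show "step k (\<lambda>c. s * \<gamma> i c) \<in> kernels"
            unfolding step_scale using \<gamma>w k by (intro kernels_scale weights_kernels) auto
        qed (use k in \<open>auto intro: weights_kernels\<close>)
        also have "\<dots> = (\<Sum>\<sigma>\<in>SS. s ^ n * multi_density n p (\<lambda>j. step k (\<gamma> (\<sigma> j))))"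
          unfolding step_scale multi_density_scale ..
        finally show "a p * mixed_diff {..<n} (\<lambda>f. multi_density n p (\<lambda>_. f)) (\<lambda>i. step k (\<lambda>c. s * \<gamma> i c)) (step k (\<lambda>_. 0))
            = (\<Sum>\<sigma>\<in>SS. s ^ n * (a p * multi_density n p (\<lambda>j. step k (\<gamma> (\<sigma> j)))))"
          by (simp only: sum_distrib_left mult.left_commute)
      qed
      also have "\<dots> = (\<Sum>\<sigma>\<in>SS. s ^ n * M k (\<lambda>i c. s * \<gamma> (\<sigma> i) c))"
      proof (subst sum.swap, intro sum.cong refl)
        fix \<sigma> assume "\<sigma> \<in> SS"
        then have "\<sigma> j < n" if "j < n" for j using that by (auto simp: SS_def)
        then have "M k (\<lambda>i c. s * \<gamma> (\<sigma> i) c) = (\<Sum>p\<in>loopless_maps n. a p * multi_density n p (\<lambda>j. step k (\<gamma> (\<sigma> j))))"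
          using \<gamma>w by (intro a[OF k, of "\<lambda>i. \<gamma> (\<sigma> i)"]) auto
        then show "(\<Sum>p\<in>loopless_maps n. s ^ n * (a p * multi_density n p (\<lambda>j. step k (\<gamma> (\<sigma> j)))))
            = s ^ n * M k (\<lambda>i c. s * \<gamma> (\<sigma> i) c)"
          by (simp only: sum_distrib_left)
      qed
      also have "\<dots> = (\<Sum>\<sigma>\<in>SS. s ^ n * M k (\<lambda>i c. s * \<gamma> i c))"
      proof (intro sum.cong refl arg_cong2[where f="(*)"])
        fix \<sigma> assume "\<sigma> \<in> SS"
        then have "bij_betw \<sigma> {..<n} {..<n}"
          by (auto simp: SS_def bij_betw_def intro!: eq_card_imp_inj_on)
        from mixed_diff_permute[OF this, of "\<lambda>\<beta>. F (step k \<beta>)" "\<lambda>i c. s * \<gamma> i c"]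
        show "M k (\<lambda>i c. s * \<gamma> (\<sigma> i) c) = M k (\<lambda>i c. s * \<gamma> i c)"
          unfolding M_def .
      qed
      finally show ?thesis by simp
    qed
    have "P'.M k (\<lambda>i c. s * \<gamma> i c) = M k (\<lambda>i c. s * \<gamma> i c) - \<kappa> * (s ^ n * real (card SS) * M k (\<lambda>i c. s * \<gamma> i c))"
      unfolding P'.M_def diff_F' sum_p M_def ..
    also have "\<dots> = 0" using B by (simp add: \<kappa>_def)
    finally have "s ^ n * P'.M k \<gamma> = 0"
      using P'.M_scale[OF k \<gamma> s(2)] by simp
    then show ?thesis by simp
  qed
  have "vanishing_order n F'"
    unfolding vanishing_order_def
  proof (intro allI impI ballI)
    fix k :: nat and \<beta> \<gamma> assume k: "1 \<le> k" and \<beta>: "\<beta> \<in> weights k" and \<gamma>: "\<forall>i<n. \<gamma> i \<in> weights k"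
      and w: "(\<lambda>c. \<beta> c + (\<Sum>i<n. \<gamma> i c)) \<in> weights k"
    let ?F = "\<lambda>\<beta>. F' (step k \<beta>)"
    \<comment> \<open>A base point other than 0 is reached by using \<open>\<beta>\<close> as an
      additional direction: the difference of order \<open>n + 1\<close> at 0 vanishes, and it
      equals the difference of order \<open>n\<close> at \<open>\<beta>\<close> minus that at
      0.\<close>
    let ?g = "\<gamma>(n := \<beta>)"
    have sum_eq: "(\<Sum>i<Suc n. ?g i c) = \<beta> c + (\<Sum>i<n. \<gamma> i c)" for c
    proof -
      have "(\<Sum>i<n. ?g i c) = (\<Sum>i<n. \<gamma> i c)" by (intro sum.cong) auto
      then show ?thesis by simp
    qed
    have "mixed_diff {..<Suc n} ?F ?g (\<lambda>_. 0) = 0"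
    proof (rule vanishing_orderD[OF F'_van k weights_zero])
      show "\<forall>i<Suc n. ?g i \<in> weights k" using \<beta> \<gamma> by auto
      show "(\<lambda>c. 0 + (\<Sum>i<Suc n. ?g i c)) \<in> weights k" unfolding sum_eq using w by simp
    qed
    moreover have "mixed_diff {..<Suc n} ?F ?g (\<lambda>_. 0)
        = mixed_diff {..<n} ?F ?g (\<lambda>c. 0 + ?g n c) - mixed_diff {..<n} ?F ?g (\<lambda>_. 0)"
      unfolding lessThan_Suc by (rule mixed_diff_insert) auto
    moreover have "mixed_diff {..<n} ?F ?g h = mixed_diff {..<n} ?F \<gamma> h" for h
      by (intro mixed_diff_cong) auto
    moreover have "mixed_diff {..<n} ?F \<gamma> (\<lambda>_. 0) = 0"
    proof -
      have "\<gamma> \<in> directions n k"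
        unfolding directions_def
      proof (intro CollectI conjI)
        show "(\<lambda>c. \<Sum>i<n. \<gamma> i c) \<in> weights k"
        proof (rule weights_le[OF w])
          fix a b assume ab: "a < k" "b < k"
          have "(\<Sum>i<n. \<gamma> i (a, b)) = (\<Sum>i<n. \<gamma> i (b, a))"
            using weightsD(3)[OF \<gamma>[rule_format] ab] by (intro sum.cong) auto
          moreover have "0 \<le> (\<Sum>i<n. \<gamma> i (a, b))"
            using weightsD(1)[OF \<gamma>[rule_format] ab] by (intro sum_nonneg) auto
          ultimately show "0 \<le> (\<Sum>i<n. \<gamma> i (a, b)) \<and> (\<Sum>i<n. \<gamma> i (a, b)) \<le> \<beta> (a, b) + (\<Sum>i<n. \<gamma> i (a, b))
              \<and> (\<Sum>i<n. \<gamma> i (a, b)) = (\<Sum>i<n. \<gamma> i (b, a))"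
            using weightsD(1)[OF \<beta> ab] by auto
        qed
      qed (rule \<gamma>)
      from M'_zero[OF k this] show ?thesis unfolding P'.M_def .
    qed
    ultimately show "mixed_diff {..<n} ?F \<gamma> \<beta> = 0" by simp
  qed
  from Suc.IH[OF F'_cont F'_perm this] obtain a' where a': "\<And>k \<beta>. k \<ge> 1 \<Longrightarrow> \<beta> \<in> weights k \<Longrightarrow>
    F' (step k \<beta>) = (\<Sum>m<n. \<Sum>p\<in>loopless_maps m. a' m p * multi_density m p (\<lambda>_. step k \<beta>))" by blast
  have "F (step k \<beta>) = (\<Sum>m<Suc n. \<Sum>p\<in>loopless_maps m. (if m = n then \<kappa> * a p else a' m p) * multi_density m p (\<lambda>_. step k \<beta>))"
    if "k \<ge> 1" "\<beta> \<in> weights k" for k \<beta>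
  proof -
    have "F (step k \<beta>) = F' (step k \<beta>) + \<kappa> * T (step k \<beta>)" by (simp add: F'_def)
    also have "F' (step k \<beta>) = (\<Sum>m<n. \<Sum>p\<in>loopless_maps m. (if m = n then \<kappa> * a p else a' m p) * multi_density m p (\<lambda>_. step k \<beta>))"
      unfolding a'[OF that] by (intro sum.cong refl) auto
    finally show ?thesis by (simp add: T_def sum_distrib_left mult.assoc)
  qed
  then show ?case by (intro exI[of _ "\<lambda>m p. if m = n then \<kappa> * a p else a' m p"]) auto
qed

section \<open>Isomorphism classes of multigraphs\<close>

lemma multigraph_isoI:
  "wf_multigraph H \<Longrightarrow> wf_multigraph K \<Longrightarrow> bij_betw \<phi> (verts H) (verts K) \<Longrightarrow>
    image_mset ((`) \<phi>) (edges H) = edges K \<Longrightarrow> (H, K) \<in> multigraph_iso"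
  unfolding multigraph_iso_def by blast

lemma multigraph_isoE:
  assumes "(H, K) \<in> multigraph_iso"
  obtains \<phi> where "wf_multigraph H" "wf_multigraph K" "bij_betw \<phi> (verts H) (verts K)"
    "image_mset ((`) \<phi>) (edges H) = edges K"
  using assms unfolding multigraph_iso_def by blast

lemma edge_subset: "wf_multigraph H \<Longrightarrow> e \<in># edges H \<Longrightarrow> e \<subseteq> verts H"
  by (simp add: wf_multigraph_def)

lemma multigraph_iso_refl: "wf_multigraph H \<Longrightarrow> (H, H) \<in> multigraph_iso"
  by (rule multigraph_isoI[where \<phi>=id]) auto

lemma multigraph_iso_sym:
  assumes "(H, K) \<in> multigraph_iso"
  shows "(K, H) \<in> multigraph_iso"
proof -
  obtain \<phi> where *: "wf_multigraph H" "wf_multigraph K" "bij_betw \<phi> (verts H) (verts K)"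
    "image_mset ((`) \<phi>) (edges H) = edges K" using assms by (rule multigraph_isoE)
  let ?g = "inv_into (verts H) \<phi>"
  have inj: "inj_on \<phi> (verts H)" using *(3) by (simp add: bij_betw_def)
  have "image_mset ((`) ?g) (edges K) = image_mset (\<lambda>e. ?g ` \<phi> ` e) (edges H)"
    by (simp add: *(4)[symmetric] image_mset.compositionality comp_def)
  also have "\<dots> = image_mset id (edges H)"
  proof (rule image_mset_cong)
    fix e assume "e \<in># edges H"
    then show "?g ` \<phi> ` e = id e"
      using inv_into_image_cancel[OF inj edge_subset[OF *(1)]] by simp
  qed
  finally show ?thesis
    using * by (intro multigraph_isoI[where \<phi>="?g"] bij_betw_inv_into) auto
qed

lemma multigraph_iso_trans:
  assumes "(G, H) \<in> multigraph_iso" "(H, K) \<in> multigraph_iso"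
  shows "(G, K) \<in> multigraph_iso"
proof -
  obtain \<phi> where 1: "wf_multigraph G" "bij_betw \<phi> (verts G) (verts H)"
    "image_mset ((`) \<phi>) (edges G) = edges H" using assms(1) by (rule multigraph_isoE)
  obtain \<psi> where 2: "wf_multigraph K" "bij_betw \<psi> (verts H) (verts K)"
    "image_mset ((`) \<psi>) (edges H) = edges K" using assms(2) by (rule multigraph_isoE)
  have "image_mset ((`) (\<psi> \<circ> \<phi>)) (edges G) = edges K"
    unfolding 2(3)[symmetric] 1(3)[symmetric] by (simp add: image_mset.compositionality comp_def image_image)
  then show ?thesis
    using 1 2 by (intro multigraph_isoI[where \<phi>="\<psi> \<circ> \<phi>"] bij_betw_trans) auto
qed

lemma multigraph_iso_size: "(H, K) \<in> multigraph_iso \<Longrightarrow> size (edges K) = size (edges H)"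
  by (erule multigraph_isoE) (metis size_image_mset)

lemma multigraph_iso_no_isolated:
  assumes "(H, K) \<in> multigraph_iso" "no_isolated_verts H"
  shows "no_isolated_verts K"
  unfolding no_isolated_verts_def
proof
  obtain \<phi> where *: "bij_betw \<phi> (verts H) (verts K)" "image_mset ((`) \<phi>) (edges H) = edges K"
    using assms(1) by (rule multigraph_isoE)
  fix w assume "w \<in> verts K"
  then obtain v where v: "v \<in> verts H" "w = \<phi> v" using *(1) by (auto simp: bij_betw_def)
  then obtain e where "e \<in># edges H" "v \<in> e" using assms(2) by (auto simp: no_isolated_verts_def)
  then have "\<phi> ` e \<in># edges K" "w \<in> \<phi> ` e" using v unfolding *(2)[symmetric] by auto
  then show "\<exists>e\<in>#edges K. w \<in> e" by blast
qed

section \<open>Edge lists as representatives of multigraphs\<close>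

lemma verts_graph_of [simp]: "verts (graph_of n p) = p ` {..<2 * n}"
  by (simp add: graph_of_def)

lemma edges_graph_of: "edges (graph_of n p) = image_mset (\<lambda>j. {p (2 * j), p (2 * j + 1)}) (mset_set {..<n})"
  by (simp add: graph_of_def)

lemma size_edges_graph_of [simp]: "size (edges (graph_of n p)) = n"
  by (simp add: edges_graph_of)

lemma graph_of_wf:
  assumes "edge_loopless n p"
  shows "wf_multigraph (graph_of n p)" "no_isolated_verts (graph_of n p)"
proof -
  show "wf_multigraph (graph_of n p)"
    unfolding wf_multigraph_def edges_graph_of verts_graph_of
    using assms endpoint_in[of _ n p] by (auto simp: card_2_iff)
  have "\<exists>j<n. p i \<in> {p (2 * j), p (2 * j + 1)}" if "i < 2 * n" for i
  proof (intro exI[of _ "i div 2"] conjI)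
    show "i div 2 < n" using that by auto
    show "p i \<in> {p (2 * (i div 2)), p (2 * (i div 2) + 1)}" by (cases "even i") auto
  qed
  then show "no_isolated_verts (graph_of n p)"
    unfolding no_isolated_verts_def edges_graph_of verts_graph_of by fastforce
qed

text \<open>An enumeration of the edges with chosen endpoints is a suitable list; it recovers the
  vertex set because no vertex is isolated.\<close>

lemma graph_of_surj:
  assumes H: "wf_multigraph H" "no_isolated_verts H"
  shows "\<exists>p. edge_loopless (size (edges H)) p \<and> graph_of (size (edges H)) p = H"
proof -
  let ?n = "size (edges H)"
  obtain es where es: "mset es = edges H" using ex_mset by blast
  then have len: "length es = ?n" by (metis size_mset)
  have nth: "es ! j \<in># edges H" if "j < ?n" for j
  proof -
    have "es ! j \<in> set es" using that len by simp
    then show ?thesis using es by (metis set_mset_mset)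
  qed
  have "\<exists>u v. u \<noteq> v \<and> e = {u, v}" if "e \<in># edges H" for e
    using H(1) that unfolding wf_multigraph_def by (metis card_2_iff)
  then obtain f g where fg: "\<And>e. e \<in># edges H \<Longrightarrow> f e \<noteq> g e \<and> e = {f e, g e}" by metis
  define p where "p i = (if even i then f (es ! (i div 2)) else g (es ! (i div 2)))" for i
  have e: "{p (2 * j), p (2 * j + 1)} = es ! j" and ne: "p (2 * j) \<noteq> p (2 * j + 1)" if "j < ?n" for j
    using fg[OF nth[OF that]] by (simp_all add: p_def)
  have upt: "mset_set {..<?n} = mset [0..<length es]"
    unfolding len by (simp add: atLeast0LessThan)
  have "edges (graph_of ?n p) = image_mset (\<lambda>j. es ! j) (mset_set {..<?n})"
    unfolding edges_graph_of using e by (intro image_mset_cong) auto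
  also have "\<dots> = mset (map (\<lambda>j. es ! j) [0..<length es])"
    unfolding upt by simp
  also have "\<dots> = edges H" by (simp only: map_nth es)
  finally have edges: "edges (graph_of ?n p) = edges H" .
  have loop: "edge_loopless ?n p" using ne by simp
  have "verts (graph_of ?n p) = verts H"
  proof (intro equalityI subsetI)
    fix v assume "v \<in> verts (graph_of ?n p)"
    then show "v \<in> verts H"
      using graph_of_wf(2)[OF loop] edge_subset[OF H(1)] unfolding no_isolated_verts_def edges by blast
  next
    fix v assume "v \<in> verts H"
    then show "v \<in> verts (graph_of ?n p)"
      using H(2) edge_subset[OF graph_of_wf(1)[OF loop]] unfolding no_isolated_verts_def edges by blast
  qed
  then show ?thesis using edges loop by (metis multigraph.expand)
qed

lemma graph_of_iso:
  assumes "edge_loopless n p" "edge_loopless n q"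
    and \<phi>: "bij_betw \<phi> (p ` {..<2 * n}) (q ` {..<2 * n})" and \<sigma>: "bij_betw \<sigma> {..<n} {..<n}"
    and e: "\<And>j. j < n \<Longrightarrow> \<phi> ` {p (2 * j), p (2 * j + 1)} = {q (2 * \<sigma> j), q (2 * \<sigma> j + 1)}"
  shows "(graph_of n p, graph_of n q) \<in> multigraph_iso"
proof (rule multigraph_isoI[where \<phi>=\<phi>])
  have "image_mset ((`) \<phi>) (edges (graph_of n p)) = image_mset (\<lambda>j. {q (2 * \<sigma> j), q (2 * \<sigma> j + 1)}) (mset_set {..<n})"
    unfolding edges_graph_of image_mset.compositionality comp_def
    by (intro image_mset_cong e) simp
  also have "\<dots> = image_mset (\<lambda>j. {q (2 * j), q (2 * j + 1)}) (image_mset \<sigma> (mset_set {..<n}))"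
    by (simp add: image_mset.compositionality comp_def)
  also have "image_mset \<sigma> (mset_set {..<n}) = mset_set {..<n}"
    using \<sigma> by (simp add: bij_betw_def image_mset_mset_set)
  finally show "image_mset ((`) \<phi>) (edges (graph_of n p)) = edges (graph_of n q)"
    by (simp only: edges_graph_of)
qed (use graph_of_wf assms in auto)

text \<open>Sending \<open>p i\<close> to \<open>q i\<close> is well defined by one refinement and
  injective by the other, and it keeps every edge in its place of the list.\<close>

lemma graph_of_finer_iso:
  assumes "edge_loopless n p" and pq: "finer {..<2 * n} p q" "finer {..<2 * n} q p"
  shows "edge_loopless n q" "(graph_of n p, graph_of n q) \<in> multigraph_iso"
proof -
  let ?P = "{..<2 * n}"
  define \<phi> where "\<phi> v = q (inv_into ?P p v)" for v
  have \<phi>: "\<phi> (p i) = q i" if "i \<in> ?P" for i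
    using finer_factor[OF pq(1) that] by (simp add: \<phi>_def)
  have inj: "inj_on \<phi> (p ` ?P)"
  proof (rule inj_onI)
    fix u v assume "u \<in> p ` ?P" "v \<in> p ` ?P" "\<phi> u = \<phi> v"
    then obtain i j where ij: "i \<in> ?P" "j \<in> ?P" "u = p i" "v = p j" "q i = q j" using \<phi> by auto
    then show "u = v" using pq(2) unfolding finer_def by blast
  qed
  have im: "\<phi> ` p ` ?P = q ` ?P" unfolding image_image by (rule image_cong[OF refl \<phi>])
  show loop: "edge_loopless n q"
  proof (intro allI impI notI)
    fix j assume j: "j < n" "q (2 * j) = q (2 * j + 1)"
    then have "p (2 * j) = p (2 * j + 1)" using pq(2) unfolding finer_def by auto
    then show False using assms(1) j(1) by blast
  qed
  show "(graph_of n p, graph_of n q) \<in> multigraph_iso"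
    using inj im \<phi> by (intro graph_of_iso[OF assms(1) loop, of \<phi> id]) (auto simp: bij_betw_def)
qed

lemma class_rep_in:
  assumes "C \<in> multigraph_classes n"
  shows "class_rep C \<in> C" "wf_multigraph (class_rep C)" "no_isolated_verts (class_rep C)"
    "size (edges (class_rep C)) = n" "C = multigraph_iso `` {class_rep C}"
proof -
  obtain H where H: "wf_multigraph H" "no_isolated_verts H" "size (edges H) = n" "C = multigraph_iso `` {H}"
    using assms unfolding multigraph_classes_def by (auto elim: quotientE)
  have "H \<in> C" using multigraph_iso_refl[OF H(1)] H(4) by simp
  then show rep: "class_rep C \<in> C" unfolding class_rep_def by (rule someI)
  then have iso: "(H, class_rep C) \<in> multigraph_iso" using H(4) by simp
  then show "wf_multigraph (class_rep C)" by (rule multigraph_isoE)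
  show "no_isolated_verts (class_rep C)" by (rule multigraph_iso_no_isolated[OF iso H(2)])
  show "size (edges (class_rep C)) = n" using multigraph_iso_size[OF iso] H(3) by simp
  show "C = multigraph_iso `` {class_rep C}"
  proof -
    have "multigraph_iso `` {H} = multigraph_iso `` {class_rep C}"
      using multigraph_iso_trans[OF multigraph_iso_sym[OF iso]] multigraph_iso_trans[OF iso] by blast
    then show ?thesis using H(4) by simp
  qed
qed

lemma class_rep_graph_of:
  assumes "C \<in> multigraph_classes n"
  obtains p where "edge_loopless n p" "class_rep C = graph_of n p"
  using graph_of_surj[OF class_rep_in(2,3)[OF assms]] class_rep_in(4)[OF assms] by auto

lemma multigraph_class_eqI:
  assumes "C \<in> multigraph_classes n" "D \<in> multigraph_classes m" "(class_rep C, class_rep D) \<in> multigraph_iso"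
  shows "C = D"
proof -
  have "multigraph_iso `` {class_rep C} = multigraph_iso `` {class_rep D}"
    using assms(3) multigraph_iso_sym multigraph_iso_trans by blast
  then show ?thesis using class_rep_in(5)[OF assms(1)] class_rep_in(5)[OF assms(2)] by simp
qed

definition graph_class :: "nat \<Rightarrow> (nat \<Rightarrow> nat) \<Rightarrow> multigraph set" where
  "graph_class n p = multigraph_iso `` {graph_of n p}"

lemma graph_class_in: "edge_loopless n p \<Longrightarrow> graph_class n p \<in> multigraph_classes n"
  unfolding graph_class_def multigraph_classes_def by (rule quotientI) (simp add: graph_of_wf)

lemma class_rep_graph_class:
  assumes "edge_loopless n p"
  shows "(graph_of n p, class_rep (graph_class n p)) \<in> multigraph_iso"
  using class_rep_in(1)[OF graph_class_in[OF assms]] by (simp add: graph_class_def)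

text \<open>Each class contains the graph of a canonical labelling, and these labellings are maps of
  the \<open>2 * n\<close> half-edges to themselves.\<close>

lemma finite_multigraph_classes: "finite (multigraph_classes n)"
proof (rule finite_subset)
  show "multigraph_classes n \<subseteq> graph_class n ` loopless_maps n"
  proof
    fix C assume C: "C \<in> multigraph_classes n"
    obtain p where p: "edge_loopless n p" "class_rep C = graph_of n p" using class_rep_graph_of[OF C] .
    let ?q = "canonical_labelling {..<2 * n} p"
    note ref = finer_canonical_labelling[of "{..<2 * n}" p]
    note q = graph_of_finer_iso[OF p(1) ref]
    have "?q \<in> loopless_maps n" using canonical_labelling_PiE q(1) by (simp add: loopless_maps_iff)
    moreover have "C = graph_class n ?q"
    proof (rule multigraph_class_eqI[OF C graph_class_in[OF q(1)]])
      show "(class_rep C, class_rep (graph_class n ?q)) \<in> multigraph_iso"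
        unfolding p(2) by (rule multigraph_iso_trans[OF q(2) class_rep_graph_class[OF q(1)]])
    qed
    ultimately show "C \<in> graph_class n ` loopless_maps n" by blast
  qed
qed simp

lemma finite_multigraph_classes_le [simp]: "finite (multigraph_classes_le N)"
  unfolding multigraph_classes_le_def by (simp add: finite_multigraph_classes)

lemma multigraph_classes_leE:
  assumes "C \<in> multigraph_classes_le N"
  shows "C \<in> multigraph_classes (size (edges (class_rep C)))" "size (edges (class_rep C)) \<le> N"
proof -
  obtain n where n: "n \<le> N" "C \<in> multigraph_classes n" using assms by (auto simp: multigraph_classes_le_def)
  then show "C \<in> multigraph_classes (size (edges (class_rep C)))" "size (edges (class_rep C)) \<le> N"
    using class_rep_in(4)[OF n(2)] by auto
qed

lemma hom_density_step:
  assumes H: "wf_multigraph H" "no_isolated_verts H" and k: "k \<ge> 1" and \<beta>: "\<beta> \<in> weights k"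
  shows "hom_density H (step k \<beta>) = (1 / real k) ^ card (verts H) *
     (\<Sum>y\<in>verts H \<rightarrow>\<^sub>E {..<k}. \<Prod>e\<in>#edges H. \<beta> (y (Min e), y (Max e)))"
proof -
  obtain n p where p: "edge_loopless n p" "graph_of n p = H" using graph_of_surj[OF H] by blast
  have minmax: "\<beta> (y (Min {a, b}), y (Max {a, b})) = \<beta> (y a, y b)" if "y a < k" "y b < k"
    for y :: "nat \<Rightarrow> nat" and a b :: nat
    using weightsD(3)[OF \<beta> that] by (cases "a \<le> b") (auto simp: min_def max_def)
  have "hom_density H (step k \<beta>) = multi_density n p (\<lambda>_. step k \<beta>)"
    unfolding p(2)[symmetric] by (rule hom_density_graph_of[OF p(1) weights_kernels[OF k \<beta>]])
  also have "\<dots> = (1 / real k) ^ card (verts H) *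
     (\<Sum>y\<in>verts H \<rightarrow>\<^sub>E {..<k}. \<Prod>j<n. \<beta> (y (p (2 * j)), y (p (2 * j + 1))))"
    unfolding multi_density_step[OF k] p(2)[symmetric] verts_graph_of ..
  also have "(\<Sum>y\<in>verts H \<rightarrow>\<^sub>E {..<k}. \<Prod>j<n. \<beta> (y (p (2 * j)), y (p (2 * j + 1))))
      = (\<Sum>y\<in>verts H \<rightarrow>\<^sub>E {..<k}. \<Prod>e\<in>#edges H. \<beta> (y (Min e), y (Max e)))"
  proof (rule sum.cong[OF refl])
    fix y assume y: "y \<in> verts H \<rightarrow>\<^sub>E {..<k}"
    have "(\<Prod>e\<in>#edges H. \<beta> (y (Min e), y (Max e)))
       = (\<Prod>j<n. \<beta> (y (Min {p (2 * j), p (2 * j + 1)}), y (Max {p (2 * j), p (2 * j + 1)})))"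
      unfolding p(2)[symmetric] edges_graph_of image_mset.compositionality comp_def prod_unfold_prod_mset ..
    also have "\<dots> = (\<Prod>j<n. \<beta> (y (p (2 * j)), y (p (2 * j + 1))))"
    proof (intro prod.cong refl minmax)
      fix j assume "j \<in> {..<n}"
      then show "y (p (2 * j)) < k" "y (p (2 * j + 1)) < k"
        using y endpoint_in[of j n p] unfolding p(2)[symmetric] verts_graph_of by auto
    qed
    finally show "(\<Prod>j<n. \<beta> (y (p (2 * j)), y (p (2 * j + 1)))) = (\<Prod>e\<in>#edges H. \<beta> (y (Min e), y (Max e)))" ..
  qed
  finally show ?thesis .
qed

text \<open>On step graphons isomorphism invariance is the reindexing of a finite sum over vertex
  maps. Identities obtained there extend to all graphons by density and continuity.\<close>

lemma hom_density_step_iso: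
  assumes iso: "(H, K) \<in> multigraph_iso" and H: "no_isolated_verts H" and k: "k \<ge> 1" and \<beta>: "\<beta> \<in> weights k"
  shows "hom_density H (step k \<beta>) = hom_density K (step k \<beta>)"
proof -
  obtain \<phi> where \<phi>: "wf_multigraph H" "wf_multigraph K" "bij_betw \<phi> (verts H) (verts K)"
    "image_mset ((`) \<phi>) (edges H) = edges K" using iso by (rule multigraph_isoE)
  have inj: "inj_on \<phi> (verts H)" and im: "\<phi> ` verts H = verts K" using \<phi>(3) by (auto simp: bij_betw_def)
  let ?g = "inv_into (verts H) \<phi>"
  have fin: "finite e" if "e \<in># edges H" for e
    using \<phi>(1) that unfolding wf_multigraph_def by (metis card.infinite zero_neq_numeral)
  have "(\<Sum>y\<in>verts K \<rightarrow>\<^sub>E {..<k}. \<Prod>e\<in>#edges K. \<beta> (y (Min e), y (Max e)))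
      = (\<Sum>y\<in>verts H \<rightarrow>\<^sub>E {..<k}. \<Prod>e\<in>#edges H. \<beta> (y (Min e), y (Max e)))"
  proof (rule sum.reindex_bij_witness[where j="\<lambda>y. restrict (\<lambda>v. y (\<phi> v)) (verts H)"
        and i="\<lambda>y. restrict (\<lambda>w. y (?g w)) (verts K)"])
    fix y assume y: "y \<in> verts K \<rightarrow>\<^sub>E {..<k}"
    show "restrict (\<lambda>w. restrict (\<lambda>v. y (\<phi> v)) (verts H) (?g w)) (verts K) = y"
    proof
      fix w
      show "restrict (\<lambda>w. restrict (\<lambda>v. y (\<phi> v)) (verts H) (?g w)) (verts K) w = y w"
        using PiE_arb[OF y, of w] im by (cases "w \<in> verts K") (auto simp: inv_into_into f_inv_into_f)
    qed
    show "restrict (\<lambda>v. y (\<phi> v)) (verts H) \<in> verts H \<rightarrow>\<^sub>E {..<k}" using y im by auto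
    have "(\<Prod>e\<in>#edges K. \<beta> (y (Min e), y (Max e))) = (\<Prod>e\<in>#edges H. \<beta> (y (Min (\<phi> ` e)), y (Max (\<phi> ` e))))"
      unfolding \<phi>(4)[symmetric] by (simp add: image_mset.compositionality comp_def)
    also have "\<dots> = (\<Prod>e\<in>#edges H. \<beta> (restrict (\<lambda>v. y (\<phi> v)) (verts H) (Min e), restrict (\<lambda>v. y (\<phi> v)) (verts H) (Max e)))"
    proof (intro arg_cong[where f=prod_mset] image_mset_cong)
      fix e assume e: "e \<in># edges H"
      obtain u v where uv: "e = {u, v}" using \<phi>(1) e unfolding wf_multigraph_def by (metis card_2_iff)
      have sub: "u \<in> verts H" "v \<in> verts H" using edge_subset[OF \<phi>(1) e] uv by auto
      have lt: "y (\<phi> u) < k" "y (\<phi> v) < k" using y im sub by auto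
      let ?r = "restrict (\<lambda>v. y (\<phi> v)) (verts H)"
      have mm: "\<beta> (z (Min {a, b}), z (Max {a, b})) = \<beta> (z a, z b)" if "z a < k" "z b < k"
        for z :: "nat \<Rightarrow> nat" and a b :: nat
        using weightsD(3)[OF \<beta> that] by (cases "a \<le> b") (auto simp: min_def max_def)
      have r: "?r u = y (\<phi> u)" "?r v = y (\<phi> v)" using sub by auto
      have "\<beta> (y (Min (\<phi> ` e)), y (Max (\<phi> ` e))) = \<beta> (y (\<phi> u), y (\<phi> v))"
        unfolding uv image_insert image_empty by (rule mm[of y "\<phi> u" "\<phi> v", OF lt])
      also have "\<dots> = \<beta> (?r (Min e), ?r (Max e))"
        unfolding r[symmetric] uv by (rule mm[of ?r u v, symmetric]) (simp_all only: r lt)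
      finally show "\<beta> (y (Min (\<phi> ` e)), y (Max (\<phi> ` e))) = \<beta> (?r (Min e), ?r (Max e))" .
    qed
    finally show "(\<Prod>e\<in>#edges H. \<beta> (restrict (\<lambda>v. y (\<phi> v)) (verts H) (Min e), restrict (\<lambda>v. y (\<phi> v)) (verts H) (Max e)))
        = (\<Prod>e\<in>#edges K. \<beta> (y (Min e), y (Max e)))" ..
  next
    fix y assume y: "y \<in> verts H \<rightarrow>\<^sub>E {..<k}"
    show "restrict (\<lambda>v. restrict (\<lambda>w. y (?g w)) (verts K) (\<phi> v)) (verts H) = y"
    proof
      fix v
      show "restrict (\<lambda>v. restrict (\<lambda>w. y (?g w)) (verts K) (\<phi> v)) (verts H) v = y v"
        using PiE_arb[OF y, of v] im inv_into_f_f[OF inj, of v] by (cases "v \<in> verts H") auto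
    qed
    show "restrict (\<lambda>w. y (?g w)) (verts K) \<in> verts K \<rightarrow>\<^sub>E {..<k}"
      using y im inv_into_into[of _ \<phi> "verts H"] by auto
  qed
  then show ?thesis
    using hom_density_step[OF \<phi>(1) H k \<beta>]
      hom_density_step[OF \<phi>(2) multigraph_iso_no_isolated[OF iso H] k \<beta>] bij_betw_same_card[OF \<phi>(3)]
    by simp
qed

lemma density_combination_by_classes:
  assumes k: "k \<ge> 1" and \<beta>: "\<beta> \<in> weights k"
  shows "(\<Sum>m<Suc N. \<Sum>p\<in>loopless_maps m. a m p * multi_density m p (\<lambda>_. step k \<beta>))
    = density_polynomial N (\<lambda>C. \<Sum>m<Suc N. \<Sum>p\<in>{p\<in>loopless_maps m. graph_class m p = C}. a m p) (step k \<beta>)"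
proof -
  let ?f = "step k \<beta>"
  have hd: "multi_density m p (\<lambda>_. ?f) = hom_density (class_rep (graph_class m p)) ?f"
    if "p \<in> loopless_maps m" for m p
  proof -
    have p: "edge_loopless m p" using that by (simp add: loopless_maps_iff)
    have "multi_density m p (\<lambda>_. ?f) = hom_density (graph_of m p) ?f"
      using hom_density_graph_of[OF p weights_kernels[OF k \<beta>]] ..
    also have "\<dots> = hom_density (class_rep (graph_class m p)) ?f"
      by (rule hom_density_step_iso[OF class_rep_graph_class[OF p] graph_of_wf(2)[OF p] k \<beta>])
    finally show ?thesis .
  qed
  have inner: "(\<Sum>p\<in>loopless_maps m. a m p * multi_density m p (\<lambda>_. ?f))
      = (\<Sum>C\<in>multigraph_classes_le N. (\<Sum>p\<in>{p\<in>loopless_maps m. graph_class m p = C}. a m p) * hom_density (class_rep C) ?f)"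
    if "m \<in> {..<Suc N}" for m
  proof -
    have "graph_class m ` loopless_maps m \<subseteq> multigraph_classes_le N"
      using graph_class_in that by (auto simp: multigraph_classes_le_def loopless_maps_iff less_Suc_eq_le)
    then have "(\<Sum>C\<in>multigraph_classes_le N. \<Sum>p\<in>{p\<in>loopless_maps m. graph_class m p = C}. a m p * multi_density m p (\<lambda>_. ?f))
        = (\<Sum>p\<in>loopless_maps m. a m p * multi_density m p (\<lambda>_. ?f))"
      by (intro sum.group) auto
    moreover have "(\<Sum>p\<in>{p\<in>loopless_maps m. graph_class m p = C}. a m p * multi_density m p (\<lambda>_. ?f))
        = (\<Sum>p\<in>{p\<in>loopless_maps m. graph_class m p = C}. a m p) * hom_density (class_rep C) ?f" for C
      unfolding sum_distrib_right using hd by (intro sum.cong refl) auto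
    ultimately show ?thesis by simp
  qed
  show ?thesis
    unfolding density_polynomial_def sum_distrib_right
    by (subst sum.swap) (intro sum.cong refl, simp only: inner sum_distrib_right)
qed

section \<open>Uniqueness of the coefficients\<close>

lemma image_endpoints: "f ` p ` {..<2 * n} = (\<Union>j<n. {f (p (2 * j)), f (p (2 * j + 1))})" for n :: nat
proof (intro equalityI subsetI)
  fix x assume "x \<in> f ` p ` {..<2 * n}"
  then obtain i where i: "i < 2 * n" "x = f (p i)" by auto
  then have "i div 2 < n" "x \<in> {f (p (2 * (i div 2))), f (p (2 * (i div 2) + 1))}"
    by (auto, cases "even i", auto)
  then show "x \<in> (\<Union>j<n. {f (p (2 * j)), f (p (2 * j + 1))})" by blast
qed auto

text \<open>\<open>y\<close> carries the edges of \<open>p\<close> bijectively to those of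
  \<open>q\<close>; as every vertex of \<open>q\<close> lies on an edge, it is onto the vertices. So
  \<open>q\<close> has at most as many vertices as \<open>p\<close>, and equality makes
  \<open>y\<close> injective, hence an isomorphism.\<close>

lemma homomorphism_iso:
  assumes p: "edge_loopless n p" and q: "edge_loopless n q" and \<sigma>: "\<sigma> ` {..<n} = {..<n}"
    and e: "\<And>j. j < n \<Longrightarrow> {y (p (2 * j)), y (p (2 * j + 1))} = {q (2 * \<sigma> j), q (2 * \<sigma> j + 1)}"
  shows "card (q ` {..<2 * n}) \<le> card (p ` {..<2 * n})"
    and "card (p ` {..<2 * n}) \<le> card (q ` {..<2 * n}) \<Longrightarrow> (graph_of n p, graph_of n q) \<in> multigraph_iso"
proof -
  have "y ` p ` {..<2 * n} = (\<Union>j<n. {q (2 * \<sigma> j), q (2 * \<sigma> j + 1)})"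
    unfolding image_endpoints using e by (intro SUP_cong) auto
  also have "\<dots> = (\<Union>j\<in>\<sigma> ` {..<n}. {q (2 * j), q (2 * j + 1)})" by simp
  also have "\<dots> = q ` {..<2 * n}"
    unfolding \<sigma> using image_endpoints[of "\<lambda>x. x" q n] by simp
  finally have im: "y ` p ` {..<2 * n} = q ` {..<2 * n}" .
  then show le: "card (q ` {..<2 * n}) \<le> card (p ` {..<2 * n})"
    by (metis card_image_le finite_imageI finite_lessThan)
  show "(graph_of n p, graph_of n q) \<in> multigraph_iso" if "card (p ` {..<2 * n}) \<le> card (q ` {..<2 * n})"
  proof (rule graph_of_iso[OF p q, of y \<sigma>])
    have "inj_on y (p ` {..<2 * n})"
      using le that im by (intro eq_card_imp_inj_on) auto
    then show "bij_betw y (p ` {..<2 * n}) (q ` {..<2 * n})" using im by (simp add: bij_betw_def)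
    show "bij_betw \<sigma> {..<n} {..<n}" using \<sigma> by (auto simp: bij_betw_def intro: eq_card_imp_inj_on)
  qed (use e in auto)
qed

definition surjections :: "nat \<Rightarrow> (nat \<Rightarrow> nat) set" where
  "surjections n = {\<sigma> \<in> {..<n} \<rightarrow>\<^sub>E {..<n}. \<sigma> ` {..<n} = {..<n}}"

lemma finite_surjections [simp]: "finite (surjections n)"
  unfolding surjections_def by (simp add: finite_PiE)

lemma id_surjections: "restrict id {..<n} \<in> surjections n"
  unfolding surjections_def by auto

lemma surjectionsD:
  assumes "\<sigma> \<in> surjections n"
  shows "\<sigma> ` {..<n} = {..<n}" "j < n \<Longrightarrow> \<sigma> j < n" "inj_on \<sigma> {..<n}"
  using assms by (auto simp: surjections_def intro!: eq_card_imp_inj_on)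

definition edge_weight :: "(nat \<Rightarrow> nat) \<Rightarrow> nat \<Rightarrow> nat \<times> nat \<Rightarrow> real" where
  "edge_weight q i = (\<lambda>(a, b). of_bool ({a, b} = {q (2 * i), q (2 * i + 1)}))"

lemma edge_weight_bounds:
  "0 \<le> edge_weight q i c" "edge_weight q i c \<le> 1" "edge_weight q i (a, b) = edge_weight q i (b, a)"
  "edge_weight q i (a, b) \<noteq> 0 \<longleftrightarrow> {a, b} = {q (2 * i), q (2 * i + 1)}"
  by (auto simp: edge_weight_def insert_commute split: prod.splits)

text \<open>The top difference of the density of \<open>p\<close> along the indicators of the edges
  of \<open>q\<close>, whose vertices are read as step indices. A nonzero summand stems from a
  vertex map that hits every edge of \<open>q\<close> exactly once.\<close>

definition hom_sum :: "nat \<Rightarrow> (nat \<Rightarrow> nat) \<Rightarrow> (nat \<Rightarrow> nat) \<Rightarrow> nat \<Rightarrow> real" where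
  "hom_sum n p q k = (\<Sum>\<sigma>\<in>surjections n. multi_density n p (\<lambda>j. step k (edge_weight q (\<sigma> j))))"

lemma hom_sum_nonzero:
  assumes p: "edge_loopless n p" and q: "edge_loopless n q" and k: "k \<ge> 1" and nz: "hom_sum n p q k \<noteq> 0"
  shows "card (q ` {..<2 * n}) \<le> card (p ` {..<2 * n})"
    and "card (p ` {..<2 * n}) \<le> card (q ` {..<2 * n}) \<Longrightarrow> (graph_of n p, graph_of n q) \<in> multigraph_iso"
proof -
  obtain \<sigma> where \<sigma>: "\<sigma> \<in> surjections n" "multi_density n p (\<lambda>j. step k (edge_weight q (\<sigma> j))) \<noteq> 0"
    using nz unfolding hom_sum_def by (metis (no_types, lifting) sum.neutral)
  then obtain y where y: "(\<Prod>j<n. edge_weight q (\<sigma> j) (y (p (2 * j)), y (p (2 * j + 1)))) \<noteq> 0"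
    unfolding multi_density_step[OF k] by (metis (no_types, lifting) sum.neutral mult_zero_right)
  have "{y (p (2 * j)), y (p (2 * j + 1))} = {q (2 * \<sigma> j), q (2 * \<sigma> j + 1)}" if "j < n" for j
  proof -
    have "edge_weight q (\<sigma> j) (y (p (2 * j)), y (p (2 * j + 1))) \<noteq> 0"
      using y that by (simp add: prod_zero_iff)
    then show ?thesis by (simp only: edge_weight_bounds)
  qed
  from homomorphism_iso[OF p q surjectionsD(1)[OF \<sigma>(1)] this]
  show "card (q ` {..<2 * n}) \<le> card (p ` {..<2 * n})"
    and "card (p ` {..<2 * n}) \<le> card (q ` {..<2 * n}) \<Longrightarrow> (graph_of n p, graph_of n q) \<in> multigraph_iso"
    by blast+
qed

text \<open>No term is negative, and the identity assignment together with the vertex map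
  \<open>h\<close> contributes a positive one.\<close>

lemma hom_sum_pos:
  assumes k: "k \<ge> 1" and h: "\<And>i. i < 2 * n \<Longrightarrow> h (p i) < k"
  shows "hom_sum n p (\<lambda>i. h (p i)) k > 0"
proof -
  let ?q = "\<lambda>i. h (p i)" and ?V = "p ` {..<2 * n}"
  have nonneg: "0 \<le> (\<Prod>j<n. edge_weight ?q (\<sigma> j) (y (p (2 * j)), y (p (2 * j + 1))))" for \<sigma> y
    by (intro prod_nonneg ballI edge_weight_bounds)
  let ?y = "restrict h ?V"
  have y: "?y \<in> ?V \<rightarrow>\<^sub>E {..<k}" using h by auto
  have "(\<Prod>j<n. edge_weight ?q (restrict id {..<n} j) (?y (p (2 * j)), ?y (p (2 * j + 1)))) = (\<Prod>j<n. 1)"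
  proof (rule prod.cong[OF refl])
    fix j assume j: "j \<in> {..<n}"
    then have "?y (p (2 * j)) = h (p (2 * j))" "?y (p (2 * j + 1)) = h (p (2 * j + 1))"
      using endpoint_in[of j n p] by auto
    then show "edge_weight ?q (restrict id {..<n} j) (?y (p (2 * j)), ?y (p (2 * j + 1))) = 1"
      using j by (simp add: edge_weight_def)
  qed
  also have "\<dots> > (0 :: real)" by simp
  finally have "0 < (\<Sum>y\<in>?V \<rightarrow>\<^sub>E {..<k}. \<Prod>j<n. edge_weight ?q (restrict id {..<n} j) (y (p (2 * j)), y (p (2 * j + 1))))"
    using y nonneg by (intro sum_pos2[where i="?y"]) (auto intro: finite_PiE)
  then have pos: "0 < multi_density n p (\<lambda>j. step k (edge_weight ?q (restrict id {..<n} j)))"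
    unfolding multi_density_step[OF k] using k by (intro mult_pos_pos) auto
  have nn: "0 \<le> multi_density n p (\<lambda>j. step k (edge_weight ?q (\<sigma> j)))" for \<sigma>
    unfolding multi_density_step[OF k] using nonneg by (intro mult_nonneg_nonneg sum_nonneg) auto
  show ?thesis
    unfolding hom_sum_def
    by (rule sum_pos2[where f="\<lambda>\<sigma>. multi_density n p (\<lambda>j. step k (edge_weight ?q (\<sigma> j)))",
          OF finite_surjections id_surjections pos nn])
qed

section \<open>Isomorphism classes represented by edge lists\<close>

definition class_edges :: "multigraph set \<Rightarrow> nat" where
  "class_edges C = size (edges (class_rep C))"

definition class_labelling :: "multigraph set \<Rightarrow> nat \<Rightarrow> nat" where
  "class_labelling C = (SOME p. edge_loopless (class_edges C) p \<and> class_rep C = graph_of (class_edges C) p)"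

definition class_order :: "multigraph set \<Rightarrow> nat" where
  "class_order C = card (class_labelling C ` {..<2 * class_edges C})"

lemma class_labelling:
  assumes "C \<in> multigraph_classes_le N"
  shows "edge_loopless (class_edges C) (class_labelling C)"
    and "class_rep C = graph_of (class_edges C) (class_labelling C)"
proof -
  have "\<exists>p. edge_loopless (class_edges C) p \<and> class_rep C = graph_of (class_edges C) p"
    using class_rep_graph_of[OF multigraph_classes_leE(1)[OF assms]] unfolding class_edges_def by metis
  from someI_ex[OF this]
  show "edge_loopless (class_edges C) (class_labelling C)"
    and "class_rep C = graph_of (class_edges C) (class_labelling C)"
    unfolding class_labelling_def by blast+
qed

lemma mixed_diff_hom_density_class:
  assumes C: "C \<in> multigraph_classes_le N" and I: "finite I" and f: "f \<in> kernels" and g: "\<And>i. i \<in> I \<Longrightarrow> g i \<in> kernels"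
  shows "mixed_diff I (hom_density (class_rep C)) g f
    = mixed_diff I (\<lambda>f. multi_density (class_edges C) (class_labelling C) (\<lambda>_. f)) g f"
proof (rule mixed_diff_cong[OF refl])
  fix S assume "S \<subseteq> I"
  then have "(\<lambda>p. f p + (\<Sum>i\<in>S. g i p)) \<in> kernels"
    using f g by (intro kernels_add kernels_sum) auto
  then show "hom_density (class_rep C) (\<lambda>p. f p + (\<Sum>i\<in>S. g i p))
      = multi_density (class_edges C) (class_labelling C) (\<lambda>_ p. f p + (\<Sum>i\<in>S. g i p))"
    using hom_density_graph_of[OF class_labelling(1)[OF C]] by (simp only: class_labelling(2)[OF C, symmetric])
qed

text \<open>Vertices are renumbered consecutively to serve as indices of
  \<open>Suc (class_order C)\<close> steps; \<open>Suc\<close> keeps this number positive for the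
  graph without edges.\<close>

lemma compressed_labelling:
  assumes C: "C \<in> multigraph_classes_le N"
  shows "\<exists>h. (\<forall>i<2 * class_edges C. h (class_labelling C i) < Suc (class_order C)) \<and>
    edge_loopless (class_edges C) (\<lambda>i. h (class_labelling C i)) \<and>
    (graph_of (class_edges C) (class_labelling C), graph_of (class_edges C) (\<lambda>i. h (class_labelling C i))) \<in> multigraph_iso \<and>
    card ((\<lambda>i. h (class_labelling C i)) ` {..<2 * class_edges C}) = class_order C \<and>
    inj_on h (class_labelling C ` {..<2 * class_edges C})"
proof -
  let ?n = "class_edges C" and ?p = "class_labelling C"
  let ?V = "?p ` {..<2 * ?n}"
  obtain h where h: "bij_betw h ?V {0..<card ?V}" using ex_bij_betw_finite_nat[of ?V] by auto
  then have inj: "inj_on h ?V" and im: "h ` ?V = {0..<card ?V}" by (auto simp: bij_betw_def)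
  have lt: "h (?p i) < Suc (class_order C)" if "i < 2 * ?n" for i
  proof -
    have "h (?p i) \<in> h ` ?V" using that by blast
    then show ?thesis unfolding im class_order_def by simp
  qed
  have fin: "finer {..<2 * ?n} ?p (\<lambda>i. h (?p i))" "finer {..<2 * ?n} (\<lambda>i. h (?p i)) ?p"
    unfolding finer_def using inj by (auto simp: inj_on_def)
  have "card ((\<lambda>i. h (?p i)) ` {..<2 * ?n}) = card (h ` ?V)" by (simp add: image_image)
  also have "\<dots> = class_order C" unfolding im class_order_def by simp
  finally show ?thesis
    using lt graph_of_finer_iso[OF class_labelling(1)[OF C] fin] inj by (intro exI[of _ h] conjI allI impI) auto
qed

lemma multigraph_class_eq_if_iso:
  assumes "C \<in> multigraph_classes_le N" "D \<in> multigraph_classes_le N"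
    and "(graph_of (class_edges C) (class_labelling C), G) \<in> multigraph_iso"
    and "(graph_of (class_edges D) (class_labelling D), G) \<in> multigraph_iso"
  shows "C = D"
  using multigraph_class_eqI[OF multigraph_classes_leE(1)[OF assms(1)] multigraph_classes_leE(1)[OF assms(2)]]
    multigraph_iso_trans[OF assms(3) multigraph_iso_sym[OF assms(4)]]
  by (simp only: class_labelling(2)[OF assms(1)] class_labelling(2)[OF assms(2)])

lemma edge_weight_kernels: "k \<ge> 1 \<Longrightarrow> step k (\<lambda>c. s * edge_weight q i c) \<in> kernels"
  by (intro step_kernels) (auto simp: edge_weight_bounds(3))

text \<open>A difference of order \<open>n\<close>, the largest number of edges that occurs, removes
  all graphs with fewer edges. By maximality of \<open>class_order C0\<close> and
  \<open>hom_sum_nonzero\<close> any class that survives is isomorphic to \<open>C0\<close>.\<close>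

theorem density_polynomial_unique:
  assumes zero: "\<And>f. f \<in> graphons \<Longrightarrow> density_polynomial N d f = 0" and C: "C \<in> multigraph_classes_le N"
  shows "d C = 0"
proof (rule ccontr)
  assume "d C \<noteq> 0"
  define X where "X = {C \<in> multigraph_classes_le N. d C \<noteq> 0}"
  have X: "finite X" "X \<noteq> {}" using C \<open>d C \<noteq> 0\<close> by (auto simp: X_def)
  define n where "n = Max (class_edges ` X)"
  define X' where "X' = {C \<in> X. class_edges C = n}"
  have "n \<in> class_edges ` X" unfolding n_def using X by (intro Max_in) auto
  then have X': "finite X'" "X' \<noteq> {}" using X by (auto simp: X'_def)
  have "Max (class_order ` X') \<in> class_order ` X'" using X' by (intro Max_in) auto
  then obtain C0 where C0: "C0 \<in> X'" "class_order C0 = Max (class_order ` X')" by auto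
  have max: "class_order C \<le> class_order C0" if "C \<in> X'" for C
    unfolding C0(2) using that X' by (intro Max_ge) auto
  have C0N: "C0 \<in> multigraph_classes_le N" "d C0 \<noteq> 0" "class_edges C0 = n" using C0(1) by (auto simp: X'_def X_def)
  let ?p = "class_labelling C0"
  let ?K = "Suc (class_order C0)"
  obtain h where h: "\<forall>i<2 * n. h (?p i) < ?K" "edge_loopless n (\<lambda>i. h (?p i))"
    "(graph_of n ?p, graph_of n (\<lambda>i. h (?p i))) \<in> multigraph_iso"
    "card ((\<lambda>i. h (?p i)) ` {..<2 * n}) = class_order C0"
    using compressed_labelling[OF C0N(1)] unfolding C0N(3) by (elim exE conjE) (rule that; assumption)
  define q where "q i = h (?p i)" for i
  define s where "s = 1 / real (Suc n)"
  have s: "s > 0" "s \<le> 1 / real (Suc n)" by (auto simp: s_def)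
  let ?g = "\<lambda>i. step ?K (\<lambda>c. s * edge_weight q i c)"
  have gk: "?g i \<in> kernels" for i by (rule edge_weight_kernels) simp
  have graphon: "(\<lambda>p. 0 + (\<Sum>i\<in>S. ?g i p)) \<in> graphons" if S: "S \<subseteq> {..<n}" for S
  proof -
    have dir: "(\<lambda>i c. s * edge_weight q i c) \<in> directions n ?K"
    proof (rule directions_bounded)
      fix i a b
      have "s * edge_weight q i (a, b) \<le> s * 1"
        using s(1) by (intro mult_left_mono edge_weight_bounds) auto
      then have "s * edge_weight q i (a, b) \<le> 1 / real (Suc n)" using s(2) by linarith
      then show "0 \<le> s * edge_weight q i (a, b) \<and> s * edge_weight q i (a, b) \<le> 1 / real (Suc n) \<and>
          s * edge_weight q i (a, b) = s * edge_weight q i (b, a)"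
        using s edge_weight_bounds(1)[of q i "(a, b)"] edge_weight_bounds(3)[of q i a b] by simp
    qed
    have "(\<lambda>c. \<Sum>i\<in>S. s * edge_weight q i c) \<in> weights ?K"
    proof (rule weights_sum_subset[where I="{..<n}"])
      show "(\<lambda>c. \<Sum>i<n. s * edge_weight q i c) \<in> weights ?K" using dir unfolding directions_def by blast
      show "(\<lambda>c. s * edge_weight q i c) \<in> weights ?K" if "i \<in> {..<n}" for i
        using directionsD[OF dir, of i] that by blast
    qed (use S in auto)
    moreover have "(\<lambda>p. 0 + (\<Sum>i\<in>S. ?g i p)) = step ?K (\<lambda>c. \<Sum>i\<in>S. s * edge_weight q i c)"
      using step_add_sum[of ?K "\<lambda>_. 0" "\<lambda>i c. s * edge_weight q i c" S] by simp
    ultimately show ?thesis by (simp add: step_graphons)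
  qed
  have "0 = mixed_diff {..<n} (\<lambda>_. 0) ?g (\<lambda>_. 0)" by (simp add: mixed_diff_def)
  also have "\<dots> = mixed_diff {..<n} (density_polynomial N d) ?g (\<lambda>_. 0)"
    by (rule mixed_diff_cong) (use zero graphon in auto)
  also have "\<dots> = (\<Sum>C\<in>multigraph_classes_le N. d C * mixed_diff {..<n} (hom_density (class_rep C)) ?g (\<lambda>_. 0))"
    unfolding density_polynomial_def[abs_def] by (rule mixed_diff_linear)
  also have "\<dots> = (\<Sum>C\<in>multigraph_classes_le N. if C = C0 then d C0 * (s ^ n * hom_sum n ?p q ?K) else 0)"
  proof (rule sum.cong[OF refl])
    fix C assume C: "C \<in> multigraph_classes_le N"
    let ?m = "class_edges C" and ?r = "class_labelling C"
    have md: "mixed_diff {..<n} (hom_density (class_rep C)) ?g (\<lambda>_. 0)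
        = mixed_diff {..<n} (\<lambda>f. multi_density ?m ?r (\<lambda>_. f)) ?g (\<lambda>_. 0)"
      using gk by (intro mixed_diff_hom_density_class[OF C]) auto
    note loop = class_labelling(1)[OF C]
    have top: "mixed_diff {..<n} (hom_density (class_rep C)) ?g (\<lambda>_. 0) = s ^ n * hom_sum n ?r q ?K" if "?m = n"
    proof -
      have "mixed_diff {..<n} (hom_density (class_rep C)) ?g (\<lambda>_. 0)
          = (\<Sum>\<sigma>\<in>surjections n. multi_density n ?r (\<lambda>j. ?g (\<sigma> j)))"
        unfolding md that surjections_def using loop that gk by (intro mixed_diff_multi_density) auto
      then show ?thesis
        unfolding step_scale multi_density_scale hom_sum_def sum_distrib_left .
    qed
    consider "d C = 0" | "C \<in> X" "?m < n" | "C \<in> X'"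
    proof -
      have "?m \<le> n" if "C \<in> X" unfolding n_def using that X by (intro Max_ge) auto
      then show ?thesis using that C unfolding X'_def X_def by fastforce
    qed
    then show "d C * mixed_diff {..<n} (hom_density (class_rep C)) ?g (\<lambda>_. 0)
        = (if C = C0 then d C0 * (s ^ n * hom_sum n ?p q ?K) else 0)"
    proof cases
      case 1
      then show ?thesis using C0N(2) by auto
    next
      case 2
      then have "mixed_diff {..<n} (hom_density (class_rep C)) ?g (\<lambda>_. 0) = 0"
        unfolding md using gk by (intro mixed_diff_multi_density_eq_0[OF loop]) auto
      moreover have "C \<noteq> C0" using 2 C0N(3) by auto
      ultimately show ?thesis by simp
    next
      case 3
      then have m: "?m = n" by (simp add: X'_def)
      have "C = C0" if "hom_sum n ?r q ?K \<noteq> 0"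
      proof (rule multigraph_class_eq_if_iso[OF C C0N(1)])
        have lq: "edge_loopless n q" using h(2) by (simp add: q_def)
        have cq: "card (q ` {..<2 * n}) = class_order C0" using h(4) by (simp add: q_def[abs_def])
        have "card (?r ` {..<2 * n}) \<le> card (q ` {..<2 * n})"
          using max[OF 3] unfolding cq class_order_def m .
        then show "(graph_of ?m ?r, graph_of n q) \<in> multigraph_iso"
          unfolding m using loop that m by (intro hom_sum_nonzero(2)[OF _ lq _ that]) auto
        show "(graph_of (class_edges C0) ?p, graph_of n q) \<in> multigraph_iso"
          using h(3) by (simp add: C0N(3) q_def[abs_def])
      qed
      then show ?thesis unfolding top[OF m] by (cases "C = C0") auto
    qed
  qed
  also have "\<dots> = d C0 * (s ^ n * hom_sum n ?p q ?K)"
    using C0N(1) by simp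
  finally have "hom_sum n ?p q ?K = 0" using C0N(2) s(1) by simp
  moreover have "hom_sum n ?p q ?K > 0"
    unfolding q_def[abs_def] by (rule hom_sum_pos) (use h(1) in auto)
  ultimately show False by simp
qed

section \<open>Oscillating step functions\<close>

text \<open>Sylvester's Hadamard matrices: the entry is -1 to the number of common ones among the
  last \<open>d\<close> binary digits of \<open>a\<close> and \<open>b\<close>.\<close>

primrec hadamard :: "nat \<Rightarrow> nat \<Rightarrow> nat \<Rightarrow> real" where
  "hadamard 0 a b = 1"
| "hadamard (Suc d) a b = hadamard d (a div 2) (b div 2) * (if odd a \<and> odd b then -1 else 1)"

text \<open>The Hadamard matrix has a constant row; tensoring with the 2 by 2 pattern of alternating
  signs makes all row sums 0. These serve \<open>averaging\<close>, while orthogonality serves the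
  cut norm.\<close>

definition wave :: "nat \<Rightarrow> nat \<Rightarrow> nat \<Rightarrow> real" where
  "wave d a b = hadamard d (a div 2) (b div 2) * (-1) ^ (a + b)"

lemma sum_lessThan_blocks: "(\<Sum>a<k * m. f a) = (\<Sum>u<k. \<Sum>r<m. f (u * m + r))" for k m :: nat
proof -
  have "(\<Sum>u<k. sum f {u * m..<u * m + m}) = (\<Sum>a<k * m. f a)" by (rule sum.nat_group)
  moreover have "sum f {u * m..<u * m + m} = (\<Sum>r<m. f (u * m + r))" for u
    by (subst sum.atLeastLessThan_shift_0) (simp add: atLeast0LessThan comp_def)
  ultimately show ?thesis by simp
qed

lemma sum_lessThan_double: "(\<Sum>a<2 * q. f a) = (\<Sum>c<q. f (2 * c) + f (2 * c + 1))" for q :: nat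
  using sum_lessThan_blocks[of f q 2] by (simp add: mult.commute numeral_2_eq_2)

lemma hadamard_sym: "hadamard d a b = hadamard d b a"
  by (induction d arbitrary: a b) auto

lemma hadamard_sq: "hadamard d a b * hadamard d a b = 1"
proof -
  have "hadamard d a b = 1 \<or> hadamard d a b = -1"
  proof (induction d arbitrary: a b)
    case (Suc d)
    from Suc[of "a div 2" "b div 2"] show ?case by auto
  qed simp
  then show ?thesis by auto
qed

text \<open>Pairing the indices \<open>2 * c\<close> and \<open>2 * c + 1\<close> leaves the factor
  \<open>1 + g b * g b'\<close>, which is 2 if the last digits agree and 0 otherwise; the other
  digits are covered by induction.\<close>

lemma hadamard_orthogonal:
  "b < 2 ^ d \<Longrightarrow> b' < 2 ^ d \<Longrightarrow>
    (\<Sum>a<2 ^ d. hadamard d a b * hadamard d a b') = (if b = b' then 2 ^ d else 0)"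
proof (induction d arbitrary: b b')
  case (Suc d)
  define g where "g x = (if odd x then -1 else 1 :: real)" for x :: nat
  have "(\<Sum>a<2 ^ Suc d. hadamard (Suc d) a b * hadamard (Suc d) a b')
      = (\<Sum>c<2 ^ d. hadamard d c (b div 2) * hadamard d c (b' div 2) * (1 + g b * g b'))"
    unfolding power_Suc sum_lessThan_double by (intro sum.cong refl) (auto simp: g_def)
  also have "\<dots> = (if b div 2 = b' div 2 then 2 ^ d else 0) * (1 + g b * g b')"
    using Suc by (simp flip: sum_distrib_right)
  also have "\<dots> = (if b = b' then 2 ^ Suc d else 0)"
  proof (cases "b div 2 = b' div 2")
    case True
    then have "b = b' \<longleftrightarrow> (odd b \<longleftrightarrow> odd b')"
      by (metis div_mult_mod_eq odd_iff_mod_2_eq_one even_iff_mod_2_eq_zero)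
    then show ?thesis using True by (auto simp: g_def)
  qed auto
  finally show ?case .
qed auto

text \<open>Cauchy-Schwarz in the row index; orthogonality then reduces the squared norm of the
  matrix applied to \<open>t\<close> to \<open>2 ^ d\<close> times that of \<open>t\<close>.\<close>

lemma hadamard_bilinear:
  "(\<Sum>a<2 ^ d. \<Sum>b<2 ^ d. hadamard d a b * (s a * t b))\<^sup>2 \<le> (\<Sum>a<2 ^ d. (s a)\<^sup>2) * (2 ^ d * (\<Sum>b<2 ^ d. (t b)\<^sup>2))"
proof -
  let ?N = "{..<2 ^ d :: nat}"
  have "(\<Sum>a\<in>?N. \<Sum>b\<in>?N. hadamard d a b * (s a * t b)) = (\<Sum>a\<in>?N. s a * (\<Sum>b\<in>?N. hadamard d a b * t b))"
    by (simp add: sum_distrib_left mult_ac)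
  then have "(\<Sum>a\<in>?N. \<Sum>b\<in>?N. hadamard d a b * (s a * t b))\<^sup>2
      \<le> (\<Sum>a\<in>?N. (s a)\<^sup>2) * (\<Sum>a\<in>?N. (\<Sum>b\<in>?N. hadamard d a b * t b)\<^sup>2)"
    by (simp only: Cauchy_Schwarz_ineq_sum)
  also have "(\<Sum>a\<in>?N. (\<Sum>b\<in>?N. hadamard d a b * t b)\<^sup>2)
      = (\<Sum>a\<in>?N. \<Sum>b\<in>?N. \<Sum>b'\<in>?N. t b * t b' * (hadamard d a b * hadamard d a b'))"
    unfolding power2_eq_square sum_product by (intro sum.cong refl) simp
  also have "\<dots> = (\<Sum>b\<in>?N. \<Sum>b'\<in>?N. \<Sum>a\<in>?N. t b * t b' * (hadamard d a b * hadamard d a b'))"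
    by (subst sum.swap) (intro sum.cong refl sum.swap)
  also have "\<dots> = (\<Sum>b\<in>?N. \<Sum>b'\<in>?N. t b * t b' * (if b = b' then 2 ^ d else 0))"
    unfolding sum_distrib_left[symmetric] by (intro sum.cong refl arg_cong2[where f="(*)"] hadamard_orthogonal) auto
  also have "\<dots> = (\<Sum>b\<in>?N. t b * t b * 2 ^ d)"
  proof (intro sum.cong refl)
    fix b assume b: "b \<in> ?N"
    have "(\<Sum>b'\<in>?N. t b * t b' * (if b = b' then 2 ^ d else 0)) = (\<Sum>b'\<in>?N. if b' = b then t b * t b * 2 ^ d else 0)"
      by (intro sum.cong refl) auto
    then show "(\<Sum>b'\<in>?N. t b * t b' * (if b = b' then 2 ^ d else 0)) = t b * t b * 2 ^ d"
      using b by simp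
  qed
  also have "\<dots> = 2 ^ d * (\<Sum>b\<in>?N. (t b)\<^sup>2)"
    by (simp add: sum_distrib_left power2_eq_square mult_ac)
  finally show ?thesis .
qed

lemma wave_sym: "wave d a b = wave d b a"
  by (simp add: wave_def hadamard_sym[of d "a div 2"] add.commute)

lemma wave_sq: "wave d a b * wave d a b = 1"
proof -
  have "wave d a b * wave d a b = (hadamard d (a div 2) (b div 2) * hadamard d (a div 2) (b div 2)) * ((-1) ^ (a + b) * (-1) ^ (a + b))"
    by (simp add: wave_def mult_ac)
  then show ?thesis by (simp add: hadamard_sq flip: power_add mult_2)
qed

lemma wave_abs: "\<bar>wave d a b\<bar> = 1"
  using wave_sq[of d a b] by (metis abs_1 abs_mult_self_eq abs_ge_zero abs_square_eq_1 power2_eq_square)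

lemma wave_row_sum: "(\<Sum>a<2 * 2 ^ d. wave d a b) = 0"
  unfolding sum_lessThan_double by (intro sum.neutral ballI) (simp add: wave_def)

text \<open>The alternating signs replace \<open>s\<close> and \<open>t\<close> by differences of
  neighbouring values, still bounded by \<open>\<eta>\<close> because all values lie between 0 and
  \<open>\<eta>\<close>. The remaining Hadamard sum beats the trivial bound by a factor of order
  \<open>sqrt (2 ^ d)\<close>.\<close>

lemma wave_bilinear:
  assumes s: "\<And>a. 0 \<le> s a \<and> s a \<le> \<eta>" and t: "\<And>b. 0 \<le> t b \<and> t b \<le> \<eta>"
  shows "(\<Sum>a<2 * 2 ^ d. \<Sum>b<2 * 2 ^ d. wave d a b * (s a * t b))\<^sup>2 \<le> (2 ^ d) ^ 3 * \<eta> ^ 4"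
proof -
  let ?q = "2 ^ d :: nat"
  define s' where "s' c = s (2 * c) - s (2 * c + 1)" for c
  define t' where "t' c = t (2 * c) - t (2 * c + 1)" for c
  have "(\<Sum>a<2 * ?q. \<Sum>b<2 * ?q. wave d a b * (s a * t b)) = (\<Sum>c<?q. \<Sum>c'<?q. hadamard d c c' * (s' c * t' c'))"
    unfolding sum_lessThan_double sum.distrib[symmetric]
    by (intro sum.cong refl) (simp add: wave_def s'_def t'_def algebra_simps power_add)
  then have "(\<Sum>a<2 * ?q. \<Sum>b<2 * ?q. wave d a b * (s a * t b))\<^sup>2
      \<le> (\<Sum>a<?q. (s' a)\<^sup>2) * (2 ^ d * (\<Sum>b<?q. (t' b)\<^sup>2))"
    by (simp only: hadamard_bilinear)
  also have "\<dots> \<le> (\<Sum>a<?q. \<eta>\<^sup>2) * (2 ^ d * (\<Sum>b<?q. \<eta>\<^sup>2))"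
  proof -
    have "(s' c)\<^sup>2 \<le> \<eta>\<^sup>2" "(t' c)\<^sup>2 \<le> \<eta>\<^sup>2" for c
    proof -
      have "\<bar>s' c\<bar> \<le> \<eta>" using s[of "2 * c"] s[of "2 * c + 1"] unfolding s'_def by linarith
      then show "(s' c)\<^sup>2 \<le> \<eta>\<^sup>2" by (rule power2_le_iff_abs_le[THEN iffD2, rotated]) (use s[of 0] in linarith)
      have "\<bar>t' c\<bar> \<le> \<eta>" using t[of "2 * c"] t[of "2 * c + 1"] unfolding t'_def by linarith
      then show "(t' c)\<^sup>2 \<le> \<eta>\<^sup>2" by (rule power2_le_iff_abs_le[THEN iffD2, rotated]) (use s[of 0] in linarith)
    qed
    then show ?thesis by (intro mult_mono sum_mono mult_left_mono sum_nonneg mult_nonneg_nonneg) auto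
  qed
  also have "\<dots> = (2 ^ d) ^ 3 * \<eta> ^ 4"
    by (simp add: power2_eq_square power3_eq_cube power4_eq_xxxx mult_ac)
  finally show ?thesis .
qed

text \<open>Each cell of the \<open>k\<close> by \<open>k\<close> grid carries a full copy of the
  wave, multiplied by the value of \<open>E\<close> on that cell.\<close>

definition wave_step :: "nat \<Rightarrow> (nat \<times> nat \<Rightarrow> real) \<Rightarrow> nat \<Rightarrow> kernel" where
  "wave_step k E d = step (k * (2 * 2 ^ d)) (\<lambda>(a, b).
     E (a div (2 * 2 ^ d), b div (2 * 2 ^ d)) * wave d (a mod (2 * 2 ^ d)) (b mod (2 * 2 ^ d)))"

text \<open>The sides of a rectangle meet fine cells in measures between 0 and
  \<open>1 / real K\<close>, so \<open>wave_bilinear\<close> bounds the contribution of each of the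
  \<open>k * k\<close> blocks uniformly in \<open>S\<close> and \<open>T\<close>.\<close>

lemma wave_step_rectangle:
  assumes k: "k \<ge> 1" and E: "\<And>c. \<bar>E c\<bar> \<le> B"
    and S: "S \<in> sets (lebesgue_on unit_interval)" and T: "T \<in> sets (lebesgue_on unit_interval)"
  shows "\<bar>LINT p:S \<times> T|lebesgue. wave_step k E d p\<bar> \<le> B / sqrt (2 ^ d)"
proof -
  define Q where "Q = (2 * 2 ^ d :: nat)"
  define K where "K = k * Q"
  have Q: "Q \<ge> 1" by (simp add: Q_def)
  then have K: "K \<ge> 1" using k by (simp add: K_def)
  define s where "s a = measure lebesgue (S \<inter> cell K a)" for a
  define t where "t b = measure lebesgue (T \<inter> cell K b)" for b
  have bound: "0 \<le> measure lebesgue (R \<inter> cell K a) \<and> measure lebesgue (R \<inter> cell K a) \<le> 1 / real K"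
    if R: "R \<in> sets (lebesgue_on unit_interval)" for R a
  proof -
    have RL: "R \<in> sets lebesgue" using R by (auto simp: sets_restrict_space_iff)
    have cL: "cell K a \<in> lmeasurable" using emeasure_cell[OF K, of a]
      by (intro fmeasurableI) (auto intro: sets_completionI_sets)
    have "measure lebesgue (R \<inter> cell K a) \<le> measure lebesgue (cell K a)"
      using RL cL by (intro measure_mono_fmeasurable) (auto dest: fmeasurableD)
    then show ?thesis by (simp add: measure_cell[OF K])
  qed
  have B: "0 \<le> B" using E[of "(0, 0)"] by linarith
  have inner: "\<bar>\<Sum>r<Q. \<Sum>r'<Q. wave d r r' * (s (u * Q + r) * t (v * Q + r'))\<bar> \<le> 1 / (real k * real k * sqrt (2 ^ d))" for u v
  proof -
    have "(\<Sum>r<Q. \<Sum>r'<Q. wave d r r' * (s (u * Q + r) * t (v * Q + r')))\<^sup>2 \<le> (2 ^ d) ^ 3 * (1 / real K) ^ 4"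
      unfolding Q_def
      by (rule wave_bilinear) (use bound[OF S] bound[OF T] in \<open>auto simp: s_def t_def\<close>)
    \<comment> \<open>Since \<open>K = k * (2 * 2 ^ d)\<close>, the fourth power of the factor 2
      gives the 16.\<close>
    also have "\<dots> = (1 / (real k * real k * sqrt (2 ^ d)))\<^sup>2 * (1 / 16)"
      by (simp add: K_def Q_def power_mult_distrib power_divide field_simps power2_eq_square power3_eq_cube power4_eq_xxxx)
    also have "\<dots> \<le> (1 / (real k * real k * sqrt (2 ^ d)))\<^sup>2 * 1"
      by (intro mult_left_mono) auto
    finally have "(\<Sum>r<Q. \<Sum>r'<Q. wave d r r' * (s (u * Q + r) * t (v * Q + r')))\<^sup>2 \<le> (1 / (real k * real k * sqrt (2 ^ d)))\<^sup>2"
      by simp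
    then show ?thesis by (rule power2_le_iff_abs_le[THEN iffD1, rotated]) simp
  qed
  have "(LINT p:S \<times> T|lebesgue. wave_step k E d p)
     = (\<Sum>a<K. \<Sum>b<K. E (a div Q, b div Q) * wave d (a mod Q) (b mod Q) * (s a * t b))"
    unfolding wave_step_def Q_def[symmetric] K_def[symmetric] integral_rectangle_step[OF K S T] s_def t_def
    by (simp add: sum.cartesian_product case_prod_unfold)
  also have "\<dots> = (\<Sum>u<k. \<Sum>r<Q. \<Sum>v<k. \<Sum>r'<Q. E (u, v) * (wave d r r' * (s (u * Q + r) * t (v * Q + r'))))"
    unfolding K_def sum_lessThan_blocks by (intro sum.cong refl) (simp add: mult.assoc)
  also have "\<dots> = (\<Sum>u<k. \<Sum>v<k. E (u, v) * (\<Sum>r<Q. \<Sum>r'<Q. wave d r r' * (s (u * Q + r) * t (v * Q + r'))))"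
    unfolding sum_distrib_left by (rule sum.cong[OF refl], rule sum.swap)
  finally have eq: "(LINT p:S \<times> T|lebesgue. wave_step k E d p)
      = (\<Sum>u<k. \<Sum>v<k. E (u, v) * (\<Sum>r<Q. \<Sum>r'<Q. wave d r r' * (s (u * Q + r) * t (v * Q + r'))))" .
  have "\<bar>LINT p:S \<times> T|lebesgue. wave_step k E d p\<bar>
      \<le> (\<Sum>u<k. \<Sum>v<k. \<bar>E (u, v) * (\<Sum>r<Q. \<Sum>r'<Q. wave d r r' * (s (u * Q + r) * t (v * Q + r')))\<bar>)"
    unfolding eq by (intro order_trans[OF sum_abs] sum_mono sum_abs)
  also have "\<dots> \<le> (\<Sum>u<k. \<Sum>v<k. B * (1 / (real k * real k * sqrt (2 ^ d))))"
    unfolding abs_mult using E inner B by (intro sum_mono mult_mono) auto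
  also have "\<dots> = B / sqrt (2 ^ d)" using k by simp
  finally show ?thesis .
qed

lemma cut_norm_wave_step:
  assumes k: "k \<ge> 1" and E: "\<And>c. \<bar>E c\<bar> \<le> B"
  shows "(\<lambda>d. cut_norm (wave_step k E d)) \<longlonglongrightarrow> 0"
proof -
  have "\<bar>wave_step k E d p\<bar> \<le> B" for d p
  proof -
    have "\<bar>E c * wave d a b\<bar> \<le> B" for c a b
      using E[of c] by (simp add: abs_mult wave_abs)
    moreover have "0 \<le> B" using E[of "(0, 0)"] by linarith
    ultimately show ?thesis by (cases p) (simp add: wave_step_def step_def)
  qed
  then have *: "0 \<le> cut_norm (wave_step k E d)" "cut_norm (wave_step k E d) \<le> B / sqrt (2 ^ d)" for d
    using cut_norm_bounds[of "wave_step k E d" B "B / sqrt (2 ^ d)"] wave_step_rectangle[OF k E] by auto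
  have "(\<lambda>d. (1 / sqrt 2) ^ d) \<longlonglongrightarrow> 0"
    by (rule LIMSEQ_power_zero) (simp add: real_less_rsqrt)
  then have "(\<lambda>d. B * (1 / sqrt 2) ^ d) \<longlonglongrightarrow> B * 0"
    by (rule tendsto_mult[OF tendsto_const])
  moreover have "B * (1 / sqrt 2) ^ d = B / sqrt (2 ^ d)" for d
    by (simp add: power_one_over real_sqrt_power divide_inverse power_inverse)
  ultimately have lim: "(\<lambda>d. B / sqrt (2 ^ d)) \<longlonglongrightarrow> 0" by simp
  show ?thesis
    by (rule tendsto_sandwich[OF _ _ tendsto_const lim]) (use * in \<open>auto intro: always_eventually\<close>)
qed

lemma cut_norm_half:
  assumes h: "h \<in> kernels"
  shows "cut_norm (\<lambda>p. h p / 2) \<le> cut_norm h"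
proof -
  obtain B where B: "\<And>p. p \<in> unit_square \<Longrightarrow> \<bar>h p\<bar> \<le> B" using kernels_bounded[OF h] by metis
  let ?I = "sets (lebesgue_on unit_interval) \<times> sets (lebesgue_on unit_interval)"
  let ?f = "\<lambda>(S, T). \<bar>LINT p:S \<times> T|lebesgue. h p\<bar>"
  have sub: "S \<subseteq> unit_interval" if "S \<in> sets (lebesgue_on unit_interval)" for S
    using sets.sets_into_space[OF that] by simp
  have bdd: "bdd_above (?f ` ?I)"
    using abs_rectangle_integral_le[OF B] sub by (intro bdd_aboveI2[of _ _ B]) auto
  have B2: "\<bar>h p / 2\<bar> \<le> B" if "p \<in> unit_square" for p
    using B[OF that] by (simp add: abs_mult)
  show ?thesis
  proof (rule cut_norm_bounds(2)[OF B2])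
    fix S T assume ST: "S \<in> sets (lebesgue_on unit_interval)" "T \<in> sets (lebesgue_on unit_interval)"
    have "(LINT p:S \<times> T|lebesgue. h p / 2) = (LINT p:S \<times> T|lebesgue. h p) / 2"
    proof -
      have "(LINT p:S \<times> T|lebesgue. h p / 2) = (LINT p|lebesgue. (indicator (S \<times> T) p *\<^sub>R h p) / 2)"
        unfolding set_lebesgue_integral_def by (intro Bochner_Integration.integral_cong) auto
      then show ?thesis unfolding set_lebesgue_integral_def by simp
    qed
    then have "\<bar>LINT p:S \<times> T|lebesgue. h p / 2\<bar> \<le> ?f (S, T)" by simp
    also have "\<dots> \<le> cut_norm h"
      unfolding cut_norm_def using ST by (intro cSUP_upper[OF _ bdd]) auto
    finally show "\<bar>LINT p:S \<times> T|lebesgue. h p / 2\<bar> \<le> cut_norm h" .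
  qed
qed

section \<open>Parallel edges\<close>

lemma simple_graph_of_iff:
  "simple_graph (graph_of n p) \<longleftrightarrow>
    (\<forall>i<n. \<forall>j<n. {p (2 * i), p (2 * i + 1)} = {p (2 * j), p (2 * j + 1)} \<longrightarrow> i = j)"
proof -
  let ?e = "\<lambda>j. {p (2 * j), p (2 * j + 1)}"
  have count: "count (edges (graph_of n p)) x = card {j \<in> {..<n}. x = ?e j}" for x
    unfolding edges_graph_of count_image_mset' by simp
  show ?thesis
  proof
    assume simple: "simple_graph (graph_of n p)"
    show "\<forall>i<n. \<forall>j<n. ?e i = ?e j \<longrightarrow> i = j"
    proof (intro allI impI)
      fix i j assume ij: "i < n" "j < n" "?e i = ?e j"
      have "card {l \<in> {..<n}. ?e i = ?e l} \<le> 1"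
        using simple unfolding simple_graph_def count by blast
      moreover have "{i, j} \<subseteq> {l \<in> {..<n}. ?e i = ?e l}" using ij by auto
      ultimately have "card {i, j} \<le> 1"
        using card_mono[of "{l \<in> {..<n}. ?e i = ?e l}" "{i, j}"] by simp
      then show "i = j" by (simp add: card_insert_if split: if_splits)
    qed
  next
    assume inj: "\<forall>i<n. \<forall>j<n. ?e i = ?e j \<longrightarrow> i = j"
    show "simple_graph (graph_of n p)"
      unfolding simple_graph_def count
    proof
      fix x
      have "i = j" if "i \<in> {j \<in> {..<n}. x = ?e j}" "j \<in> {j \<in> {..<n}. x = ?e j}" for i j
        using inj that by auto
      then show "card {j \<in> {..<n}. x = ?e j} \<le> 1"
        by (subst card_le_Suc0_iff_eq[unfolded One_nat_def[symmetric]]) auto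
    qed
  qed
qed

text \<open>Two parallel edges \<open>i1\<close>, \<open>i2\<close> of the target graph get oscillating weights whose product is
  nonnegative, while each of them averages out over any fine coordinate that it alone contains.\<close>

locale parallel_edges =
  fixes n k :: nat and q :: "nat \<Rightarrow> nat" and i1 i2 :: nat and s :: real
  assumes k: "k \<ge> 1" and i12: "i1 < n" "i2 < n" "i1 \<noteq> i2"
    and parallel: "{q (2 * i1), q (2 * i1 + 1)} = {q (2 * i2), q (2 * i2 + 1)}"
    and s: "0 < s" "real (n + 2) * s \<le> 1"
begin

definition E :: "nat \<Rightarrow> nat \<times> nat \<Rightarrow> real" where
  "E i c = s * edge_weight q i c"

definition W :: "nat \<Rightarrow> nat \<Rightarrow> nat \<times> nat \<Rightarrow> real" where
  "W d i = (\<lambda>(a, b). E i (a div (2 * 2 ^ d), b div (2 * 2 ^ d)) *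
     (if i \<in> {i1, i2} then wave d (a mod (2 * 2 ^ d)) (b mod (2 * 2 ^ d)) else 1))"

abbreviation K :: "nat \<Rightarrow> nat" where "K d \<equiv> k * (2 * 2 ^ d)"

lemma K: "K d \<ge> 1" using k by simp

lemma E12: "E i2 = E i1"
  using parallel by (simp add: E_def edge_weight_def fun_eq_iff)

lemma E_bounds: "0 \<le> E i c" "E i c \<le> s" "E i (a, b) = E i (b, a)"
  "E i (a, b) \<noteq> 0 \<longleftrightarrow> {a, b} = {q (2 * i), q (2 * i + 1)}"
proof -
  have "s * edge_weight q i c \<le> s * 1" using s by (intro mult_left_mono edge_weight_bounds) auto
  then show "E i c \<le> s" by (simp add: E_def)
  show "0 \<le> E i c" using s by (simp add: E_def edge_weight_bounds)
  show "E i (a, b) = E i (b, a)" by (simp add: E_def edge_weight_bounds(3)[of q i a b])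
  show "E i (a, b) \<noteq> 0 \<longleftrightarrow> {a, b} = {q (2 * i), q (2 * i + 1)}"
    using s edge_weight_bounds(4)[of q i a b] by (simp add: E_def)
qed

lemma W_sym: "W d i (a, b) = W d i (b, a)"
  unfolding W_def prod.case
  using E_bounds(3)[of i "a div (2 * 2 ^ d)" "b div (2 * 2 ^ d)"] wave_sym[of d "a mod (2 * 2 ^ d)" "b mod (2 * 2 ^ d)"]
  by (simp only:)

lemma W_abs: "\<bar>W d i (a, b)\<bar> = E i (a div (2 * 2 ^ d), b div (2 * 2 ^ d))"
  by (simp add: W_def abs_mult wave_abs E_bounds)

lemma W_plain: "i \<notin> {i1, i2} \<Longrightarrow> W d i (a, b) = E i (a div (2 * 2 ^ d), b div (2 * 2 ^ d))"
  by (simp add: W_def)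

lemma W_oscillating: "i \<in> {i1, i2} \<Longrightarrow> W d i (a, b) = E i1 (a div (2 * 2 ^ d), b div (2 * 2 ^ d)) *
    wave d (a mod (2 * 2 ^ d)) (b mod (2 * 2 ^ d))"
  using E12 by (auto simp: W_def)

text \<open>Parallel edges read the same pair of indices up to order, where the two oscillating
  weights agree; the product is a square.\<close>

lemma W_product_nonneg:
  assumes "{a, b} = {a', b'}"
  shows "0 \<le> W d i1 (a, b) * W d i2 (a', b')"
proof -
  have "W d i2 (a', b') = W d i2 (a, b)"
    using assms W_sym by (auto simp: doubleton_eq_iff)
  also have "\<dots> = W d i1 (a, b)"
    using W_oscillating[of i1 d a b] W_oscillating[of i2 d a b] by simp
  finally show ?thesis by simp
qed

text \<open>Each of the two oscillating directions can be as low as minus \<open>E i1\<close>, so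
  twice \<open>E i1\<close> as base keeps all vertices of the cube nonnegative. Together with
  \<open>n\<close> directions of size at most \<open>s\<close> this explains the bound
  \<open>real (n + 2) * s \<le> 1\<close>.\<close>

definition base :: "nat \<Rightarrow> nat \<times> nat \<Rightarrow> real" where
  "base d = (\<lambda>(a, b). 2 * E i1 (a div (2 * 2 ^ d), b div (2 * 2 ^ d)))"

lemma cube_weights:
  assumes S: "S \<subseteq> {..<n}"
  shows "(\<lambda>c. base d c + (\<Sum>i\<in>S. W d i c)) \<in> weights (K d)"
proof (rule weightsI)
  fix a b :: nat
  let ?x = "(a div (2 * 2 ^ d), b div (2 * 2 ^ d))"
  have fS: "finite S" using S finite_subset by blast
  have "- (2 * E i1 ?x) \<le> (\<Sum>i\<in>S. W d i (a, b))"
  proof -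
    have "(\<Sum>i\<in>S. - (if i = i1 then E i1 ?x else 0) - (if i = i2 then E i1 ?x else 0)) \<le> (\<Sum>i\<in>S. W d i (a, b))"
    proof (rule sum_mono)
      fix i assume "i \<in> S"
      show "- (if i = i1 then E i1 ?x else 0) - (if i = i2 then E i1 ?x else 0) \<le> W d i (a, b)"
      proof (cases "i \<in> {i1, i2}")
        case True
        then have "\<bar>W d i (a, b)\<bar> = E i1 ?x" using W_abs[of d i a b] E12 by auto
        then show ?thesis using True i12(3) by auto
      next
        case False
        then show ?thesis using W_plain[OF False, of d a b] E_bounds(1)[of i ?x] by simp
      qed
    qed
    moreover have "(\<Sum>i\<in>S. - (if i = i1 then E i1 ?x else 0) - (if i = i2 then E i1 ?x else 0))
        = - (if i1 \<in> S then E i1 ?x else 0) - (if i2 \<in> S then E i1 ?x else 0)"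
      using fS by (simp add: sum_subtractf sum_negf)
    ultimately show ?thesis using E_bounds(1)[of i1 ?x] by (auto split: if_splits)
  qed
  then show "0 \<le> base d (a, b) + (\<Sum>i\<in>S. W d i (a, b))" by (simp add: base_def)
  have "(\<Sum>i\<in>S. W d i (a, b)) \<le> (\<Sum>i\<in>S. s)"
  proof (rule sum_mono)
    fix i
    show "W d i (a, b) \<le> s"
      using W_abs[of d i a b] E_bounds(2)[of i ?x] by linarith
  qed
  also have "\<dots> \<le> real n * s"
    using s card_mono[OF finite_lessThan S] by (simp add: mult_right_mono)
  finally have "base d (a, b) + (\<Sum>i\<in>S. W d i (a, b)) \<le> 2 * s + real n * s"
    using E_bounds(2)[of i1 ?x] by (simp add: base_def)
  also have "\<dots> \<le> 1" using s by (simp add: algebra_simps)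
  finally show "base d (a, b) + (\<Sum>i\<in>S. W d i (a, b)) \<le> 1" .
  show "base d (a, b) + (\<Sum>i\<in>S. W d i (a, b)) = base d (b, a) + (\<Sum>i\<in>S. W d i (b, a))"
    unfolding base_def prod.case E_bounds(3)[of i1 "a div (2 * 2 ^ d)"] W_sym[of d _ a b] ..
qed

lemma W_kernels: "step (K d) (W d i) \<in> kernels"
  by (rule step_kernels[OF K]) (rule W_sym)

text \<open>The limits of the directions in the cut norm: the oscillating ones disappear, and the
  others represent the same function for every \<open>d\<close>.\<close>

definition W_limit :: "nat \<Rightarrow> nat \<times> nat \<Rightarrow> real" where
  "W_limit i c = (if i \<in> {i1, i2} then 0 else E i c)"

text \<open>Both oscillating directions carry the same wave, so each vertex differs from its limit
  by a multiple of a single wave, whose cut norm tends to 0.\<close>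

lemma cube_limit:
  assumes G: "graphon_continuous cut_norm G" and S: "S \<subseteq> {..<n}"
  shows "(\<lambda>d. G (step (K d) (\<lambda>c. base d c + (\<Sum>i\<in>S. W d i c))))
    \<longlonglongrightarrow> G (step k (\<lambda>c. 2 * E i1 c + (\<Sum>i\<in>S. W_limit i c)))"
proof (rule graphon_continuous_tendsto[OF G])
  have fS: "finite S" using S finite_subset by blast
  show "step (K d) (\<lambda>c. base d c + (\<Sum>i\<in>S. W d i c)) \<in> graphons" for d
    by (intro step_graphons K cube_weights S)
  let ?q = "\<lambda>c. 2 * E i1 c + (\<Sum>i\<in>S. W_limit i c)"
  have "?q \<in> weights k"
  proof (rule weightsI)
    fix a b
    have w: "0 \<le> W_limit i c" "W_limit i c \<le> s" "W_limit i (a, b) = W_limit i (b, a)" for i c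
      using E_bounds(1)[of i c] E_bounds(2)[of i c] E_bounds(3)[of i a b] s by (auto simp: W_limit_def)
    show "0 \<le> ?q (a, b)" using E_bounds(1)[of i1 "(a, b)"] w by (simp add: sum_nonneg)
    have "(\<Sum>i\<in>S. W_limit i (a, b)) \<le> (\<Sum>i\<in>S. s)" by (intro sum_mono w)
    also have "\<dots> \<le> real n * s" using s card_mono[OF finite_lessThan S] by (simp add: mult_right_mono)
    finally show "?q (a, b) \<le> 1" using E_bounds(2)[of i1 "(a, b)"] s by (simp add: algebra_simps)
    show "?q (a, b) = ?q (b, a)" using w(3) E_bounds(3)[of i1 a b] by (simp only:)
  qed
  then show "step k ?q \<in> graphons" by (rule step_graphons[OF k])
  define m where "m = (\<Sum>i\<in>S. of_bool (i \<in> {i1, i2}) :: real)"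
  have "(\<lambda>p. step (K d) (\<lambda>c. base d c + (\<Sum>i\<in>S. W d i c)) p - step k ?q p) = wave_step k (\<lambda>c. m * E i1 c) d" for d
  proof -
    have ref: "step k ?q = step (K d) (\<lambda>(a, b). ?q (a div (2 * 2 ^ d), b div (2 * 2 ^ d)))"
      by (rule step_refine[OF k, symmetric]) simp
    have "(base d (a, b) + (\<Sum>i\<in>S. W d i (a, b))) - ?q (a div (2 * 2 ^ d), b div (2 * 2 ^ d))
        = m * E i1 (a div (2 * 2 ^ d), b div (2 * 2 ^ d)) * wave d (a mod (2 * 2 ^ d)) (b mod (2 * 2 ^ d))" for a b
    proof -
      let ?x = "(a div (2 * 2 ^ d), b div (2 * 2 ^ d))"
      have "W d i (a, b) - W_limit i ?x = of_bool (i \<in> {i1, i2}) * (E i1 ?x * wave d (a mod (2 * 2 ^ d)) (b mod (2 * 2 ^ d)))" for i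
      proof (cases "i \<in> {i1, i2}")
        case True
        then show ?thesis using W_oscillating[OF True, of d a b] by (simp only: W_limit_def if_True of_bool_eq mult_1 diff_zero)
      next
        case False
        then show ?thesis using W_plain[OF False, of d a b] by (simp only: W_limit_def if_False of_bool_eq mult_zero_left diff_self)
      qed
      then have "(\<Sum>i\<in>S. W d i (a, b)) - (\<Sum>i\<in>S. W_limit i ?x) = m * (E i1 ?x * wave d (a mod (2 * 2 ^ d)) (b mod (2 * 2 ^ d)))"
        unfolding m_def sum_subtractf[symmetric] sum_distrib_right by (intro sum.cong refl) 
      then show ?thesis by (simp only: base_def prod.case mult.assoc)
    qed
    then show ?thesis
      unfolding ref wave_step_def by (auto simp: step_def fun_eq_iff)
  qed
  moreover have "\<bar>m * E i1 c\<bar> \<le> \<bar>m\<bar> * s" for c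
    using E_bounds(1,2)[of i1 c] by (simp add: abs_mult mult_left_mono)
  ultimately show "(\<lambda>d. cut_norm (\<lambda>p. step (K d) (\<lambda>c. base d c + (\<Sum>i\<in>S. W d i c)) p - step k ?q p)) \<longlonglongrightarrow> 0"
    using cut_norm_wave_step[OF k, of "\<lambda>c. m * E i1 c" "\<bar>m\<bar> * s"] by (simp only:)
qed

text \<open>In the limit the direction in slot \<open>i1\<close> is 0, and a difference with a zero
  direction vanishes.\<close>

lemma mixed_diff_tendsto_0:
  assumes G: "graphon_continuous cut_norm G"
  shows "(\<lambda>d. mixed_diff {..<n} G (\<lambda>i. step (K d) (W d i)) (step (K d) (base d))) \<longlonglongrightarrow> 0"
proof -
  let ?F = "\<lambda>\<beta>. G (step k \<beta>)"
  have "(\<lambda>d. mixed_diff {..<n} G (\<lambda>i. step (K d) (W d i)) (step (K d) (base d)))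
      \<longlonglongrightarrow> mixed_diff {..<n} ?F W_limit (\<lambda>c. 2 * E i1 c)"
    unfolding mixed_diff_def step_add_sum
    by (intro tendsto_sum tendsto_mult tendsto_const cube_limit[OF G]) auto
  moreover have "mixed_diff {..<n} ?F W_limit (\<lambda>c. 2 * E i1 c) = 0"
  proof -
    have ins: "{..<n} = insert i1 ({..<n} - {i1})" using i12 by auto
    have "W_limit i1 = (\<lambda>_. 0)" by (simp add: W_limit_def fun_eq_iff)
    then show ?thesis by (subst ins, subst mixed_diff_insert) simp_all
  qed
  ultimately show ?thesis by simp
qed

definition pattern_sum :: "(nat \<Rightarrow> nat) \<Rightarrow> nat \<Rightarrow> real" where
  "pattern_sum p d = (\<Sum>\<sigma>\<in>surjections n. multi_density n p (\<lambda>j. step (K d) (W d (\<sigma> j))))"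

text \<open>If the edges sent to \<open>i1\<close> and \<open>i2\<close> are not parallel, the first
  has an endpoint \<open>v\<close> outside the second. While the fine position of \<open>v\<close>
  runs through one coarse step, only the wave at \<open>j1\<close> changes, and its row sum is
  0.\<close>

lemma averaging:
  assumes p: "edge_loopless n p" and \<sigma>: "\<sigma> \<in> surjections n"
    and j12: "j1 < n" "j2 < n" "\<sigma> j1 = i1" "\<sigma> j2 = i2"
    and ne: "{p (2 * j1), p (2 * j1 + 1)} \<noteq> {p (2 * j2), p (2 * j2 + 1)}"
  shows "multi_density n p (\<lambda>j. step (K d) (W d (\<sigma> j))) = 0"
proof -
  let ?V = "p ` {..<2 * n}" and ?Q = "2 * 2 ^ d :: nat"
  \<comment> \<open>Both edges have exactly two endpoints, so different ones cannot be
    nested.\<close>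
  have "card {p (2 * j1), p (2 * j1 + 1)} = 2" "card {p (2 * j2), p (2 * j2 + 1)} = 2"
    using p j12 by auto
  then have "\<not> {p (2 * j1), p (2 * j1 + 1)} \<subseteq> {p (2 * j2), p (2 * j2 + 1)}"
    using ne by (metis card_subset_eq finite.emptyI finite.insertI)
  then obtain v where v: "v \<in> {p (2 * j1), p (2 * j1 + 1)}" "v \<notin> {p (2 * j2), p (2 * j2 + 1)}" by blast
  then obtain z where z: "{p (2 * j1), p (2 * j1 + 1)} = {v, z}" "z \<noteq> v"
    using p j12(1) by (metis doubleton_eq_iff empty_iff insertE)
  have vV: "v \<in> ?V" using v(1) endpoint_in[OF j12(1), of p] by auto
  then have V: "?V = insert v (?V - {v})" "v \<notin> ?V - {v}" by auto
  have other: "\<sigma> j \<notin> {i1, i2}" if "j < n" "j \<noteq> j1" "j \<noteq> j2" for j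
    using surjectionsD(3)[OF \<sigma>] that j12 by (auto dest: inj_onD)
  have "(\<Sum>t<K d. \<Prod>j<n. W d (\<sigma> j) ((y(v := t)) (p (2 * j)), (y(v := t)) (p (2 * j + 1)))) = 0" for y
  proof -
    \<comment> \<open>Everything except the wave at \<open>j1\<close>. It depends on
      \<open>t\<close> only through the coarse step \<open>t div ?Q\<close>, since \<open>j2\<close>
      avoids \<open>v\<close> and the other directions do not oscillate.\<close>
    define A where "A t = E i1 (t div ?Q, y z div ?Q) *
      (\<Prod>j\<in>{..<n} - {j1}. W d (\<sigma> j) ((y(v := t)) (p (2 * j)), (y(v := t)) (p (2 * j + 1))))" for t
    have A: "A t = A t'" if "t div ?Q = t' div ?Q" for t t'
    proof -
      have "W d (\<sigma> j) ((y(v := t)) (p (2 * j)), (y(v := t)) (p (2 * j + 1)))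
          = W d (\<sigma> j) ((y(v := t')) (p (2 * j)), (y(v := t')) (p (2 * j + 1)))" if j: "j \<in> {..<n} - {j1}" for j
      proof (cases "j = j2")
        case True
        then show ?thesis using v(2) by simp
      next
        case False
        have "(y(v := t)) x div ?Q = (y(v := t')) x div ?Q" for x
          using \<open>t div ?Q = t' div ?Q\<close> by simp
        then show ?thesis
          using j False by (simp only: W_plain[OF other] lessThan_iff Diff_iff insert_iff empty_iff simp_thms)
      qed
      then show ?thesis unfolding A_def that by (intro arg_cong2[where f="(*)"] refl prod.cong)
    qed
    have "(\<Prod>j<n. W d (\<sigma> j) ((y(v := t)) (p (2 * j)), (y(v := t)) (p (2 * j + 1))))
        = A t * wave d (t mod ?Q) (y z mod ?Q)" for t
    proof -
      have "W d i1 ((y(v := t)) (p (2 * j1)), (y(v := t)) (p (2 * j1 + 1))) = W d i1 (t, y z)"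
        using z W_sym[of d i1 "y z" t] by (auto simp: doubleton_eq_iff)
      also have "\<dots> = E i1 (t div ?Q, y z div ?Q) * wave d (t mod ?Q) (y z mod ?Q)"
        by (rule W_oscillating) simp
      finally show ?thesis
        using j12 by (subst prod.remove[of _ j1]) (simp_all add: A_def mult_ac)
    qed
    then have "(\<Sum>t<K d. \<Prod>j<n. W d (\<sigma> j) ((y(v := t)) (p (2 * j)), (y(v := t)) (p (2 * j + 1))))
        = (\<Sum>t<K d. A t * wave d (t mod ?Q) (y z mod ?Q))" by (simp only:)
    also have "\<dots> = (\<Sum>u<k. \<Sum>r<?Q. A (u * ?Q) * wave d r (y z mod ?Q))"
      unfolding sum_lessThan_blocks[where k=k and m="?Q"]
    proof (intro sum.cong refl)
      fix u r :: nat assume r: "r \<in> {..<?Q}"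
      then have "(u * ?Q + r) mod ?Q = r" "(u * ?Q + r) div ?Q = u * ?Q div ?Q" by simp_all
      then show "A (u * ?Q + r) * wave d ((u * ?Q + r) mod ?Q) (y z mod ?Q) = A (u * ?Q) * wave d r (y z mod ?Q)"
        using A[of "u * ?Q + r" "u * ?Q"] by (simp only:)
    qed
    also have "\<dots> = 0"
      unfolding sum_distrib_left[symmetric] wave_row_sum by simp
    finally show ?thesis .
  qed
  then have "(\<Sum>y\<in>?V \<rightarrow>\<^sub>E {..<K d}. \<Prod>j<n. W d (\<sigma> j) (y (p (2 * j)), y (p (2 * j + 1)))) = 0"
    by (subst V(1), subst sum_PiE_insert[OF V(2)]) (simp only: sum.neutral_const)
  then show ?thesis unfolding multi_density_step[OF K] by simp
qed

lemma parallel_product: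
  assumes \<sigma>: "\<sigma> \<in> surjections n" and j12: "j1 < n" "j2 < n" "\<sigma> j1 = i1" "\<sigma> j2 = i2"
    and eq: "{p (2 * j1), p (2 * j1 + 1)} = {p (2 * j2), p (2 * j2 + 1)}"
  shows "0 \<le> (\<Prod>j<n. W d (\<sigma> j) (y (p (2 * j)), y (p (2 * j + 1))))"
proof -
  have j: "j1 \<noteq> j2" using j12 i12 by auto
  have other: "\<sigma> j \<notin> {i1, i2}" if "j < n" "j \<noteq> j1" "j \<noteq> j2" for j
    using surjectionsD(3)[OF \<sigma>] that j12 by (auto dest: inj_onD)
  let ?w = "\<lambda>j. W d (\<sigma> j) (y (p (2 * j)), y (p (2 * j + 1)))"
  have "(\<Prod>j<n. ?w j) = ?w j1 * ?w j2 * (\<Prod>j\<in>{..<n} - {j1} - {j2}. ?w j)"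
    using j12 j by (subst prod.remove[of _ j1], simp, simp, subst prod.remove[of _ j2]) (simp_all add: mult.assoc)
  moreover have "0 \<le> ?w j1 * ?w j2"
  proof -
    have "y ` {p (2 * j1), p (2 * j1 + 1)} = y ` {p (2 * j2), p (2 * j2 + 1)}" using eq by (simp only:)
    then show ?thesis unfolding j12(3,4) by (intro W_product_nonneg) simp
  qed
  moreover have "0 \<le> (\<Prod>j\<in>{..<n} - {j1} - {j2}. ?w j)"
  proof (rule prod_nonneg)
    fix j assume "j \<in> {..<n} - {j1} - {j2}"
    then have "\<sigma> j \<notin> {i1, i2}" by (intro other) auto
    from W_plain[OF this] show "0 \<le> ?w j" using E_bounds(1) by simp
  qed
  ultimately show ?thesis by (simp only: mult_nonneg_nonneg)
qed

lemma preimages: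
  assumes "\<sigma> \<in> surjections n"
  obtains j1 j2 where "j1 < n" "j2 < n" "\<sigma> j1 = i1" "\<sigma> j2 = i2"
proof -
  have "i1 \<in> \<sigma> ` {..<n}" "i2 \<in> \<sigma> ` {..<n}" using surjectionsD(1)[OF assms] i12 by auto
  then show ?thesis using that by auto
qed

lemma multi_density_W_nonneg:
  assumes p: "edge_loopless n p" and \<sigma>: "\<sigma> \<in> surjections n"
  shows "0 \<le> multi_density n p (\<lambda>j. step (K d) (W d (\<sigma> j)))"
proof -
  obtain j1 j2 where j12: "j1 < n" "j2 < n" "\<sigma> j1 = i1" "\<sigma> j2 = i2" using preimages[OF \<sigma>] .
  show ?thesis
  proof (cases "{p (2 * j1), p (2 * j1 + 1)} = {p (2 * j2), p (2 * j2 + 1)}")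
    case True
    show ?thesis
      unfolding multi_density_step[OF K]
      by (intro mult_nonneg_nonneg sum_nonneg parallel_product[OF \<sigma> j12 True]) simp
  next
    case False
    then show ?thesis using averaging[OF p \<sigma> j12] by simp
  qed
qed

text \<open>By \<open>averaging\<close> a surviving assignment sends parallel edges to
  \<open>i1\<close> and \<open>i2\<close>, so simple graphs drop out. The coarse steps of a
  surviving vertex map give a homomorphism that hits every edge of \<open>q\<close> once.\<close>

lemma pattern_sum_nonzero:
  assumes p: "edge_loopless n p" and q: "edge_loopless n q" and nz: "pattern_sum p d \<noteq> 0"
  shows "\<not> simple_graph (graph_of n p)"
    and "card (p ` {..<2 * n}) \<le> card (q ` {..<2 * n}) \<Longrightarrow> (graph_of n p, graph_of n q) \<in> multigraph_iso"
proof -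
  obtain \<sigma> where \<sigma>: "\<sigma> \<in> surjections n" "multi_density n p (\<lambda>j. step (K d) (W d (\<sigma> j))) \<noteq> 0"
    using nz unfolding pattern_sum_def by (metis (no_types, lifting) sum.neutral)
  obtain j1 j2 where j12: "j1 < n" "j2 < n" "\<sigma> j1 = i1" "\<sigma> j2 = i2" using preimages[OF \<sigma>(1)] .
  have "{p (2 * j1), p (2 * j1 + 1)} = {p (2 * j2), p (2 * j2 + 1)}"
    using averaging[OF p \<sigma>(1) j12] \<sigma>(2) by metis
  moreover have "j1 \<noteq> j2" using j12 i12 by auto
  ultimately show "\<not> simple_graph (graph_of n p)"
    unfolding simple_graph_of_iff using j12 by blast
  obtain y where y: "(\<Prod>j<n. W d (\<sigma> j) (y (p (2 * j)), y (p (2 * j + 1)))) \<noteq> 0"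
    using \<sigma>(2) unfolding multi_density_step[OF K] by (metis (no_types, lifting) sum.neutral mult_zero_right)
  let ?y = "\<lambda>v. y v div (2 * 2 ^ d)"
  have "{?y (p (2 * j)), ?y (p (2 * j + 1))} = {q (2 * \<sigma> j), q (2 * \<sigma> j + 1)}" if "j < n" for j
  proof -
    have "W d (\<sigma> j) (y (p (2 * j)), y (p (2 * j + 1))) \<noteq> 0"
      using y that by (simp add: prod_zero_iff)
    then have "E (\<sigma> j) (?y (p (2 * j)), ?y (p (2 * j + 1))) \<noteq> 0"
      by (auto simp only: W_def prod.case mult_zero_left)
    then show ?thesis by (simp only: E_bounds(4))
  qed
  from homomorphism_iso(2)[OF p q surjectionsD(1)[OF \<sigma>(1)], of ?y, OF this]
  show "card (p ` {..<2 * n}) \<le> card (q ` {..<2 * n}) \<Longrightarrow> (graph_of n p, graph_of n q) \<in> multigraph_iso" .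
qed

text \<open>No density in the sum is negative, so it suffices to count the vertex maps that lie over
  \<open>h\<close> and vary only in the fine positions: with \<open>v\<close> vertices there are
  \<open>(2 * 2 ^ d) ^ v\<close> of them, each with product \<open>s ^ n\<close>, against the volume
  \<open>(1 / real (K d)) ^ v\<close>. The resulting bound does not depend on
  \<open>d\<close>.\<close>

lemma pattern_sum_lower_bound:
  assumes p: "edge_loopless n p" and q: "\<And>i. i < 2 * n \<Longrightarrow> q i = h (p i) \<and> q i < k"
    and inj: "inj_on h (p ` {..<2 * n})"
  shows "(1 / real k) ^ card (p ` {..<2 * n}) * s ^ n \<le> pattern_sum p d"
proof -
  let ?V = "p ` {..<2 * n}" and ?Q = "2 * 2 ^ d :: nat" and ?id = "restrict id {..<n}"
  let ?t = "\<lambda>y. \<Prod>j<n. W d (?id j) (y (p (2 * j)), y (p (2 * j + 1)))"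
  let ?Y = "Pi\<^sub>E ?V (\<lambda>v. {h v * ?Q..<h v * ?Q + ?Q})"
  have id: "?id \<in> surjections n" by (rule id_surjections)
  have id12: "?id i1 = i1" "?id i2 = i2" using i12 by auto
  \<comment> \<open>Injectivity of \<open>h\<close> will carry the parallelism of \<open>i1\<close>
    and \<open>i2\<close> from \<open>q\<close> back to \<open>p\<close>.\<close>
  have "h ` {p (2 * i1), p (2 * i1 + 1)} = h ` {p (2 * i2), p (2 * i2 + 1)}"
    using parallel q[of "2 * i1"] q[of "2 * i1 + 1"] q[of "2 * i2"] q[of "2 * i2 + 1"] i12 by simp
  then have par: "{p (2 * i1), p (2 * i1 + 1)} = {p (2 * i2), p (2 * i2 + 1)}"
    using inj_on_image_eq_iff[OF inj] endpoint_in[OF i12(1), of p] endpoint_in[OF i12(2), of p]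
    by (metis (no_types, lifting) empty_subsetI insert_subset)
  have hk: "h v < k" if "v \<in> ?V" for v using that q by fastforce
  have Ysub: "?Y \<subseteq> ?V \<rightarrow>\<^sub>E {..<K d}"
  proof (rule PiE_mono)
    fix v assume "v \<in> ?V"
    then have "h v + 1 \<le> k" using hk by fastforce
    then have "(h v + 1) * ?Q \<le> k * ?Q" by (rule mult_le_mono1)
    then show "{h v * ?Q..<h v * ?Q + ?Q} \<subseteq> {..<K d}" by auto
  qed
  have val: "?t y = s ^ n" if y: "y \<in> ?Y" for y
  proof -
    have ydiv: "y v div ?Q = h v" if "v \<in> ?V" for v
    proof -
      have "y v \<in> {h v * ?Q..<h v * ?Q + ?Q}" using y that by auto
      then have "h v * ?Q \<le> y v" "y v < Suc (h v) * ?Q" by auto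
      then show ?thesis by (intro div_nat_eqI) (simp_all add: mult.commute)
    qed
    have absW: "\<bar>W d (?id j) (y (p (2 * j)), y (p (2 * j + 1)))\<bar> = s" if j: "j < n" for j
    proof -
      have "y (p (2 * j)) div ?Q = q (2 * j)" "y (p (2 * j + 1)) div ?Q = q (2 * j + 1)"
        using ydiv endpoint_in[OF j, of p] q j by auto
      then have "\<bar>W d (?id j) (y (p (2 * j)), y (p (2 * j + 1)))\<bar> = E j (q (2 * j), q (2 * j + 1))"
        using j by (simp only: W_abs restrict_apply lessThan_iff if_True id_apply)
      also have "\<dots> = s" by (simp add: E_def edge_weight_def)
      finally show ?thesis .
    qed
    have "?t y = \<bar>?t y\<bar>"
      using parallel_product[OF id i12(1,2) id12 par, of d y] by simp
    also have "\<dots> = (\<Prod>j<n. \<bar>W d (?id j) (y (p (2 * j)), y (p (2 * j + 1)))\<bar>)" by (rule abs_prod)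
    also have "\<dots> = (\<Prod>j<n. s)" using absW by (intro prod.cong refl) simp
    also have "\<dots> = s ^ n" by simp
    finally show ?thesis .
  qed
  have cardY: "card ?Y = ?Q ^ card ?V"
    by (simp add: card_PiE)
  have "(1 / real k) ^ card ?V * s ^ n = (1 / real (K d)) ^ card ?V * (\<Sum>y\<in>?Y. s ^ n)"
  proof -
    have "1 / real (K d) * real ?Q = 1 / real k" using k by simp
    then have "(1 / real k) ^ card ?V = (1 / real (K d)) ^ card ?V * real (?Q ^ card ?V)"
      by (simp only: power_mult_distrib[symmetric] of_nat_power)
    then show ?thesis by (simp only: sum_constant cardY mult.assoc)
  qed
  also have "(\<Sum>y\<in>?Y. s ^ n) = (\<Sum>y\<in>?Y. ?t y)" using val by (intro sum.cong refl) simp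
  also have "(1 / real (K d)) ^ card ?V * (\<Sum>y\<in>?Y. ?t y) \<le> (1 / real (K d)) ^ card ?V * (\<Sum>y\<in>?V \<rightarrow>\<^sub>E {..<K d}. ?t y)"
    using parallel_product[OF id i12(1,2) id12 par] Ysub
    by (intro mult_left_mono sum_mono2) (auto intro: finite_PiE)
  also have "\<dots> = multi_density n p (\<lambda>j. step (K d) (W d (?id j)))"
    unfolding multi_density_step[OF K] ..
  also have "\<dots> \<le> pattern_sum p d"
    unfolding pattern_sum_def using multi_density_W_nonneg[OF p] by (intro member_le_sum id finite_surjections) auto
  finally show ?thesis .
qed

end

section \<open>The characterisation\<close>

text \<open>Cut continuity drives the difference to 0, while it equals the coefficient of
  \<open>C0\<close> times a pattern sum bounded away from 0. Since simple graphs have pattern sum 0,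
  maximality of the number of vertices is required only among non-simple graphs with nonzero
  coefficient. Equal numbers of edges matter: a graph with more than \<open>n\<close> edges would
  bring in terms that involve the base point.\<close>

lemma cut_continuous_homogeneous_simple:
  assumes G: "graphon_continuous cut_norm G" and Y: "Y \<subseteq> multigraph_classes_le N"
    and hom: "\<And>C. C \<in> Y \<Longrightarrow> class_edges C = n"
    and rep: "\<And>f. f \<in> graphons \<Longrightarrow> G f = (\<Sum>C\<in>Y. a C * hom_density (class_rep C) f)"
    and C: "C \<in> Y" "\<not> simple_graph (class_rep C)"
  shows "a C = 0"
proof (rule ccontr)
  assume "a C \<noteq> 0"
  have finY: "finite Y" using Y finite_multigraph_classes_le finite_subset by blast
  define X where "X = {C \<in> Y. \<not> simple_graph (class_rep C) \<and> a C \<noteq> 0}"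
  have X: "finite X" "X \<noteq> {}" using finY C \<open>a C \<noteq> 0\<close> by (auto simp: X_def)
  have "Max (class_order ` X) \<in> class_order ` X" using X by (intro Max_in) auto
  then obtain C0 where C0: "C0 \<in> X" "class_order C0 = Max (class_order ` X)" by auto
  have max: "class_order C \<le> class_order C0" if "C \<in> X" for C
    unfolding C0(2) using that X by (intro Max_ge) auto
  have C0Y: "C0 \<in> Y" "\<not> simple_graph (class_rep C0)" "a C0 \<noteq> 0" using C0(1) by (auto simp: X_def)
  note C0N = subsetD[OF Y C0Y(1)] and n0 = hom[OF C0Y(1)]
  let ?p = "class_labelling C0" and ?k = "Suc (class_order C0)"
  note p0 = class_labelling[OF C0N, unfolded n0]
  obtain h where h: "\<forall>i<2 * n. h (?p i) < ?k" "edge_loopless n (\<lambda>i. h (?p i))"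
    "(graph_of n ?p, graph_of n (\<lambda>i. h (?p i))) \<in> multigraph_iso"
    "card ((\<lambda>i. h (?p i)) ` {..<2 * n}) = class_order C0" "inj_on h (?p ` {..<2 * n})"
    using compressed_labelling[OF C0N] unfolding n0 by (elim exE conjE) (rule that; assumption)
  define q where "q = (\<lambda>i. h (?p i))"
  have ql: "edge_loopless n q" unfolding q_def by (rule h(2))
  note hq = h[folded q_def]
  obtain i1 i2 where i12: "i1 < n" "i2 < n" "i1 \<noteq> i2" "{?p (2 * i1), ?p (2 * i1 + 1)} = {?p (2 * i2), ?p (2 * i2 + 1)}"
    using C0Y(2) unfolding p0(2) simple_graph_of_iff by blast
  \<comment> \<open>The largest scale that \<open>parallel_edges\<close> allows.\<close>
  define s where "s = 1 / real (n + 2)"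
  interpret parallel_edges n ?k q i1 i2 s
  proof
    have "h ` {?p (2 * i1), ?p (2 * i1 + 1)} = h ` {?p (2 * i2), ?p (2 * i2 + 1)}"
      using i12(4) by (simp only:)
    then show "{q (2 * i1), q (2 * i1 + 1)} = {q (2 * i2), q (2 * i2 + 1)}"
      by (simp add: q_def)
  qed (use i12 in \<open>auto simp: s_def\<close>)
  have bk: "step (K d) (base d) \<in> kernels" for d
    using step_graphons[OF K cube_weights[of "{}" d]] graphonsD(1) by simp
  have "mixed_diff {..<n} G (\<lambda>i. step (K d) (W d i)) (step (K d) (base d)) = a C0 * pattern_sum ?p d" for d
  proof -
    have "mixed_diff {..<n} G (\<lambda>i. step (K d) (W d i)) (step (K d) (base d))
        = mixed_diff {..<n} (\<lambda>f. \<Sum>C\<in>Y. a C * hom_density (class_rep C) f) (\<lambda>i. step (K d) (W d i)) (step (K d) (base d))"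
    proof (rule mixed_diff_cong[OF refl])
      fix S assume "S \<subseteq> {..<n}"
      then show "G (\<lambda>p. step (K d) (base d) p + (\<Sum>i\<in>S. step (K d) (W d i) p))
          = (\<Sum>C\<in>Y. a C * hom_density (class_rep C) (\<lambda>p. step (K d) (base d) p + (\<Sum>i\<in>S. step (K d) (W d i) p)))"
        unfolding step_add_sum by (intro rep step_graphons K cube_weights)
    qed
    also have "\<dots> = (\<Sum>C\<in>Y. a C * mixed_diff {..<n} (hom_density (class_rep C)) (\<lambda>i. step (K d) (W d i)) (step (K d) (base d)))"
      by (rule mixed_diff_linear)
    also have "\<dots> = (\<Sum>C\<in>Y. if C = C0 then a C0 * pattern_sum ?p d else 0)"
    proof (rule sum.cong[OF refl])
      fix C assume C: "C \<in> Y"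
      let ?r = "class_labelling C"
      note CN = subsetD[OF Y C] and nC = hom[OF C]
      note pC = class_labelling[OF CN, unfolded nC]
      have ps: "mixed_diff {..<n} (hom_density (class_rep C)) (\<lambda>i. step (K d) (W d i)) (step (K d) (base d)) = pattern_sum ?r d"
        unfolding pattern_sum_def surjections_def
        by (subst mixed_diff_hom_density_class[OF CN _ bk W_kernels], simp, unfold nC)
          (rule mixed_diff_multi_density[OF pC(1) _ _ bk W_kernels]; simp)
      have "C = C0" if nz: "a C * pattern_sum ?r d \<noteq> 0"
      proof (rule multigraph_class_eq_if_iso[OF CN C0N])
        have nz': "a C \<noteq> 0" "pattern_sum ?r d \<noteq> 0" using nz by auto
        have "C \<in> X"
          using pattern_sum_nonzero(1)[OF pC(1) ql nz'(2)] C nz'(1) by (simp add: X_def pC(2))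
        then have "card (?r ` {..<2 * n}) \<le> card (q ` {..<2 * n})"
          using max[of C] unfolding hq(4) by (simp add: class_order_def nC)
        then show "(graph_of (class_edges C) ?r, graph_of n q) \<in> multigraph_iso"
          unfolding nC by (rule pattern_sum_nonzero(2)[OF pC(1) ql nz'(2)])
        show "(graph_of (class_edges C0) ?p, graph_of n q) \<in> multigraph_iso"
          unfolding n0 by (rule hq(3))
      qed
      then show "a C * mixed_diff {..<n} (hom_density (class_rep C)) (\<lambda>i. step (K d) (W d i)) (step (K d) (base d))
          = (if C = C0 then a C0 * pattern_sum ?p d else 0)"
        unfolding ps by auto
    qed
    also have "\<dots> = a C0 * pattern_sum ?p d" using finY C0Y(1) by simp
    finally show ?thesis .
  qed
  then have lim: "(\<lambda>d. \<bar>a C0 * pattern_sum ?p d\<bar>) \<longlonglongrightarrow> 0"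
    using tendsto_rabs[OF mixed_diff_tendsto_0[OF G]] by simp
  define c where "c = (1 / real ?k) ^ card (?p ` {..<2 * n}) * s ^ n"
  have c: "c > 0" unfolding c_def using s by (intro mult_pos_pos) auto
  have "c \<le> pattern_sum ?p d" for d
    unfolding c_def using hq(1) by (intro pattern_sum_lower_bound[OF p0(1) _ hq(5)]) (auto simp: q_def)
  then have "\<bar>a C0\<bar> * c \<le> \<bar>a C0 * pattern_sum ?p d\<bar>" for d
    unfolding abs_mult using c by (intro mult_left_mono) (auto intro: order_trans[OF _ abs_ge_self])
  then have "\<bar>a C0\<bar> * c \<le> 0"
    by (intro LIMSEQ_le_const[OF lim]) auto
  then show False using c C0Y(3) by (simp add: mult_le_0_iff)
qed

lemma graphons_half: "f \<in> graphons \<Longrightarrow> (\<lambda>p. f p / 2) \<in> graphons"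
  using kernels_scale[of f "1 / 2"] graphonsD[of f] by (intro graphonsI) (auto intro: order_trans[of _ 1])

lemma hom_density_class_half:
  assumes C: "C \<in> multigraph_classes_le N" and f: "f \<in> graphons"
  shows "hom_density (class_rep C) (\<lambda>p. f p / 2) = (1 / 2) ^ class_edges C * hom_density (class_rep C) f"
  using multi_density_scale[of "class_edges C" "class_labelling C" "1 / 2" "\<lambda>_. f"]
    hom_density_graph_of[OF class_labelling(1)[OF C]] graphonsD(1)[OF f] graphonsD(1)[OF graphons_half[OF f]]
  by (simp add: class_labelling(2)[OF C])

text \<open>Subtracting \<open>2 ^ r\<close> times the value at \<open>f / 2\<close> removes the terms of degree \<open>r\<close> and rescales
  the others, which reduces the claim to homogeneous combinations.\<close>

lemma cut_continuous_simple:
  assumes "graphon_continuous cut_norm G" "Y \<subseteq> multigraph_classes_le N"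
    and "\<And>f. f \<in> graphons \<Longrightarrow> G f = (\<Sum>C\<in>Y. a C * hom_density (class_rep C) f)"
    and "C \<in> Y" "\<not> simple_graph (class_rep C)"
  shows "a C = 0"
  using assms
\<comment> \<open>The induction counts the degrees that occur; each step removes one that differs
  from the degree of \<open>C\<close>.\<close>
proof (induction "card (class_edges ` Y)" arbitrary: Y G a rule: less_induct)
  case less
  note G = less.prems(1) and Y = less.prems(2) and rep = less.prems(3) and C = less.prems(4,5)
  have finY: "finite Y" using Y finite_multigraph_classes_le finite_subset by blast
  show ?case
  proof (cases "\<forall>D\<in>Y. class_edges D = class_edges C")
    case True
    show ?thesis
    proof (rule cut_continuous_homogeneous_simple[where G=G and Y=Y and N=N and n="class_edges C" and a=a and C=C])
      show "class_edges D = class_edges C" if "D \<in> Y" for D using True that by blast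
      show "G f = (\<Sum>C\<in>Y. a C * hom_density (class_rep C) f)" if "f \<in> graphons" for f by (rule rep[OF that])
    qed (rule G Y C)+
  next
    case False
    then obtain D where D: "D \<in> Y" "class_edges D \<noteq> class_edges C" by blast
    define r where "r = class_edges D"
    define Y' where "Y' = {C \<in> Y. class_edges C \<noteq> r}"
    define G' where "G' f = 1 * G f + (- (2 ^ r)) * G (\<lambda>p. f p / 2)" for f
    \<comment> \<open>A term of degree \<open>e\<close> is multiplied by
      \<open>1 - 2 ^ r / 2 ^ e\<close>, which is 0 exactly for \<open>e = r\<close>.\<close>
    define a' where "a' C = a C * (1 - 2 ^ r * (1 / 2) ^ class_edges C)" for C
    have "graphon_continuous cut_norm (\<lambda>f. G (\<lambda>p. f p / 2))"
      unfolding graphon_continuous_def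
    proof (intro ballI allI impI)
      fix f and e :: real assume f: "f \<in> graphons" and e: "e > 0"
      have "\<forall>e>0. \<exists>\<delta>>0. \<forall>h\<in>graphons. cut_norm (\<lambda>p. h p - f p / 2) < \<delta> \<longrightarrow> \<bar>G h - G (\<lambda>p. f p / 2)\<bar> < e"
        using bspec[OF G[unfolded graphon_continuous_def] graphons_half[OF f]] .
      then obtain \<delta> where \<delta>: "\<delta> > 0" "\<forall>h\<in>graphons. cut_norm (\<lambda>p. h p - f p / 2) < \<delta> \<longrightarrow> \<bar>G h - G (\<lambda>p. f p / 2)\<bar> < e"
        using e by meson
      have "\<bar>G (\<lambda>p. h p / 2) - G (\<lambda>p. f p / 2)\<bar> < e"
        if h: "h \<in> graphons" "cut_norm (\<lambda>p. h p - f p) < \<delta>" for h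
      proof -
        have "cut_norm (\<lambda>p. (h p - f p) / 2) \<le> cut_norm (\<lambda>p. h p - f p)"
          using f h(1) by (intro cut_norm_half kernels_diff graphonsD(1))
        then have "cut_norm (\<lambda>p. h p / 2 - f p / 2) < \<delta>"
          using h(2) by (simp add: diff_divide_distrib)
        then show ?thesis by (rule mp[OF bspec[OF \<delta>(2) graphons_half[OF h(1)]]])
      qed
      then show "\<exists>\<delta>>0. \<forall>h\<in>graphons. cut_norm (\<lambda>p. h p - f p) < \<delta> \<longrightarrow> \<bar>G (\<lambda>p. h p / 2) - G (\<lambda>p. f p / 2)\<bar> < e"
        by (intro exI[where x=\<delta>] conjI \<delta>(1) ballI impI)
    qed
    then have G': "graphon_continuous cut_norm G'"
      unfolding G'_def[abs_def] by (intro graphon_continuous_linear G)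
    have rep': "G' f = (\<Sum>C\<in>Y'. a' C * hom_density (class_rep C) f)" if f: "f \<in> graphons" for f
    proof -
      have "G' f = (\<Sum>C\<in>Y. a C * hom_density (class_rep C) f) - 2 ^ r * (\<Sum>C\<in>Y. a C * hom_density (class_rep C) (\<lambda>p. f p / 2))"
        using rep[OF f] rep[OF graphons_half[OF f]] by (simp add: G'_def)
      also have "\<dots> = (\<Sum>C\<in>Y. a' C * hom_density (class_rep C) f)"
        unfolding sum_distrib_left sum_subtractf[symmetric]
      proof (rule sum.cong[OF refl])
        fix C assume "C \<in> Y"
        then have "C \<in> multigraph_classes_le N" using Y by blast
        then show "a C * hom_density (class_rep C) f - 2 ^ r * (a C * hom_density (class_rep C) (\<lambda>p. f p / 2))
            = a' C * hom_density (class_rep C) f"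
          using hom_density_class_half[OF _ f] by (simp add: a'_def algebra_simps)
      qed
      also have "\<dots> = (\<Sum>C\<in>Y'. a' C * hom_density (class_rep C) f)"
        using finY by (intro sum.mono_neutral_right) (auto simp: Y'_def a'_def power_one_over)
      finally show ?thesis .
    qed
    have "r \<in> class_edges ` Y" "r \<notin> class_edges ` Y'"
      using D(1) by (auto simp: Y'_def r_def)
    moreover have "class_edges ` Y' \<subseteq> class_edges ` Y"
      by (auto simp: Y'_def)
    ultimately have "class_edges ` Y' \<subset> class_edges ` Y" by blast
    then have lt: "card (class_edges ` Y') < card (class_edges ` Y)"
      using finY by (intro psubset_card_mono) auto
    have "a' C = 0"
      using Y C D(2) by (intro less.hyps[OF lt G' _ rep']) (auto simp: Y'_def r_def)
    moreover have "(1 - 2 ^ r * (1 / 2) ^ class_edges C :: real) \<noteq> 0"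
    proof -
      have "(2 :: real) ^ r \<noteq> 2 ^ class_edges C" using D(2) by (simp add: r_def)
      then show ?thesis by (simp add: power_one_over field_simps)
    qed
    ultimately show ?thesis by (simp add: a'_def)
  qed
qed

lemma density_polynomial_L1_continuous: "graphon_continuous L1_norm (density_polynomial N a)"
proof -
  let ?P = "\<lambda>f. \<Sum>C\<in>multigraph_classes_le N. a C * multi_density (class_edges C) (class_labelling C) (\<lambda>_. f)"
  have "graphon_continuous L1_norm ?P"
    using class_labelling(1) by (intro graphon_continuous_sum graphon_continuous_multi_density) blast
  moreover have "density_polynomial N a f = ?P f" if "f \<in> graphons" for f
    unfolding density_polynomial_def
    using hom_density_graph_of[OF class_labelling(1) graphonsD(1)[OF that]] class_labelling(2)
    by (intro sum.cong refl) simp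
  ultimately show ?thesis unfolding graphon_continuous_def by simp
qed

lemma mixed_diff_density_polynomial:
  assumes "f \<in> kernels" "\<And>i. i \<in> I \<Longrightarrow> g i \<in> kernels" "finite I" "N < card I"
  shows "mixed_diff I (density_polynomial N a) g f = 0"
proof -
  have "mixed_diff I (density_polynomial N a) g f
      = (\<Sum>C\<in>multigraph_classes_le N. a C * mixed_diff I (hom_density (class_rep C)) g f)"
    unfolding density_polynomial_def[abs_def] by (rule mixed_diff_linear)
  also have "\<dots> = 0"
  proof (rule sum.neutral, rule ballI)
    fix C assume C: "C \<in> multigraph_classes_le N"
    have "class_edges C < card I"
      using multigraph_classes_leE(2)[OF C] assms(4) by (simp add: class_edges_def)
    then have "mixed_diff I (\<lambda>f. multi_density (class_edges C) (class_labelling C) (\<lambda>_. f)) g f = 0"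
      by (intro mixed_diff_multi_density_eq_0 class_labelling(1)[OF C] assms)
    then have "mixed_diff I (hom_density (class_rep C)) g f = 0"
      by (subst mixed_diff_hom_density_class[OF C assms(3,1)]) (rule assms(2))
    then show "a C * mixed_diff I (hom_density (class_rep C)) g f = 0" by simp
  qed
  finally show ?thesis .
qed

text \<open>Differences of order \<open>N + 1\<close> vanish on cubes of step graphons, so
  \<open>F\<close> is a combination of densities there; both sides are continuous in
  \<open>L\<^sup>1\<close>, and step graphons are dense.\<close>

lemma density_polynomial_if_gateaux_deriv_eq_0:
  assumes F: "class_function F" "graphon_continuous L1_norm F" "gateaux_differentiable (Suc N) F"
    and zero: "\<And>f g. f \<in> graphons \<Longrightarrow> (\<And>i. i \<le> N \<Longrightarrow> g i \<in> Adm f) \<Longrightarrow> gateaux_deriv F (Suc N) g f = 0"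
  shows "\<exists>a. \<forall>f\<in>graphons. F f = density_polynomial N a f"
proof -
  have perm: "permutation_invariant F"
    unfolding permutation_invariant_def using class_function_step_permute[OF F(1)] by blast
  have van: "vanishing_order (Suc N) F"
    unfolding vanishing_order_def
  proof (intro allI impI ballI)
    fix k :: nat and \<beta> \<gamma> assume k: "1 \<le> k" and \<beta>: "\<beta> \<in> weights k" and \<gamma>: "\<forall>i<Suc N. \<gamma> i \<in> weights k"
      and w: "(\<lambda>c. \<beta> c + (\<Sum>i<Suc N. \<gamma> i c)) \<in> weights k"
    have g: "step k (\<gamma> i) \<in> graphons" if "i \<le> N" for i
      using \<gamma> that by (intro step_graphons k) auto
    note b = step_graphons[OF k \<beta>]
    have "mixed_diff {..<Suc N} F (\<lambda>i. step k (\<gamma> i)) (step k \<beta>) = 0"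
    proof (rule mixed_diff_eq_0_if_gateaux_deriv_eq_0[OF F(3,2) zero])
      fix p :: "real \<times> real" assume p: "p \<in> unit_square"
      have "step k (\<lambda>c. \<beta> c + (\<Sum>i<Suc N. \<gamma> i c)) p \<le> 1"
        using graphonsD(3)[OF step_graphons[OF k w] p] .
      then show "step k \<beta> p + (\<Sum>i<Suc N. step k (\<gamma> i) p) \<le> 1"
        unfolding step_add_sum[symmetric] .
    qed (use g b graphonsD in auto)
    then show "mixed_diff {..<Suc N} (\<lambda>\<beta>. F (step k \<beta>)) \<gamma> \<beta> = 0"
      unfolding mixed_diff_step .
  qed
  obtain a where "\<forall>k\<ge>1. \<forall>\<beta>\<in>weights k. F (step k \<beta>) =
      (\<Sum>m<Suc N. \<Sum>p\<in>loopless_maps m. a m p * multi_density m p (\<lambda>_. step k \<beta>))"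
    using vanishing_order_imp_density_combination[OF F(2) perm van] by blast
  then have "F (step k \<beta>) = density_polynomial N
      (\<lambda>C. \<Sum>m<Suc N. \<Sum>p\<in>{p\<in>loopless_maps m. graph_class m p = C}. a m p) (step k \<beta>)"
    if "k \<ge> 1" "\<beta> \<in> weights k" for k \<beta>
    using that density_combination_by_classes[OF that] by simp
  then show ?thesis
    using graphon_continuous_eqI[OF F(2) density_polynomial_L1_continuous] by blast
qed

theorem theorem1p4:
  fixes N :: nat and F :: "kernel \<Rightarrow> real"
  assumes "class_function F"
    and "graphon_continuous L1_norm F"
    and "gateaux_differentiable (N + 1) F"
  shows "((\<forall>f\<in>graphons. \<forall>g. (\<forall>i<N + 1. g i \<in> Adm f) \<longrightarrow> gateaux_deriv F (N + 1) g f = 0)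
        \<longleftrightarrow> (\<exists>a. \<forall>f\<in>graphons. F f = density_polynomial N a f))
    \<and> (\<forall>a b. (\<forall>f\<in>graphons. F f = density_polynomial N a f)
        \<longrightarrow> (\<forall>f\<in>graphons. F f = density_polynomial N b f)
        \<longrightarrow> (\<forall>C\<in>multigraph_classes_le N. a C = b C))
    \<and> (graphon_continuous cut_norm F \<longrightarrow>
        (\<forall>a. (\<forall>f\<in>graphons. F f = density_polynomial N a f)
          \<longrightarrow> (\<forall>C\<in>multigraph_classes_le N. \<not> simple_graph (class_rep C) \<longrightarrow> a C = 0)))"
proof (intro conjI iffI allI impI ballI)
  assume "\<forall>f\<in>graphons. \<forall>g. (\<forall>i<N + 1. g i \<in> Adm f) \<longrightarrow> gateaux_deriv F (N + 1) g f = 0"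
  then show "\<exists>a. \<forall>f\<in>graphons. F f = density_polynomial N a f"
    using assms by (intro density_polynomial_if_gateaux_deriv_eq_0) (auto simp: less_Suc_eq_le)
next
  fix f g assume "\<exists>a. \<forall>f\<in>graphons. F f = density_polynomial N a f"
    and f: "f \<in> graphons" and g: "\<forall>i<N + 1. g i \<in> Adm f"
  then obtain a where a: "\<And>f. f \<in> graphons \<Longrightarrow> F f = density_polynomial N a f" by blast
  have "gateaux_deriv F (Suc N) g f = 0"
  proof (rule gateaux_deriv_eq_0_if_mixed_diff_eq_0[OF _ _ f])
    fix f g assume g: "\<And>i. i \<le> N \<Longrightarrow> g i \<in> kernels"
      and cube: "\<And>S. S \<subseteq> {..<Suc N} \<Longrightarrow> (\<lambda>p. f p + (\<Sum>i\<in>S. g i p)) \<in> graphons"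
    have "mixed_diff {..<Suc N} F g f = mixed_diff {..<Suc N} (density_polynomial N a) g f"
      by (rule mixed_diff_cong[OF refl]) (rule a[OF cube])
    \<comment> \<open>The vertex of the empty set of directions shows that the base point
      \<open>f\<close> is a kernel.\<close>
    also have "\<dots> = 0"
      using graphonsD(1)[OF cube[of "{}"]] g by (intro mixed_diff_density_polynomial) auto
    finally show "mixed_diff {..<Suc N} F g f = 0" .
  qed (use assms(3) g in auto)
  then show "gateaux_deriv F (N + 1) g f = 0" by simp
next
  fix a b C
  assume a: "\<forall>f\<in>graphons. F f = density_polynomial N a f" and b: "\<forall>f\<in>graphons. F f = density_polynomial N b f"
    and C: "C \<in> multigraph_classes_le N"
  have "a C - b C = 0"
  proof (rule density_polynomial_unique[OF _ C])
    fix f assume "f \<in> graphons"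
    then have "density_polynomial N a f = density_polynomial N b f" using a b by metis
    then show "density_polynomial N (\<lambda>C. a C - b C) f = 0"
      by (simp add: density_polynomial_def left_diff_distrib sum_subtractf)
  qed
  then show "a C = b C" by simp
next
  fix a C
  assume "graphon_continuous cut_norm F" "\<forall>f\<in>graphons. F f = density_polynomial N a f"
    and "C \<in> multigraph_classes_le N" "\<not> simple_graph (class_rep C)"
  then show "a C = 0"
    by (intro cut_continuous_simple[where G=F and Y="multigraph_classes_le N" and N=N])
      (auto simp: density_polynomial_def)
qed

end
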